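(* Let $d\ge 2$ and let $g(x,y)\in\mathbb{Z}[x,y]$ together with a function $F_g(z)$ be one of the following, where $T(z)=\sec z+\tan z$: ($A_n$, $n\ge 1$) $g=x^{n+1}+y^2$, $F_g(z)=\dfrac{n+1}{2}\cdot\dfrac{\cos\frac{(n-1)z}{n+1}+\sin\frac{2z}{n+1}}{\cos z}$; ($D_n$, $n\ge 4$) $g=x^2y+y^{n-1}$, $F_g(z)=\dfrac{(n-1)^2}{4(n-2)}\cos\dfrac{z}{n-1}+\dfrac{(n-3)^2}{4(n-2)}\cos\dfrac{z}{n-3}+\left(1+\dfrac{(n-1)^2}{4(n-2)}\sin\dfrac{z}{n-1}+\dfrac{(n-3)^2}{4(n-2)}\sin\dfrac{z}{n-3}\right)T(z)$; ($E_6$) $g=x^3+y^4$, $F_g(z)=3\,\dfrac{\cos\frac z2+\sin\frac z2}{\cos z}\cos\dfrac z3$; ($E_7$) $g=x^3+xy^3$, $F_g(z)=\dfrac{27}{16}\left(\cos\dfrac z9-\sin\dfrac{2z}{9}\right)+\dfrac{27}{16}\left(\sin\dfrac z9+\cos\dfrac{2z}{9}\right)T(z)$; ($E_8$) $g=x^3+y^5$, $F_g(z)=\dfrac{15}{4}\cdot\dfrac{\cos\frac{3z}{5}+\sin\frac{2z}{5}}{\cos z}\cos\dfrac z3$. Let $R_d=\mathbb{C}[[x_0,\dots,x_d]]/(g(x_0,x_1)+x_2^2+\dots+x_d^2)$. Then the limit Hilbert–Kunz multiplicity and limit $F$-signature of $R_d$ exist and $$e_{\mathrm{HK},\infty}(R_d)=1+\frac{c_d}{d!},\qquad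 s_\infty(R_d)=1-\frac{c_d}{d!},$$ where $c_d/d!$ is the $d$-th Taylor coefficient of $F_g(z)$ at $z=0$ (i.e. $F_g(z)=\sum_{d\ge0}c_d z^d/d!$).
   Context: For a local ring $(S,\mathfrak m)$ of characteristic $p>0$ and dimension $d$, $e_{\mathrm{HK}}(S)=\lim_{e\to\infty}p^{-ed}\ell(S/\mathfrak m^{[p^e]})$ where $\mathfrak m^{[p^e]}$ is generated by the $p^e$-th powers of elements of $\mathfrak m$; if $S$ is reduced, $F$-finite with perfect residue field, the $F$-signature is $s(S)=\lim_{e}a_e/p^{ed}$, where $a_e$ is the largest rank of a free direct summand of the $S$-module $S^{1/p^e}$ (and $s(S)=0$ if $S$ is not reduced). For $f\in\mathbb{Z}[x_0,\dots,x_d]$ and $R=\mathbb{C}[[x_0,\dots,x_d]]/(f)$, put $R_p=\mathbb{F}_p[[x_0,\dots,x_d]]/(f \bmod p)$. The limit $F$-invariants are $e_{\mathrm{HK},\infty}(R)=\lim_{p\to\infty}e_{\mathrm{HK}}(R_p)$ and $s_\infty(R)=\lim_{p\to\infty}s(R_p)$ ($p$ ranging over primes), when these limits exist. *)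

theory Defs
  imports
    "HOL-Analysis.Analysis"
    "HOL-Library.Extended_Nat"
    "HOL-Library.FuncSet"
    "HOL-Library.Poly_Mapping"
    "HOL-Algebra.Module"
    "HOL-Algebra.QuotRing"
    "HOL-Algebra.Multiplicative_Group"
    "HOL-Number_Theory.Residues"
begin

section \<open>Rings and modules\<close>

definition ring_characteristic :: "('a, 'r) ring_scheme \<Rightarrow> nat" where
  "ring_characteristic R = group.ord (add_monoid R) \<one>\<^bsub>R\<^esub>"

definition krull_dim :: "('a, 'r) ring_scheme \<Rightarrow> enat" where
  "krull_dim R = Sup {enat n | n. \<exists>P. (\<forall>i\<le>n. primeideal (P i) R) \<and> (\<forall>i<n. P i \<subset> P (Suc i))}"

definition reduced_ring :: "('a, 'r) ring_scheme \<Rightarrow> bool" where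
  "reduced_ring R \<longleftrightarrow> (\<forall>x\<in>carrier R. \<forall>n::nat. x [^]\<^bsub>R\<^esub> n = \<zero>\<^bsub>R\<^esub> \<longrightarrow> x = \<zero>\<^bsub>R\<^esub>)"

text \<open>Only meaningful for local rings, where the maximal ideal is unique.\<close>
definition max_ideal :: "('a, 'r) ring_scheme \<Rightarrow> 'a set" where
  "max_ideal R = (THE I. maximalideal I R)"

definition module_length :: "('a, 'r) ring_scheme \<Rightarrow> ('a, 'b, 'm) module_scheme \<Rightarrow> enat" where
  "module_length R M =
     Sup {enat n | n. \<exists>N. (\<forall>i\<le>n. submodule (N i) R M) \<and> (\<forall>i<n. N i \<subset> N (Suc i))}"

definition quotient_module :: "('a, 'r) ring_scheme \<Rightarrow> 'a set \<Rightarrow> ('a, 'a set) module" where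
  "quotient_module R I =
     \<lparr>carrier = carrier (R Quot I), mult = mult (R Quot I), one = one (R Quot I),
      zero = zero (R Quot I), add = add (R Quot I),
      smult = (\<lambda>r C. (I +>\<^bsub>R\<^esub> r) \<otimes>\<^bsub>R Quot I\<^esub> C)\<rparr>"

definition free_of_rank ::
  "('a, 'r) ring_scheme \<Rightarrow> ('a, 'b, 'm) module_scheme \<Rightarrow> 'b set \<Rightarrow> nat \<Rightarrow> bool" where
  "free_of_rank R M F a \<longleftrightarrow>
     (\<exists>b \<in> {..<a} \<rightarrow> F. \<forall>x\<in>F. \<exists>!c. c \<in> {..<a} \<rightarrow>\<^sub>E carrier R \<and>
        x = (\<Oplus>\<^bsub>M\<^esub>i\<in>{..<a}. c i \<odot>\<^bsub>M\<^esub> b i))"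

definition has_free_direct_summand ::
  "('a, 'r) ring_scheme \<Rightarrow> ('a, 'b, 'm) module_scheme \<Rightarrow> nat \<Rightarrow> bool" where
  "has_free_direct_summand R M a \<longleftrightarrow>
     (\<exists>F N. submodule F R M \<and> submodule N R M \<and>
        F \<inter> N = {\<zero>\<^bsub>M\<^esub>} \<and> F <+>\<^bsub>M\<^esub> N = carrier M \<and> free_of_rank R M F a)"

definition max_free_rank :: "('a, 'r) ring_scheme \<Rightarrow> ('a, 'b, 'm) module_scheme \<Rightarrow> nat" where
  "max_free_rank R M = (GREATEST a. has_free_direct_summand R M a)"


section \<open>Hilbert--Kunz multiplicity and \<open>F\<close>-signature\<close>

definition frobenius_power :: "('a, 'r) ring_scheme \<Rightarrow> 'a set \<Rightarrow> nat \<Rightarrow> 'a set" where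
  "frobenius_power R I q = Idl\<^bsub>R\<^esub> ((\<lambda>x. x [^]\<^bsub>R\<^esub> q) ` I)"

text \<open>
  For reduced \<open>R\<close> of characteristic \<open>p\<close> and \<open>q = p\<^sup>e\<close>, this is the \<open>R\<close>-module \<open>R\<^bsup>1/q\<^esup>\<close>:
  the element \<open>x\<close> of the carrier stands for the \<open>q\<close>-th root of \<open>x\<close>. Taking \<open>q\<close>-th roots is a ring
  isomorphism from \<open>R\<close> to \<open>R\<^bsup>1/q\<^esup>\<close>, so the ring operations are those of \<open>R\<close>, and \<open>r\<close> times the
  \<open>q\<close>-th root of \<open>x\<close> is the \<open>q\<close>-th root of \<open>r\<^sup>q x\<close>.
\<close>
definition root_module :: "('a, 'r) ring_scheme \<Rightarrow> nat \<Rightarrow> ('a, 'a) module" where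
  "root_module R q =
     \<lparr>carrier = carrier R, mult = mult R, one = one R, zero = zero R, add = add R,
      smult = (\<lambda>r x. (r [^]\<^bsub>R\<^esub> q) \<otimes>\<^bsub>R\<^esub> x)\<rparr>"

definition HK_multiplicity :: "('a, 'r) ring_scheme \<Rightarrow> real" where
  "HK_multiplicity S =
     (let p = ring_characteristic S; d = the_enat (krull_dim S); m = max_ideal S in
      lim (\<lambda>e. real (the_enat (module_length S (quotient_module S (frobenius_power S m (p ^ e)))))
               / real p ^ (e * d)))"

definition F_signature :: "('a, 'r) ring_scheme \<Rightarrow> real" where
  "F_signature S =
     (let p = ring_characteristic S; d = the_enat (krull_dim S) in
      if reduced_ring S
      then lim (\<lambda>e. real (max_free_rank S (root_module S (p ^ e))) / real p ^ (e * d))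
      else 0)"


section \<open>Power series rings and hypersurfaces modulo \<open>p\<close>\<close>

text \<open>
  The ring of formal power series over \<open>A\<close> in the variables \<open>x\<^sub>i\<close> with \<open>i \<in> V\<close>. A series is its
  coefficient function on exponent vectors \<open>nat \<Rightarrow>\<^sub>0 nat\<close>; coefficients of monomials involving
  variables outside \<open>V\<close> are required to vanish.
\<close>
definition power_series_ring :: "('a, 'r) ring_scheme \<Rightarrow> nat set \<Rightarrow> ((nat \<Rightarrow>\<^sub>0 nat) \<Rightarrow> 'a) ring" where
  "power_series_ring A V =
     \<lparr>carrier = {f. (\<forall>m. f m \<in> carrier A) \<and> (\<forall>m. \<not> Poly_Mapping.keys m \<subseteq> V \<longrightarrow> f m = \<zero>\<^bsub>A\<^esub>)},
      mult = (\<lambda>f g m. \<Oplus>\<^bsub>A\<^esub>u\<in>{u. fst u + snd u = m}. f (fst u) \<otimes>\<^bsub>A\<^esub> g (snd u)),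
      one = (\<lambda>m. if m = 0 then \<one>\<^bsub>A\<^esub> else \<zero>\<^bsub>A\<^esub>),
      zero = (\<lambda>m. \<zero>\<^bsub>A\<^esub>),
      add = (\<lambda>f g m. f m \<oplus>\<^bsub>A\<^esub> g m)\<rparr>"

text \<open>Polynomials with integer coefficients in variables \<open>x\<^sub>0, x\<^sub>1, \<dots>\<close>\<close>
type_synonym int_mpoly = "(nat \<Rightarrow>\<^sub>0 nat) \<Rightarrow>\<^sub>0 int"

definition mvar :: "nat \<Rightarrow> int_mpoly" where
  "mvar i = Poly_Mapping.single (Poly_Mapping.single i 1) 1"

definition reduce_mod :: "nat \<Rightarrow> int_mpoly \<Rightarrow> (nat \<Rightarrow>\<^sub>0 nat) \<Rightarrow> int" where
  "reduce_mod p f = (\<lambda>m. Poly_Mapping.lookup f m mod int p)"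

text \<open>The ring \<open>R\<^sub>p\<close>, the quotient of \<open>F\<^sub>p[[x\<^sub>0,\<dots>,x\<^sub>d]]\<close> by \<open>f mod p\<close>.\<close>
definition hypersurface_mod ::
  "nat \<Rightarrow> int_mpoly \<Rightarrow> nat \<Rightarrow> ((nat \<Rightarrow>\<^sub>0 nat) \<Rightarrow> int) set ring" where
  "hypersurface_mod d f p =
     (let P = power_series_ring (residue_ring (int p)) {..d}
      in P Quot (Idl\<^bsub>P\<^esub> {reduce_mod p f}))"

definition at_top_primes :: "nat filter" where
  "at_top_primes = inf at_top (principal {p. prime p})"

text \<open>
  The limit invariants of \<open>C[[x\<^sub>0,\<dots>,x\<^sub>d]]/(f)\<close> exist and have the value \<open>L\<close>. They are defined
  through the given integral equation \<open>f\<close> only.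
\<close>
definition has_limit_HK_multiplicity :: "nat \<Rightarrow> int_mpoly \<Rightarrow> real \<Rightarrow> bool" where
  "has_limit_HK_multiplicity d f L \<longleftrightarrow>
     ((\<lambda>p. HK_multiplicity (hypersurface_mod d f p)) \<longlongrightarrow> L) at_top_primes"

definition has_limit_F_signature :: "nat \<Rightarrow> int_mpoly \<Rightarrow> real \<Rightarrow> bool" where
  "has_limit_F_signature d f L \<longleftrightarrow>
     ((\<lambda>p. F_signature (hypersurface_mod d f p)) \<longlongrightarrow> L) at_top_primes"


section \<open>The ADE polynomials and their generating functions\<close>

datatype ADE = Type_A nat | Type_D nat | Type_E6 | Type_E7 | Type_E8

fun valid_ADE :: "ADE \<Rightarrow> bool" where
  "valid_ADE (Type_A n) \<longleftrightarrow> n \<ge> 1"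
| "valid_ADE (Type_D n) \<longleftrightarrow> n \<ge> 4"
| "valid_ADE Type_E6 \<longleftrightarrow> True"
| "valid_ADE Type_E7 \<longleftrightarrow> True"
| "valid_ADE Type_E8 \<longleftrightarrow> True"

fun ADE_poly :: "ADE \<Rightarrow> int_mpoly" where
  "ADE_poly (Type_A n) = mvar 0 ^ (n + 1) + mvar 1 ^ 2"
| "ADE_poly (Type_D n) = mvar 0 ^ 2 * mvar 1 + mvar 1 ^ (n - 1)"
| "ADE_poly Type_E6 = mvar 0 ^ 3 + mvar 1 ^ 4"
| "ADE_poly Type_E7 = mvar 0 ^ 3 + mvar 0 * mvar 1 ^ 3"
| "ADE_poly Type_E8 = mvar 0 ^ 3 + mvar 1 ^ 5"

definition sec_plus_tan :: "real \<Rightarrow> real" where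
  "sec_plus_tan z = 1 / cos z + tan z"

fun ADE_fun :: "ADE \<Rightarrow> real \<Rightarrow> real" where
  "ADE_fun (Type_A n) z =
     (real n + 1) / 2 *
     ((cos ((real n - 1) * z / (real n + 1)) + sin (2 * z / (real n + 1))) / cos z)"
| "ADE_fun (Type_D n) z =
     (real n - 1)^2 / (4 * (real n - 2)) * cos (z / (real n - 1))
     + (real n - 3)^2 / (4 * (real n - 2)) * cos (z / (real n - 3))
     + (1 + (real n - 1)^2 / (4 * (real n - 2)) * sin (z / (real n - 1))
          + (real n - 3)^2 / (4 * (real n - 2)) * sin (z / (real n - 3))) * sec_plus_tan z"
| "ADE_fun Type_E6 z = 3 * ((cos (z / 2) + sin (z / 2)) / cos z) * cos (z / 3)"
| "ADE_fun Type_E7 z =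
     27 / 16 * (cos (z / 9) - sin (2 * z / 9))
     + 27 / 16 * (sin (z / 9) + cos (2 * z / 9)) * sec_plus_tan z"
| "ADE_fun Type_E8 z = 15 / 4 * ((cos (3 * z / 5) + sin (2 * z / 5)) / cos z) * cos (z / 3)"

definition ADE_hypersurface :: "ADE \<Rightarrow> nat \<Rightarrow> int_mpoly" where
  "ADE_hypersurface t d = ADE_poly t + (\<Sum>i=2..d. mvar i ^ 2)"

definition taylor_coeff :: "(real \<Rightarrow> real) \<Rightarrow> nat \<Rightarrow> real" where
  "taylor_coeff F k = (deriv ^^ k) F 0 / fact k"

end

theory Submission
  imports
    Defs
    "HOL-Computational_Algebra.Computational_Algebra"
    "HOL-Complex_Analysis.Laurent_Convergence"
begin

text \<open>
  Write the equation as \<open>f = h + z\<^sup>2\<close> with \<open>z = x\<^sub>d\<close>, put \<open>A = F\<^sub>p[[x\<^sub>0, \<dots>, x\<^bsub>d-1\<^esub>]]\<close>, \<open>q = p\<^sup>e\<close>, and let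
  \<open>D\<^sub>q(n)\<close> be the dimension of \<open>A/(x\<^sub>i\<^sup>q, h\<^sup>n)\<close>. As \<open>R\<^sub>p = A \<oplus> A z\<close>, the colength of the \<open>e\<close>-th Frobenius power of
  the maximal ideal is \<open>D\<^sub>q((q+1)/2) + D\<^sub>q((q-1)/2)\<close>. The free rank of \<open>R\<^sub>p\<^bsup>1/q\<^esup>\<close> is the dimension of
  \<open>z\<^sup>q R\<^sub>p\<close> modulo \<open>(x\<^sub>0\<^sup>q, \<dots>, x\<^bsub>d-1\<^esub>\<^sup>q)\<close>, because \<open>R\<^sub>p\<close> is Gorenstein: it is \<open>2 q\<^sup>d\<close> minus that colength. So
  both limits are governed by \<open>D\<^sub>p((p-1)/2)/p\<^sup>d\<close>, up to \<open>O(1/p)\<close>. Adding a square \<open>x\<^sub>n\<^sup>2\<close> changes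
  \<open>D\<^sub>p\<close> by the Clebsch--Gordan rule for Jordan blocks, valid in the range below \<open>p\<close>. In the limit this is
  an integral operator, and the generating function of its iterates is built from \<open>sec + tan\<close>; only
  the plane curves have to be computed by hand.
\<close>

subsection \<open>Formal power series with integer coefficients\<close>

text \<open>Before the very end neither F_p nor any quotient ring is formed. All computations take
  place in one commutative ring \<open>mps\<close>, in which reduction modulo \<open>p\<close> and
  the restriction to finitely many variables are both parts of an ideal. Dimensions are logarithms
  to base \<open>p\<close> of indices of additive groups, so exact sequences become products of
  indices. The obstacle is that the Clebsch-Gordan rule fails for large exponents. It is applied
  only to sizes b, n with b + n <= p + 1; the rest of the range is reached by the reflection s -> p
  - s, and higher powers of \<open>p\<close> are controlled by concavity of D_q instead of being
  computed. Symmetrising about 1/2 turns the limit operator into w -> 2 int_0^t w(1/2 - x) dx. The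
  function H(s) = cos(2sz) + T(z) sin(2sz) generates its iterates, because T = sec + tan is the
  factor for which dH/ds = 2z H(1/2 - s). The free rank is bounded below by splitting off one
  summand at a time while the count permits. The dimension of R_p, which normalises both limits,
  needs its own proof by Artin-Rees and lying over.\<close>

type_synonym expo = "nat \<Rightarrow>\<^sub>0 nat"

abbreviation ex :: "expo => nat => nat" where "ex \<equiv> Poly_Mapping.lookup"

abbreviation sng :: "nat => nat => expo" where "sng \<equiv> Poly_Mapping.single"

lemma finite_le_expo: "finite {\<beta>::expo. \<forall>i. ex \<beta> i <= ex \<alpha> i}"
proof -
  let ?D = "{\<beta>::expo. \<forall>i. ex \<beta> i <= ex \<alpha> i}"
  let ?B = "insert 0 (\<Union>i\<in>Poly_Mapping.keys \<alpha>. {..ex \<alpha> i})"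
  have "ex ` ?D \<subseteq> {f. \<forall>x. (x \<in> Poly_Mapping.keys \<alpha> --> f x \<in> ?B) \<and> (x \<notin> Poly_Mapping.keys \<alpha> --> f x = 0)}"
  proof (intro subsetI CollectI allI conjI impI)
    fix f x assume "f \<in> ex ` ?D"
    then obtain \<beta> where f: "f = ex \<beta>" and b: "\<forall>i. ex \<beta> i <= ex \<alpha> i" by blast
    show "f x \<in> ?B" if "x \<in> Poly_Mapping.keys \<alpha>" using that b f by auto
    show "f x = 0" if "x \<notin> Poly_Mapping.keys \<alpha>" using that b[rule_format, of x] f by (simp add: not_in_keys_iff_lookup_eq_zero)
  qed
  moreover have "finite {f. \<forall>x. (x \<in> Poly_Mapping.keys \<alpha> --> f x \<in> ?B) \<and> (x \<notin> Poly_Mapping.keys \<alpha> --> f x = (0::nat))}"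
    by (intro finite_set_of_finite_funs) auto
  ultimately have "finite (ex ` ?D)" by (rule finite_subset)
  moreover have "inj_on ex ?D" by (auto intro!: inj_onI poly_mapping_eqI)
  ultimately show ?thesis by (rule finite_imageD)
qed

definition splits :: "expo => (expo \<times> expo) set" where
  "splits \<alpha> = {u. fst u + snd u = \<alpha>}"

lemma finite_splits [simp]: "finite (splits \<alpha>)"
proof (rule finite_subset)
  let ?D = "{\<beta>::expo. \<forall>i. ex \<beta> i <= ex \<alpha> i}"
  show "splits \<alpha> \<subseteq> ?D \<times> ?D" by (auto simp: splits_def lookup_add)
  show "finite (?D \<times> ?D)" using finite_le_expo by blast
qed

text \<open>A type of its own rather than a function type, so that it can be an instance of
  \<open>comm_ring_1\<close>. Variables are indexed by all naturals, so adjoining one never changes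
  the type.\<close>

typedef mps = "UNIV :: (expo => int) set" morphisms coef Mps by simp

setup_lifting type_definition_mps

lemma mps_eqI: "(\<And>\<alpha>. coef f \<alpha> = coef g \<alpha>) ==> f = g"
  by (simp add: coef_inject[symmetric] fun_eq_iff)

lemma coef_Mps [simp]: "coef (Mps f) = f" by (simp add: Mps_inverse)

lemma sum_splits_swap: "(\<Sum>u\<in>splits \<alpha>. f (snd u) (fst u)) = (\<Sum>u\<in>splits \<alpha>. f (fst u) (snd u))"
  by (rule sum.reindex_bij_witness[where i = prod.swap and j = prod.swap])
     (auto simp: splits_def add.commute)

lemma sum_splits_assoc:
  fixes f g h :: "expo => 'a::comm_semiring_0"
  shows "(\<Sum>u\<in>splits \<alpha>. (\<Sum>v\<in>splits (fst u). f (fst v) * g (snd v)) * h (snd u))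
    = (\<Sum>u\<in>splits \<alpha>. f (fst u) * (\<Sum>v\<in>splits (snd u). g (fst v) * h (snd v)))" (is "?l = ?r")
proof -
  have "?l = (\<Sum>(u,v)\<in>Sigma (splits \<alpha>) (\<lambda>u. splits (fst u)). f (fst v) * g (snd v) * h (snd u))"
    by (simp add: sum_distrib_right sum.Sigma)
  also have "... = (\<Sum>(u,v)\<in>Sigma (splits \<alpha>) (\<lambda>u. splits (snd u)). f (fst u) * (g (fst v) * h (snd v)))"
    by (rule sum.reindex_bij_witness[where
          i = "\<lambda>(u,v). ((fst u + fst v, snd v), (fst u, fst v))" and
          j = "\<lambda>(u,v). ((fst v, snd v + snd u), (snd v, snd u))"])
       (auto simp: splits_def ac_simps)
  also have "... = ?r" by (simp add: sum_distrib_left sum.Sigma)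
  finally show ?thesis .
qed

lemma sum_splits_single:
  fixes g :: "expo => 'a::comm_ring_1"
  shows "(\<Sum>u\<in>splits (\<mu> + \<beta>). (if fst u = \<mu> then c else 0) * g (snd u)) = c * g \<beta>"
proof -
  have "(\<Sum>u\<in>splits (\<mu> + \<beta>). (if fst u = \<mu> then c else 0) * g (snd u))
     = (\<Sum>u\<in>{(\<mu>, \<beta>)}. c * g (snd u))"
    by (rule sum.mono_neutral_cong_right) (use finite_splits in \<open>auto simp: splits_def\<close>)
  thus ?thesis by simp
qed

instantiation mps :: comm_ring_1
begin
lift_definition zero_mps :: mps is "\<lambda>_. 0" .
lift_definition one_mps :: mps is "\<lambda>\<alpha>. if \<alpha> = 0 then 1 else 0" .
lift_definition plus_mps :: "mps => mps => mps" is "\<lambda>f g \<alpha>. f \<alpha> + g \<alpha>" .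
lift_definition minus_mps :: "mps => mps => mps" is "\<lambda>f g \<alpha>. f \<alpha> - g \<alpha>" .
lift_definition uminus_mps :: "mps => mps" is "\<lambda>f \<alpha>. - f \<alpha>" .
lift_definition times_mps :: "mps => mps => mps" is
  "\<lambda>f g \<alpha>. \<Sum>u\<in>splits \<alpha>. f (fst u) * g (snd u)" .
instance
proof
  fix a b c :: mps
  show "a * b * c = a * (b * c)" by transfer (rule ext, rule sum_splits_assoc)
  show "a * b = b * a"
    by transfer (rule ext, subst sum_splits_swap[symmetric], simp add: mult.commute)
  show "1 * a = a"
  proof (transfer, rule ext)
    fix a :: "expo => int" and \<alpha>
    show "(\<Sum>u\<in>splits \<alpha>. (if fst u = 0 then 1 else 0) * a (snd u)) = a \<alpha>"
      using sum_splits_single[where \<mu> = 0 and \<beta> = \<alpha> and c = 1 and g = a] by simp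
  qed
  show "(a + b) * c = a * c + b * c"
    by transfer (simp add: fun_eq_iff sum.distrib distrib_right)
  show "(0::mps) \<noteq> 1" by transfer (auto simp: fun_eq_iff)
qed (transfer; simp add: fun_eq_iff)+
end

lemma coef_0 [simp]: "coef 0 \<alpha> = 0" by transfer simp
lemma coef_1: "coef 1 \<alpha> = (if \<alpha> = 0 then 1 else 0)" by transfer simp
lemma coef_add [simp]: "coef (f + g) \<alpha> = coef f \<alpha> + coef g \<alpha>" by transfer simp
lemma coef_diff [simp]: "coef (f - g) \<alpha> = coef f \<alpha> - coef g \<alpha>" by transfer simp
lemma coef_minus [simp]: "coef (- f) \<alpha> = - coef f \<alpha>" by transfer simp
lemma coef_mult: "coef (f * g) \<alpha> = (\<Sum>u\<in>splits \<alpha>. coef f (fst u) * coef g (snd u))" by transfer simp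
lemma coef_sum [simp]: "coef (sum f A) \<alpha> = (\<Sum>i\<in>A. coef (f i) \<alpha>)"
  by (induction A rule: infinite_finite_induct) auto

definition mono :: "expo => mps" where "mono \<mu> = Mps (\<lambda>\<alpha>. if \<alpha> = \<mu> then 1 else 0)"

abbreviation vr :: "nat => mps" where "vr i \<equiv> mono (sng i (Suc 0))"

lemma coef_mono: "coef (mono \<mu>) \<alpha> = (if \<alpha> = \<mu> then 1 else 0)" by (simp add: mono_def)

lemma coef_mono_mult [simp]: "coef (mono \<mu> * f) (\<mu> + \<beta>) = coef f \<beta>"
  using sum_splits_single[where \<mu> = \<mu> and \<beta> = \<beta> and c = 1 and g = "coef f"] by (simp add: coef_mult coef_mono)

lemma coef_mono_mult_eq_0: "(\<And>\<beta>. \<alpha> \<noteq> \<mu> + \<beta>) ==> coef (mono \<mu> * f) \<alpha> = 0"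
  unfolding coef_mult coef_mono by (rule sum.neutral) (auto simp: splits_def)

lemma mono_0 [simp]: "mono 0 = 1" by (rule mps_eqI) (simp add: coef_mono coef_1)

lemma mono_add: "mono (\<mu> + \<nu>) = mono \<mu> * mono \<nu>"
proof (rule mps_eqI)
  fix \<alpha>
  show "coef (mono (\<mu> + \<nu>)) \<alpha> = coef (mono \<mu> * mono \<nu>) \<alpha>"
  proof (cases "\<exists>\<beta>. \<alpha> = \<mu> + \<beta>")
    case True thus ?thesis by (auto simp: coef_mono)
  next
    case False thus ?thesis by (subst coef_mono_mult_eq_0) (auto simp: coef_mono)
  qed
qed

lemma vr_power: "vr i ^ k = mono (sng i k)"
  by (induction k) (simp_all add: mono_add[symmetric] single_add[symmetric])

lemma of_nat_mps: "(of_nat n :: mps) = Mps (\<lambda>\<alpha>. if \<alpha> = 0 then int n else 0)"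
  by (induction n) (auto intro!: mps_eqI simp: coef_1)

lemma of_int_mps: "(of_int c :: mps) = Mps (\<lambda>\<alpha>. if \<alpha> = 0 then c else 0)"
  by (cases c rule: int_diff_cases) (auto intro!: mps_eqI simp: of_nat_mps)

lemma coef_of_int: "coef (of_int c) \<alpha> = (if \<alpha> = 0 then c else 0)"
  by (simp add: of_int_mps)

lemma coef_of_int_mult [simp]: "coef (of_int c * f) \<alpha> = c * coef f \<alpha>"
  using sum_splits_single[where \<mu> = 0 and \<beta> = \<alpha> and c = c and g = "coef f"] by (simp add: coef_mult coef_of_int)

lemma coef_of_nat_mult [simp]: "coef (of_nat c * f) \<alpha> = int c * coef f \<alpha>"
  using coef_of_int_mult[of "int c" f \<alpha>] by simp

lemma coef_0_mult [simp]: "coef (f * g) 0 = coef f 0 * coef g 0"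
proof -
  have "u = (0,0)" if "u \<in> splits 0" for u
  proof -
    have "ex (fst u) i + ex (snd u) i = 0" for i using that lookup_add[of "fst u" "snd u" i] by (simp add: splits_def)
    hence "fst u = 0" "snd u = 0" by (simp_all add: poly_mapping_eqI)
    thus ?thesis by (simp add: prod_eq_iff)
  qed
  moreover have "(0,0) \<in> splits 0" by (simp add: splits_def)
  ultimately have "splits 0 = {(0,0)}" by blast
  thus ?thesis by (simp add: coef_mult)
qed

definition emb :: "int_mpoly => mps" where "emb f = Mps (Poly_Mapping.lookup f)"

lemma coef_emb [simp]: "coef (emb f) \<alpha> = Poly_Mapping.lookup f \<alpha>" by (simp add: emb_def)

lemma emb_add [simp]: "emb (f + g) = emb f + emb g" by (rule mps_eqI) (simp add: lookup_add)

lemma emb_1 [simp]: "emb 1 = 1" by (rule mps_eqI) (simp add: lookup_one coef_1 when_def)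

lemma emb_0 [simp]: "emb 0 = 0" by (rule mps_eqI) simp

lemma emb_sum [simp]: "emb (sum f A) = (\<Sum>i\<in>A. emb (f i))"
  by (induction A rule: infinite_finite_induct) auto

lemma emb_mult [simp]: "emb (f * g) = emb f * emb g"
proof (rule mps_eqI)
  fix \<alpha>
  let ?F = "Poly_Mapping.lookup f" and ?G = "Poly_Mapping.lookup g"
  have "Poly_Mapping.lookup (f * g) \<alpha> = prod_fun ?F ?G \<alpha>" by (simp add: times_poly_mapping.rep_eq)
  also have "... = (\<Sum>(a, b). ?F a * ?G b when \<alpha> = a + b)" by (rule prod_fun_unfold_prod) auto
  also have "... = (\<Sum>u\<in>splits \<alpha>. case u of (a, b) => ?F a * ?G b when \<alpha> = a + b)"
    by (rule Sum_any.expand_superset) (use finite_splits in \<open>auto simp: splits_def\<close>)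
  also have "... = coef (emb f * emb g) \<alpha>" by (simp add: coef_mult) (rule sum.cong, auto simp: splits_def)
  finally show "coef (emb (f * g)) \<alpha> = coef (emb f * emb g) \<alpha>" by simp
qed

lemma emb_power [simp]: "emb (f ^ k) = emb f ^ k" by (induction k) auto

lemma emb_mvar [simp]: "emb (mvar i) = vr i"
  by (rule mps_eqI) (auto simp: mvar_def coef_mono lookup_single when_def)

subsection \<open>Ideals and subgroups, and their indices\<close>

definition is_subgp :: "'a::ab_group_add set => bool" where
  "is_subgp H \<longleftrightarrow> 0 \<in> H \<and> (\<forall>x\<in>H. \<forall>y\<in>H. x - y \<in> H)"

definition is_ideal :: "'a::comm_ring_1 set => bool" where
  "is_ideal I \<longleftrightarrow> 0 \<in> I \<and> (\<forall>x\<in>I. \<forall>y\<in>I. x + y \<in> I) \<and> (\<forall>x\<in>I. \<forall>r. r * x \<in> I)"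

definition is_prime :: "'a::comm_ring_1 set => bool" where
  "is_prime P \<longleftrightarrow> is_ideal P \<and> 1 \<notin> P \<and> (\<forall>a b. a * b \<in> P --> a \<in> P \<or> b \<in> P)"

definition with_gen :: "'a::comm_ring_1 set => 'a => 'a set" where
  "with_gen I x = {y. \<exists>r. y - r * x \<in> I}"

lemma is_subgpI: "0 \<in> H ==> (\<And>x y. x \<in> H ==> y \<in> H ==> x - y \<in> H) ==> is_subgp H"
  by (simp add: is_subgp_def)

lemma subgp_0: "is_subgp H ==> 0 \<in> H" by (simp add: is_subgp_def)
lemma subgp_diff: "is_subgp H ==> x \<in> H ==> y \<in> H ==> x - y \<in> H" by (simp add: is_subgp_def)
lemma subgp_minus: "is_subgp H ==> x \<in> H ==> - x \<in> H"
  using subgp_diff[of H 0 x] subgp_0[of H] by simp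
lemma subgp_add: "is_subgp H ==> x \<in> H ==> y \<in> H ==> x + y \<in> H"
  using subgp_diff[of H x "- y"] subgp_minus by fastforce
lemma subgp_sum: "is_subgp H ==> (\<And>i. i \<in> A ==> f i \<in> H) ==> sum f A \<in> H"
  by (induction A rule: infinite_finite_induct) (auto intro: subgp_add simp: subgp_0)
lemma subgp_UNIV [simp]: "is_subgp UNIV" by (simp add: is_subgp_def)
lemma subgp_diff_commute: "is_subgp H ==> x - y \<in> H \<longleftrightarrow> y - x \<in> H"
  using subgp_minus by (metis minus_diff_eq)
lemma subgp_trans: "is_subgp H ==> x - y \<in> H ==> y - z \<in> H ==> x - z \<in> H"
  using subgp_add by fastforce

lemma is_idealI:
  "0 \<in> I ==> (\<And>x y. x \<in> I ==> y \<in> I ==> x + y \<in> I) ==> (\<And>x r. x \<in> I ==> r * x \<in> I) ==> is_ideal I"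
  by (simp add: is_ideal_def)

lemma ideal_0: "is_ideal I ==> 0 \<in> I" by (simp add: is_ideal_def)
lemma ideal_add: "is_ideal I ==> x \<in> I ==> y \<in> I ==> x + y \<in> I" by (simp add: is_ideal_def)
lemma ideal_mult: "is_ideal I ==> x \<in> I ==> r * x \<in> I" by (simp add: is_ideal_def)
lemma ideal_mult2: "is_ideal I ==> x \<in> I ==> x * r \<in> I" using ideal_mult[of I x r] by (simp add: mult.commute)
lemma ideal_minus: "is_ideal I ==> x \<in> I ==> - x \<in> I" using ideal_mult[of I x "-1"] by simp
lemma ideal_diff: "is_ideal I ==> x \<in> I ==> y \<in> I ==> x - y \<in> I"
  using ideal_add[of I x "- y"] ideal_minus[of I y] by simp
lemma ideal_subgp: "is_ideal I ==> is_subgp I" by (simp add: is_subgp_def ideal_0 ideal_diff)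
lemma ideal_sum: "is_ideal I ==> (\<And>i. i \<in> A ==> f i \<in> I) ==> sum f A \<in> I"
  by (rule subgp_sum[OF ideal_subgp])
lemma ideal_UNIV_iff: "is_ideal I ==> 1 \<in> I \<longleftrightarrow> I = UNIV"
  using ideal_mult[of I 1] by auto
lemma ideal_diff_iff: "is_ideal I ==> x - y \<in> I ==> x \<in> I \<longleftrightarrow> y \<in> I"
  using ideal_diff[of I x "x - y"] ideal_add[of I "x - y" y] by auto
lemma ideal_power: "is_ideal I ==> x \<in> I ==> k > 0 ==> x ^ k \<in> I"
  by (cases k) (auto intro: ideal_mult2)

lemma prime_ideal: "is_prime P ==> is_ideal P" by (simp add: is_prime_def)
lemma prime_1: "is_prime P ==> 1 \<notin> P" by (simp add: is_prime_def)
lemma prime_mult: "is_prime P ==> a * b \<in> P ==> a \<in> P \<or> b \<in> P" by (simp add: is_prime_def)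
lemma prime_power: "is_prime P ==> a ^ n \<in> P ==> a \<in> P"
  by (induction n) (auto dest: prime_mult prime_1)

lemma ideal_with_gen: "is_ideal I ==> is_ideal (with_gen I x)"
proof (rule is_idealI)
  assume I: "is_ideal I"
  show "0 \<in> with_gen I x" by (auto simp: with_gen_def intro!: exI[of _ 0] ideal_0[OF I])
next
  fix a b assume I: "is_ideal I" and "a \<in> with_gen I x" "b \<in> with_gen I x"
  then obtain r s where "a - r * x \<in> I" "b - s * x \<in> I" by (auto simp: with_gen_def)
  hence "(a - r * x) + (b - s * x) \<in> I" by (rule ideal_add[OF I])
  hence "(a + b) - (r + s) * x \<in> I" by (simp add: algebra_simps)
  thus "a + b \<in> with_gen I x" unfolding with_gen_def by blast
next
  fix a t assume I: "is_ideal I" and "a \<in> with_gen I x"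
  then obtain r where "a - r * x \<in> I" by (auto simp: with_gen_def)
  hence "t * (a - r * x) \<in> I" by (rule ideal_mult[OF I])
  hence "t * a - (t * r) * x \<in> I" by (simp add: algebra_simps)
  thus "t * a \<in> with_gen I x" unfolding with_gen_def by blast
qed

lemma with_gen_sub: "is_ideal I ==> I \<subseteq> with_gen I x"
  unfolding with_gen_def by (auto intro!: exI[of _ 0])

lemma with_gen_gen: "is_ideal I ==> r * x \<in> with_gen I x"
  unfolding with_gen_def by (auto intro!: exI[of _ r] simp: ideal_0)

lemma with_gen_least: "is_ideal J ==> I \<subseteq> J ==> x \<in> J ==> with_gen I x \<subseteq> J"
  unfolding with_gen_def using ideal_diff_iff ideal_mult by blast

text \<open>The index of \<open>J\<close> in \<open>K\<close>, counted by cosets. As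
  \<open>card\<close> of an infinite set is 0, for nonempty \<open>K\<close> the statement
  \<open>ind K J > 0\<close> says that the index is finite.\<close>

definition ind :: "'a::ab_group_add set => 'a set => nat" where
  "ind K J = card ((\<lambda>x. {y. y - x \<in> J}) ` K)"

lemma card_image_kernel:
  assumes "\<And>x y. x \<in> K ==> y \<in> K ==> f x = f y \<longleftrightarrow> g x = g y"
  shows "card (f ` K) = card (g ` K)"
proof (rule bij_betw_same_card[where f = "g \<circ> inv_into K f"])
  have 1: "g (inv_into K f (f x)) = g x" if "x \<in> K" for x using assms[OF inv_into_into[of "f x" f K] that] that by (simp add: f_inv_into_f)
  show "bij_betw (g \<circ> inv_into K f) (f ` K) (g ` K)" unfolding bij_betw_def
  proof
    show "inj_on (g \<circ> inv_into K f) (f ` K)" by (rule inj_onI) (auto simp: 1 assms)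
    show "(g \<circ> inv_into K f) ` f ` K = g ` K" by (force simp: 1 image_iff)
  qed
qed

lemma coset_eq_iff:
  assumes "is_subgp J" shows "{y. y - x \<in> J} = {y. y - x' \<in> J} \<longleftrightarrow> x - x' \<in> J"
proof
  assume "{y. y - x \<in> J} = {y. y - x' \<in> J}"
  moreover have "x \<in> {y. y - x \<in> J}" using subgp_0[OF assms] by simp
  ultimately show "x - x' \<in> J" by blast
next
  assume "x - x' \<in> J"
  thus "{y. y - x \<in> J} = {y. y - x' \<in> J}" using subgp_trans[OF assms] subgp_diff_commute[OF assms] by blast
qed

lemma ind_eq_card_image:
  assumes "is_subgp J" "\<And>x y. x \<in> K ==> y \<in> K ==> F x = F y \<longleftrightarrow> x - y \<in> J"
  shows "ind K J = card (F ` K)"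
  unfolding ind_def by (rule card_image_kernel) (simp add: coset_eq_iff[OF assms(1)] assms(2))

text \<open>A map that induces a bijection of cosets preserves the index. \<open>\<phi>\<close> need
  not be additive, and surjectivity is asked only modulo \<open>J'\<close>; differentiation, slicing
  and expansion in a basis all fit this form.\<close>

lemma ind_eqI:
  assumes J: "is_subgp J" and J': "is_subgp J'"
    and "\<And>x. x \<in> K ==> \<phi> x \<in> K'"
    and "\<And>x y. x \<in> K ==> y \<in> K ==> \<phi> x - \<phi> y \<in> J' \<longleftrightarrow> x - y \<in> J"
    and "\<And>y. y \<in> K' ==> \<exists>x\<in>K. y - \<phi> x \<in> J'"
  shows "ind K J = ind K' J'"
proof -
  let ?F = "\<lambda>x. {y. y - \<phi> x \<in> J'}"
  have "ind K J = card (?F ` K)" by (rule ind_eq_card_image[OF J]) (simp add: coset_eq_iff[OF J'] assms(4))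
  also have "?F ` K = (\<lambda>x. {y. y - x \<in> J'}) ` K'"
  proof (safe)
    fix x assume "x \<in> K"
    thus "?F x \<in> (\<lambda>x. {y. y - x \<in> J'}) ` K'" using assms(3) by auto
  next
    fix y assume "y \<in> K'"
    then obtain x where "x \<in> K" "y - \<phi> x \<in> J'" using assms(5) by blast
    hence "{z. z - y \<in> J'} = ?F x" by (subst coset_eq_iff[OF J'])
    thus "{z. z - y \<in> J'} \<in> ?F ` K" using \<open>x \<in> K\<close> by blast
  qed
  finally show ?thesis by (simp add: ind_def)
qed

lemma ind_tower:
  assumes L: "is_subgp L" and J: "is_subgp J" and K: "is_subgp K" and LJ: "L \<subseteq> J" and JK: "J \<subseteq> K"
  shows "ind K L = ind K J * ind J L"
proof -
  \<comment> \<open>The chosen representative depends only on the coset modulo \<open>J\<close>, so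
    \<open>x\<close> is encoded by that coset together with the coset of \<open>x - r x\<close>
    modulo \<open>L\<close>.\<close>
  define r where "r x = (SOME y. y \<in> K \<and> x - y \<in> J)" for x
  have r0: "r x \<in> K \<and> x - r x \<in> J" if "x \<in> K" for x unfolding r_def by (rule someI[of _ x]) (use that subgp_0[OF J] in auto)
  have r1: "r x = r y \<longleftrightarrow> x - y \<in> J" if "x \<in> K" "y \<in> K" for x y
  proof
    assume "r x = r y" thus "x - y \<in> J" using r0[OF that(1)] r0[OF that(2)] subgp_trans[OF J] subgp_diff_commute[OF J] by metis
  next
    assume "x - y \<in> J"
    hence "x - z \<in> J \<longleftrightarrow> y - z \<in> J" for z using subgp_trans[OF J] subgp_diff_commute[OF J] by metis
    thus "r x = r y" unfolding r_def by simp
  qed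
  let ?C = "\<lambda>x. {y. y - x \<in> L}"
  let ?F = "\<lambda>x. (r x, ?C (x - r x))"
  have "ind K L = card (?F ` K)"
  proof (rule ind_eq_card_image[OF L])
    fix x y assume xy: "x \<in> K" "y \<in> K"
    have "?F x = ?F y \<longleftrightarrow> x - y \<in> J \<and> x - r x - (y - r y) \<in> L" by (simp add: coset_eq_iff[OF L] r1[OF xy])
    also have "... \<longleftrightarrow> x - y \<in> L"
    proof (cases "x - y \<in> J")
      case True thus ?thesis using r1[OF xy] by simp
    next
      case False thus ?thesis using LJ by blast
    qed
    finally show "?F x = ?F y \<longleftrightarrow> x - y \<in> L" .
  qed
  also have "?F ` K = r ` K \<times> ?C ` J"
  proof (safe)
    fix x assume "x \<in> K" thus "?C (x - r x) \<in> ?C ` J" using r0 by blast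
  next
    fix x j assume x: "x \<in> K" and j: "j \<in> J"
    let ?y = "r x + j"
    have y: "?y \<in> K" using x j r0 JK subgp_add[OF K] by blast
    have "?y - x \<in> J" using r0[OF x] j subgp_diff[OF J j, of "x - r x"] by (simp add: algebra_simps)
    hence "r ?y = r x" using r1[OF y x] by simp
    thus "(r x, ?C j) \<in> ?F ` K" using y by (intro image_eqI[of _ _ ?y]) auto
  qed auto
  also have "card \<dots> = card (r ` K) * card (?C ` J)" by (rule card_cartesian_product)
  also have "card (r ` K) = ind K J" by (rule ind_eq_card_image[OF J, symmetric]) (simp add: r1)
  finally show ?thesis by (simp add: ind_def)
qed

lemma ind_self: "is_subgp J ==> ind J J = 1"
proof -
  assume J: "is_subgp J"
  have "ind J J = card ((\<lambda>_. ()) ` J)" by (rule ind_eq_card_image[OF J]) (auto intro: subgp_diff[OF J])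
  also have "(\<lambda>_. ()) ` J = {()}" using subgp_0[OF J] by blast
  finally show ?thesis by simp
qed

subsection \<open>Truncated polynomials over a module with an endomorphism\<close>

text \<open>Coordinates are peeled off one at a time. The section \<open>e k\<close> has to hit
  coordinate \<open>k\<close> and to vanish in the earlier ones; nothing is asked of the later
  ones.\<close>

lemma ind_coordinates:
  fixes s :: "nat => 'a::ab_group_add => 'b::ab_group_add" and e :: "nat => 'b => 'a"
  assumes add: "\<And>r x y. s r (x - y) = s r x - s r y"
    and se: "\<And>r k x. r <= k ==> k < n ==> s r (e k x) = (if r = k then x else 0)"
    and J: "\<And>r. is_subgp (J r)"
  shows "ind UNIV {g. \<forall>r<n. s r g \<in> J r} = (\<Prod>r<n. ind UNIV (J r))"
proof -
  define A where "A k = {g. \<forall>r<k. s r g \<in> J r}" for k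
  have s0: "s r 0 = 0" for r using add[of r 0 0] by simp
  have sg: "is_subgp (A k)" for k by (rule is_subgpI) (auto simp: A_def s0 add subgp_0[OF J] subgp_diff[OF J])
  have "k <= n ==> ind UNIV (A k) = (\<Prod>r<k. ind UNIV (J r))" for k
  proof (induction k)
    case 0
    thus ?case using ind_self[of "UNIV::'a set"] by (simp add: A_def)
  next
    case (Suc k)
    have "ind UNIV (A (Suc k)) = ind UNIV (A k) * ind (A k) (A (Suc k))" by (rule ind_tower[OF sg sg subgp_UNIV]) (auto simp: A_def)
    also have "ind (A k) (A (Suc k)) = ind UNIV (J k)"
    proof (rule ind_eqI[where \<phi> = "s k", OF sg J])
      fix x y assume "x \<in> A k" "y \<in> A k"
      hence "x - y \<in> A k" by (rule subgp_diff[OF sg])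
      thus "s k x - s k y \<in> J k \<longleftrightarrow> x - y \<in> A (Suc k)" by (auto simp: A_def add less_Suc_eq)
    next
      fix y
      have "e k y \<in> A k" using Suc.prems by (auto simp: A_def se subgp_0[OF J])
      thus "\<exists>x\<in>A k. y - s k x \<in> J k" using Suc.prems by (intro bexI[of _ "e k y"]) (simp_all add: se subgp_0[OF J])
    qed auto
    finally show ?case using Suc by simp
  qed
  thus ?thesis by (simp add: A_def)
qed

text \<open>Modulo \<open>tri I b\<close>, power series in one variable u over V become truncated
  polynomials (V/I)[u]/(u^b).\<close>

definition tri :: "'v::comm_ring_1 set => nat => 'v fps set" where
  "tri I b = {G. \<forall>i<b. fps_nth G i \<in> I}"

lemma ideal_tri: assumes "is_ideal I" shows "is_ideal (tri I b)"
proof (rule is_idealI)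
  show "0 \<in> tri I b" by (simp add: tri_def ideal_0[OF assms])
  show "x + y \<in> tri I b" if "x \<in> tri I b" "y \<in> tri I b" for x y using that by (simp add: tri_def ideal_add[OF assms])
  show "r * x \<in> tri I b" if "x \<in> tri I b" for x r
    using that by (auto simp: tri_def fps_mult_nth intro!: ideal_sum[OF assms] ideal_mult[OF assms])
qed

lemma tri_0 [simp]: "tri I 0 = UNIV" by (simp add: tri_def)

lemma tri_const: "is_ideal I ==> c \<in> I ==> fps_const c * G \<in> tri I b"
  by (simp add: tri_def ideal_mult2)

lemma ind_tri: assumes "is_ideal I" shows "ind UNIV (tri I b) = ind UNIV I ^ b"
proof -
  have "ind UNIV {g. \<forall>r<b. fps_nth g r \<in> I} = (\<Prod>r<b. ind UNIV I)"
    by (rule ind_coordinates[where e = "\<lambda>k x. fps_const x * fps_X ^ k"])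
       (auto simp: ideal_subgp[OF assms] fps_X_power_iff)
  thus ?thesis by (simp add: tri_def)
qed

section \<open>Expansion in powers of u + h\<close>

locale power_basis =
  fixes I :: "'v::comm_ring_1 set" and h :: 'v
  assumes I: "is_ideal I"
begin

definition v :: "'v fps" where "v = fps_X + fps_const h"

text \<open>The quotient by \<open>CC b n\<close> is (V/I)[u]/(u^b, (u+h)^n): a Jordan block of size
  \<open>b\<close> combined with the endomorphism \<open>h\<close>, cut off at the
  \<open>n\<close>-th power of the sum.\<close>

definition CC :: "nat => nat => 'v fps set" where "CC b n = with_gen (tri I b) (v ^ n)"

lemma ideal_CC: "is_ideal (CC b n)"
  unfolding CC_def by (intro ideal_with_gen ideal_tri I)

lemma tri_CC: "tri I b \<subseteq> CC b n" unfolding CC_def by (intro with_gen_sub ideal_tri I)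

lemma CC_0: "CC 0 n = UNIV" using tri_CC[of 0 n] by auto

lemma CC_0': "CC b 0 = UNIV"
  unfolding CC_def using with_gen_gen[OF ideal_tri[OF I], of _ 1] by auto

lemma fps_X_eq: "fps_X = v - fps_const h" by (simp add: v_def)

lemma nth_v_power: "fps_nth (v ^ m) j = of_nat (m choose j) * h ^ (m - j)"
proof -
  have "v ^ m = (\<Sum>k\<le>m. of_nat (m choose k) * fps_X ^ k * fps_const h ^ (m - k))" unfolding v_def by (rule binomial_ring)
  also have "... = (\<Sum>k\<le>m. fps_const (of_nat (m choose k) * h ^ (m - k)) * fps_X ^ k)"
    by (rule sum.cong) (simp_all add: fps_of_nat[symmetric] ac_simps flip: fps_const_mult)
  also have "fps_nth \<dots> j = (\<Sum>k\<le>m. of_nat (m choose k) * h ^ (m - k) * (if j = k then 1 else 0))"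
    by (simp only: fps_sum_nth fps_mult_left_const_nth fps_X_power_nth)
  also have "... = (\<Sum>k\<le>m. if k = j then of_nat (m choose k) * h ^ (m - k) else 0)" by (rule sum.cong) auto
  also have "... = of_nat (m choose j) * h ^ (m - j)" by (simp add: binomial_eq_0)
  finally show ?thesis .
qed

definition comb :: "nat => (nat => 'v) => 'v fps" where
  "comb k w = (\<Sum>l<k. fps_const (w l) * v ^ l)"

lemma comb_diff: "comb k (\<lambda>l. w l - w' l) = comb k w - comb k w'"
  by (simp add: comb_def fps_const_sub[symmetric] left_diff_distrib sum_subtractf del: fps_const_sub)

text \<open>\<open>v\<close> is monic in u, so its first \<open>k\<close> powers span everything
  modulo u^k.\<close>

lemma comb_exists: "\<exists>w. G - comb k w \<in> tri I k"
proof (induction k arbitrary: G)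
  case (Suc k)
  obtain w where w: "fps_shift 1 G - comb k w \<in> tri I k" using Suc by blast
  \<comment> \<open>The coefficients, in powers of \<open>v\<close>, of G(0) + (v - h) times the
    expansion of the shifted series.\<close>
  define W where "W l = (if l = 0 then fps_nth G 0 else 0) + (if l = 0 then 0 else w (l - 1))
     - (if l < k then h * w l else 0)" for l
  have G: "G = fps_const (fps_nth G 0) + fps_X * fps_shift 1 G" by (rule fps_ext) (simp add: fps_mult_fps_X_plus_1_nth split: nat.split)
  have "comb (Suc k) W = fps_const (fps_nth G 0) + (\<Sum>l<k. fps_const (w l) * v ^ Suc l) - (\<Sum>l<k. fps_const (h * w l) * v ^ l)"
  proof -
    have "comb (Suc k) W = (\<Sum>l<Suc k. fps_const (if l = 0 then fps_nth G 0 else 0) * v ^ l)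
       + (\<Sum>l<Suc k. fps_const (if l = 0 then 0 else w (l - 1)) * v ^ l)
       - (\<Sum>l<Suc k. fps_const (if l < k then h * w l else 0) * v ^ l)" unfolding comb_def W_def
      by (simp only: fps_const_add[symmetric] fps_const_sub[symmetric] distrib_right left_diff_distrib
          sum.distrib sum_subtractf)
    also have "(\<Sum>l<Suc k. fps_const (if l = 0 then fps_nth G 0 else 0) * v ^ l) = fps_const (fps_nth G 0)" by (subst sum.lessThan_Suc_shift) simp
    also have "(\<Sum>l<Suc k. fps_const (if l = 0 then 0 else w (l - 1)) * v ^ l) = (\<Sum>l<k. fps_const (w l) * v ^ Suc l)"
      by (subst sum.lessThan_Suc_shift) simp
    also have "(\<Sum>l<Suc k. fps_const (if l < k then h * w l else 0) * v ^ l) = (\<Sum>l<k. fps_const (h * w l) * v ^ l)"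
      by simp
    finally show ?thesis .
  qed
  also have "... = fps_const (fps_nth G 0) + (v - fps_const h) * comb k w"
  proof -
    have "(\<Sum>l<k. fps_const (w l) * v ^ Suc l) = v * comb k w" by (simp add: comb_def sum_distrib_left mult.left_commute)
    moreover have "(\<Sum>l<k. fps_const (h * w l) * v ^ l) = fps_const h * comb k w"
      by (simp add: comb_def sum_distrib_left mult.assoc del: fps_const_mult flip: fps_const_mult)
    ultimately show ?thesis by (simp only: left_diff_distrib add_diff_eq)
  qed
  also have "... = fps_const (fps_nth G 0) + fps_X * comb k w" by (simp add: fps_X_eq)
  finally have "G - comb (Suc k) W = fps_X * (fps_shift 1 G - comb k w)" by (subst G) (simp add: right_diff_distrib)
  moreover have "fps_X * (fps_shift 1 G - comb k w) \<in> tri I (Suc k)" using w ideal_0[OF I] by (auto simp: tri_def less_Suc_eq_0_disj)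
  ultimately show ?case by metis
qed simp

lemma nth_comb: "fps_nth (comb k w) j = (\<Sum>l<k. w l * (of_nat (l choose j) * h ^ (l - j)))"
  by (simp add: comb_def fps_sum_nth nth_v_power)

lemma comb_in: "(\<And>l. l < k ==> w l \<in> I) ==> comb k w \<in> tri I b"
  unfolding comb_def by (intro ideal_sum[OF ideal_tri[OF I]] tri_const[OF I]) auto

text \<open>The highest coefficient of the combination is the last \<open>w\<close> alone, so the
  coefficients can be removed from the top.\<close>

lemma comb_indep: "comb k w \<in> tri I k ==> l < k ==> w l \<in> I"
proof (induction k)
  case (Suc k)
  have "fps_nth (comb (Suc k) w) k = w k" by (simp add: nth_comb binomial_eq_0)
  hence k: "w k \<in> I" using Suc.prems(1) by (auto simp: tri_def)
  have "comb (Suc k) w - fps_const (w k) * v ^ k \<in> tri I (Suc k)" by (intro ideal_diff[OF ideal_tri[OF I]] tri_const[OF I] k Suc.prems)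
  moreover have "comb (Suc k) w - fps_const (w k) * v ^ k = comb k w" by (simp add: comb_def)
  ultimately have "comb k w \<in> tri I k" by (simp add: tri_def)
  thus ?case using Suc k by (auto simp: less_Suc_eq)
qed simp

text \<open>Expand h = v - u: as soon as the exponent is at least b + n - 1, every binomial term
  contains v^n or u^b.\<close>

lemma h_power_in: "fps_const (h ^ (b + n)) \<in> CC b (Suc n)" "fps_const (h ^ (b + n)) \<in> CC (Suc b) n"
proof -
  have *: "fps_const (h ^ N) \<in> CC b n" if "N + 1 \<ge> b + n" for N b n
  proof -
    have "fps_const (h ^ N) = (v + (- fps_X)) ^ N" by (simp add: v_def fps_const_power)
    also have "... = (\<Sum>k\<le>N. of_nat (N choose k) * v ^ k * (- fps_X) ^ (N - k))" by (rule binomial_ring)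
    also have "... \<in> CC b n"
    proof (rule ideal_sum[OF ideal_CC])
      fix k assume "k \<in> {..N}"
      show "of_nat (N choose k) * v ^ k * (- fps_X) ^ (N - k) \<in> CC b n"
      proof (cases "k \<ge> n")
        case True
        have "v ^ k = v ^ (k - n) * v ^ n" using True by (simp add: power_add[symmetric])
        moreover have "v ^ (k - n) * v ^ n \<in> CC b n" unfolding CC_def by (rule with_gen_gen[OF ideal_tri[OF I]])
        ultimately show ?thesis by (simp add: ideal_mult ideal_mult2 ideal_CC)
      next
        case False
        hence "N - k \<ge> b" using that by simp
        have "(- fps_X :: 'v fps) ^ (N - k) = (-1) ^ (N - k) * fps_X ^ (N - k)" by (metis mult_minus1 power_mult_distrib)
        also have "... \<in> tri I b" by (rule ideal_mult[OF ideal_tri[OF I]])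
            (use \<open>N - k \<ge> b\<close> ideal_0[OF I] in \<open>auto simp: tri_def fps_X_power_iff\<close>)
        finally show ?thesis using tri_CC ideal_mult[OF ideal_CC] by blast
      qed
    qed
    finally show ?thesis .
  qed
  show "fps_const (h ^ (b + n)) \<in> CC b (Suc n)" "fps_const (h ^ (b + n)) \<in> CC (Suc b) n" by (rule *, simp)+
qed

end

text \<open>Vandermonde for the exponents n + 1 + l and -(n + 1). For l <= b the right side singles
  out l = b, which is why these weights serve as a dual functional in
  \<open>const_CC\<close>.\<close>

lemma vandermonde_shift:
  "(\<Sum>j\<le>b. (-1) ^ (b - j) * int ((n + b - j) choose (b - j)) * int ((Suc n + l) choose j)) = int (l choose b)"
proof -
  have "real_of_int (\<Sum>j\<le>b. (-1) ^ (b - j) * int ((n + b - j) choose (b - j)) * int ((Suc n + l) choose j))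
     = (\<Sum>j\<le>b. (real (Suc n + l) gchoose j) * ((- real (Suc n)) gchoose (b - j)))"
  proof (simp only: of_int_sum, rule sum.cong[OF refl])
    fix j assume "j \<in> {..b}"
    hence "real (n + b - j) = real (Suc n) + of_nat (b - j) - 1" by (simp add: of_nat_diff)
    hence "(- real (Suc n)) gchoose (b - j) = (-1) ^ (b - j) * (real (n + b - j) gchoose (b - j))" by (simp only: gbinomial_minus)
    thus "real_of_int ((-1) ^ (b - j) * int ((n + b - j) choose (b - j)) * int ((Suc n + l) choose j))
      = (real (Suc n + l) gchoose j) * ((- real (Suc n)) gchoose (b - j))"
      by (simp only: of_int_mult of_int_power of_int_minus of_int_1 of_int_of_nat_eq binomial_gbinomial mult.commute)
  qed
  also have "... = (real (Suc n + l) + (- real (Suc n))) gchoose b" unfolding atMost_atLeast0 by (rule gbinomial_Vandermonde)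
  also have "... = real_of_int (int (l choose b))" by (simp add: binomial_gbinomial)
  finally show ?thesis by linarith
qed

section \<open>The Clebsch-Gordan rule in characteristic p\<close>

locale power_basis_p = power_basis I h for I :: "'v::comm_ring_1 set" and h :: 'v +
  fixes p :: nat
  assumes p: "prime p" and pI: "of_nat p \<in> I"
begin

lemma mod_unit: assumes "\<not> p dvd k" obtains u :: nat where "\<And>x. of_nat u * of_nat k * x - x \<in> I"
proof -
  have "coprime k p" using assms p by (metis prime_imp_coprime coprime_commute)
  then obtain u where "[k * u = 1] (mod p)" using cong_solve_coprime_nat[of k p] by auto
  hence "int p dvd (int k * int u - 1)" using cong_int_iff by (metis cong_iff_dvd_diff of_nat_1 of_nat_mult)
  then obtain c where c: "int k * int u - 1 = int p * c" by (rule dvdE)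
  have "of_nat u * of_nat k * x - x \<in> I" for x :: 'v
  proof -
    have "of_nat u * of_nat k * x - x = of_int (int k * int u - 1) * x" by (simp add: algebra_simps)
    also have "... = (of_int c * x) * of_nat p" by (simp add: c)
    finally show ?thesis by (simp add: ideal_mult[OF I pI])
  qed
  thus ?thesis using that by blast
qed

lemma mod_cancel: assumes "\<not> p dvd k" "of_nat k * x \<in> I" shows "x \<in> I"
proof -
  obtain u :: nat where u: "\<And>x. of_nat u * of_nat k * x - x \<in> I" using mod_unit[OF assms(1)] by blast
  have "of_nat u * (of_nat k * x) \<in> I" by (rule ideal_mult[OF I assms(2)])
  thus ?thesis using u[of x] ideal_diff_iff[OF I, of "of_nat u * of_nat k * x" x] by (simp add: mult.assoc)
qed

lemma small_ndvd: "0 < k ==> k < p ==> \<not> p dvd k"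
  by (meson nat_dvd_not_less)

lemma deriv_v: "fps_deriv v = 1" by (simp add: v_def)

lemma deriv_v_pow: "fps_deriv (v ^ Suc n) = of_nat (Suc n) * v ^ n"
  by (simp add: fps_deriv_power' deriv_v del: power_Suc of_nat_Suc)

lemma deriv_tri: "G \<in> tri I (Suc b) ==> fps_deriv G \<in> tri I b"
  by (auto simp: tri_def intro!: ideal_mult[OF I] simp del: of_nat_Suc)

lemma deriv_CC: assumes "G \<in> CC (Suc b) (Suc n)" shows "fps_deriv G \<in> CC b n"
proof -
  obtain H where H: "G - H * v ^ Suc n \<in> tri I (Suc b)" using assms by (auto simp: CC_def with_gen_def)
  have "fps_deriv (G - H * v ^ Suc n) \<in> tri I b" by (rule deriv_tri[OF H])
  moreover have "fps_deriv (G - H * v ^ Suc n) = fps_deriv G - (of_nat (Suc n) * H + fps_deriv H * v) * v ^ n"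
    unfolding fps_deriv_sub fps_deriv_mult[of H] deriv_v_pow by (simp add: algebra_simps del: of_nat_Suc)
  ultimately have "fps_deriv G - (of_nat (Suc n) * H + fps_deriv H * v) * v ^ n \<in> tri I b" by (simp only:)
  thus ?thesis unfolding CC_def with_gen_def by blast
qed

text \<open>Integrate F' = H v^n termwise after expanding \<open>H\<close> in powers of
  \<open>v\<close>; the divisors n + l + 1 and i + 1 that occur stay below \<open>p\<close>. What is
  left has derivative 0 modulo u^b and is therefore constant modulo u^(b+1).\<close>

lemma deriv_CC_conv:
  assumes F: "fps_deriv F \<in> CC b n" and bn: "b + n < p"
  shows "\<exists>c. F - fps_const c \<in> CC (Suc b) (Suc n)"
proof -
  obtain H where H: "fps_deriv F - H * v ^ n \<in> tri I b" using F by (auto simp: CC_def with_gen_def)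
  obtain w where w: "H - comb b w \<in> tri I b" using comb_exists by blast
  have "\<exists>u. \<forall>x::'v. of_nat u * of_nat (Suc (n + l)) * x - x \<in> I" if "l < b" for l
  proof -
    have "\<not> p dvd Suc (n + l)" using that bn by (intro small_ndvd) auto
    thus ?thesis using mod_unit by metis
  qed
  then obtain u :: "nat => nat" where
    u: "\<And>l x. l < b ==> of_nat (u l) * of_nat (Suc (n + l)) * x - x \<in> I" by metis
  define E where "E = (\<Sum>l<b. fps_const (of_nat (u l) * w l) * v ^ Suc (n + l))"
  have "fps_deriv E - comb b w * v ^ n
     = (\<Sum>l<b. fps_const (of_nat (u l) * of_nat (Suc (n + l)) * w l - w l) * v ^ (n + l))"
  proof -
    have "fps_deriv (fps_const c * v ^ Suc m) = fps_const (c * of_nat (Suc m)) * v ^ m" for c m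
      by (simp only: fps_deriv_mult_const_left deriv_v_pow fps_of_nat[symmetric] mult.assoc flip: fps_const_mult)
    hence "fps_deriv E = (\<Sum>l<b. fps_const (of_nat (u l) * of_nat (Suc (n + l)) * w l) * v ^ (n + l))"
      by (simp only: E_def fps_deriv_sum) (simp only: ac_simps)
    moreover have "comb b w * v ^ n = (\<Sum>l<b. fps_const (w l) * v ^ (n + l))"
      unfolding comb_def sum_distrib_right by (rule sum.cong) (simp_all add: power_add ac_simps)
    ultimately show ?thesis by (simp only: sum_subtractf[symmetric] left_diff_distrib[symmetric] fps_const_sub)
  qed
  also have "... \<in> tri I b" by (intro ideal_sum[OF ideal_tri[OF I]] tri_const[OF I] u) auto
  finally have 1: "fps_deriv E - comb b w * v ^ n \<in> tri I b" .
  have 2: "(H - comb b w) * v ^ n \<in> tri I b" by (rule ideal_mult2[OF ideal_tri[OF I] w])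
  have "fps_deriv (F - E) \<in> tri I b"
  proof -
    have "fps_deriv (F - E) = (fps_deriv F - H * v ^ n) + (H - comb b w) * v ^ n - (fps_deriv E - comb b w * v ^ n)" by (simp add: algebra_simps)
    thus ?thesis using ideal_diff[OF ideal_tri[OF I] ideal_add[OF ideal_tri[OF I] H 2] 1] by (simp only:)
  qed
  hence der: "of_nat (Suc i) * fps_nth (F - E) (Suc i) \<in> I" if "i < b" for i
  proof -
    have "fps_nth (fps_deriv (F - E)) i \<in> I" using \<open>fps_deriv (F - E) \<in> tri I b\<close> that unfolding tri_def by blast
    thus ?thesis by (simp only: fps_deriv_nth Suc_eq_plus1)
  qed
  have "F - E - fps_const (fps_nth (F - E) 0) \<in> tri I (Suc b)" unfolding tri_def
  proof (intro CollectI allI impI)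
    fix i assume i: "i < Suc b"
    show "fps_nth (F - E - fps_const (fps_nth (F - E) 0)) i \<in> I"
    proof (cases i)
      case 0 thus ?thesis using ideal_0[OF I] by simp
    next
      case (Suc j)
      have "\<not> p dvd Suc j" using i Suc bn by (intro small_ndvd) auto
      hence "fps_nth (F - E) (Suc j) \<in> I" using der[of j] i Suc mod_cancel by auto
      thus ?thesis using Suc by simp
    qed
  qed
  moreover have "E = (\<Sum>l<b. fps_const (of_nat (u l) * w l) * v ^ l) * v ^ Suc n"
    unfolding E_def sum_distrib_right by (rule sum.cong) (simp_all add: power_add ac_simps)
  ultimately show ?thesis unfolding CC_def with_gen_def
    by (intro exI[of _ "fps_nth (F - E) 0"] CollectI exI[of _ "\<Sum>l<b. fps_const (of_nat (u l) * w l) * v ^ l"])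
       (simp add: algebra_simps)
qed

text \<open>Modulo u^(b+1) the multiples of v^(n+1) are spanned by v^(n+1), ..., v^(n+1+b). A linear
  functional kills all of these but the last, where its value is h^(n+1+b), and it multiplies
  constants by a binomial coefficient prime to \<open>p\<close>.\<close>

lemma const_CC:
  assumes bn: "b + n < p"
  shows "fps_const c \<in> CC (Suc b) (Suc n) \<longleftrightarrow> c \<in> with_gen I (h ^ Suc (b + n))"
proof
  assume "c \<in> with_gen I (h ^ Suc (b + n))"
  then obtain r where r: "c - r * h ^ Suc (b + n) \<in> I" by (auto simp: with_gen_def)
  have "fps_const r * fps_const (h ^ (Suc b + n)) \<in> CC (Suc b) (Suc n)" by (rule ideal_mult[OF ideal_CC h_power_in(1)])
  moreover have "fps_const (c - r * h ^ Suc (b + n)) \<in> CC (Suc b) (Suc n)" using tri_const[OF I r, of 1] tri_CC by auto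
  ultimately have "fps_const (c - r * h ^ Suc (b + n)) + fps_const r * fps_const (h ^ (Suc b + n)) \<in> CC (Suc b) (Suc n)"
    by (intro ideal_add[OF ideal_CC])
  thus "fps_const c \<in> CC (Suc b) (Suc n)" by simp
next
  assume "fps_const c \<in> CC (Suc b) (Suc n)"
  then obtain H where H: "fps_const c - H * v ^ Suc n \<in> tri I (Suc b)" by (auto simp: CC_def with_gen_def)
  obtain w where w: "H - comb (Suc b) w \<in> tri I (Suc b)" using comb_exists by blast
  let ?N = "\<lambda>l. Suc n + l"
  have "(fps_const c - H * v ^ Suc n) + (H - comb (Suc b) w) * v ^ Suc n \<in> tri I (Suc b)"
    by (intro ideal_add[OF ideal_tri[OF I]] H ideal_mult2[OF ideal_tri[OF I]] w)
  hence "fps_const c - comb (Suc b) w * v ^ Suc n \<in> tri I (Suc b)" by (simp add: algebra_simps)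
  moreover have "comb (Suc b) w * v ^ Suc n = (\<Sum>l<Suc b. fps_const (w l) * v ^ ?N l)"
    unfolding comb_def sum_distrib_right by (rule sum.cong) (simp_all add: power_add ac_simps)
  ultimately have t: "fps_const c - (\<Sum>l<Suc b. fps_const (w l) * v ^ ?N l) \<in> tri I (Suc b)" by (simp only:)
  have co: "(if j = 0 then c else 0) - (\<Sum>l<Suc b. w l * (of_nat (?N l choose j) * h ^ (?N l - j))) \<in> I"
    if "j <= b" for j
  proof -
    have "fps_nth (fps_const c - (\<Sum>l<Suc b. fps_const (w l) * v ^ ?N l)) j
      = (if j = 0 then c else 0) - (\<Sum>l<Suc b. w l * (of_nat (?N l choose j) * h ^ (?N l - j)))"
      by (simp only: fps_sub_nth fps_sum_nth fps_nth_fps_const fps_mult_left_const_nth nth_v_power)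
    moreover have "fps_nth (fps_const c - (\<Sum>l<Suc b. fps_const (w l) * v ^ ?N l)) j \<in> I"
      using t that by (simp only: tri_def mem_Collect_eq le_imp_less_Suc)
    ultimately show ?thesis by (simp only:)
  qed
  \<comment> \<open>Weights of that functional: the coefficient of u^j is multiplied by
    \<open>\<beta> j\<close> h^j before summing.\<close>
  define \<beta> :: "nat => int" where "\<beta> j = (-1) ^ (b - j) * int ((n + b - j) choose (b - j))" for j
  have "(\<Sum>j\<le>b. of_int (\<beta> j) * h ^ j * ((if j = 0 then c else 0) -
      (\<Sum>l<Suc b. w l * (of_nat (?N l choose j) * h ^ (?N l - j))))) \<in> I" (is "?S \<in> I")
    by (intro ideal_sum[OF I] ideal_mult[OF I] co) auto
  moreover have "?S = of_int (\<beta> 0) * c - (\<Sum>l<Suc b. w l * h ^ ?N l * of_int (\<Sum>j\<le>b. \<beta> j * int (?N l choose j)))"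
  proof -
    have "(\<Sum>j\<le>b. of_int (\<beta> j) * h ^ j * (if j = 0 then c else 0)) = (\<Sum>j\<le>b. if j = 0 then of_int (\<beta> 0) * c else 0)"
      by (rule sum.cong) auto
    also have "... = of_int (\<beta> 0) * c" by simp
    finally have 1: "(\<Sum>j\<le>b. of_int (\<beta> j) * h ^ j * (if j = 0 then c else 0)) = of_int (\<beta> 0) * c" .
    have 2: "of_int (\<beta> j) * h ^ j * (w l * (of_nat (?N l choose j) * h ^ (?N l - j)))
      = w l * h ^ ?N l * (of_int (\<beta> j) * of_nat (?N l choose j))" for j l
    proof (cases "j <= ?N l")
      case True
      hence "h ^ ?N l = h ^ j * h ^ (?N l - j)" by (simp only: power_add[symmetric]) simp
      thus ?thesis by (simp only: ac_simps)
    next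
      case False hence "?N l choose j = 0" by (simp add: binomial_eq_0)
      thus ?thesis by (simp only: of_nat_0 mult_zero_left mult_zero_right)
    qed
    have "(\<Sum>j\<le>b. of_int (\<beta> j) * h ^ j * (\<Sum>l<Suc b. w l * (of_nat (?N l choose j) * h ^ (?N l - j))))
      = (\<Sum>j\<le>b. \<Sum>l<Suc b. w l * h ^ ?N l * (of_int (\<beta> j) * of_nat (?N l choose j)))" by (simp only: sum_distrib_left 2)
    also have "... = (\<Sum>l<Suc b. \<Sum>j\<le>b. w l * h ^ ?N l * (of_int (\<beta> j) * of_nat (?N l choose j)))" by (rule sum.swap)
    also have "... = (\<Sum>l<Suc b. w l * h ^ ?N l * of_int (\<Sum>j\<le>b. \<beta> j * int (?N l choose j)))"
      by (simp only: sum_distrib_left of_int_sum of_int_mult of_int_of_nat_eq)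
    finally show ?thesis by (simp only: right_diff_distrib sum_subtractf 1)
  qed
  moreover have "(\<Sum>l<Suc b. w l * h ^ ?N l * of_int (\<Sum>j\<le>b. \<beta> j * int (?N l choose j))) = w b * h ^ ?N b"
  proof -
    have "(\<Sum>l<Suc b. w l * h ^ ?N l * of_int (\<Sum>j\<le>b. \<beta> j * int (?N l choose j)))
      = (\<Sum>l<Suc b. if l = b then w b * h ^ ?N b else 0)" unfolding \<beta>_def vandermonde_shift by (rule sum.cong) (auto simp: binomial_eq_0)
    thus ?thesis by (simp add: sum.delta)
  qed
  ultimately have key: "of_int (\<beta> 0) * c - w b * h ^ Suc (b + n) \<in> I" by (simp add: add.commute)
  \<comment> \<open>Up to sign this is \<open>\<beta> 0\<close>, the factor in front of
    \<open>c\<close>; it is a unit modulo \<open>p\<close> because n + b < p.\<close>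
  have "\<not> p dvd ((n + b) choose b)"
  proof
    assume "p dvd ((n + b) choose b)"
    moreover have "((n + b) choose b) dvd fact (n + b)" by (metis binomial_fact_lemma dvd_triv_right le_add2)
    ultimately have "p dvd fact (n + b)" by (rule dvd_trans)
    thus False using bn p by (simp add: prime_dvd_fact_iff)
  qed
  then obtain u :: nat where u: "\<And>x. of_nat u * of_nat ((n + b) choose b) * x - x \<in> I" using mod_unit by blast
  have "of_nat u * (-1) ^ b * (of_int (\<beta> 0) * c - w b * h ^ Suc (b + n)) \<in> I" by (rule ideal_mult[OF I key])
  moreover have "of_nat u * (-1) ^ b * (of_int (\<beta> 0) * c - w b * h ^ Suc (b + n))
     = of_nat u * of_nat ((n + b) choose b) * c - (of_nat u * (-1) ^ b * w b) * h ^ Suc (b + n)"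
  proof -
    have "((-1) ^ b * (-1) ^ b :: 'v) = 1" by (simp add: power_mult_distrib[symmetric])
    moreover have "of_nat u * (-1) ^ b * (of_int (\<beta> 0) * c)
      = of_nat u * ((-1) ^ b * (-1) ^ b) * of_nat ((n + b) choose b) * c" by (simp add: \<beta>_def ac_simps)
    ultimately have "of_nat u * (-1) ^ b * (of_int (\<beta> 0) * c) = of_nat u * of_nat ((n + b) choose b) * c" by (simp only: mult_1_right)
    thus ?thesis by (simp add: algebra_simps)
  qed
  ultimately have "of_nat u * of_nat ((n + b) choose b) * c - (of_nat u * (-1) ^ b * w b) * h ^ Suc (b + n) \<in> I" by (simp only:)
  hence "of_nat u * of_nat ((n + b) choose b) * c - (of_nat u * (-1) ^ b * w b) * h ^ Suc (b + n)
     - (of_nat u * of_nat ((n + b) choose b) * c - c) \<in> I" by (rule ideal_diff[OF I _ u])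
  thus "c \<in> with_gen I (h ^ Suc (b + n))" unfolding with_gen_def
    by (intro CollectI exI[of _ "of_nat u * (-1) ^ b * w b"]) (simp add: algebra_simps)
qed

text \<open>Differentiation identifies the quotient of \<open>V[u]/(u\<^bsup>b+1\<^esup>, (u+h)\<^bsup>n+1\<^esup>)\<close> by the
  constants with \<open>V[u]/(u\<^sup>b, (u+h)\<^sup>n)\<close>. This is the Clebsch--Gordan rule for Jordan blocks,
  in the range where the characteristic does not interfere.\<close>

lemma ind_CC_step:
  assumes bn: "b + n < p"
  shows "ind UNIV (CC (Suc b) (Suc n)) = ind UNIV (with_gen I (h ^ Suc (b + n))) * ind UNIV (CC b n)"
proof -
  let ?J = "CC (Suc b) (Suc n)"
  let ?K = "{G. \<exists>c. G - fps_const c \<in> ?J}"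
  have sJ: "is_subgp (CC b n)" for b n by (rule ideal_subgp[OF ideal_CC])
  have sK: "is_subgp ?K"
  proof (rule is_subgpI)
    show "0 \<in> ?K" by (auto intro!: exI[of _ 0] ideal_0[OF ideal_CC])
    fix x y assume "x \<in> ?K" "y \<in> ?K"
    then obtain c d where "x - fps_const c \<in> ?J" "y - fps_const d \<in> ?J" by auto
    hence "(x - fps_const c) - (y - fps_const d) \<in> ?J" by (rule ideal_diff[OF ideal_CC])
    hence "(x - y) - fps_const (c - d) \<in> ?J" by (simp add: algebra_simps flip: fps_const_sub)
    thus "x - y \<in> ?K" by blast
  qed
  have JK: "?J \<subseteq> ?K" by (auto intro!: exI[of _ 0])
  have "ind UNIV ?J = ind UNIV ?K * ind ?K ?J" by (rule ind_tower[OF sJ sK subgp_UNIV JK]) simp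
  also have "ind UNIV ?K = ind UNIV (CC b n)"
  proof (rule ind_eqI[OF sK sJ, where \<phi> = fps_deriv])
    fix x y :: "'v fps"
    have "fps_deriv (x - y) \<in> CC b n \<longleftrightarrow> x - y \<in> ?K"
    proof
      assume "x - y \<in> ?K"
      then obtain c where "x - y - fps_const c \<in> ?J" by blast
      hence "fps_deriv (x - y - fps_const c) \<in> CC b n" by (rule deriv_CC)
      thus "fps_deriv (x - y) \<in> CC b n" by simp
    qed (use deriv_CC_conv bn in blast)
    thus "fps_deriv x - fps_deriv y \<in> CC b n \<longleftrightarrow> x - y \<in> ?K" by simp
  next
    fix y :: "'v fps"
    have "\<exists>u. \<forall>x::'v. of_nat u * of_nat (Suc l) * x - x \<in> I" if "l < b" for l
    proof -
      have "\<not> p dvd Suc l" using that bn by (intro small_ndvd) auto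
      thus ?thesis using mod_unit by metis
    qed
    then obtain u :: "nat => nat" where
      u: "\<And>l x. l < b ==> of_nat (u l) * of_nat (Suc l) * x - x \<in> I" by metis
    define x where "x = Abs_fps (\<lambda>i. of_nat (u (i - 1)) * fps_nth y (i - 1))"
    have "fps_deriv x - y \<in> tri I b"
    proof -
      have "fps_nth (fps_deriv x - y) i \<in> I" if "i < b" for i using u[OF that, of "fps_nth y i"] by (simp add: x_def ac_simps del: of_nat_Suc)
      thus ?thesis by (simp add: tri_def)
    qed
    hence "- (fps_deriv x - y) \<in> CC b n" using tri_CC ideal_minus[OF ideal_CC] by blast
    thus "\<exists>x\<in>UNIV. y - fps_deriv x \<in> CC b n" by auto
  qed simp
  also have "ind ?K ?J = ind UNIV (with_gen I (h ^ Suc (b + n)))"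
  proof (rule ind_eqI[symmetric, OF _ sJ, where \<phi> = fps_const])
    show "is_subgp (with_gen I (h ^ Suc (b + n)))" by (intro ideal_subgp ideal_with_gen I)
    show "fps_const x \<in> ?K" for x using ideal_0[OF ideal_CC] by (auto intro!: exI[of _ x])
    show "fps_const x - fps_const y \<in> ?J \<longleftrightarrow> x - y \<in> with_gen I (h ^ Suc (b + n))" for x y
      using const_CC[OF bn, of "x - y"] by simp
    show "y \<in> ?K ==> \<exists>x\<in>UNIV. y - fps_const x \<in> ?J" for y by auto
  qed
  finally show ?thesis by simp
qed

text \<open>Each use of \<open>ind_CC_step\<close> lowers \<open>b\<close> and \<open>n\<close> by
  one, hence the exponent of \<open>h\<close> by two, until one of them vanishes.\<close>

lemma ind_CC:
  assumes "b + n <= p + 1"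
  shows "ind UNIV (CC b n) = (\<Prod>i<min b n. ind UNIV (with_gen I (h ^ (b + n - 1 - 2 * i))))"
  using assms
proof (induction b arbitrary: n)
  case 0
  thus ?case using ind_self[OF subgp_UNIV] by (simp add: CC_0)
next
  case (Suc b)
  show ?case
  proof (cases n)
    case 0 thus ?thesis using ind_self[OF subgp_UNIV] by (simp add: CC_0')
  next
    case n: (Suc n')
    have "ind UNIV (CC (Suc b) n) = ind UNIV (with_gen I (h ^ Suc (b + n'))) * ind UNIV (CC b n')"
      unfolding n using Suc.prems n by (intro ind_CC_step) simp
    also have "ind UNIV (CC b n') = (\<Prod>i<min b n'. ind UNIV (with_gen I (h ^ (b + n' - 1 - 2 * i))))" using Suc.prems n by (intro Suc.IH) simp
    also have "ind UNIV (with_gen I (h ^ Suc (b + n'))) * \<dots> = (\<Prod>i<Suc (min b n'). ind UNIV (with_gen I (h ^ (Suc b + n - 1 - 2 * i))))"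
      by (subst prod.lessThan_Suc_shift) (simp add: n)
    finally show ?thesis by (simp add: n)
  qed
qed

end

section \<open>Substituting u^a for u\<close>

context power_basis
begin

lemma fps_split: "G - fps_X ^ k * fps_shift k G \<in> tri I N" if "G \<in> tri I k"
  using that ideal_0[OF I] by (auto simp: tri_def fps_X_power_mult_nth)

lemma X_power_tri: "fps_X ^ k * F \<in> tri I (k + b) \<longleftrightarrow> F \<in> tri I b"
proof
  assume *: "fps_X ^ k * F \<in> tri I (k + b)"
  show "F \<in> tri I b" unfolding tri_def
  proof (intro CollectI allI impI)
    fix i assume "i < b"
    hence "fps_nth (fps_X ^ k * F) (k + i) \<in> I" using * by (simp add: tri_def)
    thus "fps_nth F i \<in> I" by (simp add: fps_X_power_mult_nth)
  qed
next
  assume "F \<in> tri I b"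
  thus "fps_X ^ k * F \<in> tri I (k + b)" using ideal_0[OF I] by (auto simp: tri_def fps_X_power_mult_nth)
qed

text \<open>The part of a series with exponents congruent to \<open>r\<close> modulo
  \<open>a\<close>, reread as a series in u^a.\<close>

definition sl :: "nat => nat => 'v fps => 'v fps" where
  "sl a r G = Abs_fps (\<lambda>i. fps_nth G (a * i + r))"

lemma sl_diff: "sl a r (x - y) = sl a r x - sl a r y" by (rule fps_ext) (simp add: sl_def)

lemma sl_mult_step: "r < a ==> sl a r ((fps_X ^ a + fps_const h) * G) = v * sl a r G"
proof (rule fps_ext)
  fix i assume r: "r < a"
  show "fps_nth (sl a r ((fps_X ^ a + fps_const h) * G)) i = fps_nth (v * sl a r G) i"
  proof (cases i)
    case 0 thus ?thesis using r by (simp add: sl_def v_def distrib_right fps_X_power_mult_nth)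
  next
    case (Suc j) thus ?thesis using r by (simp add: sl_def v_def distrib_right fps_X_power_mult_nth)
  qed
qed

lemma sl_mult: "r < a ==> sl a r (G * (fps_X ^ a + fps_const h) ^ n) = sl a r G * v ^ n"
proof (induction n)
  case (Suc n)
  have "sl a r (G * (fps_X ^ a + fps_const h) ^ Suc n)
    = sl a r ((fps_X ^ a + fps_const h) * (G * (fps_X ^ a + fps_const h) ^ n))" by (simp add: ac_simps)
  also have "... = v * (sl a r G * v ^ n)" using Suc by (simp add: sl_mult_step)
  finally show ?case by (simp add: ac_simps)
qed simp

text \<open>The quotient is the number of exponents below \<open>N\<close> congruent to
  \<open>r\<close>, that is, (N - r)/a rounded up.\<close>

lemma less_block_iff: "r < a ==> i < (N + a - 1 - r) div a \<longleftrightarrow> a * i + r < (N::nat)"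
proof -
  assume r: "r < a"
  have "i < (N + a - 1 - r) div a \<longleftrightarrow> Suc i * a <= N + a - 1 - r"
    using r by (simp only: Suc_le_eq[symmetric] less_eq_div_iff_mult_less_eq)
  also have "... \<longleftrightarrow> a * i + r < N" using r by (simp add: algebra_simps) linarith
  finally show ?thesis .
qed

text \<open>Series in u are free over series in u^a with basis 1, ..., u^(a-1). Multiplication by
  u^a + h preserves each summand and acts there as \<open>v\<close>.\<close>

lemma ind_power_var:
  assumes a: "a > 0"
  shows "ind UNIV (with_gen (tri I N) ((fps_X ^ a + fps_const h) ^ n))
     = (\<Prod>r<a. ind UNIV (CC ((N + a - 1 - r) div a) n))"
proof -
  let ?Q = "(fps_X ^ a + fps_const h) ^ n"
  let ?N = "\<lambda>r. (N + a - 1 - r) div a"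
  have "with_gen (tri I N) ?Q = {G. \<forall>r<a. sl a r G \<in> CC (?N r) n}"
  proof (intro equalityI subsetI CollectI allI impI)
    fix G r assume "G \<in> with_gen (tri I N) ?Q" and r: "r < a"
    then obtain R where "G - R * ?Q \<in> tri I N" by (auto simp: with_gen_def)
    hence "sl a r (G - R * ?Q) \<in> tri I (?N r)" using less_block_iff[OF r] by (simp add: tri_def sl_def)
    thus "sl a r G \<in> CC (?N r) n" unfolding CC_def with_gen_def using sl_diff sl_mult[OF r] by auto
  next
    fix G assume "G \<in> {G. \<forall>r<a. sl a r G \<in> CC (?N r) n}"
    hence "\<forall>r. \<exists>R. r < a --> sl a r G - R * v ^ n \<in> tri I (?N r)" by (auto simp: CC_def with_gen_def)
    then obtain R where R: "\<And>r. r < a ==> sl a r G - R r * v ^ n \<in> tri I (?N r)" by metis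
    define S where "S = Abs_fps (\<lambda>k. fps_nth (R (k mod a)) (k div a))"
    have S: "sl a r S = R r" if "r < a" for r by (rule fps_ext) (use that a in \<open>simp add: sl_def S_def\<close>)
    have "G - S * ?Q \<in> tri I N" unfolding tri_def
    proof (intro CollectI allI impI)
      fix k assume k: "k < N"
      let ?r = "k mod a" and ?i = "k div a"
      have r: "?r < a" using a by simp
      have ki: "a * ?i + ?r = k" by simp
      have "fps_nth (G - S * ?Q) k = fps_nth (sl a ?r (G - S * ?Q)) ?i" by (simp add: sl_def)
      also have "... = fps_nth (sl a ?r G - R ?r * v ^ n) ?i" by (simp only: sl_diff sl_mult[OF r] S[OF r])
      also have "... \<in> I" using R[OF r] less_block_iff[OF r, of ?i N] k ki by (simp add: tri_def)
      finally show "fps_nth (G - S * ?Q) k \<in> I" .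
    qed
    thus "G \<in> with_gen (tri I N) ?Q" by (auto simp: with_gen_def)
  qed
  also have "ind UNIV \<dots> = (\<Prod>r<a. ind UNIV (CC (?N r) n))"
    by (rule ind_coordinates[where e = "\<lambda>k x. Abs_fps (\<lambda>m. if m mod a = k then fps_nth x (m div a) else 0)"])
       (auto simp: sl_diff sl_def fps_eq_iff intro!: ideal_subgp ideal_CC)
  finally show ?thesis .
qed

end

section \<open>The symmetry between u and u + h modulo u^p\<close>

context power_basis_p
begin

text \<open>The freshman's dream gives v^p = u^p + h^p. So the powers of \<open>v\<close> below
  \<open>p\<close> are a second basis modulo u^p, on which \<open>v\<close> acts as a pure shift,
  just as u does on its own powers.\<close>

lemma v_power_p: assumes "h ^ p \<in> I" shows "v ^ p \<in> tri I p"
  unfolding tri_def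
proof (intro CollectI allI impI)
  fix j assume j: "j < p"
  show "fps_nth (v ^ p) j \<in> I"
  proof (cases "j = 0")
    case True thus ?thesis using assms by (simp add: nth_v_power)
  next
    case False
    hence "p dvd (p choose j)" by (intro dvd_choose_prime) (use j p False in auto)
    then obtain c where "p choose j = p * c" by (rule dvdE)
    thus ?thesis by (simp add: nth_v_power mult.assoc ideal_mult2[OF I pI])
  qed
qed

lemma comb_mult_v:
  assumes hp: "h ^ p \<in> I" and n: "n <= p"
  shows "comb p w * v ^ n - comb p (\<lambda>l. if l < n then 0 else w (l - n)) \<in> tri I p"
proof -
  let ?t = "\<lambda>l. fps_const (w l) * v ^ (l + n)"
  have "comb p w * v ^ n = (\<Sum>l<p. ?t l)" unfolding comb_def sum_distrib_right by (rule sum.cong) (simp_all add: power_add ac_simps)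
  also have "... = (\<Sum>l<p-n. ?t l) + (\<Sum>l=p-n..<p. ?t l)"
    using sum.atLeastLessThan_concat[of 0 "p - n" p ?t] by (simp add: lessThan_atLeast0)
  also have "(\<Sum>l<p-n. ?t l) = (\<Sum>l=n..<p. fps_const (w (l - n)) * v ^ l)"
    by (rule sum.reindex_bij_witness[where i = "\<lambda>l. l - n" and j = "\<lambda>l. l + n"]) auto
  also have "... = comb p (\<lambda>l. if l < n then 0 else w (l - n))" unfolding comb_def by (rule sum.mono_neutral_cong_left) auto
  finally have "comb p w * v ^ n - comb p (\<lambda>l. if l < n then 0 else w (l - n)) = (\<Sum>l=p-n..<p. ?t l)"
    by simp
  also have "... \<in> tri I p"
  proof (rule ideal_sum[OF ideal_tri[OF I]])
    fix l assume "l \<in> {p-n..<p}"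
    hence "?t l = (fps_const (w l) * v ^ (l + n - p)) * v ^ p" by (auto simp: mult.assoc power_add[symmetric])
    thus "?t l \<in> tri I p" by (simp add: ideal_mult[OF ideal_tri[OF I] v_power_p[OF hp]])
  qed
  finally show ?thesis .
qed

lemma comb_in_CC:
  assumes hp: "h ^ p \<in> I" and n: "n <= p"
  shows "comb p g \<in> CC p n \<longleftrightarrow> (\<forall>l<n. g l \<in> I)"
proof
  assume "comb p g \<in> CC p n"
  then obtain H where H: "comb p g - H * v ^ n \<in> tri I p" by (auto simp: CC_def with_gen_def)
  obtain w where w: "H - comb p w \<in> tri I p" using comb_exists by blast
  let ?w = "\<lambda>l. if l < n then 0 else w (l - n)"
  have "(comb p g - H * v ^ n) + (H - comb p w) * v ^ n + (comb p w * v ^ n - comb p ?w) \<in> tri I p"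
    by (intro ideal_add[OF ideal_tri[OF I]] H ideal_mult2[OF ideal_tri[OF I]] w comb_mult_v[OF hp n])
  hence "comb p (\<lambda>l. g l - ?w l) \<in> tri I p" by (simp only: comb_diff) (simp add: algebra_simps)
  hence gw: "g l - ?w l \<in> I" if "l < p" for l using comb_indep that by blast
  show "\<forall>l<n. g l \<in> I"
  proof (intro allI impI)
    fix l assume "l < n" thus "g l \<in> I" using gw[of l] n by simp
  qed
next
  assume g: "\<forall>l<n. g l \<in> I"
  have "fps_const (g l) * v ^ l \<in> CC p n" for l
  proof (cases "l < n")
    case True thus ?thesis using g tri_const[OF I] tri_CC by blast
  next
    case False
    hence "fps_const (g l) * v ^ l = (fps_const (g l) * v ^ (l - n)) * v ^ n" by (simp add: mult.assoc power_add[symmetric])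
    thus ?thesis unfolding CC_def using with_gen_gen[OF ideal_tri[OF I]] by metis
  qed
  thus "comb p g \<in> CC p n" unfolding comb_def by (intro ideal_sum[OF ideal_CC])
qed

lemma ind_CC_p:
  assumes hp: "h ^ p \<in> I" and n: "n <= p"
  shows "ind UNIV (CC p n) = ind UNIV I ^ n"
proof -
  have "ind UNIV (tri I n) = ind UNIV (CC p n)"
  proof (rule ind_eqI[where \<phi> = "\<lambda>G. comb p (fps_nth G)"])
    show "comb p (fps_nth x) - comb p (fps_nth y) \<in> CC p n \<longleftrightarrow> x - y \<in> tri I n" for x y
      using comb_in_CC[OF hp n, of "\<lambda>l. fps_nth x l - fps_nth y l"] by (simp add: comb_diff tri_def)
    show "\<exists>x\<in>UNIV. y - comb p (fps_nth x) \<in> CC p n" for y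
    proof -
      obtain w where "y - comb p w \<in> tri I p" using comb_exists by blast
      hence "y - comb p w \<in> CC p n" using tri_CC by blast
      moreover have "comb p (fps_nth (Abs_fps w)) = comb p w" by (simp add: comb_def)
      ultimately show ?thesis by (metis UNIV_I)
    qed
  qed (auto intro: ideal_subgp ideal_CC ideal_tri I)
  thus ?thesis by (simp add: ind_tri[OF I])
qed

text \<open>In the basis of powers of \<open>v\<close>, multiplication by v^n shifts coordinates by
  \<open>n\<close>, so modulo u^p its kernel is generated by v^(p-n).\<close>

lemma colon_v:
  assumes hp: "h ^ p \<in> I" and n: "n <= p"
  shows "F * v ^ n \<in> tri I p \<longleftrightarrow> F \<in> CC p (p - n)"
proof -
  obtain w where w: "F - comb p w \<in> tri I p" using comb_exists by blast
  let ?w = "\<lambda>l. if l < n then 0 else w (l - n)"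
  have "F * v ^ n \<in> tri I p \<longleftrightarrow> comb p w * v ^ n \<in> tri I p" using ideal_mult2[OF ideal_tri[OF I] w, of "v ^ n"]
    by (intro ideal_diff_iff[OF ideal_tri[OF I]]) (simp add: algebra_simps)
  also have "... \<longleftrightarrow> comb p ?w \<in> tri I p" by (rule ideal_diff_iff[OF ideal_tri[OF I] comb_mult_v[OF hp n]])
  also have "... \<longleftrightarrow> (\<forall>l<p. ?w l \<in> I)"
  proof
    assume "comb p ?w \<in> tri I p"
    thus "\<forall>l<p. ?w l \<in> I" by (intro allI impI) (rule comb_indep[where w = ?w])
  next
    assume *: "\<forall>l<p. ?w l \<in> I"
    show "comb p ?w \<in> tri I p" by (rule comb_in) (rule *[rule_format])
  qed
  also have "... \<longleftrightarrow> (\<forall>l<p-n. w l \<in> I)"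
  proof
    assume *: "\<forall>l<p. ?w l \<in> I"
    show "\<forall>l<p-n. w l \<in> I"
    proof (intro allI impI)
      fix l assume "l < p - n" thus "w l \<in> I" using *[rule_format, of "l + n"] by simp
    qed
  qed (use ideal_0[OF I] in auto)
  also have "... \<longleftrightarrow> comb p w \<in> CC p (p - n)" by (rule comb_in_CC[OF hp, symmetric]) simp
  also have "... \<longleftrightarrow> F \<in> CC p (p - n)" using w tri_CC by (intro ideal_diff_iff[OF ideal_CC, symmetric]) auto
  finally show ?thesis .
qed

text \<open>Both sides compute the index of the ideal generated by \<open>u\<^bsup>p-b\<^esup> (u+h)\<^sup>n\<close> modulo \<open>u\<^sup>p\<close>.\<close>

lemma ind_CC_reflect:
  assumes hp: "h ^ p \<in> I" and n: "n <= p" and b: "b <= p"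
  shows "ind UNIV I ^ (p - b) * ind UNIV (CC b n) = ind UNIV I ^ n * ind UNIV (CC (p - b) (p - n))"
proof -
  let ?T = "tri I p" and ?k = "p - b"
  let ?U = "with_gen ?T (fps_X ^ ?k * v ^ n)"
  have iT: "is_ideal ?T" by (rule ideal_tri[OF I])
  have iU: "is_ideal ?U" by (rule ideal_with_gen[OF iT])
  have TU: "?T \<subseteq> ?U" by (rule with_gen_sub[OF iT])
  have kb: "?k + b = p" using b by simp
  have Xk: "fps_X ^ ?k * F \<in> tri I ?k" for F using X_power_tri[of ?k F 0] by simp
  have "ind UNIV ?U = ind UNIV (tri I ?k) * ind (tri I ?k) ?U"
  proof (rule ind_tower[OF ideal_subgp[OF iU] ideal_subgp[OF ideal_tri[OF I]] subgp_UNIV])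
    show "?U \<subseteq> tri I ?k" by (rule with_gen_least[OF ideal_tri[OF I]]) (use Xk in \<open>auto simp: tri_def\<close>)
  qed simp
  also have "ind (tri I ?k) ?U = ind UNIV (CC b n)"
  proof (rule ind_eqI[where \<phi> = "\<lambda>F. fps_X ^ ?k * F", symmetric, OF ideal_subgp[OF ideal_CC] ideal_subgp[OF iU]])
    fix x y
    have "fps_X ^ ?k * (x - y) \<in> ?U \<longleftrightarrow> (\<exists>r. fps_X ^ ?k * (x - y - r * v ^ n) \<in> tri I (?k + b))"
      unfolding with_gen_def kb by (simp add: algebra_simps)
    also have "... \<longleftrightarrow> x - y \<in> CC b n" unfolding X_power_tri CC_def with_gen_def by simp
    finally show "fps_X ^ ?k * x - fps_X ^ ?k * y \<in> ?U \<longleftrightarrow> x - y \<in> CC b n" by (simp add: right_diff_distrib)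
  next
    fix y assume "y \<in> tri I ?k"
    hence "y - fps_X ^ ?k * fps_shift ?k y \<in> ?U" using fps_split TU by blast
    thus "\<exists>x\<in>UNIV. y - fps_X ^ ?k * x \<in> ?U" by blast
  qed (use Xk in auto)
  finally have 1: "ind UNIV ?U = ind UNIV I ^ ?k * ind UNIV (CC b n)" by (simp add: ind_tri[OF I])
  \<comment> \<open>The second route to the same index, through (u^p, v^n). Multiplication by v^n,
    whose kernel is known from \<open>colon_v\<close>, identifies the remaining factor with the
    index of (u^(p-b), v^(p-n)).\<close>
  have "ind UNIV ?U = ind UNIV (CC p n) * ind (CC p n) ?U"
  proof (rule ind_tower[OF ideal_subgp[OF iU] ideal_subgp[OF ideal_CC] subgp_UNIV])
    show "?U \<subseteq> CC p n"
    proof (rule with_gen_least[OF ideal_CC tri_CC])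
      show "fps_X ^ ?k * v ^ n \<in> CC p n" unfolding CC_def by (rule with_gen_gen[OF iT])
    qed
  qed simp
  also have "ind (CC p n) ?U = ind UNIV (CC ?k (p - n))"
  proof (rule ind_eqI[where \<phi> = "\<lambda>F. F * v ^ n", symmetric, OF ideal_subgp[OF ideal_CC] ideal_subgp[OF iU]])
    show "x * v ^ n \<in> CC p n" for x unfolding CC_def by (rule with_gen_gen[OF iT])
    fix x y
    have "(x - y) * v ^ n \<in> ?U \<longleftrightarrow> (\<exists>r. (x - y - r * fps_X ^ ?k) * v ^ n \<in> ?T)"
      unfolding with_gen_def by (simp add: algebra_simps)
    also have "... \<longleftrightarrow> (\<exists>r. x - y - r * fps_X ^ ?k \<in> CC p (p - n))" unfolding colon_v[OF hp n] ..
    also have "... \<longleftrightarrow> x - y \<in> CC ?k (p - n)"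
    proof
      assume "\<exists>r. x - y - r * fps_X ^ ?k \<in> CC p (p - n)"
      then obtain r s where "x - y - r * fps_X ^ ?k - s * v ^ (p - n) \<in> ?T" by (auto simp: CC_def with_gen_def)
      hence "x - y - r * fps_X ^ ?k - s * v ^ (p - n) \<in> tri I ?k" by (simp add: tri_def)
      hence "x - y - r * fps_X ^ ?k - s * v ^ (p - n) + fps_X ^ ?k * r \<in> tri I ?k" by (intro ideal_add[OF ideal_tri[OF I]] Xk)
      hence "x - y - s * v ^ (p - n) \<in> tri I ?k" by (simp add: algebra_simps)
      thus "x - y \<in> CC ?k (p - n)" by (auto simp: CC_def with_gen_def)
    next
      assume "x - y \<in> CC ?k (p - n)"
      then obtain s where s: "x - y - s * v ^ (p - n) \<in> tri I ?k" by (auto simp: CC_def with_gen_def)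
      let ?r = "fps_shift ?k (x - y - s * v ^ (p - n))"
      have "x - y - s * v ^ (p - n) - fps_X ^ ?k * ?r \<in> ?T" by (rule fps_split[OF s])
      hence "(x - y - ?r * fps_X ^ ?k) - s * v ^ (p - n) \<in> ?T" by (simp add: algebra_simps)
      thus "\<exists>r. x - y - r * fps_X ^ ?k \<in> CC p (p - n)" unfolding CC_def with_gen_def by blast
    qed
    finally show "x * v ^ n - y * v ^ n \<in> ?U \<longleftrightarrow> x - y \<in> CC ?k (p - n)" by (simp add: left_diff_distrib)
  next
    fix y assume "y \<in> CC p n"
    then obtain r where "y - r * v ^ n \<in> ?T" by (auto simp: CC_def with_gen_def)
    thus "\<exists>x\<in>UNIV. y - x * v ^ n \<in> ?U" using TU by blast
  qed
  finally have "ind UNIV ?U = ind UNIV I ^ n * ind UNIV (CC ?k (p - n))" by (simp add: ind_CC_p[OF hp n])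
  with 1 show ?thesis by simp
qed

end

subsection \<open>Monomial ideals and slices\<close>

definition down_closed :: "expo set => bool" where
  "down_closed D \<longleftrightarrow> (\<forall>\<alpha> \<beta>. \<alpha> + \<beta> \<in> D --> \<beta> \<in> D)"

text \<open>The common form of most ideals below: for down-closed \<open>D\<close> it consists, up
  to completion, of what \<open>m\<close> and the monomials outside \<open>D\<close>
  generate.\<close>

definition did :: "int => expo set => mps set" where
  "did m D = {f. \<forall>\<alpha>\<in>D. m dvd coef f \<alpha>}"

lemma ideal_did: assumes "down_closed D" shows "is_ideal (did m D)"
proof (rule is_idealI)
  show "r * x \<in> did m D" if "x \<in> did m D" for x r unfolding did_def
  proof (intro CollectI ballI)
    fix \<alpha> assume a: "\<alpha> \<in> D"
    show "m dvd coef (r * x) \<alpha>" unfolding coef_mult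
    proof (intro dvd_sum dvd_mult)
      fix u assume "u \<in> splits \<alpha>"
      hence "snd u \<in> D" using assms a by (auto simp: down_closed_def splits_def)
      thus "m dvd coef x (snd u)" using that by (simp add: did_def)
    qed
  qed
qed (auto simp: did_def)

definition box :: "(nat => nat) => expo set" where "box c = {\<alpha>. \<forall>i. ex \<alpha> i < c i}"

text \<open>The ideal of \<open>p\<close> and all x_i^(c i). The value c i = 1 removes the variable
  x_i, so \<open>c\<close> also records which variables are present.\<close>

definition bI :: "nat => (nat => nat) => mps set" where "bI p c = did (int p) (box c)"

lemma down_closed_box: "down_closed (box c)"
  unfolding down_closed_def box_def by (auto simp: lookup_add) (metis add_lessD1 add.commute)

lemma ideal_bI: "is_ideal (bI p c)" unfolding bI_def by (rule ideal_did[OF down_closed_box])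

lemma p_bI: "of_nat p \<in> bI p c"
  using coef_of_nat_mult[of p 1] by (simp add: bI_def did_def)

text \<open>A series read as a series in x_n. The coefficients keep the type \<open>mps\<close> and
  merely avoid x_n, so variables can be stripped off repeatedly without changing types.\<close>

definition slice :: "nat => mps => mps fps" where
  "slice n f = Abs_fps (\<lambda>i. Mps (\<lambda>\<alpha>. if ex \<alpha> n = 0 then coef f (\<alpha> + sng n i) else 0))"

lemma coef_slice: "coef (fps_nth (slice n f) i) \<alpha> = (if ex \<alpha> n = 0 then coef f (\<alpha> + sng n i) else 0)"
  by (simp add: slice_def)

lemma slice_eqI: "(\<And>i \<alpha>. ex \<alpha> n = 0 ==> coef f (\<alpha> + sng n i) = coef (fps_nth G i) \<alpha>) ==>
   (\<And>i \<alpha>. ex \<alpha> n \<noteq> 0 ==> coef (fps_nth G i) \<alpha> = 0) ==> slice n f = G"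
  by (rule fps_ext, rule mps_eqI) (auto simp: coef_slice)

lemma slice_diff: "slice n (f - g) = slice n f - slice n g" by (rule slice_eqI) (auto simp: coef_slice)
lemma slice_add: "slice n (f + g) = slice n f + slice n g" by (rule slice_eqI) (auto simp: coef_slice)

lemma expo_split:
  obtains \<alpha>' where "\<alpha> = \<alpha>' + sng n (ex \<alpha> n)" "ex \<alpha>' n = 0"
proof
  show "\<alpha> = (\<alpha> - sng n (ex \<alpha> n)) + sng n (ex \<alpha> n)"
    by (rule poly_mapping_eqI) (simp add: lookup_add lookup_minus lookup_single when_def)
  show "ex (\<alpha> - sng n (ex \<alpha> n)) n = 0" by (simp add: lookup_minus)
qed

lemma splits_slice:
  fixes F :: "expo => expo => int"
  assumes \<alpha>: "ex \<alpha> n = 0"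
  shows "(\<Sum>u\<in>splits (\<alpha> + sng n i). F (fst u) (snd u))
    = (\<Sum>j\<le>i. \<Sum>u\<in>splits \<alpha>. F (fst u + sng n j) (snd u + sng n (i - j)))"
proof -
  let ?r = "\<lambda>\<beta>. \<beta> - sng n (ex \<beta> n)"
  have r: "?r \<beta> + sng n (ex \<beta> n) = \<beta>" "ex (?r \<beta>) n = 0" for \<beta> :: expo
    by (auto intro!: poly_mapping_eqI simp: lookup_add lookup_minus lookup_single when_def)
  have "(\<Sum>j\<le>i. \<Sum>u\<in>splits \<alpha>. F (fst u + sng n j) (snd u + sng n (i - j)))
    = (\<Sum>(j,u)\<in>{..i} \<times> splits \<alpha>. F (fst u + sng n j) (snd u + sng n (i - j)))" by (simp add: sum.cartesian_product)
  also have "... = (\<Sum>u\<in>splits (\<alpha> + sng n i). F (fst u) (snd u))"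
  proof (rule sum.reindex_bij_witness[where
        i = "\<lambda>u. (ex (fst u) n, (?r (fst u), ?r (snd u)))" and
        j = "\<lambda>(j,u). (fst u + sng n j, snd u + sng n (i - j))"])
    fix x assume "x \<in> {..i} \<times> splits \<alpha>"
    then obtain j \<beta> \<gamma> where x: "x = (j, (\<beta>, \<gamma>))" and j: "j <= i" and s: "\<beta> + \<gamma> = \<alpha>"
      by (cases x) (auto simp: splits_def)
    have z: "ex \<beta> n = 0" "ex \<gamma> n = 0" using \<alpha> s by (auto simp: lookup_add)
    have rr: "?r (\<delta> + sng n k) = \<delta>" if "ex \<delta> n = 0" for \<delta> :: expo and k
      using that by (intro poly_mapping_eqI) (auto simp: lookup_add lookup_minus lookup_single when_def)
    show "(\<lambda>u. (ex (fst u) n, (?r (fst u), ?r (snd u)))) ((\<lambda>(j,u). (fst u + sng n j, snd u + sng n (i - j))) x) = x"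
      using z by (simp add: x rr lookup_add)
    show "(\<lambda>(j,u). (fst u + sng n j, snd u + sng n (i - j))) x \<in> splits (\<alpha> + sng n i)"
      using s j by (simp add: x splits_def) (metis (no_types, lifting) add.assoc add.commute le_add_diff_inverse single_add)
  next
    fix u assume "u \<in> splits (\<alpha> + sng n i)"
    hence u: "fst u + snd u = \<alpha> + sng n i" by (simp add: splits_def)
    have e: "ex (fst u) k + ex (snd u) k = ex \<alpha> k + (if k = n then i else 0)" for k
      using arg_cong[OF u, of "\<lambda>x. ex x k"] by (simp add: lookup_add lookup_single when_def eq_commute)
    have n: "ex (fst u) n + ex (snd u) n = i" using e[of n] \<alpha> by simp
    show "(\<lambda>(j,u). (fst u + sng n j, snd u + sng n (i - j))) (ex (fst u) n, (?r (fst u), ?r (snd u))) = u"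
      using n r(1)[of "fst u"] r(1)[of "snd u"] by (simp add: prod_eq_iff flip: n)
    show "(ex (fst u) n, (?r (fst u), ?r (snd u))) \<in> {..i} \<times> splits \<alpha>"
    proof -
      have "?r (fst u) + ?r (snd u) = \<alpha>"
      proof (rule poly_mapping_eqI)
        fix k show "ex (?r (fst u) + ?r (snd u)) k = ex \<alpha> k"
          using e[of k] \<alpha> by (auto simp: lookup_add lookup_minus lookup_single when_def)
      qed
      thus ?thesis using n by (auto simp: splits_def)
    qed
  qed auto
  finally show ?thesis by simp
qed

lemma slice_mult: "slice n (f * g) = slice n f * slice n g"
proof (rule slice_eqI)
  fix i and \<alpha> :: expo
  have *: "coef (fps_nth (slice n f * slice n g) i) \<alpha>
    = (\<Sum>j\<le>i. \<Sum>u\<in>splits \<alpha>. coef (fps_nth (slice n f) j) (fst u) * coef (fps_nth (slice n g) (i - j)) (snd u))"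
    by (simp add: fps_mult_nth coef_mult atLeast0AtMost)
  show "coef (f * g) (\<alpha> + sng n i) = coef (fps_nth (slice n f * slice n g) i) \<alpha>" if \<alpha>: "ex \<alpha> n = 0"
    unfolding * coef_mult splits_slice[OF \<alpha>, where F = "\<lambda>x y. coef f x * coef g y"]
  proof (intro sum.cong refl)
    fix j u assume "u \<in> splits \<alpha>"
    hence "ex (fst u) n = 0" "ex (snd u) n = 0" using \<alpha> by (auto simp: splits_def lookup_add)
    thus "coef f (fst u + sng n j) * coef g (snd u + sng n (i - j))
      = coef (fps_nth (slice n f) j) (fst u) * coef (fps_nth (slice n g) (i - j)) (snd u)" by (simp add: coef_slice)
  qed
  show "coef (fps_nth (slice n f * slice n g) i) \<alpha> = 0" if \<alpha>: "ex \<alpha> n \<noteq> 0" unfolding *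
  proof (intro sum.neutral ballI)
    fix j u assume "u \<in> splits \<alpha>"
    hence "ex (fst u) n \<noteq> 0 \<or> ex (snd u) n \<noteq> 0" using \<alpha> by (auto simp: splits_def lookup_add)
    thus "coef (fps_nth (slice n f) j) (fst u) * coef (fps_nth (slice n g) (i - j)) (snd u) = 0" by (auto simp: coef_slice)
  qed
qed

lemma sng_eq_0_iff: "\<alpha> + sng n i = 0 \<longleftrightarrow> \<alpha> = 0 \<and> i = 0"
proof
  assume *: "\<alpha> + sng n i = 0"
  have e: "ex \<alpha> k + ex (sng n i) k = 0" for k using arg_cong[OF *, of "\<lambda>x. ex x k"] by (simp only: lookup_add lookup_zero)
  have k: "ex \<alpha> k = 0 \<and> (k = n --> i = 0)" for k using e[of k] by (auto simp: lookup_single)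
  have "i = 0" using k[of n] by simp
  thus "\<alpha> = 0 \<and> i = 0" using k by (simp add: poly_mapping_eqI)
qed simp

lemma slice_1: "slice n 1 = 1"
  by (rule slice_eqI) (auto simp: coef_1 sng_eq_0_iff fps_one_nth)

lemma slice_power: "slice n (f ^ k) = slice n f ^ k" by (induction k) (auto simp: slice_1 slice_mult)

definition free_of :: "nat => mps => bool" where "free_of n f \<longleftrightarrow> slice n f = fps_const f"

lemma free_of_add: "free_of n f ==> free_of n g ==> free_of n (f + g)" by (simp add: free_of_def slice_add)
lemma free_of_mult: "free_of n f ==> free_of n g ==> free_of n (f * g)" by (simp add: free_of_def slice_mult)
lemma free_of_power: "free_of n f ==> free_of n (f ^ k)" by (simp add: free_of_def slice_power fps_const_power)
lemma free_of_vr: "i \<noteq> n ==> free_of n (vr i)"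
  unfolding free_of_def
proof (rule slice_eqI)
  fix j and \<alpha> :: expo assume i: "i \<noteq> n"
  have *: "\<alpha> + sng n j = sng i 1 \<longleftrightarrow> \<alpha> = sng i 1 \<and> j = 0" if "ex \<alpha> n = 0"
  proof
    assume e: "\<alpha> + sng n j = sng i 1"
    have "j = 0" using arg_cong[OF e, of "\<lambda>x. ex x n"] i by (simp add: lookup_add lookup_single)
    thus "\<alpha> = sng i 1 \<and> j = 0" using e by simp
  qed auto
  show "coef (vr i) (\<alpha> + sng n j) = coef (fps_nth (fps_const (vr i)) j) \<alpha>" if "ex \<alpha> n = 0"
    using *[OF that] by (auto simp: coef_mono)
  show "coef (fps_nth (fps_const (vr i)) j) \<alpha> = 0" if "ex \<alpha> n \<noteq> 0" using that i by (auto simp: coef_mono lookup_single)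
qed

lemma slice_vr: "slice n (vr n) = fps_X"
proof (rule slice_eqI)
  fix j and \<alpha> :: expo
  have *: "\<alpha> + sng n j = sng n 1 \<longleftrightarrow> \<alpha> = 0 \<and> j = 1" if "ex \<alpha> n = 0"
  proof
    assume e: "\<alpha> + sng n j = sng n 1"
    have "j = 1" using arg_cong[OF e, of "\<lambda>x. ex x n"] that by (simp add: lookup_add)
    thus "\<alpha> = 0 \<and> j = 1" using e by simp
  qed auto
  show "coef (vr n) (\<alpha> + sng n j) = coef (fps_nth fps_X j) \<alpha>" if "ex \<alpha> n = 0" using *[OF that] by (auto simp: coef_mono coef_1)
  show "coef (fps_nth fps_X j) \<alpha> = 0" if "ex \<alpha> n \<noteq> 0" using that by (auto simp: coef_1)
qed

lemma box_upd: "ex \<alpha> n = 0 ==> \<alpha> + sng n i \<in> box c \<longleftrightarrow> \<alpha> \<in> box (c(n := 1)) \<and> i < c n"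
  unfolding box_def by (auto simp: lookup_add lookup_single when_def)

lemma bI_slice: "f \<in> bI p c \<longleftrightarrow> slice n f \<in> tri (bI p (c(n := 1))) (c n)"
proof
  assume f: "f \<in> bI p c"
  show "slice n f \<in> tri (bI p (c(n := 1))) (c n)" unfolding tri_def bI_def did_def
  proof (intro CollectI allI impI ballI)
    fix i \<alpha> assume i: "i < c n" and a: "\<alpha> \<in> box (c(n := 1))"
    have "ex \<alpha> n = 0" using a by (auto simp: box_def dest: spec[of _ n])
    thus "int p dvd coef (fps_nth (slice n f) i) \<alpha>" using f i a box_upd[of \<alpha> n i c] by (simp add: coef_slice bI_def did_def)
  qed
next
  assume s: "slice n f \<in> tri (bI p (c(n := 1))) (c n)"
  show "f \<in> bI p c" unfolding bI_def did_def
  proof (intro CollectI ballI)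
    fix \<alpha> assume a: "\<alpha> \<in> box c"
    obtain \<alpha>' where al: "\<alpha> = \<alpha>' + sng n (ex \<alpha> n)" "ex \<alpha>' n = 0" by (rule expo_split)
    have "\<alpha>' \<in> box (c(n := 1))" "ex \<alpha> n < c n" using a al box_upd[of \<alpha>' n "ex \<alpha> n" c] by auto
    hence "int p dvd coef (fps_nth (slice n f) (ex \<alpha> n)) \<alpha>'" using s by (simp add: tri_def bI_def did_def)
    thus "int p dvd coef f \<alpha>" using al by (simp add: coef_slice)
  qed
qed

text \<open>Slices only produce coefficients free of x_n, but terms containing x_n are invisible
  modulo an ideal \<open>bI\<close> whose bound in place \<open>n\<close> is 1.\<close>

lemma slice_surj: "\<exists>f. R - slice n f \<in> tri (bI p (c(n := 1))) b"
proof
  let ?f = "Mps (\<lambda>\<alpha>. coef (fps_nth R (ex \<alpha> n)) (\<alpha> - sng n (ex \<alpha> n)))"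
  show "R - slice n ?f \<in> tri (bI p (c(n := 1))) b" unfolding tri_def bI_def did_def
  proof (intro CollectI allI impI ballI)
    fix i \<alpha> assume "\<alpha> \<in> box (c(n := 1))"
    hence "ex \<alpha> n = 0" by (auto simp: box_def dest: spec[of _ n])
    thus "int p dvd coef (fps_nth (R - slice n ?f) i) \<alpha>" by (simp add: coef_slice lookup_add)
  qed
qed

lemma ind_slice:
  "ind UNIV (with_gen (bI p c) f) = ind UNIV (with_gen (tri (bI p (c(n := 1))) (c n)) (slice n f))"
proof -
  let ?T = "tri (bI p (c(n := 1))) (c n)"
  have iT: "is_ideal ?T" by (intro ideal_tri ideal_bI)
  show ?thesis
  proof (rule ind_eqI[where \<phi> = "slice n"])
    show "is_subgp (with_gen (bI p c) f)" "is_subgp (with_gen ?T (slice n f))" by (intro ideal_subgp ideal_with_gen iT ideal_bI)+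
    fix x y
    show "slice n x - slice n y \<in> with_gen ?T (slice n f) \<longleftrightarrow> x - y \<in> with_gen (bI p c) f"
    proof
      assume "slice n x - slice n y \<in> with_gen ?T (slice n f)"
      then obtain R where R: "slice n x - slice n y - R * slice n f \<in> ?T" by (auto simp: with_gen_def)
      obtain r where r: "R - slice n r \<in> ?T" using slice_surj by blast
      have "slice n x - slice n y - R * slice n f + (R - slice n r) * slice n f \<in> ?T" by (intro ideal_add[OF iT] R ideal_mult2[OF iT] r)
      hence "slice n (x - y - r * f) \<in> ?T" unfolding slice_diff slice_mult by (simp add: algebra_simps)
      thus "x - y \<in> with_gen (bI p c) f" unfolding bI_slice[symmetric] with_gen_def by blast
    next
      assume "x - y \<in> with_gen (bI p c) f"
      then obtain r where "slice n (x - y - r * f) \<in> ?T" unfolding with_gen_def bI_slice[of _ p c n] by blast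
      thus "slice n x - slice n y \<in> with_gen ?T (slice n f)" unfolding with_gen_def by (auto simp: slice_diff slice_mult)
    qed
  next
    fix y
    obtain f' where "y - slice n f' \<in> ?T" using slice_surj by blast
    thus "\<exists>x\<in>UNIV. y - slice n x \<in> with_gen ?T (slice n f)" using with_gen_sub[OF iT] by blast
  qed auto
qed

lemma ind_bI_slice: "ind UNIV (bI p c) = ind UNIV (bI p (c(n := 1))) ^ c n"
proof -
  have g0: "with_gen J 0 = J" for J :: "'x::comm_ring_1 set" by (simp add: with_gen_def)
  have "slice n 0 = 0" by (rule slice_eqI) auto
  thus ?thesis using ind_slice[of p c 0 n] by (simp add: g0 ind_tri[OF ideal_bI])
qed

lemma ind_bI_one: "p > 0 ==> ind UNIV (bI p (\<lambda>_. 1)) = p"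
proof -
  assume p: "p > 0"
  have "box (\<lambda>_. 1) = {0}" by (auto simp: box_def intro: poly_mapping_eqI)
  hence b: "bI p (\<lambda>_. 1) = {f. int p dvd coef f 0}" by (simp add: bI_def did_def)
  have "ind UNIV (bI p (\<lambda>_. 1)) = card ((\<lambda>f. coef f 0 mod int p) ` UNIV)"
    by (rule ind_eq_card_image[OF ideal_subgp[OF ideal_bI]]) (simp only: b mod_eq_dvd_iff mem_Collect_eq coef_diff)
  also have "(\<lambda>f. coef f 0 mod int p) ` UNIV = {0..<int p}"
  proof
    show "(\<lambda>f. coef f 0 mod int p) ` UNIV \<subseteq> {0..<int p}" using p by auto
    show "{0..<int p} \<subseteq> (\<lambda>f. coef f 0 mod int p) ` UNIV"
    proof
      fix x assume "x \<in> {0..<int p}"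
      hence "x = coef (of_int x) 0 mod int p" by (simp add: coef_of_int)
      thus "x \<in> (\<lambda>f. coef f 0 mod int p) ` UNIV" by blast
    qed
  qed
  finally show ?thesis by simp
qed

lemma ind_bI:
  assumes p: "p > 0" and "\<And>i. i \<ge> n ==> c i = 1"
  shows "ind UNIV (bI p c) = p ^ (\<Prod>i<n. c i)"
  using assms(2)
proof (induction n arbitrary: c)
  case 0
  hence "c = (\<lambda>_. 1)" by auto
  thus ?case using ind_bI_one[OF p] by simp
next
  case (Suc n)
  have "ind UNIV (bI p (c(n := 1))) = p ^ (\<Prod>i<n. (c(n := 1)) i)" by (rule Suc.IH) (use Suc.prems in \<open>auto simp: le_Suc_eq\<close>)
  thus ?case by (subst ind_bI_slice[of p c n]) (simp add: power_mult)
qed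

text \<open>Adjoining a variable \<open>x\<^sub>n\<close> with the term \<open>x\<^sub>n\<^sup>a\<close> splits into \<open>a\<close> Jordan blocks.\<close>

lemma ind_add_variable:
  assumes "free_of n h" "a > 0"
  shows "ind UNIV (with_gen (bI p c) ((h + vr n ^ a) ^ s)) =
    (\<Prod>r<a. ind UNIV (power_basis.CC (bI p (c(n := 1))) h ((c n + a - 1 - r) div a) s))"
proof -
  interpret power_basis "bI p (c(n := 1))" h by unfold_locales (rule ideal_bI)
  have "slice n ((h + vr n ^ a) ^ s) = (fps_X ^ a + fps_const h) ^ s"
    using assms(1) by (simp only: slice_power slice_add slice_vr free_of_def add.commute)
  thus ?thesis using ind_slice[of p c _ n] ind_power_var[OF assms(2)] by simp
qed

subsection \<open>Dimensions over the prime field\<close>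

lemma ind_pos_mono:
  assumes "is_subgp L" "is_subgp J" "L \<subseteq> J" "ind UNIV L > 0"
  shows "ind UNIV J > 0"
  using ind_tower[OF assms(1,2) subgp_UNIV assms(3)] assms(4) by simp

text \<open>The F_p-dimension of the quotient, when that is a finite F_p-space. For infinite index
  the logarithm carries no meaning, hence the many positivity facts.\<close>

definition ldim :: "nat => 'a::ab_group_add set => real" where
  "ldim p J = log (real p) (real (ind UNIV J))"

lemma ldim_power: "p > 1 ==> ind UNIV J = p ^ k ==> ldim p J = real k"
  by (simp add: ldim_def log_nat_power)

text \<open>\<open>LD p (cV d q) h n\<close> is the function D_q(n) of the overview.\<close>

definition LD :: "nat => (nat => nat) => mps => nat => real" where
  "LD p c h s = ldim p (with_gen (bI p c) (h ^ s))"

definition cV :: "nat => nat => nat => nat" where "cV n q = (\<lambda>i. if i < n then q else 1)"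

lemma ind_cV: "p > 0 ==> ind UNIV (bI p (cV n q)) = p ^ (q ^ n)"
  by (subst ind_bI[where n = n]) (auto simp: cV_def)

lemma cV_upd: "(cV (Suc n) q)(n := 1) = cV n q" by (auto simp: cV_def fun_eq_iff)

lemma with_gen_monomial:
  "with_gen (bI p c) (vr i ^ k) = bI p (c(i := min (c i) k))"
proof
  have "bI p c \<subseteq> bI p (c(i := min (c i) k))" by (force simp: bI_def did_def box_def split: if_splits)
  moreover have "vr i ^ k \<in> bI p (c(i := min (c i) k))" by (auto simp: vr_power bI_def did_def box_def coef_mono dest: spec[of _ i])
  ultimately show "with_gen (bI p c) (vr i ^ k) \<subseteq> bI p (c(i := min (c i) k))" by (intro with_gen_least ideal_bI)
  show "bI p (c(i := min (c i) k)) \<subseteq> with_gen (bI p c) (vr i ^ k)"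
  proof
    fix f assume f: "f \<in> bI p (c(i := min (c i) k))"
    define r where "r = Mps (\<lambda>\<alpha>. coef f (sng i k + \<alpha>))"
    have "f - r * vr i ^ k \<in> bI p c" unfolding bI_def did_def
    proof (intro CollectI ballI)
      fix \<alpha> assume a: "\<alpha> \<in> box c"
      show "int p dvd coef (f - r * vr i ^ k) \<alpha>"
      proof (cases "ex \<alpha> i < k")
        case True
        have "\<alpha> \<noteq> sng i k + \<beta>" for \<beta> using True by (auto simp: lookup_add)
        hence "coef (r * vr i ^ k) \<alpha> = 0" unfolding vr_power mult.commute[of r] by (rule coef_mono_mult_eq_0)
        moreover have "\<alpha> \<in> box (c(i := min (c i) k))" using a True by (auto simp: box_def)
        ultimately show ?thesis using f by (simp add: bI_def did_def)
      next
        case False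
        hence "\<alpha> = sng i k + (\<alpha> - sng i k)" by (intro poly_mapping_eqI) (auto simp: lookup_add lookup_minus lookup_single when_def)
        hence "coef (r * vr i ^ k) \<alpha> = coef f \<alpha>"
          using coef_mono_mult[of "sng i k" r "\<alpha> - sng i k"] by (simp add: vr_power mult.commute r_def)
        thus ?thesis by simp
      qed
    qed
    thus "f \<in> with_gen (bI p c) (vr i ^ k)" by (auto simp: with_gen_def)
  qed
qed

lemma colon_monomial: "vr i ^ k * f \<in> bI p c \<longleftrightarrow> f \<in> bI p (c(i := c i - k))"
proof
  assume f: "vr i ^ k * f \<in> bI p c"
  show "f \<in> bI p (c(i := c i - k))" unfolding bI_def did_def
  proof (intro CollectI ballI)
    fix \<alpha> assume "\<alpha> \<in> box (c(i := c i - k))"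
    hence "ex \<alpha> j < (if j = i then c i - k else c j)" for j by (auto simp: box_def split: if_splits)
    hence "ex (sng i k + \<alpha>) j < c j" for j by (cases "j = i") (force simp: lookup_add lookup_single when_def split: if_splits)+
    hence "int p dvd coef (vr i ^ k * f) (sng i k + \<alpha>)" using f by (simp add: bI_def did_def box_def)
    thus "int p dvd coef f \<alpha>" by (simp only: vr_power coef_mono_mult)
  qed
next
  assume f: "f \<in> bI p (c(i := c i - k))"
  show "vr i ^ k * f \<in> bI p c" unfolding bI_def did_def
  proof (intro CollectI ballI)
    fix \<alpha> assume a: "\<alpha> \<in> box c"
    show "int p dvd coef (vr i ^ k * f) \<alpha>"
    proof (cases "\<exists>\<beta>. \<alpha> = sng i k + \<beta>")
      case True
      then obtain \<beta> where b: "\<alpha> = sng i k + \<beta>" by blast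
      have "ex \<beta> j < (c(i := c i - k)) j" for j
        using a by (auto simp: b box_def lookup_add lookup_single when_def dest: spec[of _ j] split: if_splits)
      hence "\<beta> \<in> box (c(i := c i - k))" by (simp add: box_def)
      thus ?thesis using f by (simp only: b vr_power coef_mono_mult bI_def did_def mem_Collect_eq)
    next
      case False
      thus ?thesis by (simp add: vr_power coef_mono_mult_eq_0)
    qed
  qed
qed

text \<open>Additivity along (x^k f) inside (x^k), where taking the colon of a box ideal by x^k only
  shortens one side of the box. It strips the linear factor from the curves of types D and
  E7.\<close>

lemma ind_monomial_factor:
  "ind UNIV (with_gen (bI p c) (vr i ^ k * f))
    = ind UNIV (bI p (c(i := min (c i) k))) * ind UNIV (with_gen (bI p (c(i := c i - k))) f)"
proof -
  let ?I = "bI p c" and ?U = "with_gen (bI p c) (vr i ^ k * f)" and ?W = "with_gen (bI p c) (vr i ^ k)"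
  have U: "is_ideal ?U" and W: "is_ideal ?W" by (intro ideal_with_gen ideal_bI)+
  have "ind UNIV ?U = ind UNIV ?W * ind ?W ?U"
  proof (rule ind_tower[OF ideal_subgp[OF U] ideal_subgp[OF W] subgp_UNIV])
    show "?U \<subseteq> ?W" using with_gen_gen[OF ideal_bI, of f "vr i ^ k" p c]
      by (intro with_gen_least W with_gen_sub ideal_bI) (simp add: mult.commute)
  qed simp
  also have "ind ?W ?U = ind UNIV (with_gen (bI p (c(i := c i - k))) f)"
  proof (rule ind_eqI[where \<phi> = "\<lambda>g. vr i ^ k * g", symmetric, OF _ ideal_subgp[OF U]])
    show "is_subgp (with_gen (bI p (c(i := c i - k))) f)" by (intro ideal_subgp ideal_with_gen ideal_bI)
    show "vr i ^ k * x \<in> ?W" for x using with_gen_gen[OF ideal_bI, of x "vr i ^ k"] by (simp add: mult.commute)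
    fix x y
    have "vr i ^ k * (x - y) \<in> ?U \<longleftrightarrow> (\<exists>r. vr i ^ k * (x - y - r * f) \<in> ?I)"
      by (simp add: with_gen_def algebra_simps)
    also have "... \<longleftrightarrow> x - y \<in> with_gen (bI p (c(i := c i - k))) f" unfolding colon_monomial by (simp add: with_gen_def)
    finally show "vr i ^ k * x - vr i ^ k * y \<in> ?U \<longleftrightarrow> x - y \<in> with_gen (bI p (c(i := c i - k))) f"
      by (simp only: right_diff_distrib)
  next
    fix y assume "y \<in> ?W"
    then obtain r where "y - r * vr i ^ k \<in> ?I" by (auto simp: with_gen_def)
    hence "y - vr i ^ k * r \<in> ?U" using with_gen_sub[OF ideal_bI] by (auto simp: mult.commute)
    thus "\<exists>x\<in>UNIV. y - vr i ^ k * x \<in> ?U" by blast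
  qed
  finally show ?thesis by (simp add: with_gen_monomial)
qed

lemma log_prod_pos:
  "(\<And>i. i \<in> A ==> f i > (0::real)) ==> log b (\<Prod>i\<in>A. f i) = (\<Sum>i\<in>A. log b (f i))"
  by (induction A rule: infinite_finite_induct) (auto simp: log_mult_pos prod_pos)

locale gf_module = power_basis_p +
  assumes fin: "ind UNIV I > 0"
begin

lemma p1: "real p > 1" using prime_gt_1_nat[OF p] by simp

definition lc :: "nat => nat => real" where "lc b n = ldim p (CC b n)"
definition ld :: "nat => real" where "ld n = ldim p (with_gen I (h ^ n))"

lemma fin_with_gen: "ind UNIV (with_gen I x) > 0"
  by (rule ind_pos_mono[OF _ _ with_gen_sub fin]) (auto intro: ideal_subgp ideal_with_gen I)

lemma fin_CC: "ind UNIV (CC b n) > 0"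
proof -
  have "ind UNIV (tri I b) > 0" using fin by (simp add: ind_tri[OF I])
  thus ?thesis using ind_pos_mono[OF ideal_subgp[OF ideal_tri[OF I]] ideal_subgp[OF ideal_CC] tri_CC] by blast
qed

lemma lc_sum: "b + n <= p + 1 ==> lc b n = (\<Sum>i<min b n. ld (b + n - 1 - 2 * i))"
proof -
  assume "b + n <= p + 1"
  hence "real (ind UNIV (CC b n)) = (\<Prod>i<min b n. real (ind UNIV (with_gen I (h ^ (b + n - 1 - 2 * i)))))" by (simp add: ind_CC)
  thus ?thesis using p1 fin_with_gen by (simp add: lc_def ld_def ldim_def log_prod_pos)
qed

lemma lc_reflect:
  assumes "h ^ p \<in> I" "n <= p" "b <= p"
  shows "real (p - b) * ldim p I + lc b n = real n * ldim p I + lc (p - b) (p - n)"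
proof -
  have "real (ind UNIV I) ^ (p - b) * real (ind UNIV (CC b n)) = real (ind UNIV I) ^ n * real (ind UNIV (CC (p - b) (p - n)))"
    using ind_CC_reflect[OF assms] by (metis of_nat_mult of_nat_power)
  hence "log p (real (ind UNIV I) ^ (p - b) * real (ind UNIV (CC b n)))
     = log p (real (ind UNIV I) ^ n * real (ind UNIV (CC (p - b) (p - n))))" by simp
  thus ?thesis using p1 fin fin_CC by (simp add: log_mult_pos log_nat_power lc_def ldim_def)
qed

end

lemma gf_module_bI:
  assumes "prime p" "\<And>i. i \<ge> n ==> c i = 1"
  shows "gf_module (bI p c) p"
proof unfold_locales
  show "0 < ind UNIV (bI p c)" using prime_gt_0_nat[OF assms(1)] by (subst ind_bI[OF _ assms(2)]) auto
qed (auto intro: ideal_bI p_bI assms(1))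

lemma ldim_bI:
  assumes "prime p" "\<And>i. i \<ge> n ==> c i = 1"
  shows "ldim p (bI p c) = real (\<Prod>i<n. c i)"
  using prime_gt_1_nat[OF assms(1)] by (intro ldim_power ind_bI assms(2)) auto

lemma LD_add_variable:
  assumes p: "prime p" and c: "\<And>i. i \<ge> N ==> c i = 1" and h: "free_of n h" and a: "a > 0"
  shows "LD p c (h + vr n ^ a) s
    = (\<Sum>r<a. gf_module.lc (bI p (c(n := 1))) h p ((c n + a - 1 - r) div a) s)"
proof -
  interpret gf_module "bI p (c(n := 1))" h p by (rule gf_module_bI[OF p, of N]) (simp add: c)
  have "LD p c (h + vr n ^ a) s = log p (\<Prod>r<a. real (ind UNIV (CC ((c n + a - 1 - r) div a) s)))"
    by (simp only: LD_def ldim_def ind_add_variable[OF h a] of_nat_prod)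
  also have "... = (\<Sum>r<a. log p (real (ind UNIV (CC ((c n + a - 1 - r) div a) s))))"
    by (rule log_prod_pos) (simp only: of_nat_0_less_iff fin_CC)
  finally show ?thesis by (simp only: lc_def ldim_def)
qed

lemma LD_nonneg: assumes "prime p" "\<And>i. i \<ge> n ==> c i = 1" shows "0 <= LD p c h s"
proof -
  interpret gf_module "bI p c" h p by (rule gf_module_bI[OF assms])
  have "ind UNIV (with_gen (bI p c) (h ^ s)) \<ge> 1" using fin_with_gen[of "h ^ s"] by simp
  thus ?thesis using p1 by (simp add: LD_def ldim_def)
qed

subsection \<open>Adjoining a square\<close>

lemma sum_even_odd: "(\<Sum>i<2 * s. f i) = (\<Sum>i<s. f (2 * i)) + (\<Sum>i<s. f (Suc (2 * i)) :: real)"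
  by (induction s) auto

text \<open>Among the exponents of x_n below p = 2M + 1, the even ones form a block of size M + 1
  and the odd ones a block of size \<open>M\<close>.\<close>

lemma LD_square:
  assumes pp: "prime p" "p = 2 * M + 1" and h: "free_of n h"
  shows "LD p (cV (Suc n) p) (h + vr n ^ 2) s
    = gf_module.lc (bI p (cV n p)) h p (M + 1) s + gf_module.lc (bI p (cV n p)) h p M s"
proof -
  have c: "\<And>i. i \<ge> Suc n ==> cV (Suc n) p i = 1" by (simp add: cV_def)
  have i: "(cV (Suc n) p n + 2 - 1 - 0) div 2 = M + 1" "(cV (Suc n) p n + 2 - 1 - 1) div 2 = M" by (simp_all add: cV_def pp(2))
  have sum2: "(\<Sum>r<2::nat. f r) = f 0 + f 1" for f :: "nat => real" by (simp add: numeral_2_eq_2)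
  show ?thesis by (simp only: LD_add_variable[OF pp(1) c h pos2] cV_upd sum2 i)
qed

text \<open>The exponents from the two blocks interleave: M + s - 2i and M + s - 1 - 2i together run
  through all integers from M - s + 1 to M + s.\<close>

lemma LD_square_low:
  assumes pp: "prime p" "p = 2 * M + 1" and h: "free_of n h" and s: "s <= M"
  shows "LD p (cV (Suc n) p) (h + vr n ^ 2) s = (\<Sum>i<2 * s. LD p (cV n p) h (M - s + 1 + i))"
proof -
  interpret gf_module "bI p (cV n p)" h p by (rule gf_module_bI[OF pp(1), of n]) (simp add: cV_def)
  have "LD p (cV (Suc n) p) (h + vr n ^ 2) s = lc (M + 1) s + lc M s" by (rule LD_square[OF pp h])
  also have "lc (M + 1) s = (\<Sum>i<s. ld (M + s - 2 * i))" using s pp(2) by (subst lc_sum) auto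
  also have "lc M s = (\<Sum>i<s. ld (M + s - Suc (2 * i)))" using s pp(2) by (subst lc_sum) auto
  also have "(\<Sum>i<s. ld (M + s - 2 * i)) + (\<Sum>i<s. ld (M + s - Suc (2 * i))) = (\<Sum>i<2 * s. ld (M + s - i))" by (subst sum_even_odd) simp
  also have "... = (\<Sum>i<2 * s. ld (M + s - (2 * s - Suc i)))" by (rule sum.nat_diff_reindex[symmetric])
  also have "... = (\<Sum>i<2 * s. ld (M - s + 1 + i))" by (intro sum.cong refl arg_cong[where f = ld]) (use s in auto)
  finally show ?thesis by (simp add: LD_def ld_def)
qed

text \<open>Above \<open>M\<close> the Clebsch-Gordan rule is out of range. Reflection exchanges the
  blocks of size \<open>M\<close> and M + 1, so their sum returns to the same expression at p - s,
  plus a linear correction.\<close>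

lemma LD_square_high:
  assumes pp: "prime p" "p = 2 * M + 1" and h: "free_of n h" and hp: "h ^ p \<in> bI p (cV n p)" and s: "s <= p"
  shows "LD p (cV (Suc n) p) (h + vr n ^ 2) s
     = LD p (cV (Suc n) p) (h + vr n ^ 2) (p - s) + (2 * real s - real p) * real p ^ n"
proof -
  interpret gf_module "bI p (cV n p)" h p by (rule gf_module_bI[OF pp(1), of n]) (simp add: cV_def)
  have L: "LD p (cV (Suc n) p) (h + vr n ^ 2) s = lc (M + 1) s + lc M s" for s by (rule LD_square[OF pp h])
  have d: "ldim p (bI p (cV n p)) = real p ^ n" using prime_gt_1_nat[OF pp(1)] by (subst ldim_power[OF _ ind_cV]) auto
  have e: "p - (M + 1) = M" "p - M = M + 1" "M + 1 <= p" "M <= p" using pp(2) by auto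
  have "real M * real p ^ n + lc (M + 1) s = real s * real p ^ n + lc M (p - s)" using lc_reflect[OF hp s e(3)] unfolding d e(1) by (simp only:)
  moreover have "(real M + 1) * real p ^ n + lc M s = real s * real p ^ n + lc (M + 1) (p - s)"
    using lc_reflect[OF hp s e(4)] unfolding d e(2) by (simp add: add.commute)
  ultimately show ?thesis unfolding L using pp(2) by (simp add: algebra_simps)
qed

subsection \<open>Riemann sums\<close>

lemma midpoint_step:
  fixes \<psi> :: "real => real"
  assumes L: "L-lipschitz_on {a..b} \<psi>" and d: "\<delta> \<ge> 0" and y: "a <= y" and b: "y + 2 * \<delta> <= b"
  shows "\<bar>2 * \<delta> * \<psi> (y + \<delta>) - integral {y..y + 2 * \<delta>} \<psi>\<bar> <= 2 * L * \<delta>\<^sup>2"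
proof -
  have cont: "continuous_on {a..b} \<psi>" by (rule lipschitz_on_continuous_on[OF L])
  have int: "\<psi> integrable_on {y..y + 2 * \<delta>}" by (rule integrable_continuous_real, rule continuous_on_subset[OF cont]) (use y b in auto)
  have "\<bar>integral {y..y + 2 * \<delta>} (\<lambda>t. \<psi> (y + \<delta>) - \<psi> t)\<bar> <= integral {y..y + 2 * \<delta>} (\<lambda>t. L * \<delta>)"
  proof (subst real_norm_def[symmetric], rule integral_norm_bound_integral)
    show "(\<lambda>t. \<psi> (y + \<delta>) - \<psi> t) integrable_on {y..y + 2 * \<delta>}" by (intro integrable_diff int integrable_const_ivl)
    show "norm (\<psi> (y + \<delta>) - \<psi> t) <= L * \<delta>" if "t \<in> {y..y + 2 * \<delta>}" for t
    proof -
      have "dist (\<psi> (y + \<delta>)) (\<psi> t) <= L * dist (y + \<delta>) t" by (rule lipschitz_onD[OF L]) (use that y b d in auto)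
      also have "... <= L * \<delta>" using that lipschitz_on_nonneg[OF L] by (intro mult_left_mono) (auto simp: dist_real_def)
      finally show ?thesis by (simp add: dist_norm)
    qed
  qed (rule integrable_const_ivl)
  also have "... = 2 * L * \<delta>\<^sup>2" using d by (simp add: power2_eq_square)
  also have "integral {y..y + 2 * \<delta>} (\<lambda>t. \<psi> (y + \<delta>) - \<psi> t) = 2 * \<delta> * \<psi> (y + \<delta>) - integral {y..y + 2 * \<delta>} \<psi>"
    using d int by (subst integral_diff) auto
  finally show ?thesis .
qed

text \<open>Lipschitz continuity gives an error of order \<delta>^2 per step; with about
  \<open>p\<close> steps of width 1/p this sums to O(1/p), the accuracy required.\<close>

lemma midpoint_sum:
  fixes \<psi> :: "real => real"
  assumes L: "L-lipschitz_on {a..b} \<psi>" and d: "\<delta> \<ge> 0" and x: "a <= x"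
    and b: "x + 2 * real N * \<delta> <= b"
  shows "\<bar>2 * \<delta> * (\<Sum>i<N. \<psi> (x + (2 * real i + 1) * \<delta>)) - integral {x..x + 2 * real N * \<delta>} \<psi>\<bar>
    <= real N * (2 * L * \<delta>\<^sup>2)" using b
proof (induction N)
  case (Suc N)
  define y where "y = x + 2 * real N * \<delta>"
  have yz: "x + 2 * real (Suc N) * \<delta> = y + 2 * \<delta>" "x + (2 * real N + 1) * \<delta> = y + \<delta>"
    by (simp_all add: y_def algebra_simps)
  have le: "x <= y" "y + 2 * \<delta> <= b" using d Suc.prems yz(1) by (simp_all only: y_def) simp
  have cont: "continuous_on {a..b} \<psi>" by (rule lipschitz_on_continuous_on[OF L])
  have int: "\<psi> integrable_on {x..y + 2 * \<delta>}" by (rule integrable_continuous_real, rule continuous_on_subset[OF cont]) (use x le in auto)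
  have 1: "\<bar>2 * \<delta> * \<psi> (y + \<delta>) - integral {y..y + 2 * \<delta>} \<psi>\<bar> <= 2 * L * \<delta>\<^sup>2"
    by (rule midpoint_step[OF L d]) (use le x in auto)
  have 2: "integral {x..y + 2 * \<delta>} \<psi> = integral {x..y} \<psi> + integral {y..y + 2 * \<delta>} \<psi>"
    by (rule Henstock_Kurzweil_Integration.integral_combine[symmetric]) (use le x d int in auto)
  have 3: "\<bar>2 * \<delta> * (\<Sum>i<N. \<psi> (x + (2 * real i + 1) * \<delta>)) - integral {x..y} \<psi>\<bar> <= real N * (2 * L * \<delta>\<^sup>2)"
    unfolding y_def by (rule Suc.IH) (use le d in \<open>simp add: y_def\<close>)
  have 4: "real (Suc N) * (2 * L * \<delta>\<^sup>2) = real N * (2 * L * \<delta>\<^sup>2) + 2 * L * \<delta>\<^sup>2" by (simp add: algebra_simps)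
  show ?case unfolding yz(1) 2 4 sum.lessThan_Suc yz(2) distrib_left using 1 3 by linarith
qed simp

text \<open>Uniformity in \<open>s\<close> is essential, because the next square sums over 2s
  arguments.\<close>

definition approx :: "mps => nat => (real => real) => bool" where
  "approx h n \<psi> \<longleftrightarrow> (\<exists>C P. \<forall>p. prime p --> p \<ge> P -->
     (\<forall>s\<le>p. \<bar>LD p (cV n p) h s / real p ^ n - \<psi> (real s / real p)\<bar> <= C / real p))"

text \<open>The integral is the limit of \<open>LD_square_low\<close>; the maximum is the correction
  of \<open>LD_square_high\<close>, active for t > 1/2.\<close>

definition Wop :: "(real => real) => real => real" where
  "Wop \<psi> t = integral {1/2 - min t (1 - t)..1/2 + min t (1 - t)} \<psi> + max 0 (2 * t - 1)"

text \<open>Regularity has to be carried along with the approximation, since the Riemann sums of the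
  next square use it.\<close>

lemma Wop_lipschitz:
  assumes L: "L-lipschitz_on {0..1} \<psi>"
  shows "\<exists>L'. L'-lipschitz_on {0..1} (Wop \<psi>)"
proof -
  have cont: "continuous_on {0..1} \<psi>" by (rule lipschitz_on_continuous_on[OF L])
  have "bounded (\<psi> ` {0..1})" by (intro compact_imp_bounded compact_continuous_image cont) simp
  then obtain B where "\<forall>y\<in>\<psi> ` {0..1}. norm y <= B" unfolding bounded_iff by blast
  hence B: "\<And>x. x \<in> {0..1} ==> \<bar>\<psi> x\<bar> <= B" by auto
  have B0: "B \<ge> 0" using B[of 0] by simp
  have int: "\<psi> integrable_on {u..w}" if "0 <= u" "w <= 1" for u w
    by (rule integrable_continuous_real, rule continuous_on_subset[OF cont]) (use that in auto)
  have bd: "\<bar>integral {u..w} \<psi>\<bar> <= B * (w - u)" if "0 <= u" "u <= w" "w <= 1" for u w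
  proof -
    have "\<bar>integral {u..w} \<psi>\<bar> <= integral {u..w} (\<lambda>_. B)"
      by (subst real_norm_def[symmetric], rule integral_norm_bound_integral)
         (use that B in \<open>auto intro!: int\<close>)
    thus ?thesis using that by (simp add: mult.commute)
  qed
  have I: "\<bar>integral {1/2 - u..1/2 + u} \<psi> - integral {1/2 - w..1/2 + w} \<psi>\<bar> <= 2 * B * (u - w)"
    if "0 <= w" "w <= u" "u <= 1/2" for u w
  proof -
    have "integral {1/2 - u..1/2 + u} \<psi> = integral {1/2 - u..1/2 - w} \<psi> + integral {1/2 - w..1/2 + u} \<psi>"
      by (rule Henstock_Kurzweil_Integration.integral_combine[symmetric]) (use that in \<open>auto intro!: int\<close>)
    also have "integral {1/2 - w..1/2 + u} \<psi> = integral {1/2 - w..1/2 + w} \<psi> + integral {1/2 + w..1/2 + u} \<psi>"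
      by (rule Henstock_Kurzweil_Integration.integral_combine[symmetric]) (use that in \<open>auto intro!: int\<close>)
    finally show ?thesis using bd[of "1/2 - u" "1/2 - w"] bd[of "1/2 + w" "1/2 + u"] that by (simp add: algebra_simps)
  qed
  have "(2 * B + 2)-lipschitz_on {0..1} (Wop \<psi>)"
  proof (rule lipschitz_onI)
    fix s t :: real assume st: "s \<in> {0..1}" "t \<in> {0..1}"
    let ?a = "min s (1 - s)" and ?b = "min t (1 - t)"
    have half: "?a <= 1/2" "?b <= 1/2" "0 <= ?a" "0 <= ?b" using st by (auto simp: min_def)
    have "\<bar>integral {1/2 - ?a..1/2 + ?a} \<psi> - integral {1/2 - ?b..1/2 + ?b} \<psi>\<bar> <= 2 * B * \<bar>?a - ?b\<bar>"
    proof (cases "?b <= ?a")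
      case True thus ?thesis using I[of ?b ?a] half by linarith
    next
      case False
      hence "\<bar>integral {1/2 - ?b..1/2 + ?b} \<psi> - integral {1/2 - ?a..1/2 + ?a} \<psi>\<bar> <= 2 * B * (?b - ?a)"
        by (intro I) (use half False in linarith)+
      moreover have "?b - ?a = \<bar>?a - ?b\<bar>" using False by linarith
      ultimately show ?thesis by (metis abs_minus_commute)
    qed
    also have "... <= 2 * B * \<bar>s - t\<bar>" using B0 by (intro mult_left_mono) auto
    finally have *: "\<bar>integral {1/2 - ?a..1/2 + ?a} \<psi> - integral {1/2 - ?b..1/2 + ?b} \<psi>\<bar> <= 2 * B * \<bar>s - t\<bar>" .
    show "dist (Wop \<psi> s) (Wop \<psi> t) <= (2 * B + 2) * dist s t"
    proof -
      have "\<bar>max 0 u - max 0 w\<bar> <= \<bar>u - w\<bar>" for u w :: real by (auto simp: max_def)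
      from this[of "2 * s - 1" "2 * t - 1"]
      have m: "\<bar>max 0 (2 * s - 1) - max 0 (2 * t - 1)\<bar> <= \<bar>(2 * s - 1) - (2 * t - 1)\<bar>" .
      have e: "\<bar>(2 * s - 1) - (2 * t - 1)\<bar> = 2 * \<bar>s - t\<bar>" by (simp add: abs_if)
      have tri: "\<bar>a + m - (b + n)\<bar> <= \<bar>a - b\<bar> + \<bar>m - n\<bar>" for a b m n :: real by linarith
      show ?thesis unfolding Wop_def dist_real_def distrib_right by (rule order.trans[OF tri add_mono[OF * m[unfolded e]]])
    qed
  qed (use B0 in auto)
  thus ?thesis by blast
qed

lemma approx_square:
  assumes ap: "approx h n \<psi>" and L: "L-lipschitz_on {0..1} \<psi>" and h: "free_of n h"
    and hp: "\<And>p. prime p ==> h ^ p \<in> bI p (cV n p)"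
  shows "approx (h + vr n ^ 2) (Suc n) (Wop \<psi>)"
proof -
  obtain C P where C: "\<And>p s. prime p ==> p \<ge> P ==> s <= p ==>
      \<bar>LD p (cV n p) h s / real p ^ n - \<psi> (real s / real p)\<bar> <= C / real p" using ap unfolding approx_def by blast
  have low: "\<bar>LD p (cV (Suc n) p) (h + vr n ^ 2) s / real p ^ Suc n - integral {1/2 - real s / real p..1/2 + real s / real p} \<psi>\<bar>
      <= (C + L) / real p" if p: "prime p" "p \<ge> P" and M: "p = 2 * M + 1" and s: "s <= M" for p s M
  proof -
    let ?D = "LD p (cV n p) h"
    have p0: "real p > 0" using prime_gt_0_nat[OF p(1)] by simp
    \<comment> \<open>Since p = 2M + 1, the cells of width 1/p starting at 1/2 - s/p have the
      midpoints (M - s + 1 + i)/p, which are exactly the arguments in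
      \<open>LD_square_low\<close>.\<close>
    define x where "x = 1/2 - real s / real p"
    define \<delta> where "\<delta> = 1 / (2 * real p)"
    have x1: "x + 2 * real (2 * s) * \<delta> = 1/2 + real s / real p" using p0 by (simp add: x_def \<delta>_def field_simps)
    have sp: "real s / real p <= 1/2" using s M p0 by (simp add: field_simps)
    have pt: "x + (2 * real i + 1) * \<delta> = real (M - s + 1 + i) / real p" for i
    proof -
      have "x + (2 * real i + 1) * \<delta> = (real p - 2 * real s + 2 * real i + 1) / (2 * real p)"
        using p0 by (simp add: x_def \<delta>_def field_simps)
      also have "real p - 2 * real s + 2 * real i + 1 = 2 * real (M - s + 1 + i)" using s M by (simp add: of_nat_diff)
      finally show ?thesis using p0 by (simp add: field_simps)
    qed
    have "\<bar>2 * \<delta> * (\<Sum>i<2 * s. \<psi> (x + (2 * real i + 1) * \<delta>)) - integral {x..x + 2 * real (2 * s) * \<delta>} \<psi>\<bar>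
      <= real (2 * s) * (2 * L * \<delta>\<^sup>2)"
    proof (rule midpoint_sum[OF L])
      show "0 <= \<delta>" by (simp add: \<delta>_def)
      show "0 <= x" using sp unfolding x_def by linarith
      show "x + 2 * real (2 * s) * \<delta> <= 1" unfolding x1 using sp by linarith
    qed
    also have "... <= real p * (2 * L * \<delta>\<^sup>2)" by (rule mult_right_mono) (use s M lipschitz_on_nonneg[OF L] in auto)
    also have "... = L / (2 * real p)" using p0 by (simp add: \<delta>_def power2_eq_square field_simps)
    also have "... <= L / real p" using p0 lipschitz_on_nonneg[OF L] by (simp add: field_simps)
    finally have 1: "\<bar>(\<Sum>i<2 * s. \<psi> (real (M - s + 1 + i) / real p)) / real p - integral {x..1/2 + real s / real p} \<psi>\<bar> <= L / real p"
      using x1 p0 unfolding pt by (simp add: \<delta>_def)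
    have "\<bar>(\<Sum>i<2 * s. ?D (M - s + 1 + i) / real p ^ n - \<psi> (real (M - s + 1 + i) / real p))\<bar> <= (\<Sum>i<2 * s. C / real p)"
      by (rule order.trans[OF sum_abs], rule sum_mono, rule C[OF p]) (use s M in auto)
    also have "... = (C / real p) * real (2 * s)" by simp
    also have "... <= (C / real p) * real p"
    proof (rule mult_left_mono)
      show "0 <= C / real p" using C[OF p, of 0] by linarith
    qed (use s M in auto)
    also have "... = C" using p0 by simp
    finally have "\<bar>(\<Sum>i<2 * s. ?D (M - s + 1 + i) / real p ^ n - \<psi> (real (M - s + 1 + i) / real p))\<bar> / real p <= C / real p"
      using p0 by (simp add: divide_right_mono)
    hence "\<bar>(\<Sum>i<2 * s. ?D (M - s + 1 + i) / real p ^ n - \<psi> (real (M - s + 1 + i) / real p)) / real p\<bar> <= C / real p"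
      using p0 by (simp only: abs_divide abs_of_pos)
    also have "(\<Sum>i<2 * s. ?D (M - s + 1 + i) / real p ^ n - \<psi> (real (M - s + 1 + i) / real p))
       = (\<Sum>i<2 * s. ?D (M - s + 1 + i)) / real p ^ n - (\<Sum>i<2 * s. \<psi> (real (M - s + 1 + i) / real p))"
      by (simp only: sum_subtractf sum_divide_distrib)
    also have "... / real p = LD p (cV (Suc n) p) (h + vr n ^ 2) s / real p ^ Suc n - (\<Sum>i<2 * s. \<psi> (real (M - s + 1 + i) / real p)) / real p"
      unfolding LD_square_low[OF p(1) M h s] by (simp add: diff_divide_distrib mult.commute)
    finally have 2: "\<bar>LD p (cV (Suc n) p) (h + vr n ^ 2) s / real p ^ Suc n - (\<Sum>i<2 * s. \<psi> (real (M - s + 1 + i) / real p)) / real p\<bar> <= C / real p" .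
    show ?thesis using 1 2 unfolding x_def add_divide_distrib by linarith
  qed
  have "\<bar>LD p (cV (Suc n) p) (h + vr n ^ 2) s / real p ^ Suc n - Wop \<psi> (real s / real p)\<bar> <= (C + L) / real p"
    if p: "prime p" "p \<ge> max P 3" and s: "s <= p" for p s
  proof -
    have p0: "real p > 0" using prime_gt_0_nat[OF p(1)] by simp
    have "odd p" using prime_odd_nat[OF p(1)] p(2) by simp
    then obtain M where M: "p = 2 * M + 1" by (rule oddE)
    show ?thesis
    proof (cases "s <= M")
      case True
      have "real s / real p <= 1/2" using True M p0 by (simp add: field_simps)
      hence "Wop \<psi> (real s / real p) = integral {1/2 - real s / real p..1/2 + real s / real p} \<psi>"
      proof -
        have "min (real s / real p) (1 - real s / real p) = real s / real p" "max 0 (2 * (real s / real p) - 1) = 0"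
          using \<open>real s / real p <= 1/2\<close> by linarith+
        thus ?thesis unfolding Wop_def by (simp only: add_0_right)
      qed
      thus ?thesis using low[OF p(1) _ M True] p(2) by simp
    next
      case False
      have sp: "real (p - s) / real p = 1 - real s / real p" using s p0 by (simp add: of_nat_diff field_simps)
      have "real s / real p \<ge> 1/2" using False M p0 by (simp add: field_simps)
      hence W: "Wop \<psi> (real s / real p) = integral {1/2 - (1 - real s / real p)..1/2 + (1 - real s / real p)} \<psi> + (2 * (real s / real p) - 1)"
      proof -
        have "min (real s / real p) (1 - real s / real p) = 1 - real s / real p"
          "max 0 (2 * (real s / real p) - 1) = 2 * (real s / real p) - 1" using \<open>real s / real p \<ge> 1/2\<close> by linarith+
        thus ?thesis unfolding Wop_def by (simp only:)
      qed
      have *: "LD p (cV (Suc n) p) (h + vr n ^ 2) s / real p ^ Suc n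
        = LD p (cV (Suc n) p) (h + vr n ^ 2) (p - s) / real p ^ Suc n + (2 * (real s / real p) - 1)"
        unfolding LD_square_high[OF p(1) M h hp[OF p(1)] s] using p0 by (simp add: field_simps)
      have ps: "p - s <= M" using False M by simp
      have "p \<ge> P" using p(2) by simp
      from low[OF p(1) this M ps] show ?thesis unfolding W * sp by linarith
    qed
  qed
  thus ?thesis unfolding approx_def by blast
qed

subsection \<open>The freshman's dream\<close>

lemma frobenius_add:
  assumes I: "is_ideal I" and p: "prime p" "of_nat p \<in> I"
  shows "(x + y) ^ p - (x ^ p + y ^ p) \<in> I"
proof -
  let ?t = "\<lambda>k. of_nat (p choose k) * x ^ k * y ^ (p - k)"
  have p0: "p > 0" using prime_gt_0_nat[OF p(1)] .
  have "(x + y) ^ p = (\<Sum>k\<le>p. ?t k)" by (rule binomial_ring)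
  also have "{..p} = insert 0 (insert p {1..<p})" using p0 by auto
  also have "(\<Sum>k\<in>\<dots>. ?t k) = y ^ p + (x ^ p + (\<Sum>k=1..<p. ?t k))" using p0 by simp
  finally have "(x + y) ^ p - (x ^ p + y ^ p) = (\<Sum>k=1..<p. ?t k)" by simp
  also have "... \<in> I"
  proof (rule ideal_sum[OF I])
    fix k assume "k \<in> {1..<p}"
    hence "p dvd (p choose k)" by (intro dvd_choose_prime) (use p p0 in auto)
    then obtain c where "p choose k = p * c" by (rule dvdE)
    thus "?t k \<in> I" by (simp add: mult.assoc ideal_mult2[OF I p(2)])
  qed
  finally show ?thesis .
qed

text \<open>The second condition is what the reflection rule asks of \<open>h\<close>; sums inherit
  it by the freshman's dream.\<close>

definition good :: "nat => mps => bool" where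
  "good n h \<longleftrightarrow> (\<forall>k\<ge>n. free_of k h) \<and> (\<forall>k\<ge>n. \<forall>p. prime p --> h ^ p \<in> bI p (cV k p))"

lemma good_mono: "good n h ==> n <= m ==> good m h" by (auto simp: good_def)

lemma good_vr: "i < n ==> good n (vr i)"
proof -
  assume i: "i < n"
  have "vr i ^ p \<in> bI p (cV k p)" if "k \<ge> n" for k p
    using i that by (auto simp: vr_power bI_def did_def box_def coef_mono cV_def dest: spec[of _ i])
  thus ?thesis using i by (auto simp: good_def intro: free_of_vr)
qed

lemma good_add: assumes "good n f" "good n g" shows "good n (f + g)"
proof -
  have "(f + g) ^ p \<in> bI p (cV k p)" if k: "k \<ge> n" and p: "prime p" for k p
  proof -
    have "(f + g) ^ p - (f ^ p + g ^ p) \<in> bI p (cV k p)" by (rule frobenius_add[OF ideal_bI p p_bI])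
    moreover have "f ^ p + g ^ p \<in> bI p (cV k p)" using assms k p by (intro ideal_add[OF ideal_bI]) (auto simp: good_def)
    ultimately show ?thesis using ideal_diff_iff[OF ideal_bI] by blast
  qed
  thus ?thesis using assms by (auto simp: good_def intro: free_of_add)
qed

lemma good_mult: assumes "good n f" "\<And>k. k \<ge> n ==> free_of k g" shows "good n (f * g)"
  using assms by (auto simp: good_def power_mult_distrib intro: free_of_mult ideal_mult2[OF ideal_bI])

lemma good_free: "good n f ==> k \<ge> n ==> free_of k f" by (simp add: good_def)

lemma good_power: "good n f ==> m > 0 ==> good n (f ^ m)"
  by (cases m) (auto intro!: good_mult free_of_power good_free)

lemma iterate_squares:
  assumes "approx h n \<psi>" "L-lipschitz_on {0..1} \<psi>" "good n h"
  shows "approx (h + (\<Sum>i=n..<n+k. vr i ^ 2)) (n + k) ((Wop ^^ k) \<psi>)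
    \<and> (\<exists>L. L-lipschitz_on {0..1} ((Wop ^^ k) \<psi>)) \<and> good (n + k) (h + (\<Sum>i=n..<n+k. vr i ^ 2))"
proof (induction k)
  case 0 thus ?case using assms by auto
next
  case (Suc k)
  let ?h = "h + (\<Sum>i=n..<n+k. vr i ^ 2)"
  have e: "h + (\<Sum>i=n..<n + Suc k. vr i ^ 2) = ?h + vr (n + k) ^ 2" by simp
  obtain L' where L': "L'-lipschitz_on {0..1} ((Wop ^^ k) \<psi>)" using Suc by blast
  have g: "good (n + k) ?h" using Suc by blast
  have "approx (?h + vr (n + k) ^ 2) (Suc (n + k)) (Wop ((Wop ^^ k) \<psi>))"
  proof (rule approx_square[OF _ L'])
    show "approx ?h (n + k) ((Wop ^^ k) \<psi>)" using Suc by blast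
    show "free_of (n + k) ?h" using g by (simp add: good_def)
    show "?h ^ p \<in> bI p (cV (n + k) p)" if "prime p" for p using g that by (simp add: good_def)
  qed
  moreover have "\<exists>L. L-lipschitz_on {0..1} (Wop ((Wop ^^ k) \<psi>))" by (rule Wop_lipschitz[OF L'])
  moreover have "good (Suc (n + k)) (?h + vr (n + k) ^ 2)" by (intro good_add good_power good_mono[OF g] good_vr) auto
  ultimately show ?case unfolding e by simp
qed

subsection \<open>The base cases\<close>

lemma ldim_monomial:
  assumes p: "prime p" and c: "\<And>j. j \<ge> n ==> c j = 1" and i: "i < n"
  shows "ldim p (with_gen (bI p c) (vr i ^ k)) = real (\<Prod>j<n. (c(i := min (c i) k)) j)"
  unfolding with_gen_monomial using i c by (intro ldim_bI[OF p]) auto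

text \<open>The curve of type A already ends in a square, so one variable is enough to start with:
  F_p[x] modulo x^p and x^(Ns), whose dimension needs no error term.\<close>

lemma approx_A: "N \<ge> 1 ==> approx (vr 0 ^ N) 1 (\<lambda>t. min 1 (real N * t))"
proof -
  assume N: "N \<ge> 1"
  have "LD p (cV 1 p) (vr 0 ^ N) s / real p ^ 1 = min 1 (real N * (real s / real p))" if "prime p" for p s
  proof -
    have p0: "real p > 0" using prime_gt_0_nat[OF that] by simp
    have "LD p (cV 1 p) (vr 0 ^ N) s = real (min p (N * s))"
      unfolding LD_def power_mult[symmetric] by (subst ldim_monomial[OF that, of 1]) (auto simp: cV_def)
    thus ?thesis using p0 by (simp add: min_def field_simps of_nat_mult[symmetric] del: of_nat_mult)
  qed
  thus ?thesis unfolding approx_def by (intro exI[of _ 0]) auto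
qed

text \<open>An antiderivative of min(c, m x), with value 0 at 0 when c >= 0.\<close>

definition G :: "real => real => real => real" where
  "G m c x = (if m * x <= c then m * x\<^sup>2 / 2 else c * x - c\<^sup>2 / (2 * m))"

lemma G_deriv:
  assumes m: "m > 0" shows "(G m c has_real_derivative min c (m * x)) (at x)"
proof -
  \<comment> \<open>In this form the change of branch at m x = c is carried by the square of a
    maximum, which is differentiable there.\<close>
  have eq: "G m c = (\<lambda>x. c * x - c\<^sup>2 / (2 * m) + (max 0 (c - m * x))\<^sup>2 / (2 * m))"
  proof
    fix x
    show "G m c x = c * x - c\<^sup>2 / (2 * m) + (max 0 (c - m * x))\<^sup>2 / (2 * m)"
      using m by (simp add: G_def max_def power2_eq_square field_simps)
  qed
  have sq: "((\<lambda>x. (max 0 x)\<^sup>2) has_real_derivative 2 * max 0 x) (at x)" for x :: real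
  proof (cases "x = 0")
    case True
    have "((\<lambda>y. ((max 0 y)\<^sup>2 - (max 0 0)\<^sup>2) / (y - 0)) \<longlongrightarrow> 0) (at (0::real))"
    proof (rule tendsto_0_le[where K = 1 and f = "\<lambda>y. y :: real"])
      show "((\<lambda>y. y) \<longlongrightarrow> (0::real)) (at 0)" by (rule tendsto_ident_at)
      show "\<forall>\<^sub>F y in at (0::real). norm (((max 0 y)\<^sup>2 - (max 0 0)\<^sup>2) / (y - 0)) <= norm y * 1"
        by (intro always_eventually allI) (simp add: max_def power2_eq_square)
    qed
    thus ?thesis using True by (simp add: has_field_derivative_iff)
  next
    case False
    show ?thesis
    proof (cases "x > 0")
      case True
      have "((\<lambda>x. x\<^sup>2) has_real_derivative 2 * x) (at x)" by (auto intro!: derivative_eq_intros)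
      moreover have "\<forall>\<^sub>F y in nhds x. y\<^sup>2 = (max 0 y)\<^sup>2"
        using eventually_nhds_in_open[of "{0<..}" x] True by (auto elim!: eventually_mono)
      ultimately have "((\<lambda>x. (max 0 x)\<^sup>2) has_real_derivative 2 * x) (at x)" by (rule iffD1[OF DERIV_cong_ev[OF refl _ refl], rotated])
      thus ?thesis using True by simp
    next
      case F: False
      have "((\<lambda>x. 0 :: real) has_real_derivative 0) (at x)" by simp
      moreover have "\<forall>\<^sub>F y in nhds x. 0 = (max 0 y)\<^sup>2"
        using eventually_nhds_in_open[of "{..<0}" x] F False by (auto elim!: eventually_mono)
      ultimately have "((\<lambda>x. (max 0 x)\<^sup>2) has_real_derivative 0) (at x)" by (rule iffD1[OF DERIV_cong_ev[OF refl _ refl], rotated])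
      thus ?thesis using F by simp
    qed
  qed
  have "((\<lambda>x. (max 0 (c - m * x))\<^sup>2) has_real_derivative (2 * max 0 (c - m * x)) * (0 - m)) (at x)"
    by (rule DERIV_chain'[OF _ sq]) (auto intro!: derivative_eq_intros)
  hence "(G m c has_real_derivative (c - 0 + (2 * max 0 (c - m * x)) * (0 - m) / (2 * m))) (at x)"
    unfolding eq by (intro DERIV_add[OF DERIV_diff[OF DERIV_cmult_Id DERIV_const] DERIV_cdivide])
  moreover have "c - 0 + (2 * max 0 (c - m * x)) * (0 - m) / (2 * m) = min c (m * x)" using m by (simp add: max_def min_def)
  ultimately show ?thesis by simp
qed

lemma G_integral:
  assumes "m > 0" "a <= b"
  shows "((\<lambda>x. min c (m * x)) has_integral (G m c b - G m c a)) {a..b}"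
  by (rule fundamental_theorem_of_calculus[OF assms(2)])
     (intro has_real_derivative_iff_has_vector_derivative[THEN iffD1] DERIV_subset[OF G_deriv[OF assms(1)]], simp)

lemma G_lip:
  assumes m: "m > 0" and c: "0 <= c" "c <= 1" and ab: "0 <= a" "0 <= b"
  shows "\<bar>G m c a - G m c b\<bar> <= \<bar>a - b\<bar>"
proof -
  have *: "\<bar>G m c b - G m c a\<bar> <= b - a" if "0 <= a" "a <= b" for a b
  proof -
    have i: "((\<lambda>x. min c (m * x)) has_integral (G m c b - G m c a)) {a..b}" by (rule G_integral[OF m that(2)])
    have r: "0 <= min c (m * x) \<and> min c (m * x) <= 1" if "x \<in> {a..b}" for x
      using that \<open>0 <= a\<close> c m by (auto simp: min_def)
    have "((\<lambda>x. 1::real) has_integral (b - a)) {a..b}" using has_integral_const_real[of "1::real" a b] that by simp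
    hence "G m c b - G m c a <= b - a" using has_integral_le[OF i] r by blast
    moreover have "0 <= G m c b - G m c a" using has_integral_nonneg[OF i] r by blast
    ultimately show ?thesis by simp
  qed
  show ?thesis using *[of a b] *[of b a] ab by (cases "a <= b") (auto simp: abs_minus_commute)
qed

lemma G_lip_c:
  assumes m: "m \<ge> 1" and c: "0 <= c" "c <= 1" "0 <= c'" "c' <= 1" and x: "0 <= x" "x <= 2"
  shows "\<bar>G m c x - G m c' x\<bar> <= 2 * \<bar>c - c'\<bar>"
proof -
  have i: "((\<lambda>x. min c (m * x)) has_integral G m c x) {0..x}" if "0 <= c" for c using G_integral[of m 0 x c] m x that by (simp add: G_def)
  have "\<bar>G m c x - G m c' x\<bar> = norm (integral {0..x} (\<lambda>y. min c (m * y) - min c' (m * y)))"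
    using i[OF c(1)] i[OF c(3)] by (simp add: integral_unique[OF has_integral_diff])
  also have "... <= integral {0..x} (\<lambda>y. \<bar>c - c'\<bar>)"
  proof (rule integral_norm_bound_integral)
    show "(\<lambda>y. min c (m * y) - min c' (m * y)) integrable_on {0..x}"
      using i[OF c(1)] i[OF c(3)] by (intro integrable_diff) (auto simp: has_integral_integrable)
    show "norm (min c (m * y) - min c' (m * y)) <= \<bar>c - c'\<bar>" for y by (auto simp: min_def)
  qed (rule integrable_const_ivl)
  also have "... = x * \<bar>c - c'\<bar>" using x by simp
  also have "... <= 2 * \<bar>c - c'\<bar>" using x by (intro mult_right_mono) auto
  finally show ?thesis .
qed

text \<open>The limit function of x^\<kappa> (x^m + y^a). Each of the \<open>a\<close> blocks has
  length about p/a and contributes half the integral of min(1 - \<kappa> t, m x) from |1/a - t| to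
  1/a + t, half because the exponents advance by 2. The summand \<kappa> t comes from the monomial
  factor, which also lowers the truncation from 1 to 1 - \<kappa> t.\<close>

definition psib :: "nat => nat => nat => real => real" where
  "psib \<kappa> a m t = real \<kappa> * t + real a / 2 *
     (G (real m) (1 - real \<kappa> * t) (1 / real a + t) - G (real m) (1 - real \<kappa> * t) \<bar>1 / real a - t\<bar>)"

lemma psib_lipschitz:
  assumes k: "\<kappa> <= 1" and a: "a \<ge> 2" and m: "m \<ge> 2"
  shows "\<exists>L. L-lipschitz_on {0..1} (psib \<kappa> a m)"
proof
  show "(1 + real a / 2 * 6)-lipschitz_on {0..1} (psib \<kappa> a m)"
  proof (rule lipschitz_onI)
    fix s t :: real assume st: "s \<in> {0..1}" "t \<in> {0..1}"
    hence st': "0 <= s" "s <= 1" "0 <= t" "t <= 1" by auto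
    let ?c = "\<lambda>t. 1 - real \<kappa> * t"
    have k01: "\<kappa> = 0 \<or> \<kappa> = 1" using k by auto
    have c: "0 <= ?c t" "?c t <= 1" "0 <= ?c s" "?c s <= 1" using st k01 by auto
    have cc: "\<bar>?c s - ?c t\<bar> <= \<bar>s - t\<bar>" using k01 by auto
    have ia: "0 < 1 / real a" "1 / real a <= 1/2" using a by (auto simp: field_simps)
    have m1: "real m > 0" "real m \<ge> 1" using m by auto
    have 1: "\<bar>G m (?c s) x - G m (?c t) y\<bar> <= 3 * \<bar>s - t\<bar>"
      if "0 <= x" "x <= 2" "0 <= y" "\<bar>x - y\<bar> <= \<bar>s - t\<bar>" for x y
    proof -
      have tri: "\<bar>u - w\<bar> <= \<bar>u - v\<bar> + \<bar>v - w\<bar>" for u v w :: real by linarith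
      have "\<bar>G m (?c s) x - G m (?c t) y\<bar> <= 2 * \<bar>?c s - ?c t\<bar> + \<bar>x - y\<bar>"
        by (rule order.trans[OF tri add_mono[OF G_lip_c[OF m1(2) c(3,4) c(1,2) that(1,2)] G_lip[OF m1(1) c(1,2) that(1,3)]]])
      also have "... <= 2 * \<bar>s - t\<bar> + \<bar>s - t\<bar>" by (intro add_mono mult_left_mono cc that(4)) simp
      finally show ?thesis by simp
    qed
    have 2: "\<bar>G m (?c s) (1 / real a + s) - G m (?c t) (1 / real a + t)\<bar> <= 3 * \<bar>s - t\<bar>" by (rule 1) (use st' ia in linarith)+
    have 3: "\<bar>G m (?c s) \<bar>1 / real a - s\<bar> - G m (?c t) \<bar>1 / real a - t\<bar>\<bar> <= 3 * \<bar>s - t\<bar>"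
      by (rule 1) (use st' ia in linarith)+
    let ?D = "\<lambda>t. G m (?c t) (1 / real a + t) - G m (?c t) \<bar>1 / real a - t\<bar>"
    have "\<bar>?D s - ?D t\<bar> <= 6 * \<bar>s - t\<bar>" using 2 3 by linarith
    hence "real a / 2 * \<bar>?D s - ?D t\<bar> <= real a / 2 * (6 * \<bar>s - t\<bar>)" by (intro mult_left_mono) auto
    moreover have "\<bar>real a / 2 * ?D s - real a / 2 * ?D t\<bar> = real a / 2 * \<bar>?D s - ?D t\<bar>"
      unfolding right_diff_distrib[symmetric] abs_mult by simp
    moreover have "\<bar>real \<kappa> * s - real \<kappa> * t\<bar> <= \<bar>s - t\<bar>" using k01 by auto
    moreover have tri: "\<bar>x + y - (x' + y')\<bar> <= \<bar>x - x'\<bar> + \<bar>y - y'\<bar>" for x y x' y' :: real by linarith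
    ultimately have "\<bar>psib \<kappa> a m s - psib \<kappa> a m t\<bar> <= \<bar>s - t\<bar> + real a / 2 * (6 * \<bar>s - t\<bar>)"
      unfolding psib_def by (intro order.trans[OF tri add_mono]) simp_all
    thus "dist (psib \<kappa> a m s) (psib \<kappa> a m t) <= (1 + real a / 2 * 6) * dist s t" unfolding dist_real_def distrib_right by simp
  qed auto
qed

text \<open>The truncation \<open>D(n) = min(R, mn)\<close> saturates so early that the reflected
  Clebsch--Gordan rule coincides with the unreflected one.\<close>

lemma (in gf_module) lc_saturated:
  assumes ldk: "\<And>k. ld k = real (min R (m * k))" and dI: "ldim p I = real R" and hp: "h ^ p \<in> I"
    and R: "R <= p" and m: "m \<ge> 2" and b: "2 * b <= p + 1" and s: "s <= p"
  shows "lc b s = (\<Sum>l<min b s. real (min R (m * (b + s - 1 - 2 * l))))"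
proof (cases "b + s <= p + 1")
  case True thus ?thesis by (simp add: lc_sum ldk)
next
  case False
  \<comment> \<open>The first \<open>e\<close> terms of the sum reach the truncation and give
    \<open>R\<close> each; the others form the sum for the complementary sizes p - b and p -
    s.\<close>
  define e where "e = b + s - p"
  have pp: "p \<ge> 2" using prime_ge_2_nat[OF p] .
  have bp: "b <= p" using b pp by linarith
  have mn: "min b s = e + min (p - b) (p - s)" using False s bp by (auto simp: e_def)
  have "lc b s = real e * real R + lc (p - b) (p - s)"
  proof -
    have "real e = real s - real (p - b)" using False bp by (simp add: e_def of_nat_diff)
    hence "real e * real R = real s * real R - real (p - b) * real R" by (simp only: left_diff_distrib)
    thus ?thesis using lc_reflect[OF hp s bp] unfolding dI by linarith
  qed
  also have "lc (p - b) (p - s) = (\<Sum>l<min (p - b) (p - s). real (min R (m * (p - b + (p - s) - 1 - 2 * l))))"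
    using False by (simp add: lc_sum ldk)
  also have "... = (\<Sum>l=e..<min b s. real (min R (m * (b + s - 1 - 2 * l))))"
  proof (rule sum.reindex_bij_witness[where i = "\<lambda>l. l - e" and j = "\<lambda>l. l + e"])
    fix l assume l: "l \<in> {..<min (p - b) (p - s)}"
    have "b + s - 1 - 2 * (l + e) = p - b + (p - s) - 1 - 2 * l" using False bp s by (simp add: e_def)
    thus "real (min R (m * (b + s - 1 - 2 * (l + e)))) = real (min R (m * (p - b + (p - s) - 1 - 2 * l)))" by (simp only:)
  qed (use mn in auto)
  also have "real e * real R = (\<Sum>l<e. real (min R (m * (b + s - 1 - 2 * l))))"
  proof -
    have "min R (m * (b + s - 1 - 2 * l)) = R" if "l < e" for l
    proof -
      have "p <= 2 * (b + s - 1 - 2 * l)" using that False b s unfolding e_def by linarith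
      also have "... <= m * (b + s - 1 - 2 * l)" using m by (intro mult_right_mono) auto
      finally show ?thesis using R by simp
    qed
    thus ?thesis by simp
  qed
  also have "(\<Sum>l<e. real (min R (m * (b + s - 1 - 2 * l)))) + (\<Sum>l=e..<min b s. real (min R (m * (b + s - 1 - 2 * l))))
     = (\<Sum>l<min b s. real (min R (m * (b + s - 1 - 2 * l))))" unfolding lessThan_atLeast0 by (rule sum.atLeastLessThan_concat) (use mn in auto)
  finally show ?thesis .
qed

text \<open>The exponents run from |b - s| + 1 to b + s - 1 in steps of 2, and after division by
  \<open>p\<close> they are the midpoints of cells of width 2/p.\<close>

lemma sum_min_approx:
  assumes p: "p > 0" and R: "R <= p" and m: "m \<ge> 1" and b: "b <= p" and s: "s <= p"
  shows "\<bar>(\<Sum>l<min b s. real (min R (m * (b + s - 1 - 2 * l)))) / real p ^ 2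
     - (G m (real R / real p) ((real b + real s) / real p) - G m (real R / real p) (\<bar>real b - real s\<bar> / real p)) / 2\<bar>
     <= real m / real p"
proof -
  let ?\<psi> = "\<lambda>x. min (real R / real p) (real m * x)"
  let ?N = "min b s"
  define x where "x = \<bar>real b - real s\<bar> / real p"
  define S where "S = (\<Sum>l<min b s. real (min R (m * (b + s - 1 - 2 * l)))) / real p ^ 2"
  define D where "D = G m (real R / real p) ((real b + real s) / real p) - G m (real R / real p) (\<bar>real b - real s\<bar> / real p)"
  have p0: "real p > 0" using p by simp
  have lip: "(real m)-lipschitz_on {0..2} ?\<psi>"
  proof (rule lipschitz_onI)
    fix u w :: real
    have "\<bar>?\<psi> u - ?\<psi> w\<bar> <= \<bar>real m * u - real m * w\<bar>" by (auto simp: min_def)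
    thus "dist (?\<psi> u) (?\<psi> w) <= real m * dist u w" by (simp add: dist_real_def abs_mult flip: right_diff_distrib)
  qed simp
  have x1: "x + 2 * real ?N * (1 / real p) = (real b + real s) / real p" using p0 by (auto simp: x_def min_def field_simps)
  have x2: "(real b + real s) / real p <= 2" using b s p0 by (simp add: field_simps)
  have x0: "0 <= x" using p0 by (simp add: x_def)
  have le: "x <= (real b + real s) / real p" using x1 p0 by (metis add_increasing2 divide_nonneg_nonneg le_add_same_cancel1 mult_nonneg_nonneg of_nat_0_le_iff zero_le_numeral zero_le_one)
  have "\<bar>2 * (1 / real p) * (\<Sum>i<?N. ?\<psi> (x + (2 * real i + 1) * (1 / real p))) - integral {x..x + 2 * real ?N * (1 / real p)} ?\<psi>\<bar>
     <= real ?N * (2 * real m * (1 / real p)\<^sup>2)" by (rule midpoint_sum[OF lip]) (use p0 x0 x1 x2 in auto)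
  also have "integral {x..x + 2 * real ?N * (1 / real p)} ?\<psi> = G m (real R / real p) ((real b + real s) / real p) - G m (real R / real p) x"
    unfolding x1 using m le by (intro integral_unique G_integral) auto
  also have "real ?N * (2 * real m * (1 / real p)\<^sup>2) <= real p * (2 * real m * (1 / real p)\<^sup>2)"
    by (rule mult_right_mono) (use b in auto)
  also have "... = 2 * (real m / real p)" using p0 by (simp add: power2_eq_square)
  also have "(\<Sum>i<?N. ?\<psi> (x + (2 * real i + 1) * (1 / real p))) = (\<Sum>i<?N. real (min R (m * (b + s - 1 - 2 * (?N - Suc i)))) / real p)"
  proof (rule sum.cong[OF refl])
    fix i assume i: "i \<in> {..<?N}"
    have "real (b + s - 1 - 2 * (?N - Suc i)) = \<bar>real b - real s\<bar> + 2 * real i + 1"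
      using i by (cases "b <= s") (auto simp: min_def of_nat_diff)
    hence "x + (2 * real i + 1) * (1 / real p) = real (b + s - 1 - 2 * (?N - Suc i)) / real p" by (simp add: x_def add_divide_distrib)
    thus "?\<psi> (x + (2 * real i + 1) * (1 / real p)) = real (min R (m * (b + s - 1 - 2 * (?N - Suc i)))) / real p"
      using p0 by (simp add: min_def divide_le_cancel del: of_nat_mult add: of_nat_mult[symmetric])
  qed
  also have "... = (\<Sum>i<?N. real (min R (m * (b + s - 1 - 2 * i))) / real p)" by (rule sum.nat_diff_reindex)
  also have "2 * (1 / real p) * \<dots> = 2 * ((\<Sum>i<?N. real (min R (m * (b + s - 1 - 2 * i)))) / real p ^ 2)"
    by (simp add: sum_divide_distrib sum_distrib_left power2_eq_square)
  finally have "\<bar>2 * S - D\<bar> <= 2 * (real m / real p)" unfolding S_def D_def x_def .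
  hence "\<bar>S - D / 2\<bar> <= real m / real p" by linarith
  thus ?thesis unfolding S_def D_def .
qed

lemma approx_base:
  assumes ij: "i < 2" "j < 2" "i \<noteq> j" and k: "\<kappa> <= 1" and a: "a \<ge> 2" and m: "m \<ge> 2"
  shows "approx (vr i ^ \<kappa> * (vr i ^ m + vr j ^ a)) 2 (psib \<kappa> a m)"
proof -
  let ?g = "vr i ^ m + vr j ^ a"
  let ?f = "vr i ^ \<kappa> * ?g"
  have "\<bar>LD p (cV 2 p) ?f s / real p ^ 2 - psib \<kappa> a m (real s / real p)\<bar>
     <= real a * (real m + 1) / real p" if p: "prime p" and s: "s <= p" for p s
  proof -
    have p0: "real p > 0" and p2: "p \<ge> 2" using prime_ge_2_nat[OF p] by auto
    \<comment> \<open>What remains of the box in direction x_i after x_i^(\<kappa> s) has been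
      divided out of f^s.\<close>
    define R where "R = p - \<kappa> * s"
    define t where "t = real s / real p"
    have k01: "\<kappa> = 0 \<or> \<kappa> = 1" using k by auto
    have ks: "\<kappa> * s <= p" using k01 s by auto
    have Rp: "R <= p" by (simp add: R_def)
    have t: "0 <= t" "t <= 1" using s p0 by (auto simp: t_def field_simps)
    let ?c = "1 - real \<kappa> * t" and ?d2 = "(cV 2 p)(i := min (cV 2 p i) (\<kappa> * s))"
    let ?c1 = "(cV 2 p)(i := p - \<kappa> * s)"
    let ?c2 = "?c1(j := 1)"
    have c1: "\<And>l. l \<ge> 2 ==> ?c1 l = 1" and c2: "\<And>l. l \<ge> 2 ==> ?c2 l = 1" using ij by (auto simp: cV_def)
    have prod2: "(\<Prod>l<2. f l) = f i * f j" for f :: "nat => nat"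
    proof -
      have "{..<2::nat} = {i, j}" using ij by auto
      thus ?thesis using ij by simp
    qed
    interpret gf_module "bI p ?c2" "vr i ^ m" p by (rule gf_module_bI[OF p, of 2]) (rule c2)
    have ldk: "ld k = real (min R (m * k))" for k unfolding ld_def power_mult[symmetric]
      by (subst ldim_monomial[OF p c2 ij(1)]) (use ij in \<open>auto simp: prod2 R_def cV_def\<close>)
    have dI: "ldim p (bI p ?c2) = real R"
      by (subst ldim_bI[where c = ?c2 and n = 2, OF p c2], assumption, subst prod2) (use ij in \<open>auto simp: R_def cV_def\<close>)
    have hp: "(vr i ^ m) ^ p \<in> bI p ?c2"
    proof -
      have "vr i ^ (m * p) \<in> bI p ?c2" unfolding bI_def did_def
      proof (intro CollectI ballI)
        fix \<alpha> assume "\<alpha> \<in> box ?c2"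
        hence "ex \<alpha> i < ?c2 i" unfolding box_def by blast
        also have "?c2 i <= 1 * p" using ij by simp
        also have "... <= m * p" using m by (intro mult_right_mono) auto
        finally have "\<alpha> \<noteq> sng i (m * p)" by auto
        thus "int p dvd coef (vr i ^ (m * p)) \<alpha>" by (simp add: vr_power coef_mono)
      qed
      thus ?thesis by (simp add: power_mult)
    qed
    \<comment> \<open>Block sizes for the residues modulo \<open>a\<close> of the exponent of x_j;
      all are within 1 of p/a, and a >= 2 keeps them small enough for
      \<open>lc_saturated\<close>.\<close>
    define b where "b r = (p + a - 1 - r) div a" for r
    have bb: "2 * b r <= p + 1" "\<bar>real (b r) / real p - 1 / real a\<bar> <= 1 / real p" if r: "r < a" for r
    proof -
      have 1: "a * b r <= p + a - 1 - r" unfolding b_def by (rule times_div_less_eq_dividend)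
      have 2: "p + a - 1 - r < a * b r + a" unfolding b_def using a r
        by (metis dividend_less_times_div mult.commute add.commute le_eq_less_or_eq less_le_trans pos2)
      show "\<bar>real (b r) / real p - 1 / real a\<bar> <= 1 / real p"
      proof -
        have "\<bar>real a * real (b r) - real p\<bar> <= real a" using 1 2 r of_nat_mono[OF 1, where 'a = real] unfolding abs_le_iff
          by (auto simp flip: of_nat_mult of_nat_add simp: algebra_simps)
        moreover have "\<bar>real (b r) / real p - 1 / real a\<bar> = \<bar>real a * real (b r) - real p\<bar> / (real a * real p)"
        proof -
          have "real (b r) / real p - 1 / real a = (real a * real (b r) - real p) / (real a * real p)" using p0 a by (simp add: field_simps)
          thus ?thesis using p0 by (simp add: abs_mult)
        qed
        ultimately show ?thesis using a p0 by (simp add: field_simps)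
      qed
      show "2 * b r <= p + 1"
      proof (rule ccontr)
        assume "\<not> ?thesis"
        hence "p + 2 <= 2 * b r" by simp
        hence "a * (p + 2) <= 2 * (a * b r)" by (metis mult.left_commute mult_le_mono2)
        also have "... <= 2 * (p + a - 1)" using 1 by simp
        finally have "a * p + 2 * a <= 2 * p + 2 * a - 2" using a by (simp add: algebra_simps)
        moreover have "2 * p <= a * p" using a by simp
        ultimately show False using a by linarith
      qed
    qed
    have bp: "b r <= p" if "r < a" for r using bb(1)[OF that] p2 by linarith
    have "LD p (cV 2 p) ?f s = real (\<kappa> * s) * real p + LD p ?c1 ?g s"
    proof -
      have "ind UNIV (with_gen (bI p (cV 2 p)) (?f ^ s))
        = ind UNIV (bI p ?d2) * ind UNIV (with_gen (bI p ((cV 2 p)(i := cV 2 p i - \<kappa> * s))) (?g ^ s))"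
        unfolding power_mult_distrib power_mult[symmetric] by (rule ind_monomial_factor)
      also have "(cV 2 p)(i := cV 2 p i - \<kappa> * s) = ?c1" using ij by (simp add: cV_def)
      finally have e: "ind UNIV (with_gen (bI p (cV 2 p)) (?f ^ s))
        = ind UNIV (bI p ?d2) * ind UNIV (with_gen (bI p ?c1) (?g ^ s))" .
      have c3: "\<And>l. l \<ge> 2 ==> ?d2 l = 1" using ij by (auto simp: cV_def)
      have "ldim p (bI p ?d2) = real (\<kappa> * s) * real p"
        by (subst ldim_bI[where n = 2, OF p c3], assumption, subst prod2) (use ij ks in \<open>auto simp: cV_def\<close>)
      moreover have "ind UNIV (bI p ?d2) > 0" by (rule gf_module.fin[OF gf_module_bI[OF p c3]])
      moreover have "ind UNIV (with_gen (bI p ?c1) (?g ^ s)) > 0" by (rule gf_module.fin_with_gen[OF gf_module_bI[OF p c1]])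
      ultimately show ?thesis unfolding LD_def ldim_def e by (simp add: log_mult_pos)
    qed
    also have "LD p ?c1 ?g s = (\<Sum>r<a. lc (b r) s)"
    proof -
      have "?c1 j = p" using ij by (simp add: cV_def)
      thus ?thesis unfolding b_def by (subst LD_add_variable[OF p c1]) (use ij a in \<open>auto intro: free_of_power free_of_vr\<close>)
    qed
    finally have LD: "LD p (cV 2 p) ?f s / real p ^ 2
       = real \<kappa> * t + (\<Sum>r<a. lc (b r) s / real p ^ 2)"
      using p0 by (simp add: add_divide_distrib sum_divide_distrib t_def power2_eq_square)
    have Rt: "real R / real p = ?c" using ks p0 by (simp add: R_def t_def of_nat_diff diff_divide_distrib flip: of_nat_mult)
    have ct: "0 <= ?c" "?c <= 1" using t k01 by auto
    define X where "X = (G m ?c (1 / real a + t) - G m ?c \<bar>1 / real a - t\<bar>) / 2"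
    have each: "\<bar>lc (b r) s / real p ^ 2 - X\<bar> <= (real m + 1) / real p" if r: "r < a" for r
    proof -
      have "lc (b r) s = (\<Sum>l<min (b r) s. real (min R (m * (b r + s - 1 - 2 * l))))" by (rule lc_saturated[OF ldk dI hp Rp m bb(1)[OF r] s])
      hence 1: "\<bar>lc (b r) s / real p ^ 2 - (G m ?c (real (b r) / real p + t) - G m ?c \<bar>real (b r) / real p - t\<bar>) / 2\<bar> <= real m / real p"
        using sum_min_approx[of p R m "b r" s] p0 Rp m bp[OF r] s
        by (simp add: Rt t_def add_divide_distrib diff_divide_distrib abs_divide flip: diff_divide_distrib)
      have m0: "real m > 0" using m by simp
      have 2: "\<bar>G m ?c (real (b r) / real p + t) - G m ?c (1 / real a + t)\<bar> <= \<bar>(real (b r) / real p + t) - (1 / real a + t)\<bar>"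
        by (rule G_lip[OF m0 ct]) (use t p0 in auto)
      have 3: "\<bar>G m ?c \<bar>real (b r) / real p - t\<bar> - G m ?c \<bar>1 / real a - t\<bar>\<bar> <= \<bar>\<bar>real (b r) / real p - t\<bar> - \<bar>1 / real a - t\<bar>\<bar>"
        by (rule G_lip[OF m0 ct]) auto
      have e2: "\<bar>(u + t) - (w + t)\<bar> <= \<bar>u - w\<bar>" "\<bar>\<bar>u - t\<bar> - \<bar>w - t\<bar>\<bar> <= \<bar>u - w\<bar>" for u w :: real by linarith+
      have gen: "\<bar>L - (A - B) / 2\<bar> <= M ==> \<bar>A - A'\<bar> <= E ==> \<bar>B - B'\<bar> <= E ==> \<bar>L - (A' - B') / 2\<bar> <= M + E"
        for L A B A' B' M E :: real unfolding abs_le_iff by (elim conjE, intro conjI) (simp_all add: field_simps)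
      show ?thesis unfolding X_def add_divide_distrib by (rule gen[OF 1 order.trans[OF 2 order.trans[OF e2(1) bb(2)[OF r]]]
              order.trans[OF 3 order.trans[OF e2(2) bb(2)[OF r]]]])
    qed
    have "\<bar>(\<Sum>r<a. lc (b r) s / real p ^ 2) - real a * X\<bar> = \<bar>\<Sum>r<a. lc (b r) s / real p ^ 2 - X\<bar>"
      by (simp add: sum_subtractf)
    also have "... <= (\<Sum>r<a. (real m + 1) / real p)" by (rule order.trans[OF sum_abs sum_mono]) (use each in auto)
    also have "... = real a * (real m + 1) / real p" by simp
    finally show ?thesis unfolding LD psib_def by (simp add: X_def t_def)
  qed
  thus ?thesis unfolding approx_def by blast
qed

subsection \<open>The generating function of the limits\<close>

definition Tf :: "real fps" where "Tf = (1 + fps_sin 1) * inverse (fps_cos 1)"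

text \<open>As a series in z it has coefficients H_d(s) = \<open>Hc d s\<close> that are polynomials
  in \<open>s\<close>. They are determined by H_0 = 1, H_d(0) = 0 for d > 0 and H_(d+1)'(s) = 2
  H_d(1/2 - s), the recursion behind the operator \<open>Kop\<close>.\<close>

definition Hf :: "real => real fps" where "Hf s = fps_cos (2 * s) + Tf * fps_sin (2 * s)"

definition Hc :: "nat => real => real" where "Hc d s = fps_nth (Hf s) d"

definition Hz :: "real => real => real" where "Hz s z = cos (2 * s * z) + sec_plus_tan z * sin (2 * s * z)"

lemma fps_cos_1_nz: "fps_nth (fps_cos (1::real)) 0 \<noteq> 0" by (simp add: fps_cos_def)

lemma Tf_cos: "Tf * fps_cos 1 = 1 + fps_sin 1"
  unfolding Tf_def mult.assoc using inverse_mult_eq_1[OF fps_cos_1_nz] by simp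

lemma fps_cos_nz: "fps_cos (1::real) \<noteq> 0" by (metis fps_cos_1_nz fps_zero_nth)

text \<open>After multiplication by cos this is cos^2 + sin^2 = 1. The equation has sec + tan as its
  only solution, which is how this function enters.\<close>

lemma Tf_sin: "fps_cos 1 + Tf * fps_sin 1 = Tf"
proof -
  have "(fps_cos 1 + Tf * fps_sin 1) * fps_cos 1 = (fps_cos 1)\<^sup>2 + (Tf * fps_cos 1) * fps_sin 1" by (simp add: power2_eq_square algebra_simps)
  also have "... = ((fps_cos 1)\<^sup>2 + (fps_sin 1)\<^sup>2) + fps_sin 1" unfolding Tf_cos by (simp add: power2_eq_square algebra_simps)
  also have "... = Tf * fps_cos 1" unfolding fps_sin_cos_sum_of_squares Tf_cos ..
  finally show ?thesis using fps_cos_nz by simp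
qed

lemma Hz_expansion: "Hz s has_fps_expansion Hf s"
proof -
  have "(\<lambda>z. cos (2 * s * z) + (1 + sin z) * inverse (cos z) * sin (2 * s * z)) has_fps_expansion
     fps_cos (2 * s) + (1 + fps_sin 1) * inverse (fps_cos 1) * fps_sin (2 * s)"
    by (intro has_fps_expansion_add has_fps_expansion_mult has_fps_expansion_inverse has_fps_expansion_cos
        has_fps_expansion_sin has_fps_expansion_sin' has_fps_expansion_cos' has_fps_expansion_1 fps_cos_1_nz)
  also have "(\<lambda>z. cos (2 * s * z) + (1 + sin z) * inverse (cos z) * sin (2 * s * z)) = Hz s"
    by (auto simp: Hz_def sec_plus_tan_def tan_def fun_eq_iff divide_inverse algebra_simps)
  finally show ?thesis by (simp add: Hf_def Tf_def)
qed

lemma taylor_coeff_fps: "f has_fps_expansion F ==> taylor_coeff f k = fps_nth F k"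
proof -
  have "(deriv ^^ k) f has_fps_expansion (fps_deriv ^^ k) F" if "f has_fps_expansion F" for f :: "real => real" and F
    using that by (induction k) (auto intro: has_fps_expansion_deriv)
  moreover have "fps_nth ((fps_deriv ^^ k) F) 0 = fact k * fps_nth F k" for F :: "real fps" by (subst fps_0th_higher_deriv) simp
  moreover assume "f has_fps_expansion F"
  ultimately have "(deriv ^^ k) f 0 = fact k * fps_nth F k" using has_fps_expansion_imp_0_eq_fps_nth_0 by metis
  thus ?thesis by (simp add: taylor_coeff_def)
qed

lemma Hc_0: "Hc 0 s = 1"
  by (simp add: Hc_def Hf_def fps_cos_def fps_sin_def)

lemma Hc_at_0: "d > 0 ==> Hc d 0 = 0"
proof -
  have "fps_cos (0::real) = 1" by (rule fps_ext) (auto simp: fps_cos_def fps_one_nth power_0_left)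
  moreover have "fps_sin (0::real) = 0" by (rule fps_ext) (auto simp: fps_sin_def power_0_left odd_pos)
  ultimately show "d > 0 ==> Hc d 0 = 0" by (simp add: Hc_def Hf_def)
qed

text \<open>The right side is the derivative of \<open>Hf s\<close> in \<open>s\<close> divided by
  2z, so this is the recursion for the H_d in closed form.\<close>

lemma Hf_reflect: "Hf (1/2 - s) = - fps_sin (2 * s) + Tf * fps_cos (2 * s)"
proof -
  have c: "fps_cos (2 * (1/2 - s)) = fps_cos 1 * fps_cos (2 * s) + fps_sin 1 * fps_sin (2 * s)"
    using fps_cos_add[of 1 "- 2 * s"] by (simp add: algebra_simps fps_cos_odd fps_sin_even)
  have s: "fps_sin (2 * (1/2 - s)) = fps_sin 1 * fps_cos (2 * s) - fps_cos 1 * fps_sin (2 * s)"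
    using fps_sin_add[of 1 "- 2 * s"] by (simp add: algebra_simps fps_cos_odd fps_sin_even)
  have "Hf (1/2 - s) = (fps_cos 1 + Tf * fps_sin 1) * fps_cos (2 * s) + (fps_sin 1 - Tf * fps_cos 1) * fps_sin (2 * s)"
    unfolding Hf_def c s by (simp only: algebra_simps)
  also have "... = Tf * fps_cos (2 * s) + (- 1) * fps_sin (2 * s)" unfolding Tf_sin Tf_cos by simp
  finally show ?thesis by simp
qed

lemma deriv_monomial:
  "((\<lambda>s. c * (2 * s) ^ Suc d / fact (Suc d)) has_real_derivative 2 * (c * (2 * s) ^ d / fact d)) (at s)"
proof -
  have 1: "((\<lambda>s. 2 * s) has_real_derivative 2) (at s)" by (rule DERIV_cmult_Id)
  have "((\<lambda>s. c * (2 * s) ^ Suc d / fact (Suc d)) has_real_derivative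
      c * (real (Suc d) * (2 * (2 * s) ^ (Suc d - Suc 0))) / fact (Suc d)) (at s)" by (rule DERIV_cdivide[OF DERIV_cmult[OF DERIV_power[OF 1]]])
  moreover have "c * (real (Suc d) * (2 * (2 * s) ^ (Suc d - Suc 0))) / fact (Suc d) = 2 * (c * (2 * s) ^ d / fact d)"
  proof -
    have "c * (n * (2 * X)) / (n * F) = 2 * (c * X / F)" if "n \<noteq> 0" for n X F :: real using that by simp
    thus ?thesis unfolding fact_Suc diff_Suc_Suc diff_zero by (simp only: of_nat_eq_0_iff nat.distinct not_False_eq_True)
  qed
  ultimately show ?thesis by (simp only:)
qed

lemma deriv_cos_coeff:
  "((\<lambda>s. fps_nth (fps_cos (2 * s)) (Suc d)) has_real_derivative (- 2 * fps_nth (fps_sin (2 * s)) d)) (at s)"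
proof (cases "even d")
  case True
  thus ?thesis by (simp add: fps_cos_def fps_sin_def)
next
  case False
  have e: "(\<lambda>s. fps_nth (fps_cos (2 * s)) (Suc d)) = (\<lambda>s. (- 1) ^ (Suc d div 2) * (2 * s) ^ Suc d / fact (Suc d) :: real)"
    using False by (simp add: fps_cos_def del: power_Suc fact_Suc)
  obtain k where k: "d = 2 * k + 1" using False by (elim oddE)
  have "(-1) ^ (Suc d div 2) = - ((-1) ^ ((d - 1) div 2) :: real)" by (simp add: k)
  hence "2 * ((- 1) ^ (Suc d div 2) * (2 * s) ^ d / fact d) = - 2 * fps_nth (fps_sin (2 * s)) d" using False by (simp add: fps_sin_def)
  thus ?thesis unfolding e using deriv_monomial[of "(- 1) ^ (Suc d div 2)" d s] by (simp only:)
qed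

lemma deriv_sin_coeff:
  "((\<lambda>s. fps_nth (fps_sin (2 * s)) (Suc d)) has_real_derivative (2 * fps_nth (fps_cos (2 * s)) d)) (at s)"
proof (cases "even d")
  case True
  have e: "(\<lambda>s. fps_nth (fps_sin (2 * s)) (Suc d)) = (\<lambda>s. (- 1) ^ (d div 2) * (2 * s) ^ Suc d / fact (Suc d) :: real)"
    using True by (simp add: fps_sin_def del: power_Suc fact_Suc)
  have "2 * ((- 1) ^ (d div 2) * (2 * s) ^ d / fact d) = 2 * fps_nth (fps_cos (2 * s)) d" using True by (simp add: fps_cos_def)
  thus ?thesis unfolding e using deriv_monomial[of "(- 1) ^ (d div 2)" d s] by (simp only:)
next
  case False
  thus ?thesis by (simp add: fps_cos_def fps_sin_def)
qed

lemma Hc_deriv: "(Hc (Suc d) has_real_derivative 2 * Hc d (1/2 - s)) (at s)"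
proof -
  have "Hc (Suc d) = (\<lambda>s. fps_nth (fps_cos (2 * s)) (Suc d) + (\<Sum>i=0..d. fps_nth Tf (d - i) * fps_nth (fps_sin (2 * s)) (Suc i)))"
  proof
    fix s
    have "(\<Sum>i=0..Suc d. fps_nth Tf i * fps_nth (fps_sin (2 * s)) (Suc d - i)) = (\<Sum>i=0..Suc d. fps_nth Tf (Suc d - i) * fps_nth (fps_sin (2 * s)) i)"
      by (subst sum.atLeastAtMost_rev) auto
    also have "... = (\<Sum>i=0..d. fps_nth Tf (d - i) * fps_nth (fps_sin (2 * s)) (Suc i))"
      by (subst sum.atLeast0_atMost_Suc_shift) (simp add: fps_sin_def)
    finally show "Hc (Suc d) s = fps_nth (fps_cos (2 * s)) (Suc d) + (\<Sum>i=0..d. fps_nth Tf (d - i) * fps_nth (fps_sin (2 * s)) (Suc i))"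
      by (simp add: Hc_def Hf_def fps_mult_nth)
  qed
  moreover have "2 * Hc d (1/2 - s) = - 2 * fps_nth (fps_sin (2 * s)) d + (\<Sum>i=0..d. fps_nth Tf (d - i) * (2 * fps_nth (fps_cos (2 * s)) i))"
  proof -
    have "(\<Sum>i=0..d. fps_nth Tf i * fps_nth (fps_cos (2 * s)) (d - i)) = (\<Sum>i=0..d. fps_nth Tf (d - i) * fps_nth (fps_cos (2 * s)) i)"
      by (subst sum.atLeastAtMost_rev) auto
    thus ?thesis by (simp add: Hc_def Hf_reflect fps_mult_nth sum_distrib_left algebra_simps)
  qed
  ultimately show ?thesis by (simp only:) (intro derivative_intros deriv_cos_coeff deriv_sin_coeff DERIV_sum DERIV_cmult)
qed

lemma Hc_reflect_deriv: "((\<lambda>s. Hc (Suc d) (1/2 - s)) has_real_derivative - 2 * Hc d s) (at s)"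
proof -
  have "((\<lambda>s. Hc (Suc d) (1/2 - s)) has_real_derivative (2 * Hc d (1/2 - (1/2 - s))) * (0 - 1)) (at s)"
    by (rule DERIV_chain'[OF _ Hc_deriv]) (intro derivative_intros)
  thus ?thesis by simp
qed

lemma Hc_cont: "continuous_on S (Hc d)"
proof (cases d)
  case 0 thus ?thesis by (simp add: Hc_0[abs_def] continuous_on_cong[OF refl Hc_0])
next
  case (Suc n)
  have "isCont (Hc (Suc n)) s" for s by (rule DERIV_isCont[OF Hc_deriv])
  thus ?thesis using Suc by (simp add: continuous_at_imp_continuous_on)
qed

lemma Hc_1: "Hc 1 s = 2 * s"
  by (simp add: Hc_def Hf_def fps_cos_def fps_sin_def Tf_def fps_mult_nth)

text \<open>For d = 2 the curves of types D and E receive no square besides z^2, so no integral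
  enters and H_2 is needed explicitly.\<close>

lemma Hc_2: "Hc 2 s = 2 * s - 2 * s\<^sup>2"
proof -
  let ?f = "\<lambda>s. Hc 2 s - (2 * s - 2 * s\<^sup>2)"
  have "(?f has_real_derivative 0) (at x)" for x
  proof -
    have "(?f has_real_derivative 2 * Hc 1 (1/2 - x) - (2 - 2 * (2 * x))) (at x)"
      using Hc_deriv[of 1 x] by (auto intro!: derivative_eq_intros simp: numeral_2_eq_2)
    thus ?thesis unfolding Hc_1 by simp
  qed
  hence "?f s = ?f 0" by (intro DERIV_isconst_all) auto
  thus ?thesis using Hc_at_0[of 2] by simp
qed

subsection \<open>Iterating the square operator\<close>

definition Kop :: "(real => real) => real => real" where
  "Kop w t = 2 * integral {0..t} (\<lambda>x. w (1/2 - x))"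

text \<open>Adding the value at 1 - t turns the maximum in \<open>Wop\<close> into a polynomial, and
  subtracting 1 makes the operator the linear \<open>Kop\<close>. At t = 1/2 the result is 2
  \<psi>(1/2) - 1, the number to be computed.\<close>

definition sym :: "(real => real) => real => real" where "sym \<psi> t = \<psi> t + \<psi> (1 - t) - 1"

lemma cont_reflect: "continuous_on {0..1/2} w ==> continuous_on {0..1/2::real} (\<lambda>x. w (1/2 - x) :: real)"
  by (rule continuous_on_compose2[of "{0..1/2}" w]) (auto intro!: continuous_intros)

lemma integral_half_reflect:
  "integral {0..1/2} (\<lambda>t. f (1/2 - t)) = integral {0..1/2::real} (f :: real => real)"
proof -
  have "integral {0..1/2} (\<lambda>t. f (1/2 - t)) = integral {- (1/2)..0} (\<lambda>t. f (1/2 + t))"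
    using Henstock_Kurzweil_Integration.integral_reflect_real[of 0 "- (1/2)" "\<lambda>t. f (1/2 + t)"] by simp
  also have "... = integral {0..1/2} f" using integral_shift_Icc_real[of "- (1/2)" 0 f "1/2"] by (simp add: o_def)
  finally show ?thesis .
qed

lemma Kop_deriv:
  assumes w: "continuous_on {0..1/2} w" and t: "t \<in> {0..1/2}"
  shows "(Kop w has_real_derivative 2 * w (1/2 - t)) (at t within {0..1/2})"
proof -
  have "((\<lambda>t. integral {0..t} (\<lambda>x. w (1/2 - x))) has_real_derivative w (1/2 - t)) (at t within {0..1/2})"
    by (rule integral_has_real_derivative[OF cont_reflect[OF w] t])
  thus ?thesis unfolding Kop_def[abs_def] by (rule DERIV_cmult)
qed

lemma Kop_cont: "continuous_on {0..1/2} w ==> continuous_on {0..1/2} (Kop w)"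
  using Kop_deriv by (meson DERIV_continuous continuous_on_eq_continuous_within)

text \<open>Integration by parts, with -H_(j+1)(1/2 - t)/2 as antiderivative of H_j. The boundary
  terms vanish because both \<open>Kop w\<close> and H_(j+1) are 0 at 0.\<close>

lemma Kop_adjoint:
  assumes w: "continuous_on {0..1/2} w"
  shows "integral {0..1/2} (\<lambda>t. Kop w t * Hc j t) = integral {0..1/2} (\<lambda>t. w t * Hc (Suc j) t)"
proof -
  let ?F = "\<lambda>t. - (Kop w t * Hc (Suc j) (1/2 - t)) / 2"
  have "((\<lambda>t. Kop w t * Hc j t - w (1/2 - t) * Hc (Suc j) (1/2 - t)) has_integral ?F (1/2) - ?F 0) {0..1/2}"
  proof (rule fundamental_theorem_of_calculus)
    fix t :: real assume t: "t \<in> {0..1/2}"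
    have "(?F has_real_derivative (- (Kop w t * (- 2 * Hc j t) + 2 * w (1/2 - t) * Hc (Suc j) (1/2 - t)) / 2)) (at t within {0..1/2})"
      by (intro DERIV_cdivide DERIV_minus DERIV_mult' Kop_deriv[OF w t] DERIV_subset[OF Hc_reflect_deriv]) auto
    moreover have "- (Kop w t * (- 2 * Hc j t) + 2 * w (1/2 - t) * Hc (Suc j) (1/2 - t)) / 2
      = Kop w t * Hc j t - w (1/2 - t) * Hc (Suc j) (1/2 - t)" by (simp add: field_simps)
    ultimately show "(?F has_vector_derivative (Kop w t * Hc j t - w (1/2 - t) * Hc (Suc j) (1/2 - t))) (at t within {0..1/2})"
      unfolding has_real_derivative_iff_has_vector_derivative[symmetric] by (simp only: minus_divide_left)
  qed simp
  moreover have "?F (1/2) - ?F 0 = 0" by (simp add: Hc_at_0 Kop_def)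
  ultimately have "((\<lambda>t. Kop w t * Hc j t - w (1/2 - t) * Hc (Suc j) (1/2 - t)) has_integral 0) {0..1/2}" by (simp only:)
  hence 1: "integral {0..1/2} (\<lambda>t. Kop w t * Hc j t - w (1/2 - t) * Hc (Suc j) (1/2 - t)) = 0" by (rule integral_unique)
  have 2: "(\<lambda>t. Kop w t * Hc j t) integrable_on {0..1/2}" by (intro integrable_continuous_real continuous_on_mult Kop_cont w Hc_cont)
  have c: "continuous_on {0..1/2} (\<lambda>t. w t * Hc (Suc j) t)" by (intro continuous_on_mult w Hc_cont)
  have 3: "(\<lambda>t. w (1/2 - t) * Hc (Suc j) (1/2 - t)) integrable_on {0..1/2}" by (intro integrable_continuous_real cont_reflect[OF c])
  have "integral {0..1/2} (\<lambda>t. w (1/2 - t) * Hc (Suc j) (1/2 - t)) = integral {0..1/2} (\<lambda>t. w t * Hc (Suc j) t)"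
    using integral_half_reflect[of "\<lambda>t. w t * Hc (Suc j) t"] by simp
  thus ?thesis using 1 2 3 by (simp add: integral_diff)
qed

lemma Kop_iterate:
  "continuous_on {0..1/2} w ==> (Kop ^^ Suc j) w (1/2) = 2 * integral {0..1/2} (\<lambda>t. w t * Hc j t)"
proof (induction j arbitrary: w)
  case 0
  thus ?case using integral_half_reflect[of w] by (simp add: Hc_0 Kop_def)
next
  case (Suc j)
  have "(Kop ^^ Suc (Suc j)) w (1/2) = (Kop ^^ Suc j) (Kop w) (1/2)" by (simp add: funpow_swap1)
  also have "... = 2 * integral {0..1/2} (\<lambda>t. Kop w t * Hc j t)" by (rule Suc.IH[OF Kop_cont[OF Suc.prems]])
  finally show ?case by (simp add: Kop_adjoint[OF Suc.prems])
qed

text \<open>The two maxima and the constant -1 add up to -2t. That is the -1 inside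
  \<open>sym \<psi>\<close> integrated over a length \<open>t\<close> and doubled.\<close>

lemma sym_Wop:
  assumes c: "continuous_on {0..1} \<psi>" and t: "0 <= t" "t <= 1/2"
  shows "sym (Wop \<psi>) t = Kop (sym \<psi>) t"
proof -
  have int: "\<psi> integrable_on {u..w}" if "0 <= u" "w <= 1" for u w
    by (rule integrable_continuous_real, rule continuous_on_subset[OF c]) (use that in auto)
  have m: "min t (1 - t) = t" "min (1 - t) (1 - (1 - t)) = t" using t by auto
  have x: "max 0 (2 * t - 1) = 0" "max 0 (2 * (1 - t) - 1) = 1 - 2 * t" using t by auto
  have "sym (Wop \<psi>) t = 2 * integral {1/2 - t..1/2 + t} \<psi> - 2 * t" unfolding sym_def Wop_def m x by simp
  also have "integral {1/2 - t..1/2 + t} \<psi> = integral {1/2 - t..1/2} \<psi> + integral {1/2..1/2 + t} \<psi>"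
    by (rule Henstock_Kurzweil_Integration.integral_combine[symmetric]) (use t in \<open>auto intro!: int\<close>)
  also have "integral {1/2..1/2 + t} \<psi> = integral {0..t} (\<lambda>x. \<psi> (1/2 + x))"
    using integral_shift_Icc_real[of 0 t \<psi> "1/2"] by (simp add: o_def add.commute)
  also have "integral {1/2 - t..1/2} \<psi> = integral {0..t} (\<lambda>x. \<psi> (1/2 - x))"
  proof -
    have "integral {1/2 - t..1/2} \<psi> = integral {- t..0} (\<lambda>x. \<psi> (1/2 + x))"
      using integral_shift_Icc_real[of "- t" 0 \<psi> "1/2"] by (simp add: o_def)
    also have "... = integral {0..t} (\<lambda>x. \<psi> (1/2 - x))"
      using Henstock_Kurzweil_Integration.integral_reflect_real[of 0 "- t" "\<lambda>x. \<psi> (1/2 + x)"] by simp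
    finally show ?thesis .
  qed
  finally have 1: "sym (Wop \<psi>) t = 2 * (integral {0..t} (\<lambda>x. \<psi> (1/2 - x)) + integral {0..t} (\<lambda>x. \<psi> (1/2 + x))) - 2 * t" .
  have i: "(\<lambda>x. \<psi> (1/2 - x)) integrable_on {0..t}" "(\<lambda>x. \<psi> (1/2 + x)) integrable_on {0..t}"
    using t by (auto intro!: integrable_continuous_real continuous_on_compose2[OF c] continuous_intros)
  have s: "sym \<psi> (1/2 - x) = \<psi> (1/2 - x) + \<psi> (1/2 + x) - 1" for x by (simp add: sym_def algebra_simps)
  have "integral {0..t} (\<lambda>x. \<psi> (1/2 - x) + \<psi> (1/2 + x) - 1)
    = integral {0..t} (\<lambda>x. \<psi> (1/2 - x)) + integral {0..t} (\<lambda>x. \<psi> (1/2 + x)) - t"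
    using t i by (subst integral_diff) (auto intro: integrable_add simp: integral_add)
  thus ?thesis unfolding 1 Kop_def s by simp
qed

lemma Kop_cong:
  assumes "\<And>t. 0 <= t ==> t <= 1/2 ==> w t = w' t" "0 <= t" "t <= 1/2"
  shows "Kop w t = Kop w' t"
  unfolding Kop_def using assms by (intro arg_cong[where f = "\<lambda>x. 2 * x"] integral_cong) auto

lemma sym_cont: "continuous_on {0..1} \<psi> ==> continuous_on {0..1/2} (sym \<psi>)"
  unfolding sym_def by (intro continuous_intros continuous_on_compose2[of "{0..1}" \<psi> "{0..1/2}" "\<lambda>t. 1 - t"])
     (auto intro: continuous_on_subset)

lemma sym_iterate:
  assumes L: "L-lipschitz_on {0..1} \<psi>" and t: "0 <= t" "t <= 1/2"
  shows "sym ((Wop ^^ j) \<psi>) t = (Kop ^^ j) (sym \<psi>) t"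
  using t
proof (induction j arbitrary: t)
  case (Suc j)
  have "\<exists>L. L-lipschitz_on {0..1} ((Wop ^^ j) \<psi>)" by (induction j) (use L Wop_lipschitz in auto)
  hence "continuous_on {0..1} ((Wop ^^ j) \<psi>)" using lipschitz_on_continuous_on by blast
  thus ?case using Suc by (simp add: sym_Wop) (rule Kop_cong, auto)
qed simp

text \<open>The two invariants tend to 1 plus and 1 minus this number, where \<open>k\<close>
  squares have been adjoined to the starting polynomial and z^2 is not counted.\<close>

definition limit_value :: "(real => real) => nat => real" where
  "limit_value \<psi> k = 2 * (Wop ^^ k) \<psi> (1/2) - 1"

lemma limit_value_0: "limit_value \<psi> 0 = sym \<psi> (1/2)"
  by (simp add: limit_value_def sym_def)

lemma limit_value_Suc:
  assumes L: "L-lipschitz_on {0..1} \<psi>"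
  shows "limit_value \<psi> (Suc j) = 2 * integral {0..1/2} (\<lambda>t. sym \<psi> t * Hc j t)"
proof -
  have "limit_value \<psi> (Suc j) = sym ((Wop ^^ Suc j) \<psi>) (1/2)" by (simp add: limit_value_def sym_def del: funpow.simps)
  also have "... = (Kop ^^ Suc j) (sym \<psi>) (1/2)" by (rule sym_iterate[OF L]) auto
  also have "... = 2 * integral {0..1/2} (\<lambda>t. sym \<psi> t * Hc j t)"
    by (rule Kop_iterate[OF sym_cont[OF lipschitz_on_continuous_on[OF L]]])
  finally show ?thesis .
qed

section \<open>Moments of the polynomials H_d against truncated powers\<close>

lemma Hc_moment_linear:
  assumes A: "0 <= A" "A <= 1/2"
  shows "((\<lambda>t. max 0 (t - A) * Hc j t) has_integral Hc (j + 2) (1/2) / 4 - Hc (j + 2) A / 4) {0..1/2}"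
proof -
  \<comment> \<open>Antiderivative from repeated integration by parts: each step raises the index of
    H by one and exchanges the arguments t and 1/2 - t.\<close>
  let ?F = "\<lambda>t. - (t - A) * Hc (Suc j) (1/2 - t) / 2 + Hc (Suc (Suc j)) t / 4"
  have "((\<lambda>t. (t - A) * Hc j t) has_integral ?F (1/2) - ?F A) {A..1/2}"
  proof (rule fundamental_theorem_of_calculus[OF A(2)])
    fix t assume "t \<in> {A..1/2}"
    have m: "((\<lambda>t. - (t - A)) has_real_derivative - (1 - 0)) (at t within {A..1/2})" by (intro DERIV_minus DERIV_diff DERIV_ident DERIV_const)
    have "(?F has_real_derivative ((- (t - A) * (- 2 * Hc j t) + - (1 - 0) * Hc (Suc j) (1/2 - t)) / 2
       + 2 * Hc (Suc j) (1/2 - t) / 4)) (at t within {A..1/2})"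
      by (intro DERIV_add DERIV_cdivide DERIV_mult'[OF m] DERIV_subset[OF Hc_reflect_deriv] DERIV_subset[OF Hc_deriv]) auto
    moreover have "(- (t - A) * (- 2 * Hc j t) + - (1 - 0) * Hc (Suc j) (1/2 - t)) / 2
       + 2 * Hc (Suc j) (1/2 - t) / 4 = (t - A) * Hc j t" by (simp add: field_simps)
    ultimately show "(?F has_vector_derivative (t - A) * Hc j t) (at t within {A..1/2})" by (simp only: has_real_derivative_iff_has_vector_derivative)
  qed
  moreover have "?F (1/2) - ?F A = Hc (j + 2) (1/2) / 4 - Hc (j + 2) A / 4" by (simp add: Hc_at_0)
  ultimately have "((\<lambda>t. (t - A) * Hc j t) has_integral Hc (j + 2) (1/2) / 4 - Hc (j + 2) A / 4) {A..1/2}" by (simp only:)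
  hence 1: "((\<lambda>t. max 0 (t - A) * Hc j t) has_integral Hc (j + 2) (1/2) / 4 - Hc (j + 2) A / 4) {A..1/2}"
    by (rule has_integral_eq[rotated]) auto
  have 2: "((\<lambda>t. max 0 (t - A) * Hc j t) has_integral 0) {0..A}" by (rule has_integral_eq[OF _ has_integral_0]) auto
  show ?thesis using has_integral_combine[OF A 2 1] by simp
qed

lemma Hc_moment_square:
  assumes A: "0 <= A" "A <= 1/2"
  shows "((\<lambda>t. (max 0 (t - A))\<^sup>2 * Hc j t) has_integral (1/2 - A) * Hc (j + 2) (1/2) / 2 - Hc (j + 3) (1/2 - A) / 4) {0..1/2}"
proof -
  let ?F = "\<lambda>t. - ((t - A) * (t - A)) * Hc (Suc j) (1/2 - t) / 2 + (t - A) * Hc (Suc (Suc j)) t / 2 + Hc (Suc (Suc (Suc j))) (1/2 - t) / 4"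
  have "((\<lambda>t. (t - A)\<^sup>2 * Hc j t) has_integral ?F (1/2) - ?F A) {A..1/2}"
  proof (rule fundamental_theorem_of_calculus[OF A(2)])
    fix t assume "t \<in> {A..1/2}"
    have m: "((\<lambda>t. t - A) has_real_derivative 1 - 0) (at t within {A..1/2})" by (intro DERIV_diff DERIV_ident DERIV_const)
    have m2: "((\<lambda>t. - ((t - A) * (t - A))) has_real_derivative - ((t - A) * (1 - 0) + (1 - 0) * (t - A))) (at t within {A..1/2})"
      by (intro DERIV_minus DERIV_mult' m)
    have "(?F has_real_derivative ((- ((t - A) * (t - A)) * (- 2 * Hc j t) + - ((t - A) * (1 - 0) + (1 - 0) * (t - A)) * Hc (Suc j) (1/2 - t)) / 2
       + ((t - A) * (2 * Hc (Suc j) (1/2 - t)) + (1 - 0) * Hc (Suc (Suc j)) t) / 2 + - 2 * Hc (Suc (Suc j)) t / 4)) (at t within {A..1/2})"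
      by (intro DERIV_add DERIV_cdivide DERIV_mult'[OF m2] DERIV_mult'[OF m] DERIV_subset[OF Hc_reflect_deriv] DERIV_subset[OF Hc_deriv]) auto
    moreover have "(- ((t - A) * (t - A)) * (- 2 * Hc j t) + - ((t - A) * (1 - 0) + (1 - 0) * (t - A)) * Hc (Suc j) (1/2 - t)) / 2
       + ((t - A) * (2 * Hc (Suc j) (1/2 - t)) + (1 - 0) * Hc (Suc (Suc j)) t) / 2 + - 2 * Hc (Suc (Suc j)) t / 4 = (t - A)\<^sup>2 * Hc j t"
      by (simp add: power2_eq_square field_simps)
    ultimately show "(?F has_vector_derivative (t - A)\<^sup>2 * Hc j t) (at t within {A..1/2})"
      by (simp only: has_real_derivative_iff_has_vector_derivative)
  qed
  moreover have "?F (1/2) - ?F A = (1/2 - A) * Hc (j + 2) (1/2) / 2 - Hc (j + 3) (1/2 - A) / 4" by (simp add: Hc_at_0 numeral_3_eq_3)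
  ultimately have "((\<lambda>t. (t - A)\<^sup>2 * Hc j t) has_integral (1/2 - A) * Hc (j + 2) (1/2) / 2 - Hc (j + 3) (1/2 - A) / 4) {A..1/2}"
    by (simp only:)
  hence 1: "((\<lambda>t. (max 0 (t - A))\<^sup>2 * Hc j t) has_integral (1/2 - A) * Hc (j + 2) (1/2) / 2 - Hc (j + 3) (1/2 - A) / 4) {A..1/2}"
    by (rule has_integral_eq[rotated]) auto
  have 2: "((\<lambda>t. (max 0 (t - A))\<^sup>2 * Hc j t) has_integral 0) {0..A}" by (rule has_integral_eq[OF _ has_integral_0]) auto
  show ?thesis using has_integral_combine[OF A 2 1] by simp
qed

text \<open>\<open>sym \<psi>\<close> is invariant under t -> 1 - t, so when it is smooth its slope
  at 1/2 is 0. The hypothesis \<open>slope\<close> expresses this; it cancels the terms with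
  H_(k+1)(1/2) and leaves one value of H_(k+2) for each knot.\<close>

lemma limit_value_piecewise:
  assumes L: "L-lipschitz_on {0..1} \<psi>"
    and s: "\<And>t. 0 <= t ==> t <= 1/2 ==>
      sym \<psi> t = \<sigma> * t - \<beta> * t\<^sup>2 - \<gamma>1 * (max 0 (t - A))\<^sup>2 - \<gamma>2 * (max 0 (t - B))\<^sup>2"
    and AB: "0 <= A" "A <= 1/2" "0 <= B" "B <= 1/2"
    and slope: "\<sigma> - \<beta> - 2 * \<gamma>1 * (1/2 - A) - 2 * \<gamma>2 * (1/2 - B) = 0"
  shows "limit_value \<psi> k = (\<beta> * Hc (k + 2) (1/2) + \<gamma>1 * Hc (k + 2) (1/2 - A) + \<gamma>2 * Hc (k + 2) (1/2 - B)) / 2"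
proof (cases k)
  case 0
  define a b where "a = 1/2 - A" and "b = 1/2 - B"
  have m': "max 0 a = a" "max 0 b = b" using AB by (auto simp: a_def b_def)
  have "limit_value \<psi> 0 = \<sigma> / 2 - \<beta> / 4 - \<gamma>1 * a\<^sup>2 - \<gamma>2 * b\<^sup>2"
    unfolding limit_value_0 using s[of "1/2"] by (simp add: a_def[symmetric] b_def[symmetric] m' power2_eq_square)
  also have "\<sigma> = \<beta> + 2 * \<gamma>1 * a + 2 * \<gamma>2 * b" using slope by (simp add: a_def b_def)
  finally show ?thesis using 0 by (simp add: Hc_2[unfolded numeral_2_eq_2] a_def[symmetric] b_def[symmetric] power2_eq_square field_simps)
next
  case (Suc j)
  have t2: "t\<^sup>2 = (max 0 (t - 0))\<^sup>2" "t = max 0 (t - 0)" if "0 <= t" for t :: real using that by auto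
  have "((\<lambda>t. \<sigma> * (max 0 (t - 0) * Hc j t) - \<beta> * ((max 0 (t - 0))\<^sup>2 * Hc j t) - \<gamma>1 * ((max 0 (t - A))\<^sup>2 * Hc j t)
      - \<gamma>2 * ((max 0 (t - B))\<^sup>2 * Hc j t)) has_integral
     \<sigma> * (Hc (j + 2) (1/2) / 4 - Hc (j + 2) 0 / 4) - \<beta> * ((1/2 - 0) * Hc (j + 2) (1/2) / 2 - Hc (j + 3) (1/2 - 0) / 4)
     - \<gamma>1 * ((1/2 - A) * Hc (j + 2) (1/2) / 2 - Hc (j + 3) (1/2 - A) / 4)
     - \<gamma>2 * ((1/2 - B) * Hc (j + 2) (1/2) / 2 - Hc (j + 3) (1/2 - B) / 4)) {0..1/2}" (is "(?f has_integral ?v) _")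
    by (intro has_integral_diff has_integral_mult_right Hc_moment_linear Hc_moment_square AB) auto
  note main = this
  have eq: "?f t = sym \<psi> t * Hc j t" if "t \<in> {0..1/2}" for t
  proof -
    have t: "0 <= t" "t <= 1/2" using that by auto
    hence z: "max 0 (t - 0) = t" by simp
    show ?thesis unfolding s[OF t] z by (simp only: left_diff_distrib mult.assoc)
  qed
  have "((\<lambda>t. sym \<psi> t * Hc j t) has_integral ?v) {0..1/2}" by (rule has_integral_eq[OF eq main])
  hence "limit_value \<psi> k = 2 * ?v" unfolding Suc limit_value_Suc[OF L] by (simp add: integral_unique)
  also have "... = (\<sigma> - \<beta> - 2 * \<gamma>1 * (1/2 - A) - 2 * \<gamma>2 * (1/2 - B)) * Hc (j + 2) (1/2) / 2
     + (\<beta> * Hc (j + 3) (1/2) + \<gamma>1 * Hc (j + 3) (1/2 - A) + \<gamma>2 * Hc (j + 3) (1/2 - B)) / 2"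
  proof -
    have "2 * (\<sigma> * (H / 4 - 0 / 4) - \<beta> * ((1/2 - 0) * H / 2 - a0 / 4) - \<gamma>1 * ((1/2 - A) * H / 2 - a1 / 4)
       - \<gamma>2 * ((1/2 - B) * H / 2 - a2 / 4))
      = (\<sigma> - \<beta> - 2 * \<gamma>1 * (1/2 - A) - 2 * \<gamma>2 * (1/2 - B)) * H / 2 + (\<beta> * a0 + \<gamma>1 * a1 + \<gamma>2 * a2) / 2"
      for H a0 a1 a2 by (simp add: field_simps)
    moreover have "Hc (j + 2) 0 = 0" "1/2 - 0 = (1/2 :: real)" by (simp_all add: Hc_at_0)
    ultimately show ?thesis by (simp only:)
  qed
  finally show ?thesis unfolding slope by (simp add: Suc numeral_3_eq_3)
qed

text \<open>The starting function is piecewise linear with one kink at 1/N, so first moments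
  suffice. As N >= 2, the reflected function is constantly 1 on the left half.\<close>

lemma limit_value_A:
  assumes N: "N \<ge> 2"
  shows "limit_value (\<lambda>t. min 1 (real N * t)) (Suc j) = real N / 2 * Hc (j + 2) (1 / real N)"
proof -
  let ?\<psi> = "\<lambda>t. min 1 (real N * t)"
  have L: "(real N)-lipschitz_on {0..1} ?\<psi>"
  proof (rule lipschitz_onI)
    fix u w :: real
    have "\<bar>?\<psi> u - ?\<psi> w\<bar> <= \<bar>real N * u - real N * w\<bar>" by (auto simp: min_def)
    thus "dist (?\<psi> u) (?\<psi> w) <= real N * dist u w" by (simp add: dist_real_def abs_mult flip: right_diff_distrib)
  qed simp
  have N0: "real N > 0" "0 <= 1 / real N" "1 / real N <= 1/2" using N by (auto simp: field_simps)
  have s: "sym ?\<psi> t = real N * max 0 (t - 0) - real N * max 0 (t - 1 / real N)" if t: "0 <= t" "t <= 1/2" for t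
  proof -
    have "1 <= real N * (1/2)" using N by simp
    also have "... <= real N * (1 - t)" using t by (intro mult_left_mono) auto
    finally have "min 1 (real N * (1 - t)) = 1" by simp
    moreover have "min 1 (real N * t) = real N * t - real N * max 0 (t - 1 / real N)" using N0 by (auto simp: min_def max_def field_simps)
    ultimately show ?thesis using t by (simp add: sym_def)
  qed
  have "((\<lambda>t. real N * (max 0 (t - 0) * Hc j t) - real N * (max 0 (t - 1 / real N) * Hc j t)) has_integral
     real N * (Hc (j + 2) (1/2) / 4 - Hc (j + 2) 0 / 4) - real N * (Hc (j + 2) (1/2) / 4 - Hc (j + 2) (1 / real N) / 4)) {0..1/2}"
    (is "(?f has_integral ?v) _") by (intro has_integral_diff has_integral_mult_right Hc_moment_linear N0) auto
  note main = this
  have eq: "?f t = sym ?\<psi> t * Hc j t" if "t \<in> {0..1/2}" for t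
  proof -
    have "0 <= t" "t <= 1/2" using that by auto
    from s[OF this] show ?thesis by (simp only: left_diff_distrib mult.assoc)
  qed
  have "((\<lambda>t. sym ?\<psi> t * Hc j t) has_integral ?v) {0..1/2}" by (rule has_integral_eq[OF eq main])
  hence "limit_value ?\<psi> (Suc j) = 2 * ?v" unfolding limit_value_Suc[OF L] by (simp add: integral_unique)
  thus ?thesis using Hc_at_0[of "j + 2"] by (simp add: field_simps)
qed

lemma G_max: "m > 0 ==> G m c x = c * x - c\<^sup>2 / (2 * m) + (max 0 (c - m * x))\<^sup>2 / (2 * m)"
  by (simp add: G_def max_def power2_eq_square field_simps)

lemma max_scale: "k \<ge> 0 ==> max 0 (k * x) = k * max 0 (x::real)"
  by (cases "k = 0") (auto simp: max_def mult_le_0_iff zero_le_mult_iff)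

lemma psib_max:
  assumes "m > 0" "1 - real \<kappa> * t <= real m * (1 / real a + t)"
  shows "psib \<kappa> a m t = real \<kappa> * t + real a / 2 * ((1 - real \<kappa> * t) * (1 / real a + t - \<bar>1 / real a - t\<bar>)
     - (max 0 (1 - real \<kappa> * t - real m * \<bar>1 / real a - t\<bar>))\<^sup>2 / (2 * real m))"
  using assms by (simp add: psib_def G_max) (simp add: algebra_simps)

text \<open>The knots solve 1 - t = m (1/2 - t), from the value at \<open>t\<close>, and t = m (1/2
  - t), from the value at 1 - t.\<close>

lemma sym_psib_D:
  assumes m: "m \<ge> 2" and t: "0 <= t" "t <= 1/2"
  shows "sym (psib 1 2 m) t = 3 * t - 2 * t\<^sup>2
    - (real m - 1)\<^sup>2 / (2 * real m) * (max 0 (t - (real m - 2) / (2 * (real m - 1))))\<^sup>2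
    - (real m + 1)\<^sup>2 / (2 * real m) * (max 0 (t - real m / (2 * (real m + 1))))\<^sup>2"
proof -
  have m2: "real m \<ge> 2" using m by simp
  have c: "1 - u <= real m * (1/2 + u)" if "0 <= u" for u :: real
  proof -
    have "1 - u <= 2 * (1/2 + u)" using that by simp
    also have "... <= real m * (1/2 + u)" using m2 that by (intro mult_right_mono) auto
    finally show ?thesis .
  qed
  have 1: "psib 1 2 m t = t + ((1 - t) * (2 * t) - (max 0 (1 - t - real m * (1/2 - t)))\<^sup>2 / (2 * real m))"
    using psib_max[of m 1 t 2] c[of t] m t by simp
  have 2: "psib 1 2 m (1 - t) = 1 - (max 0 (t - real m * (1/2 - t)))\<^sup>2 / (2 * real m)"
    using psib_max[of m 1 "1 - t" 2] c[of "1 - t"] m t by (simp add: algebra_simps)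
  have 3: "1 - t - real m * (1/2 - t) = (real m - 1) * (t - (real m - 2) / (2 * (real m - 1)))" using m2 by (simp add: field_simps)
  have 4: "t - real m * (1/2 - t) = (real m + 1) * (t - real m / (2 * (real m + 1)))" using m2 by (simp add: field_simps)
  show ?thesis unfolding sym_def 1 2 3 4 using m2 by (simp add: max_scale power_mult_distrib) (simp add: algebra_simps power2_eq_square)
qed

text \<open>The knots are the points where m x meets the truncation for one of the arguments x of
  \<open>G\<close>. At t = 1/3 only the absolute value changes branch; there \<open>G\<close> is
  quadratic in its argument, so the formula continues unchanged.\<close>

lemma sym_psib_E67:
  assumes t: "0 <= t" "t <= 1/2"
  shows "sym (psib 0 3 4) t = 3 * t - 0 * t\<^sup>2 - 3 * (max 0 (t - 1/12))\<^sup>2 - 3 * (max 0 (t - 5/12))\<^sup>2"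
    and "sym (psib 1 3 2) t = 3 * t - 0 * t\<^sup>2 - 27/8 * (max 0 (t - 1/9))\<^sup>2 - 27/8 * (max 0 (t - 4/9))\<^sup>2"
    and "sym (psib 0 3 5) t = 3 * t - 0 * t\<^sup>2 - 15/4 * (max 0 (t - 2/15))\<^sup>2 - 15/4 * (max 0 (t - 7/15))\<^sup>2"
proof -
  have "t < 1/12 \<or> t = 1/12 \<or> 1/12 < t \<and> t < 1/3 \<or> t = 1/3 \<or> 1/3 < t \<and> t < 5/12 \<or> t = 5/12 \<or> 5/12 < t" by linarith
  thus "sym (psib 0 3 4) t = 3 * t - 0 * t\<^sup>2 - 3 * (max 0 (t - 1/12))\<^sup>2 - 3 * (max 0 (t - 5/12))\<^sup>2"
    using t by (elim disjE conjE; hypsubst?; simp add: sym_def psib_def G_def max_def abs_if power2_eq_square; simp add: field_simps)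
  have "t < 1/9 \<or> t = 1/9 \<or> 1/9 < t \<and> t < 1/3 \<or> t = 1/3 \<or> 1/3 < t \<and> t < 4/9 \<or> t = 4/9 \<or> 4/9 < t" by linarith
  thus "sym (psib 1 3 2) t = 3 * t - 0 * t\<^sup>2 - 27/8 * (max 0 (t - 1/9))\<^sup>2 - 27/8 * (max 0 (t - 4/9))\<^sup>2"
    using t by (elim disjE conjE; hypsubst?; simp add: sym_def psib_def G_def max_def abs_if power2_eq_square; simp add: field_simps)
  have "t < 2/15 \<or> t = 2/15 \<or> 2/15 < t \<and> t < 1/3 \<or> t = 1/3 \<or> 1/3 < t \<and> t < 7/15 \<or> t = 7/15 \<or> 7/15 < t" by linarith
  thus "sym (psib 0 3 5) t = 3 * t - 0 * t\<^sup>2 - 15/4 * (max 0 (t - 2/15))\<^sup>2 - 15/4 * (max 0 (t - 7/15))\<^sup>2"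
    using t by (elim disjE conjE; hypsubst?; simp add: sym_def psib_def G_def max_def abs_if power2_eq_square; simp add: field_simps)
qed

subsection \<open>Taylor coefficients of the generating functions\<close>

lemma cos_nz_near_0: "\<forall>\<^sub>F z in nhds (0::real). cos z \<noteq> 0"
proof -
  have "isCont cos (0::real)" by simp
  hence "(cos \<longlongrightarrow> cos 0) (nhds (0::real))" by (simp add: continuous_within tendsto_nhds_iff)
  thus ?thesis by (rule tendsto_imp_eventually_ne) simp
qed

lemma Hz_cos: "cos z \<noteq> 0 ==> Hz s z = (cos (z - 2 * s * z) + sin (2 * s * z)) / cos z"
  by (simp add: Hz_def sec_plus_tan_def tan_def cos_diff field_simps)

text \<open>Equality near 0 is all that the coefficients depend on; further away \<open>cos\<close>
  may vanish.\<close>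

lemma taylor_combination:
  assumes "\<forall>\<^sub>F z in nhds 0. f z = a * Hz u z + b * Hz v z + c * Hz w z"
  shows "taylor_coeff f d = a * Hc d u + b * Hc d v + c * Hc d w"
proof -
  have "(\<lambda>z. a * Hz u z + b * Hz v z + c * Hz w z) has_fps_expansion fps_const a * Hf u + fps_const b * Hf v + fps_const c * Hf w"
    by (intro has_fps_expansion_add has_fps_expansion_cmult_left Hz_expansion)
  hence "f has_fps_expansion fps_const a * Hf u + fps_const b * Hf v + fps_const c * Hf w" using has_fps_expansion_cong[OF assms refl] by blast
  from taylor_coeff_fps[OF this] show ?thesis by (simp add: Hc_def)
qed

text \<open>The origin of the factor cos(z/3) for E6 and E8: their knots yield the arguments 1/4 +
  1/6, 1/4 - 1/6 and 1/5 + 1/6, 1/5 - 1/6.\<close>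

lemma Hz_sum: "Hz (s + x) z + Hz (s - x) z = 2 * Hz s z * cos (2 * x * z)"
proof -
  have "2 * (s + x) * z = 2 * s * z + 2 * x * z" "2 * (s - x) * z = 2 * s * z - 2 * x * z" by (simp_all add: algebra_simps)
  thus ?thesis unfolding Hz_def by (simp add: cos_add cos_diff sin_add sin_diff algebra_simps)
qed

lemma taylor_A: "N = n + 1 ==> n \<ge> 1 ==> taylor_coeff (ADE_fun (Type_A n)) d = real N / 2 * Hc d (1 / real N)"
proof -
  assume N: "N = n + 1" and n: "n \<ge> 1"
  have "taylor_coeff (ADE_fun (Type_A n)) d = real N / 2 * Hc d (1 / real N) + 0 * Hc d 0 + 0 * Hc d 0"
  proof (rule taylor_combination, rule eventually_mono[OF cos_nz_near_0])
    fix z :: real assume z: "cos z \<noteq> 0"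
    have e: "z - 2 * z / (real n + 1) = (real n - 1) * z / (real n + 1)" by (simp add: field_simps)
    have e2: "2 * (1 / real N) * z = 2 * z / (real n + 1)" by (simp add: N add.commute)
    show "ADE_fun (Type_A n) z = real N / 2 * Hz (1 / real N) z + 0 * Hz 0 z + 0 * Hz 0 z" unfolding Hz_cos[OF z] e2 e by (simp add: N add.commute)
  qed
  thus ?thesis by simp
qed

lemma taylor_D:
  assumes m: "m = n - 2" "n \<ge> 4"
  shows "taylor_coeff (ADE_fun (Type_D n)) d = (real m + 1)\<^sup>2 / (4 * real m) * Hc d (1 / (2 * (real m + 1)))
    + (real m - 1)\<^sup>2 / (4 * real m) * Hc d (1 / (2 * (real m - 1))) + 1 * Hc d (1/2)"
proof (rule taylor_combination, rule eventually_mono[OF cos_nz_near_0])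
  fix z :: real assume z: "cos z \<noteq> 0"
  have r: "real n - 1 = real m + 1" "real n - 3 = real m - 1" "real n - 2 = real m" using m by auto
  have h: "Hz (1/2) z = sec_plus_tan z" unfolding Hz_cos[OF z] using z by (simp add: sec_plus_tan_def tan_def field_simps)
  have e: "2 * (1 / (2 * (real m + 1))) * z = z / (real m + 1)" "2 * (1 / (2 * (real m - 1))) * z = z / (real m - 1)"
  proof -
    have "2 * (1 / (2 * x)) * z = z / x" for x :: real by simp
    thus "2 * (1 / (2 * (real m + 1))) * z = z / (real m + 1)" "2 * (1 / (2 * (real m - 1))) * z = z / (real m - 1)"
      by blast+
  qed
  show "ADE_fun (Type_D n) z = (real m + 1)\<^sup>2 / (4 * real m) * Hz (1 / (2 * (real m + 1))) z
    + (real m - 1)\<^sup>2 / (4 * real m) * Hz (1 / (2 * (real m - 1))) z + 1 * Hz (1/2) z"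
    unfolding h unfolding Hz_def e ADE_fun.simps r by (simp add: distrib_left distrib_right ac_simps)
qed

lemma taylor_E6: "taylor_coeff (ADE_fun Type_E6) d = 3/2 * Hc d (5/12) + 3/2 * Hc d (1/12) + 0 * Hc d 0"
proof (rule taylor_combination, rule eventually_mono[OF cos_nz_near_0])
  fix z :: real assume z: "cos z \<noteq> 0"
  have "Hz (5/12) z + Hz (1/12) z = 2 * Hz (1/4) z * cos (z / 3)" using Hz_sum[of "1/4" "1/6" z] by simp
  moreover have "Hz (1/4) z = (cos (z / 2) + sin (z / 2)) / cos z" using Hz_cos[OF z, of "1/4"] by simp
  ultimately show "ADE_fun Type_E6 z = 3/2 * Hz (5/12) z + 3/2 * Hz (1/12) z + 0 * Hz 0 z" unfolding ADE_fun.simps by (simp only:)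
qed

lemma taylor_E7: "taylor_coeff (ADE_fun Type_E7) d = 27/16 * Hc d (7/18) + 27/16 * Hc d (1/18) + 0 * Hc d 0"
proof (rule taylor_combination, rule eventually_mono[OF cos_nz_near_0])
  fix z :: real assume z: "cos z \<noteq> 0"
  have "Hz (7/18) z = (cos (2 * z / 9) + sin (z - 2 * z / 9)) / cos z" using Hz_cos[OF z, of "7/18"] by simp
  also have "(cos y + sin (z - y)) / cos z = sec_plus_tan z * cos y - sin y" for y
    using z by (simp add: sin_diff sec_plus_tan_def tan_def field_simps)
  finally have 1: "Hz (7/18) z = sec_plus_tan z * cos (2 * z / 9) - sin (2 * z / 9)" .
  have 2: "Hz (1/18) z = cos (z / 9) + sec_plus_tan z * sin (z / 9)" by (simp add: Hz_def)
  show "ADE_fun Type_E7 z = 27/16 * Hz (7/18) z + 27/16 * Hz (1/18) z + 0 * Hz 0 z" unfolding 1 2 by (simp add: algebra_simps)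
qed

lemma taylor_E8: "taylor_coeff (ADE_fun Type_E8) d = 15/8 * Hc d (11/30) + 15/8 * Hc d (1/30) + 0 * Hc d 0"
proof (rule taylor_combination, rule eventually_mono[OF cos_nz_near_0])
  fix z :: real assume z: "cos z \<noteq> 0"
  have "Hz (11/30) z + Hz (1/30) z = 2 * Hz (1/5) z * cos (z / 3)" using Hz_sum[of "1/5" "1/6" z] by simp
  moreover have "Hz (1/5) z = (cos (3 * z / 5) + sin (2 * z / 5)) / cos z" using Hz_cos[OF z, of "1/5"] by simp
  ultimately show "ADE_fun Type_E8 z = 15/8 * Hz (11/30) z + 15/8 * Hz (1/30) z + 0 * Hz 0 z" unfolding ADE_fun.simps by (simp only:)
qed

subsection \<open>The limit dimension for the ADE polynomials\<close>

text \<open>The last square of the defining equation is left out: it plays the role of \<open>z\<^sup>2\<close> below.\<close>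

definition ADE_part :: "ADE => nat => mps" where
  "ADE_part t d = emb (ADE_poly t) + (\<Sum>i=2..<d. vr i ^ 2)"

lemma ADE_limit_aux:
  assumes e: "f = h + (\<Sum>i=2..<d. vr i ^ 2)" and ap: "approx h 2 \<psi>" and L: "\<exists>L. L-lipschitz_on {0..1} \<psi>" and g: "good 2 h"
    and lv: "\<And>L k. L-lipschitz_on {0..1} \<psi> ==> limit_value \<psi> k = c (k + 2)" and d: "d \<ge> 2"
  shows "\<exists>\<phi>. approx f d \<phi> \<and> (\<exists>L. L-lipschitz_on {0..1} \<phi>) \<and> 2 * \<phi> (1/2) - 1 = c d \<and> good d f"
proof -
  obtain L where L: "L-lipschitz_on {0..1} \<psi>" using L by blast
  have "2 + (d - 2) = d" using d by simp
  thus ?thesis unfolding e using iterate_squares[OF ap L g, of "d - 2"] lv[OF L, of "d - 2"]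
    by (intro exI[of _ "(Wop ^^ (d - 2)) \<psi>"]) (auto simp: limit_value_def add.commute)
qed

lemma ADE_limit:
  assumes d: "d \<ge> 2" and t: "valid_ADE t"
  shows "\<exists>\<phi>. approx (ADE_part t d) d \<phi> \<and> (\<exists>L. L-lipschitz_on {0..1} \<phi>)
     \<and> 2 * \<phi> (1/2) - 1 = taylor_coeff (ADE_fun t) d \<and> good d (ADE_part t d)"
proof (cases t)
  case (Type_A n)
  let ?\<psi> = "\<lambda>x. min 1 (real (n + 1) * x)"
  have n: "n \<ge> 1" using t Type_A by simp
  have L: "(real (n + 1))-lipschitz_on {0..1} ?\<psi>"
  proof (rule lipschitz_onI)
    fix u w :: real
    have "\<bar>?\<psi> u - ?\<psi> w\<bar> <= \<bar>real (n + 1) * u - real (n + 1) * w\<bar>" by (auto simp: min_def)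
    thus "dist (?\<psi> u) (?\<psi> w) <= real (n + 1) * dist u w"
      by (simp add: dist_real_def abs_mult flip: right_diff_distrib del: of_nat_add of_nat_Suc)
  qed simp
  \<comment> \<open>The y^2 of the curve is counted as the first of d - 1 squares.\<close>
  have e: "ADE_part t d = vr 0 ^ (n + 1) + (\<Sum>i=1..<1 + (d - 1). vr i ^ 2)"
  proof -
    have "(\<Sum>i=1..<1 + (d - 1). vr i ^ 2) = vr 1 ^ 2 + (\<Sum>i=2..<d. vr i ^ 2)" using d by (simp add: sum.atLeast_Suc_lessThan numeral_2_eq_2)
    thus ?thesis by (simp add: ADE_part_def Type_A)
  qed
  have d1: "1 + (d - 1) = d" using d by simp
  obtain j where j: "d - 1 = Suc j" using d by (cases "d - 1") auto
  have jd: "j + 2 = d" using j d by simp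
  have a: "approx (vr 0 ^ (n + 1)) 1 ?\<psi>" by (rule approx_A) simp
  have g: "good 1 (vr 0 ^ (n + 1))" by (intro good_power good_vr) auto
  have it: "approx (ADE_part t d) d ((Wop ^^ (d - 1)) ?\<psi>) \<and> (\<exists>L. L-lipschitz_on {0..1} ((Wop ^^ (d - 1)) ?\<psi>))
    \<and> good d (ADE_part t d)" by (rule iterate_squares[OF a L g, of "d - 1", unfolded d1 e[unfolded d1, symmetric]])
  have "2 * (Wop ^^ (d - 1)) ?\<psi> (1/2) - 1 = limit_value ?\<psi> (Suc j)" by (simp only: limit_value_def j)
  also have "... = real (n + 1) / 2 * Hc (j + 2) (1 / real (n + 1))" by (rule limit_value_A) (use n in simp)
  also have "... = taylor_coeff (ADE_fun t) d" using taylor_A[OF refl n, of d] jd by (simp add: Type_A del: One_nat_def)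
  finally show ?thesis using it by blast
next
  case (Type_D n)
  define m where "m = n - 2"
  have n: "n \<ge> 4" and m: "m \<ge> 2" using t Type_D by (auto simp: m_def)
  show ?thesis
  proof (rule ADE_limit_aux[OF _ _ _ _ _ d])
    \<comment> \<open>With m = n - 2 the curve is y (y^m + x^2), so here y is the variable that is
      split off.\<close>
    have "n - 1 = Suc m" using n by (simp add: m_def)
    hence "vr 1 ^ (n - 1) = vr 1 * vr 1 ^ m" by simp
    thus "ADE_part t d = vr 1 ^ 1 * (vr 1 ^ m + vr 0 ^ 2) + (\<Sum>i=2..<d. vr i ^ 2)" by (simp add: ADE_part_def Type_D algebra_simps)
    show "approx (vr 1 ^ 1 * (vr 1 ^ m + vr 0 ^ 2)) 2 (psib 1 2 m)" by (rule approx_base) (use m in auto)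
    show "\<exists>L. L-lipschitz_on {0..1} (psib 1 2 m)" by (rule psib_lipschitz) (use m in auto)
    show "good 2 (vr 1 ^ 1 * (vr 1 ^ m + vr 0 ^ 2))" by (intro good_mult good_power good_vr free_of_add free_of_power free_of_vr) auto
    fix L k assume L: "L-lipschitz_on {0..1} (psib 1 2 m)"
    have m2: "real m \<ge> 2" using m by simp
    have a: "1/2 - (real m - 2) / (2 * (real m - 1)) = 1 / (2 * (real m - 1))"
      "1/2 - real m / (2 * (real m + 1)) = 1 / (2 * (real m + 1))" using m2 by (simp_all add: field_simps)
    have "limit_value (psib 1 2 m) k = (2 * Hc (k + 2) (1/2)
      + (real m - 1)\<^sup>2 / (2 * real m) * Hc (k + 2) (1/2 - (real m - 2) / (2 * (real m - 1)))
      + (real m + 1)\<^sup>2 / (2 * real m) * Hc (k + 2) (1/2 - real m / (2 * (real m + 1)))) / 2"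
    proof (rule limit_value_piecewise[OF L sym_psib_D[OF m]])
      show "3 - 2 - 2 * ((real m - 1)\<^sup>2 / (2 * real m)) * (1/2 - (real m - 2) / (2 * (real m - 1)))
         - 2 * ((real m + 1)\<^sup>2 / (2 * real m)) * (1/2 - real m / (2 * (real m + 1))) = 0"
      proof -
        have x: "2 * (x\<^sup>2 / (2 * real m)) * (1 / (2 * x)) = x / (2 * real m)" if "x \<noteq> 0" for x
          using that m2 by (simp add: power2_eq_square)
        have "real m - 1 \<noteq> 0" "real m + 1 \<noteq> 0" using m2 by auto
        thus ?thesis unfolding a x[OF \<open>real m - 1 \<noteq> 0\<close>] x[OF \<open>real m + 1 \<noteq> 0\<close>]
          using m2 by (simp add: field_simps)
      qed
    qed (use m2 in \<open>auto simp: field_simps\<close>)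
    thus "limit_value (psib 1 2 m) k = taylor_coeff (ADE_fun t) (k + 2)"
      unfolding a using taylor_D[OF m_def n, of "k + 2"] by (simp add: Type_D add_divide_distrib)
  qed
next
  case Type_E6
  show ?thesis
  proof (rule ADE_limit_aux[OF _ _ _ _ _ d])
    show "ADE_part t d = vr 1 ^ 0 * (vr 1 ^ 4 + vr 0 ^ 3) + (\<Sum>i=2..<d. vr i ^ 2)" by (simp add: ADE_part_def Type_E6 add.commute)
    show "approx (vr 1 ^ 0 * (vr 1 ^ 4 + vr 0 ^ 3)) 2 (psib 0 3 4)" by (rule approx_base) auto
    show "\<exists>L. L-lipschitz_on {0..1} (psib 0 3 4)" by (rule psib_lipschitz) auto
    show "good 2 (vr 1 ^ 0 * (vr 1 ^ 4 + vr 0 ^ 3))" by (simp, intro good_add good_power good_vr) auto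
    fix L k assume L: "L-lipschitz_on {0..1} (psib 0 3 4)"
    have "limit_value (psib 0 3 4) k = (0 * Hc (k + 2) (1/2) + 3 * Hc (k + 2) (1/2 - 1/12) + 3 * Hc (k + 2) (1/2 - 5/12)) / 2"
      by (rule limit_value_piecewise[OF L sym_psib_E67(1)]) auto
    thus "limit_value (psib 0 3 4) k = taylor_coeff (ADE_fun t) (k + 2)" using taylor_E6[of "k + 2"] by (simp add: Type_E6)
  qed
next
  case Type_E7
  show ?thesis
  proof (rule ADE_limit_aux[OF _ _ _ _ _ d])
    show "ADE_part t d = vr 0 ^ 1 * (vr 0 ^ 2 + vr 1 ^ 3) + (\<Sum>i=2..<d. vr i ^ 2)"
      by (simp add: ADE_part_def Type_E7 algebra_simps power3_eq_cube power2_eq_square)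
    show "approx (vr 0 ^ 1 * (vr 0 ^ 2 + vr 1 ^ 3)) 2 (psib 1 3 2)" by (rule approx_base) auto
    show "\<exists>L. L-lipschitz_on {0..1} (psib 1 3 2)" by (rule psib_lipschitz) auto
    show "good 2 (vr 0 ^ 1 * (vr 0 ^ 2 + vr 1 ^ 3))" by (intro good_mult good_power good_vr free_of_add free_of_power free_of_vr) auto
    fix L k assume L: "L-lipschitz_on {0..1} (psib 1 3 2)"
    have "limit_value (psib 1 3 2) k = (0 * Hc (k + 2) (1/2) + 27/8 * Hc (k + 2) (1/2 - 1/9) + 27/8 * Hc (k + 2) (1/2 - 4/9)) / 2"
      by (rule limit_value_piecewise[OF L sym_psib_E67(2)]) auto
    thus "limit_value (psib 1 3 2) k = taylor_coeff (ADE_fun t) (k + 2)" using taylor_E7[of "k + 2"] by (simp add: Type_E7)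
  qed
next
  case Type_E8
  show ?thesis
  proof (rule ADE_limit_aux[OF _ _ _ _ _ d])
    show "ADE_part t d = vr 1 ^ 0 * (vr 1 ^ 5 + vr 0 ^ 3) + (\<Sum>i=2..<d. vr i ^ 2)" by (simp add: ADE_part_def Type_E8 add.commute)
    show "approx (vr 1 ^ 0 * (vr 1 ^ 5 + vr 0 ^ 3)) 2 (psib 0 3 5)" by (rule approx_base) auto
    show "\<exists>L. L-lipschitz_on {0..1} (psib 0 3 5)" by (rule psib_lipschitz) auto
    show "good 2 (vr 1 ^ 0 * (vr 1 ^ 5 + vr 0 ^ 3))" by (simp, intro good_add good_power good_vr) auto
    fix L k assume L: "L-lipschitz_on {0..1} (psib 0 3 5)"
    have "limit_value (psib 0 3 5) k = (0 * Hc (k + 2) (1/2) + 15/4 * Hc (k + 2) (1/2 - 2/15) + 15/4 * Hc (k + 2) (1/2 - 7/15)) / 2"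
      by (rule limit_value_piecewise[OF L sym_psib_E67(3)]) auto
    thus "limit_value (psib 0 3 5) k = taylor_coeff (ADE_fun t) (k + 2)" using taylor_E8[of "k + 2"] by (simp add: Type_E8)
  qed
qed

subsection \<open>Frobenius on power series\<close>

definition pM :: "nat => mps set" where "pM p = did (int p) UNIV"

lemma ideal_pM: "is_ideal (pM p)"
  unfolding pM_def by (rule ideal_did) (simp add: down_closed_def)

lemma pM_did: "pM p \<subseteq> did (int p) D" by (auto simp: pM_def did_def)

lemma pM_bI: "pM p \<subseteq> bI p c" unfolding bI_def by (rule pM_did)

lemma p_pM: "of_nat p \<in> pM p" using coef_of_nat_mult[of p 1] by (simp add: pM_def did_def)

definition sc :: "nat => expo => expo" where "sc q \<beta> = Poly_Mapping.map (\<lambda>n. q * n) \<beta>"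
definition dv :: "nat => expo => expo" where "dv q \<beta> = Poly_Mapping.map (\<lambda>n. n div q) \<beta>"

lemma ex_sc [simp]: "ex (sc q \<beta>) i = q * ex \<beta> i"
  unfolding sc_def by (simp add: Poly_Mapping.map.rep_eq when_def)

lemma ex_dv [simp]: "ex (dv q \<beta>) i = ex \<beta> i div q"
  unfolding dv_def by (simp add: Poly_Mapping.map.rep_eq when_def)

lemma dv_sc [simp]: "q > 0 ==> dv q (sc q \<beta>) = \<beta>" by (rule poly_mapping_eqI) simp

lemma sc_inj: "q > 0 ==> sc q \<beta> = sc q \<gamma> \<longleftrightarrow> \<beta> = \<gamma>" by (metis dv_sc)

lemma sc_add: "sc q (\<beta> + \<gamma>) = sc q \<beta> + sc q \<gamma>"
  by (rule poly_mapping_eqI) (simp add: lookup_add distrib_left)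

lemma sc_sc: "sc q (sc q' \<beta>) = sc (q * q') \<beta>" by (rule poly_mapping_eqI) simp

lemma mono_power: "mono \<beta> ^ q = mono (sc q \<beta>)"
proof (induction q)
  case 0
  have "sc 0 \<beta> = 0" by (rule poly_mapping_eqI) simp
  thus ?case by simp
next
  case (Suc q)
  have "sc (Suc q) \<beta> = \<beta> + sc q \<beta>" by (rule poly_mapping_eqI) (simp add: lookup_add)
  thus ?case using Suc by (simp add: mono_add)
qed

text \<open>The substitution x_i -> x_i^q. For q a power of \<open>p\<close> it agrees modulo
  \<open>p\<close> with the q-th power, and unlike the power it is additive over the
  integers.\<close>

definition FF :: "nat => mps => mps" where
  "FF q g = Mps (\<lambda>\<alpha>. if \<forall>i. q dvd ex \<alpha> i then coef g (dv q \<alpha>) else 0)"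

lemma coef_FF: "coef (FF q g) \<alpha> = (if \<forall>i. q dvd ex \<alpha> i then coef g (dv q \<alpha>) else 0)" by (simp add: FF_def)

lemma coef_FF_sc [simp]: "q > 0 ==> coef (FF q g) (sc q \<beta>) = coef g \<beta>" by (simp add: coef_FF)

lemma dvd_sc: assumes "\<forall>i. q dvd ex \<alpha> i" shows "\<alpha> = sc q (dv q \<alpha>)"
  by (rule poly_mapping_eqI) (use assms in simp)

lemma FF_FF: "q > 0 ==> q' > 0 ==> FF q (FF q' g) = FF (q * q') g"
proof (rule mps_eqI)
  fix \<alpha> assume q: "q > 0" "q' > 0"
  show "coef (FF q (FF q' g)) \<alpha> = coef (FF (q * q') g) \<alpha>"
  proof (cases "\<forall>i. q * q' dvd ex \<alpha> i")
    case True
    hence "\<alpha> = sc (q * q') (dv (q * q') \<alpha>)" by (rule dvd_sc)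
    then obtain \<beta> where b: "\<alpha> = sc (q * q') \<beta>" by blast
    have b2: "\<alpha> = sc q (sc q' \<beta>)" unfolding b sc_sc ..
    have "coef (FF q (FF q' g)) \<alpha> = coef g \<beta>" unfolding b2 using q by simp
    moreover have "coef (FF (q * q') g) \<alpha> = coef g \<beta>" unfolding b using q by simp
    ultimately show ?thesis by simp
  next
    case False
    have "\<not> ((\<forall>i. q dvd ex \<alpha> i) \<and> (\<forall>i. q' dvd ex (dv q \<alpha>) i))"
    proof
      assume *: "(\<forall>i. q dvd ex \<alpha> i) \<and> (\<forall>i. q' dvd ex (dv q \<alpha>) i)"
      have "q * q' dvd ex \<alpha> i" for i
      proof -
        have "q dvd ex \<alpha> i" "q' dvd ex \<alpha> i div q" using * unfolding ex_dv by blast+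
        hence "q * q' dvd q * (ex \<alpha> i div q)" by (intro mult_dvd_mono) auto
        thus ?thesis using \<open>q dvd ex \<alpha> i\<close> by simp
      qed
      thus False using False by blast
    qed
    thus ?thesis using False by (auto simp: coef_FF)
  qed
qed

lemma fermat_int: "prime p ==> int p dvd c ^ p - c"
proof -
  assume p: "prime p"
  have "[nat (c mod int p) ^ p = nat (c mod int p)] (mod p)"
  proof (cases "p dvd nat (c mod int p)")
    case True
    moreover have "p dvd nat (c mod int p) ^ p" using True prime_gt_0_nat[OF p] dvd_power dvd_trans by blast
    ultimately show ?thesis unfolding cong_def by (metis dvd_eq_mod_eq_0)
  next
    case False
    hence "[nat (c mod int p) ^ (p - 1) = 1] (mod p)" using p by (rule fermat_theorem[rotated])
    hence "[nat (c mod int p) ^ (p - 1) * nat (c mod int p) = 1 * nat (c mod int p)] (mod p)" by (rule cong_scalar_right)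
    thus ?thesis using prime_gt_0_nat[OF p] by (simp add: power_eq_if mult.commute)
  qed
  hence "[int (nat (c mod int p) ^ p) = int (nat (c mod int p))] (mod int p)" by (simp only: cong_int_iff)
  hence "[(c mod int p) ^ p = c mod int p] (mod int p)" using prime_gt_0_nat[OF p] by simp
  hence "[c ^ p = c] (mod int p)" by (simp add: cong_def power_mod)
  thus ?thesis by (simp add: cong_iff_dvd_diff)
qed

lemma frobenius_sum:
  assumes I: "is_ideal I" and p: "prime p" "of_nat p \<in> I"
  shows "(\<Sum>i\<in>A. f i) ^ p - (\<Sum>i\<in>A. f i ^ p) \<in> I"
proof (induction A rule: infinite_finite_induct)
  case (insert x A)
  have "(f x + sum f A) ^ p - (f x ^ p + sum f A ^ p) + (sum f A ^ p - (\<Sum>i\<in>A. f i ^ p)) \<in> I"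
    by (intro ideal_add[OF I] frobenius_add[OF I p] insert.IH)
  thus ?case using insert by (simp add: algebra_simps)
qed (use prime_gt_0_nat[OF p(1)] ideal_0[OF I] in \<open>auto simp: power_0_left\<close>)

lemma power_cong:
  assumes I: "is_ideal I" and "x - y \<in> I" shows "x ^ n - y ^ n \<in> I"
proof (induction n)
  case (Suc n)
  have "x * (x ^ n - y ^ n) + (x - y) * y ^ n \<in> I" by (intro ideal_add[OF I] ideal_mult[OF I] ideal_mult2[OF I] Suc assms)
  thus ?case by (simp add: algebra_simps)
qed (simp add: ideal_0[OF I])

lemma frobenius_FF_prime:
  assumes p: "prime p" shows "g ^ p - FF p g \<in> pM p"
  unfolding pM_def did_def
proof (intro CollectI ballI)
  let ?T = "\<lambda>\<beta>. (of_int (coef g \<beta>) * mono \<beta>) ^ p"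
  fix \<alpha> :: expo
  \<comment> \<open>The support of \<open>g\<close> may be infinite. Only the finitely many
    monomials dividing x^\<alpha> influence the coefficient at \<open>\<alpha>\<close>, and modulo
    \<open>did p D\<close> the binomial argument applies to a finite sum.\<close>
  define D where "D = {\<beta>::expo. \<forall>i. ex \<beta> i <= ex \<alpha> i}"
  have p0: "p > 0" by (rule prime_gt_0_nat[OF p])
  have fin: "finite D" unfolding D_def by (rule finite_le_expo)
  have dc: "down_closed D" unfolding down_closed_def D_def lookup_add mem_Collect_eq by (meson add_leD2)
  let ?I = "did (int p) D"
  have I: "is_ideal ?I" by (rule ideal_did[OF dc])
  have pI: "of_nat p \<in> ?I" using p_pM pM_did by blast
  define t where "t = (\<Sum>\<beta>\<in>D. of_int (coef g \<beta>) * mono \<beta>)"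
  have coeft: "coef (\<Sum>\<beta>\<in>D. of_int (c \<beta>) * mono (m \<beta>)) \<gamma> = (\<Sum>\<beta>\<in>D. c \<beta> * (if \<gamma> = m \<beta> then 1 else 0))" for c m \<gamma>
    by (simp add: coef_mono)
  have 1: "g - t \<in> ?I" unfolding did_def
  proof (intro CollectI ballI)
    fix \<gamma> assume "\<gamma> \<in> D"
    have "coef t \<gamma> = (\<Sum>\<beta>\<in>D. if \<beta> = \<gamma> then coef g \<gamma> else 0)" unfolding t_def coeft by (rule sum.cong) auto
    hence "coef t \<gamma> = coef g \<gamma>" using fin \<open>\<gamma> \<in> D\<close> by simp
    thus "int p dvd coef (g - t) \<gamma>" by simp
  qed
  let ?U = "\<Sum>\<beta>\<in>D. ?T \<beta>"
  have 2: "t ^ p - ?U \<in> ?I" unfolding t_def by (rule frobenius_sum[OF I p pI])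
  have 3: "?U - FF p g \<in> ?I" unfolding did_def
  proof (intro CollectI ballI)
    fix \<gamma> assume g: "\<gamma> \<in> D"
    have "(of_int c * mono \<beta>) ^ p = of_int (c ^ p) * mono (sc p \<beta>)" for c \<beta> by (simp add: power_mult_distrib mono_power)
    hence c: "coef ?U \<gamma> = (\<Sum>\<beta>\<in>D. coef g \<beta> ^ p * (if \<gamma> = sc p \<beta> then 1 else 0))" by (simp only: coeft)
    show "int p dvd coef (?U - FF p g) \<gamma>"
    proof (cases "\<forall>i. p dvd ex \<gamma> i")
      case True
      define \<delta> where "\<delta> = dv p \<gamma>"
      have gd: "\<gamma> = sc p \<delta>" unfolding \<delta>_def by (rule dvd_sc[OF True])
      have dD: "\<delta> \<in> D"
      proof -
        have "ex \<delta> i <= ex \<gamma> i" for i using p0 by (simp add: gd)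
        thus ?thesis using g unfolding D_def by (auto intro: order.trans)
      qed
      have "(\<Sum>\<beta>\<in>D. coef g \<beta> ^ p * (if \<gamma> = sc p \<beta> then 1 else 0)) = (\<Sum>\<beta>\<in>D. if \<beta> = \<delta> then coef g \<delta> ^ p else 0)"
        using p0 by (intro sum.cong refl) (auto simp: gd sc_inj)
      hence "coef ?U \<gamma> = coef g \<delta> ^ p" unfolding c using dD fin by simp
      thus ?thesis using fermat_int[OF p, of "coef g \<delta>"] p0 by (simp add: gd)
    next
      case False
      hence "\<gamma> \<noteq> sc p \<beta>" for \<beta> by auto
      hence "coef ?U \<gamma> = 0" unfolding c by simp
      moreover have "coef (FF p g) \<gamma> = 0" unfolding coef_FF by (rule if_not_P[OF False])
      ultimately show ?thesis unfolding coef_diff by simp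
    qed
  qed
  have "(g ^ p - t ^ p) + (t ^ p - ?U) + (?U - FF p g) \<in> ?I" by (intro ideal_add[OF I] power_cong[OF I 1] 2 3)
  hence "g ^ p - FF p g \<in> ?I" by simp
  moreover have "\<alpha> \<in> D" by (simp add: D_def)
  ultimately show "int p dvd coef (g ^ p - FF p g) \<alpha>" by (simp add: did_def)
qed

lemma frobenius_FF:
  assumes p: "prime p" shows "g ^ (p ^ e) - FF (p ^ e) g \<in> pM p"
proof (induction e)
  case 0
  have "dv 1 \<alpha> = \<alpha>" for \<alpha> by (rule poly_mapping_eqI) simp
  hence "FF 1 g = g" by (intro mps_eqI) (simp add: coef_FF)
  thus ?case by (simp add: ideal_0[OF ideal_pM])
next
  case (Suc e)
  have p0: "p > 0" by (rule prime_gt_0_nat[OF p])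
  have "((g ^ (p ^ e)) ^ p - (FF (p ^ e) g) ^ p) + ((FF (p ^ e) g) ^ p - FF p (FF (p ^ e) g)) \<in> pM p"
    by (intro ideal_add[OF ideal_pM] power_cong[OF ideal_pM Suc] frobenius_FF_prime[OF p])
  thus ?case using p0 by (simp add: FF_FF power_mult[symmetric] mult.commute)
qed

text \<open>For \<mu> with all exponents below \<open>q\<close>, the coordinate at x^\<mu> in the
  monomial basis over q-th powers, followed by extraction of the q-th root.\<close>

definition lam :: "nat => expo => mps => mps" where
  "lam q \<mu> f = Mps (\<lambda>\<beta>. coef f (\<mu> + sc q \<beta>))"

lemma coef_lam [simp]: "coef (lam q \<mu> f) \<beta> = coef f (\<mu> + sc q \<beta>)" by (simp add: lam_def)

lemma lam_diff: "lam q \<mu> (f - g) = lam q \<mu> f - lam q \<mu> g" by (rule mps_eqI) simp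
lemma lam_FF_mult:
  assumes \<mu>: "\<And>i. ex \<mu> i < q"
  shows "lam q \<mu> (FF q g * f) = g * lam q \<mu> f"
proof (rule mps_eqI)
  fix \<beta>
  have q: "q > 0" using \<mu>[of 0] by simp
  let ?S = "{u \<in> splits (\<mu> + sc q \<beta>). \<forall>i. q dvd ex (fst u) i}"
  have "coef (lam q \<mu> (FF q g * f)) \<beta> = (\<Sum>u\<in>splits (\<mu> + sc q \<beta>). coef (FF q g) (fst u) * coef f (snd u))"
    by (simp add: coef_mult)
  also have "... = (\<Sum>u\<in>?S. coef (FF q g) (fst u) * coef f (snd u))" by (rule sum.mono_neutral_right) (auto simp: coef_FF)
  also have "... = (\<Sum>u\<in>splits \<beta>. coef g (fst u) * coef f (\<mu> + sc q (snd u)))"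
  proof (rule sum.reindex_bij_witness[where j = "\<lambda>u. (dv q (fst u), \<beta> - dv q (fst u))" and i = "\<lambda>u. (sc q (fst u), \<mu> + sc q (snd u))"])
    fix u assume u: "u \<in> ?S"
    define \<gamma> where "\<gamma> = dv q (fst u)"
    have f: "fst u = sc q \<gamma>" unfolding \<gamma>_def by (rule dvd_sc) (use u in simp)
    have s: "fst u + snd u = \<mu> + sc q \<beta>" using u by (simp add: splits_def)
    have e: "q * ex \<gamma> i + ex (snd u) i = ex \<mu> i + q * ex \<beta> i" for i
      using arg_cong[OF s, of "\<lambda>x. ex x i"] by (simp add: lookup_add f)
    have le: "ex \<gamma> i <= ex \<beta> i" for i
    proof (rule ccontr)
      assume "\<not> ?thesis"
      hence "q * (ex \<beta> i + 1) <= q * ex \<gamma> i" by (intro mult_le_mono2) simp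
      thus False using e[of i] \<mu>[of i] by simp
    qed
    have sp: "\<gamma> + (\<beta> - \<gamma>) = \<beta>" using le by (intro poly_mapping_eqI) (simp add: lookup_add lookup_minus)
    have sn: "snd u = \<mu> + sc q (\<beta> - \<gamma>)"
    proof (rule poly_mapping_eqI)
      fix i
      have "q * ex \<gamma> i <= q * ex \<beta> i" by (rule mult_le_mono2[OF le])
      thus "ex (snd u) i = ex (\<mu> + sc q (\<beta> - \<gamma>)) i" using e[of i] by (simp add: lookup_add lookup_minus diff_mult_distrib2)
    qed
    show "(\<lambda>u. (sc q (fst u), \<mu> + sc q (snd u))) (dv q (fst u), \<beta> - dv q (fst u)) = u"
      unfolding \<gamma>_def[symmetric] using f sn by (simp add: prod_eq_iff)
    show "(dv q (fst u), \<beta> - dv q (fst u)) \<in> splits \<beta>" unfolding \<gamma>_def[symmetric] using sp by (simp add: splits_def)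
    show "coef g (fst (dv q (fst u), \<beta> - dv q (fst u))) * coef f (\<mu> + sc q (snd (dv q (fst u), \<beta> - dv q (fst u)))) = coef (FF q g) (fst u) * coef f (snd u)"
      unfolding \<gamma>_def[symmetric] using q by (simp add: f sn)
  next
    fix u assume "u \<in> splits \<beta>"
    hence u: "fst u + snd u = \<beta>" by (simp add: splits_def)
    show "(\<lambda>u. (dv q (fst u), \<beta> - dv q (fst u))) (sc q (fst u), \<mu> + sc q (snd u)) = u"
      using q u by (simp add: prod_eq_iff) (metis add_diff_cancel_left')
    show "(sc q (fst u), \<mu> + sc q (snd u)) \<in> ?S" using u by (auto simp: splits_def sc_add[symmetric] ac_simps)
  qed
  also have "... = coef (g * lam q \<mu> f) \<beta>" by (simp add: coef_mult)
  finally show "coef (lam q \<mu> (FF q g * f)) \<beta> = coef (g * lam q \<mu> f) \<beta>" .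
qed

lemma lam_pM: "f \<in> pM p ==> lam q \<mu> f \<in> pM p" by (simp add: pM_def did_def)

lemma lam_power_mult:
  assumes p: "prime p" and \<mu>: "\<And>i. ex \<mu> i < p ^ e"
  shows "lam (p ^ e) \<mu> (f * g ^ (p ^ e)) - lam (p ^ e) \<mu> f * g \<in> pM p"
proof -
  have "lam (p ^ e) \<mu> (f * (g ^ (p ^ e) - FF (p ^ e) g)) \<in> pM p" by (intro lam_pM ideal_mult[OF ideal_pM] frobenius_FF[OF p])
  moreover have "lam (p ^ e) \<mu> (f * (g ^ (p ^ e) - FF (p ^ e) g)) = lam (p ^ e) \<mu> (f * g ^ (p ^ e)) - g * lam (p ^ e) \<mu> f"
    using lam_FF_mult[OF \<mu>, of g f] by (simp add: right_diff_distrib lam_diff mult.commute)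
  ultimately show ?thesis by (simp add: mult.commute)
qed

lemma expo_divmod:
  assumes "q > 0"
  obtains \<mu> where "\<alpha> = \<mu> + sc q (dv q \<alpha>)" "\<And>i. ex \<mu> i = ex \<alpha> i mod q" "\<And>i. ex \<mu> i < q"
proof
  let ?m = "Poly_Mapping.map (\<lambda>n. n mod q) \<alpha>"
  have e: "ex ?m i = ex \<alpha> i mod q" for i by (simp add: Poly_Mapping.map.rep_eq when_def)
  thus "\<And>i. ex ?m i = ex \<alpha> i mod q" .
  show "\<alpha> = ?m + sc q (dv q \<alpha>)" by (rule poly_mapping_eqI) (simp add: lookup_add e)
  show "\<And>i. ex ?m i < q" using e assms by simp
qed

lemma box_cV_mult:
  assumes \<mu>: "\<And>i. ex \<mu> i < q'"
  shows "\<mu> + sc q' \<beta> \<in> box (cV d (q' * q)) \<longleftrightarrow> \<mu> \<in> box (cV d q') \<and> \<beta> \<in> box (cV d q)"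
proof -
  have "ex \<mu> i + q' * ex \<beta> i < cV d (q' * q) i \<longleftrightarrow> ex \<mu> i < cV d q' i \<and> ex \<beta> i < cV d q i" for i
  proof (cases "i < d")
    case True
    have "ex \<mu> i + q' * ex \<beta> i < q' * q \<longleftrightarrow> ex \<beta> i < q"
    proof
      assume "ex \<beta> i < q"
      hence "q' * (ex \<beta> i + 1) <= q' * q" by (intro mult_le_mono2) simp
      thus "ex \<mu> i + q' * ex \<beta> i < q' * q" using \<mu>[of i] by simp
    next
      assume "ex \<mu> i + q' * ex \<beta> i < q' * q"
      hence "q' * ex \<beta> i < q' * q" by linarith
      thus "ex \<beta> i < q" by simp
    qed
    thus ?thesis using True \<mu>[of i] by (simp add: cV_def)
  next
    case False
    thus ?thesis using \<mu>[of i] by (auto simp: cV_def)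
  qed
  thus ?thesis by (auto simp: box_def lookup_add)
qed

lemma card_box_cV: "card (box (cV d q)) = q ^ d" "finite (box (cV d q))"
proof -
  have b: "bij_betw ex (box (cV d q)) {f. \<forall>i. f i < cV d q i}"
  proof (rule bij_betw_imageI)
    show "inj_on ex (box (cV d q))" by (auto intro!: inj_onI poly_mapping_eqI)
    show "ex ` box (cV d q) = {f. \<forall>i. f i < cV d q i}"
    proof (safe)
      fix f :: "nat => nat" assume f: "\<forall>i. f i < cV d q i"
      have "f i = 0" if "i \<ge> d" for i using f[rule_format, of i] that by (simp add: cV_def)
      hence "{i. f i \<noteq> 0} \<subseteq> {..<d}" by (metis (mono_tags, lifting) lessThan_iff mem_Collect_eq not_le subsetI)
      hence "finite {i. f i \<noteq> 0}" by (rule finite_subset) simp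
      hence "ex (Abs_poly_mapping f) = f" by simp
      thus "f \<in> ex ` box (cV d q)" using f by (intro image_eqI[of _ _ "Abs_poly_mapping f"]) (auto simp: box_def)
    qed (auto simp: box_def)
  qed
  have c: "bij_betw (\<lambda>f. restrict f {..<d}) {f. \<forall>i. f i < cV d q i} ({..<d} \<rightarrow>\<^sub>E {..<q})"
  proof (rule bij_betw_byWitness[where f' = "\<lambda>g i. if i < d then g i else 0"])
    show "\<forall>f\<in>{f. \<forall>i. f i < cV d q i}. (\<lambda>i. if i < d then restrict f {..<d} i else 0) = f"
    proof (intro ballI ext)
      fix f :: "nat => nat" and i assume f: "f \<in> {f. \<forall>i. f i < cV d q i}"
      have "f i = 0" if "i \<ge> d" using f that by (auto simp: cV_def dest: spec[of _ i])
      thus "(if i < d then restrict f {..<d} i else 0) = f i" by auto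
    qed
    show "(\<lambda>f. restrict f {..<d}) ` {f. \<forall>i. f i < cV d q i} \<subseteq> {..<d} \<rightarrow>\<^sub>E {..<q}"
    proof (intro image_subsetI PiE_I)
      fix f :: "nat => nat" and i assume f: "f \<in> {f. \<forall>i. f i < cV d q i}" and i: "i \<in> {..<d}"
      have "f i < cV d q i" using f by simp
      thus "restrict f {..<d} i \<in> {..<q}" using i by (simp add: cV_def)
    qed simp
  qed (auto simp: cV_def PiE_def extensional_def fun_eq_iff restrict_def)
  have e: "card ({..<d} \<rightarrow>\<^sub>E {..<q}) = q ^ d" by (simp add: card_PiE)
  show "card (box (cV d q)) = q ^ d" using bij_betw_same_card[OF b] bij_betw_same_card[OF c] e by simp
  show "finite (box (cV d q))" using bij_betw_finite[OF b] bij_betw_finite[OF c] finite_PiE[of "{..<d}" "\<lambda>_. {..<q}"] by simp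
qed

text \<open>Modulo \<open>p\<close>, series in \<open>d\<close> variables are free of rank p^d over
  their p-th powers. In each coordinate h^(pn) acts as h^n, and the box shrinks by the factor
  \<open>p\<close>.\<close>

lemma ind_frobenius:
  assumes p: "prime p" and q: "q > 0"
  shows "ind UNIV (with_gen (bI p (cV d (p * q))) (h ^ (p * n)))
    = ind UNIV (with_gen (bI p (cV d q)) (h ^ n)) ^ (p ^ d)"
proof -
  have p0: "p > 0" by (rule prime_gt_0_nat[OF p])
  let ?J = "with_gen (bI p (cV d q)) (h ^ n)"
  obtain \<mu> where "bij_betw \<mu> {0..<card (box (cV d p))} (box (cV d p))" using ex_bij_betw_nat_finite[OF card_box_cV(2)] by blast
  hence bij: "bij_betw \<mu> {..<p ^ d} (box (cV d p))" by (simp add: card_box_cV lessThan_atLeast0)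
  \<comment> \<open>Extended by 0 beyond the basis, so that the exponent bound required by
    \<open>lam_power_mult\<close> holds for every index.\<close>
  define \<nu> where "\<nu> r = (if r < p ^ d then \<mu> r else 0)" for r
  have nu: "ex (\<nu> r) i < p" for r i
  proof (cases "r < p ^ d")
    case True
    hence "\<mu> r \<in> box (cV d p)" using bij by (auto simp: bij_betw_def)
    hence "ex (\<mu> r) i < cV d p i" by (simp add: box_def)
    thus ?thesis using True p0 by (simp add: \<nu>_def cV_def split: if_splits)
  qed (use p0 in \<open>simp add: \<nu>_def\<close>)
  have lamJ: "lam p (\<nu> r) (R * (h ^ n) ^ p) - lam p (\<nu> r) R * h ^ n \<in> pM p" for r R
    using lam_power_mult[OF p, of "\<nu> r" 1 R "h ^ n"] nu by simp
  have comp: "f \<in> bI p (cV d (p * q)) \<longleftrightarrow> (\<forall>r<p ^ d. lam p (\<nu> r) f \<in> bI p (cV d q))" for f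
  proof
    assume f: "f \<in> bI p (cV d (p * q))"
    show "\<forall>r<p ^ d. lam p (\<nu> r) f \<in> bI p (cV d q)" unfolding bI_def did_def
    proof (intro allI impI CollectI ballI)
      fix r \<beta> assume r: "r < p ^ d" and b: "\<beta> \<in> box (cV d q)"
      have "\<nu> r \<in> box (cV d p)" using r bij by (auto simp: \<nu>_def bij_betw_def)
      hence "\<nu> r + sc p \<beta> \<in> box (cV d (p * q))" using box_cV_mult[OF nu] b by blast
      thus "int p dvd coef (lam p (\<nu> r) f) \<beta>" using f by (simp add: bI_def did_def)
    qed
  next
    assume f: "\<forall>r<p ^ d. lam p (\<nu> r) f \<in> bI p (cV d q)"
    show "f \<in> bI p (cV d (p * q))" unfolding bI_def did_def
    proof (intro CollectI ballI)
      fix \<alpha> assume a: "\<alpha> \<in> box (cV d (p * q))"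
      obtain m where m: "\<alpha> = m + sc p (dv p \<alpha>)" "\<And>i. ex m i < p" using expo_divmod[OF p0] by metis
      have "m \<in> box (cV d p)" "dv p \<alpha> \<in> box (cV d q)" using a m box_cV_mult[OF m(2)] by metis+
      moreover obtain r where "r < p ^ d" "\<mu> r = m"
      proof -
        have "m \<in> \<mu> ` {..<p ^ d}" using bij calculation(1) unfolding bij_betw_def by simp
        thus ?thesis using that by blast
      qed
      ultimately have "int p dvd coef (lam p (\<nu> r) f) (dv p \<alpha>)" using f by (simp add: bI_def did_def)
      thus "int p dvd coef f \<alpha>" using m(1) \<open>\<mu> r = m\<close> \<open>r < p ^ d\<close> by (simp add: \<nu>_def)
    qed
  qed
  have inj: "\<nu> r = \<nu> k ==> r < p ^ d ==> k < p ^ d ==> r = k" for r k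
    using bij by (auto simp: \<nu>_def bij_betw_def inj_on_def)
  have lamdelta: "lam p (\<nu> r) (mono (\<nu> k) * FF p x) = (if r = k then x else 0)" if "r < p ^ d" "k < p ^ d" for r k x
  proof -
    have "lam p (\<nu> r) (mono (\<nu> k)) = (if r = k then 1 else 0)"
    proof (rule mps_eqI)
      fix \<beta>
      have "\<nu> r + sc p \<beta> = \<nu> k \<longleftrightarrow> r = k \<and> \<beta> = 0"
      proof
        assume e: "\<nu> r + sc p \<beta> = \<nu> k"
        have "ex (\<nu> r) i + p * ex \<beta> i = ex (\<nu> k) i" for i using arg_cong[OF e, of "\<lambda>x. ex x i"] by (simp add: lookup_add)
        hence "p * ex \<beta> i < p * 1" for i using nu[of k i] by (metis le_add2 le_less_trans mult.right_neutral)
        hence "ex \<beta> i = 0" for i using p0 by (metis less_one nat_mult_less_cancel1)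
        hence "\<beta> = 0" by (intro poly_mapping_eqI) simp
        moreover have "sc p 0 = 0" by (rule poly_mapping_eqI) simp
        ultimately show "r = k \<and> \<beta> = 0" using e inj that by simp
      next
        assume "r = k \<and> \<beta> = 0"
        moreover have "sc p 0 = 0" by (rule poly_mapping_eqI) simp
        ultimately show "\<nu> r + sc p \<beta> = \<nu> k" by simp
      qed
      thus "coef (lam p (\<nu> r) (mono (\<nu> k))) \<beta> = coef (if r = k then 1 else 0) \<beta>" by (simp add: coef_mono coef_1)
    qed
    thus ?thesis using lam_FF_mult[OF nu, of r x "mono (\<nu> k)"] by (simp add: mult.commute)
  qed
  have "with_gen (bI p (cV d (p * q))) (h ^ (p * n)) = {f. \<forall>r<p ^ d. lam p (\<nu> r) f \<in> ?J}"
  proof (intro equalityI subsetI CollectI allI impI)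
    fix f r assume "f \<in> with_gen (bI p (cV d (p * q))) (h ^ (p * n))" and r: "r < p ^ d"
    then obtain R where "f - R * (h ^ n) ^ p \<in> bI p (cV d (p * q))" by (auto simp: with_gen_def power_mult[symmetric] mult.commute)
    hence "lam p (\<nu> r) (f - R * (h ^ n) ^ p) \<in> bI p (cV d q)" using comp r by blast
    hence "lam p (\<nu> r) f - lam p (\<nu> r) (R * (h ^ n) ^ p) + (lam p (\<nu> r) (R * (h ^ n) ^ p) - lam p (\<nu> r) R * h ^ n) \<in> bI p (cV d q)"
      using subsetD[OF pM_bI lamJ] by (intro ideal_add[OF ideal_bI]) (simp_all add: lam_diff)
    thus "lam p (\<nu> r) f \<in> ?J" by (auto simp: with_gen_def)
  next
    fix f assume "f \<in> {f. \<forall>r<p ^ d. lam p (\<nu> r) f \<in> ?J}"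
    hence "\<forall>r. \<exists>R. r < p ^ d --> lam p (\<nu> r) f - R * h ^ n \<in> bI p (cV d q)" by (auto simp: with_gen_def)
    then obtain R where R: "\<And>r. r < p ^ d ==> lam p (\<nu> r) f - R r * h ^ n \<in> bI p (cV d q)" by metis
    define S where "S = (\<Sum>k<p ^ d. mono (\<nu> k) * FF p (R k))"
    have lamS: "lam p (\<nu> r) S = R r" if r: "r < p ^ d" for r
    proof -
      have lamsum: "lam p \<mu>' (sum g A) = (\<Sum>k\<in>A. lam p \<mu>' (g k))" for \<mu>' and g :: "nat => mps" and A by (rule mps_eqI) simp
      have "lam p (\<nu> r) S = (\<Sum>k<p ^ d. if r = k then R k else 0)"
        unfolding S_def lamsum using r by (intro sum.cong refl) (simp add: lamdelta)
      thus ?thesis using r by simp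
    qed
    have "f - S * (h ^ n) ^ p \<in> bI p (cV d (p * q))" unfolding comp
    proof (intro allI impI)
      fix r assume r: "r < p ^ d"
      have "(lam p (\<nu> r) f - R r * h ^ n) - (lam p (\<nu> r) (S * (h ^ n) ^ p) - lam p (\<nu> r) S * h ^ n) \<in> bI p (cV d q)"
        by (intro ideal_diff[OF ideal_bI] subsetD[OF pM_bI lamJ] R[OF r])
      thus "lam p (\<nu> r) (f - S * (h ^ n) ^ p) \<in> bI p (cV d q)" by (simp add: lam_diff lamS[OF r])
    qed
    thus "f \<in> with_gen (bI p (cV d (p * q))) (h ^ (p * n))" by (auto simp: with_gen_def power_mult[symmetric] mult.commute)
  qed
  also have "ind UNIV \<dots> = (\<Prod>r<p ^ d. ind UNIV ?J)" by (rule ind_coordinates[where e = "\<lambda>k x. mono (\<nu> k) * FF p x"])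
       (auto simp: lam_diff lamdelta intro!: ideal_subgp ideal_with_gen ideal_bI)
  finally show ?thesis by simp
qed

section \<open>Dimension functions: Frobenius, monotonicity and concavity\<close>

lemma LD_frobenius:
  assumes p: "prime p" and q: "q > 0"
  shows "LD p (cV d (p * q)) h (p * n) = real p ^ d * LD p (cV d q) h n"
proof -
  interpret gf_module "bI p (cV d q)" h p by (rule gf_module_bI[OF p, of d]) (simp add: cV_def)
  show ?thesis unfolding LD_def ldim_def ind_frobenius[OF assms] using p1 fin_with_gen by (simp add: log_nat_power)
qed

lemma LD_mono:
  assumes p: "prime p" and c: "\<And>i. i \<ge> N ==> c i = 1" and mn: "m <= n"
  shows "LD p c h m <= LD p c h n"
proof -
  interpret gf_module "bI p c" h p by (rule gf_module_bI[OF p c])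
  let ?A = "with_gen (bI p c) (h ^ m)" and ?B = "with_gen (bI p c) (h ^ n)"
  have "h ^ n = h ^ (n - m) * h ^ m" using mn by (simp add: power_add[symmetric])
  hence "?B \<subseteq> ?A" by (intro with_gen_least ideal_with_gen ideal_bI with_gen_sub) (simp add: with_gen_gen ideal_bI)
  hence "ind UNIV ?B = ind UNIV ?A * ind ?A ?B" by (intro ind_tower ideal_subgp ideal_with_gen ideal_bI subgp_UNIV) auto
  hence "ind UNIV ?A <= ind UNIV ?B" using fin_with_gen[of "h ^ n"] by (cases "ind ?A ?B") auto
  thus ?thesis unfolding LD_def ldim_def using p1 fin_with_gen[of "h ^ m"] by simp
qed

text \<open>Modulo the box ideal, multiplication by \<open>h\<close> maps (h^n)/(h^(n+1)) onto
  (h^(n+1))/(h^(n+2)).\<close>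

lemma LD_concave:
  assumes p: "prime p" and c: "\<And>i. i \<ge> N ==> c i = 1"
  shows "LD p c h (n + 2) - LD p c h (n + 1) <= LD p c h (n + 1) - LD p c h n"
proof -
  interpret gf_module "bI p c" h p by (rule gf_module_bI[OF p c])
  let ?A = "\<lambda>n. with_gen (bI p c) (h ^ n)"
  have I: "is_ideal (?A n)" for n by (intro ideal_with_gen ideal_bI)
  have sub: "?A (Suc n) \<subseteq> ?A n" for n by (intro with_gen_least I with_gen_sub ideal_bI) (simp add: with_gen_gen ideal_bI)
  have t: "ind UNIV (?A (Suc n)) = ind UNIV (?A n) * ind (?A n) (?A (Suc n))" for n
    by (rule ind_tower[OF ideal_subgp[OF I] ideal_subgp[OF I] subgp_UNIV sub]) simp
  have pos: "ind (?A n) (?A (Suc n)) > 0" for n using t[of n] fin_with_gen[of "h ^ Suc n"] by (cases "ind (?A n) (?A (Suc n))") auto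
  define B where "B = {x \<in> ?A n. h * x \<in> ?A (Suc (Suc n))}"
  have sB: "is_subgp B" unfolding B_def by (rule is_subgpI; unfold mem_Collect_eq mult_zero_right right_diff_distrib)
      (blast intro: ideal_0[OF I] ideal_diff[OF I])+
  have AB: "?A (Suc n) \<subseteq> B"
  proof
    fix x assume x: "x \<in> ?A (Suc n)"
    then obtain r where "x - r * h ^ Suc n \<in> bI p c" by (auto simp: with_gen_def)
    hence "h * (x - r * h ^ Suc n) \<in> bI p c" by (rule ideal_mult[OF ideal_bI])
    hence "h * x \<in> ?A (Suc (Suc n))" by (auto simp: with_gen_def algebra_simps)
    thus "x \<in> B" using x sub unfolding B_def by blast
  qed
  have "ind (?A n) (?A (Suc n)) = ind (?A n) B * ind B (?A (Suc n))"
    by (rule ind_tower[OF ideal_subgp[OF I] sB ideal_subgp[OF I] AB]) (auto simp: B_def)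
  moreover have "ind (?A n) B = ind (?A (Suc n)) (?A (Suc (Suc n)))"
  proof (rule ind_eqI[where \<phi> = "\<lambda>x. h * x", OF sB ideal_subgp[OF I]])
    show "h * x \<in> ?A (Suc n)" if x: "x \<in> ?A n" for x
    proof -
      obtain r where "x - r * h ^ n \<in> bI p c" using x by (auto simp: with_gen_def)
      hence "h * (x - r * h ^ n) \<in> bI p c" by (rule ideal_mult[OF ideal_bI])
      thus ?thesis by (auto simp: with_gen_def algebra_simps)
    qed
    show "h * x - h * y \<in> ?A (Suc (Suc n)) \<longleftrightarrow> x - y \<in> B" if "x \<in> ?A n" "y \<in> ?A n" for x y
      using that by (auto simp: B_def right_diff_distrib intro: ideal_diff[OF I])
    show "\<exists>x\<in>?A n. y - h * x \<in> ?A (Suc (Suc n))" if y: "y \<in> ?A (Suc n)" for y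
    proof -
      obtain r where "y - r * h ^ Suc n \<in> bI p c" using y by (auto simp: with_gen_def)
      hence "y - h * (r * h ^ n) \<in> ?A (Suc (Suc n))" using with_gen_sub[OF ideal_bI] by (auto simp: ac_simps)
      thus ?thesis using with_gen_gen[OF ideal_bI] by blast
    qed
  qed
  ultimately have "ind (?A (Suc n)) (?A (Suc (Suc n))) <= ind (?A n) (?A (Suc n))" using pos[of n] by (cases "ind B (?A (Suc n))") auto
  hence "log p (ind (?A (Suc n)) (?A (Suc (Suc n)))) <= log p (ind (?A n) (?A (Suc n)))"
    using p1 pos[of n] pos[of "Suc n"] by (simp del: power_Suc)
  moreover have L: "log p (ind (?A n) (?A (Suc n))) = LD p c h (Suc n) - LD p c h n" for n
    unfolding LD_def ldim_def t[of n] using p1 pos fin_with_gen[of "h ^ n"] by (simp add: log_mult_pos)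
  ultimately show ?thesis using L[of n] L[of "Suc n"] by simp
qed

text \<open>By concavity the first n + 1 increments are each at least the last of them, and together
  they cannot exceed the total dimension.\<close>

lemma LD_step_bound:
  assumes p: "prime p" and c: "\<And>i. i \<ge> N ==> c i = 1"
  shows "real (n + 1) * (LD p c h (n + 1) - LD p c h n) <= real (\<Prod>i<N. c i)"
proof -
  interpret gf_module "bI p c" h p by (rule gf_module_bI[OF p c])
  let ?\<delta> = "\<lambda>n. LD p c h (n + 1) - LD p c h n"
  have dec: "?\<delta> n <= ?\<delta> k" if "k <= n" for k using that
  proof (induction n rule: dec_induct)
    case (step n) thus ?case using LD_concave[OF p, of N c, where h = h and n = n] c by fastforce
  qed simp
  have "real (n + 1) * ?\<delta> n = (\<Sum>k<Suc n. ?\<delta> n)" by simp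
  also have "... <= (\<Sum>k<Suc n. ?\<delta> k)" by (rule sum_mono) (use dec in auto)
  also have "... = LD p c h (Suc n) - LD p c h 0" using sum_lessThan_telescope[of "LD p c h" "Suc n"] by simp
  also have "... <= LD p c h (Suc n)" using LD_nonneg[OF p, of N c, where h = h and s = 0] c by fastforce
  also have "... <= ldim p (bI p c)"
  proof -
    have "ind UNIV (bI p c) = ind UNIV (with_gen (bI p c) (h ^ Suc n)) * ind (with_gen (bI p c) (h ^ Suc n)) (bI p c)"
      by (intro ind_tower ideal_subgp ideal_with_gen ideal_bI with_gen_sub subgp_UNIV) auto
    hence "ind UNIV (with_gen (bI p c) (h ^ Suc n)) <= ind UNIV (bI p c)" using fin by (cases "ind (with_gen (bI p c) (h ^ Suc n)) (bI p c)") auto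
    thus ?thesis unfolding LD_def ldim_def using p1 fin_with_gen[of "h ^ Suc n"] by simp
  qed
  also have "ldim p (bI p c) = real (\<Prod>i<N. c i)" by (rule ldim_bI[OF p c])
  finally show ?thesis .
qed

text \<open>The intervals bounded by the two normalized dimensions are nested because raising to the
  power \<open>p\<close> multiplies dimensions by \<open>p\<^sup>d\<close>.\<close>

lemma nested_limit:
  assumes p: "prime p" "p > 2"
  obtains l where "(\<lambda>e. LD p (cV d (p ^ e)) h ((p ^ e - 1) div 2) / real p ^ (e * d)) \<longlonglongrightarrow> l"
    "(\<lambda>e. LD p (cV d (p ^ e)) h ((p ^ e + 1) div 2) / real p ^ (e * d)) \<longlonglongrightarrow> l"
    "\<bar>l - LD p (cV d p) h ((p - 1) div 2) / real p ^ d\<bar> <= 2 / real p"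
proof -
  define M where "M e = (p ^ e - 1) div 2" for e
  have od: "odd p" using prime_odd_nat[OF p(1)] p(2) by simp
  have pe: "p ^ e = 2 * M e + 1" for e
  proof -
    have "odd (p ^ e)" using od by simp
    thus ?thesis unfolding M_def by (elim oddE) simp
  qed
  have p0: "real p > 1" using p(2) by simp
  have M1: "(p ^ e + 1) div 2 = M e + 1" for e by (simp add: pe)
  define u where "u e = LD p (cV d (p ^ e)) h (M e) / real p ^ (e * d)" for e
  define w where "w e = LD p (cV d (p ^ e)) h (M e + 1) / real p ^ (e * d)" for e
  have c: "\<And>i. i \<ge> d ==> cV d q i = 1" for q by (simp add: cV_def)
  have qp: "p ^ e > 0" for e using p by simp
  have Fr: "LD p (cV d (p ^ Suc e)) h (p * n) / real p ^ (Suc e * d) = LD p (cV d (p ^ e)) h n / real p ^ (e * d)" for e n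
    using LD_frobenius[OF p(1) qp[of e], of d h n] p0 by (simp add: power_add)
  \<comment> \<open>Since 2 M(e+1) + 1 = p (2 M(e) + 1), the interval from M(e+1) to M(e+1) + 1 lies
    inside \<open>p\<close> times the interval from M(e) to M(e) + 1.\<close>
  have M_Suc: "p * M e <= M (Suc e)" "M (Suc e) + 1 <= p * (M e + 1)" for e
  proof -
    have "2 * M (Suc e) + 1 = p * (2 * M e + 1)" using pe[of "Suc e"] pe[of e] by simp
    hence *: "2 * M (Suc e) + 1 = 2 * (p * M e) + p" by (simp add: algebra_simps)
    show "p * M e <= M (Suc e)" "M (Suc e) + 1 <= p * (M e + 1)" using * p(2) by auto
  qed
  have u: "u e <= u (Suc e)" for e unfolding u_def Fr[of e "M e", symmetric] using p0 by (intro divide_right_mono LD_mono[OF p(1) c] M_Suc) auto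
  have w: "w (Suc e) <= w e" for e unfolding w_def Fr[of e "M e + 1", symmetric] using p0
    by (intro divide_right_mono LD_mono[OF p(1) c] M_Suc) auto
  have uw: "u e <= w e" for e unfolding u_def w_def using p0 by (intro divide_right_mono LD_mono[OF p(1) c]) auto
  \<comment> \<open>M(e) is about half of p^e, so the bound on a single increment becomes 2/p^e
    after normalisation.\<close>
  have gap: "w e - u e <= 2 / real p ^ e" for e
  proof -
    have "real (M e + 1) * (LD p (cV d (p ^ e)) h (M e + 1) - LD p (cV d (p ^ e)) h (M e)) <= real (\<Prod>i<d. cV d (p ^ e) i)"
      by (rule LD_step_bound[OF p(1) c])
    also have "(\<Prod>i<d. cV d (p ^ e) i) = (p ^ e) ^ d" by (simp add: cV_def)
    finally have "real (M e + 1) * (w e - u e) <= 1"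
      using p0 by (simp add: w_def u_def diff_divide_distrib[symmetric] power_mult[symmetric] divide_le_eq)
    moreover have "real p ^ e <= 2 * real (M e + 1)"
    proof -
      have "real (p ^ e) = real (2 * M e + 1)" by (simp only: pe[of e])
      thus ?thesis by simp
    qed
    hence "real p ^ e * (w e - u e) <= 2 * real (M e + 1) * (w e - u e)" using uw[of e] by (intro mult_right_mono) auto
    moreover have "2 * real (M e + 1) * (w e - u e) = 2 * (real (M e + 1) * (w e - u e))" by simp
    ultimately have "real p ^ e * (w e - u e) <= 2" by linarith
    thus ?thesis using p0 by (simp add: field_simps)
  qed
  have inc: "incseq u" using u by (rule incseq_SucI)
  have dec: "decseq w" using w by (rule decseq_SucI)
  have ub: "u e <= w 0" for e using uw[of e] decseqD[OF dec, of 0 e] by simp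
  obtain l where l: "u \<longlonglongrightarrow> l" "\<And>e. u e <= l" using incseq_convergent[OF inc] ub by metis
  have "1 / real p < 1" using p0 by simp
  hence "(\<lambda>e. 2 / real p ^ e) \<longlonglongrightarrow> 0"
    using tendsto_mult_right_zero[OF LIMSEQ_power_zero[of "1 / real p"], of 2] by (simp add: power_one_over)
  hence "(\<lambda>e. w e - u e) \<longlonglongrightarrow> 0"
    by (rule tendsto_sandwich[OF _ _ tendsto_const, rotated -1]) (use uw gap in \<open>auto intro!: always_eventually\<close>)
  from tendsto_add[OF this l(1)] have wl: "w \<longlonglongrightarrow> l" by simp
  have "l <= w 1" using decseq_ge[OF dec wl] .
  hence "\<bar>l - u 1\<bar> <= 2 / real p" using l(2)[of 1] gap[of 1] by simp
  hence "\<bar>l - LD p (cV d p) h ((p - 1) div 2) / real p ^ d\<bar> <= 2 / real p" by (simp add: u_def M_def)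
  moreover have "(\<lambda>e. LD p (cV d (p ^ e)) h ((p ^ e - 1) div 2) / real p ^ (e * d)) = u" by (simp add: u_def M_def fun_eq_iff)
  moreover have "(\<lambda>e. LD p (cV d (p ^ e)) h ((p ^ e + 1) div 2) / real p ^ (e * d)) = w" by (simp only: w_def M1 fun_eq_iff simp_thms)
  ultimately show ?thesis using that[of l] l(1) wl by simp
qed

subsection \<open>Leading exponents and division\<close>

abbreviation supp :: "expo => nat set" where "supp \<equiv> Poly_Mapping.keys"

definition deg :: "expo => nat" where "deg \<alpha> = sum (ex \<alpha>) (supp \<alpha>)"

lemma supp_add: "supp (\<alpha> + \<beta>) = supp \<alpha> \<union> supp (\<beta> :: expo)"
  by (auto simp: in_keys_iff lookup_add)

lemma deg_eq: "finite V ==> supp \<alpha> \<subseteq> V ==> deg \<alpha> = sum (ex \<alpha>) V"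
  unfolding deg_def by (rule sum.mono_neutral_left) (auto simp: in_keys_iff)

lemma deg_add: "deg (\<alpha> + \<beta>) = deg \<alpha> + deg \<beta>"
proof -
  have "finite (supp \<alpha> \<union> supp \<beta>)" by simp
  thus ?thesis by (simp add: deg_eq[of "supp \<alpha> \<union> supp \<beta>"] supp_add lookup_add sum.distrib)
qed

lemma lookup_le_deg: "ex \<alpha> i <= deg \<alpha>"
  by (cases "i \<in> supp \<alpha>") (auto simp: deg_def in_keys_iff intro: member_le_sum)

lemma finite_deg_le: "finite V ==> finite {\<alpha>. supp \<alpha> \<subseteq> V \<and> deg \<alpha> <= n}"
proof (rule finite_subset)
  assume V: "finite V"
  show "{\<alpha>. supp \<alpha> \<subseteq> V \<and> deg \<alpha> <= n} \<subseteq> {\<alpha>. \<forall>i. ex \<alpha> i <= ex (\<Sum>i\<in>V. sng i n) i}"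
  proof (intro subsetI CollectI allI)
    fix \<alpha> i assume a: "\<alpha> \<in> {\<alpha>. supp \<alpha> \<subseteq> V \<and> deg \<alpha> <= n}"
    show "ex \<alpha> i <= ex (\<Sum>i\<in>V. sng i n) i"
    proof (cases "i \<in> V")
      case True
      have "ex (\<Sum>i\<in>V. sng i n) i = (\<Sum>j\<in>V. if j = i then n else 0)" by (simp add: lookup_sum lookup_single when_def)
      thus ?thesis using True V a lookup_le_deg[of \<alpha> i] by simp
    next
      case False
      thus ?thesis using a by (metis (no_types, lifting) in_keys_iff mem_Collect_eq subsetD zero_le)
    qed
  qed
  show "finite {\<alpha>::expo. \<forall>i. ex \<alpha> i <= ex (\<Sum>i\<in>V. sng i n) i}" by (rule finite_le_expo)
qed

text \<open>Degree comes first, so that an initial exponent has least degree and measures the order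
  of vanishing; the linear order on exponents breaks ties.\<close>

definition dl :: "expo => expo => bool" where
  "dl \<alpha> \<beta> \<longleftrightarrow> deg \<alpha> < deg \<beta> \<or> deg \<alpha> = deg \<beta> \<and> \<alpha> < \<beta>"

lemma dl_trans: "dl \<alpha> \<beta> ==> dl \<beta> \<gamma> ==> dl \<alpha> \<gamma>" by (auto simp: dl_def)
lemma dl_irrefl: "\<not> dl \<alpha> \<alpha>" by (simp add: dl_def)
lemma dl_total: "\<alpha> = \<beta> \<or> dl \<alpha> \<beta> \<or> dl \<beta> \<alpha>" unfolding dl_def by (metis linorder_less_linear)
lemma dl_add: "dl \<alpha> \<beta> ==> dl (\<gamma> + \<alpha>) (\<gamma> + \<beta>)"
  unfolding dl_def deg_add by (auto intro: add_strict_left_mono)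

text \<open>The position of \<open>\<beta>\<close> in the order. It is finite for finite
  \<open>V\<close>, since only finitely many exponents have bounded degree, and provides the measure
  for recursion.\<close>

definition rk :: "nat set => expo => nat" where "rk V \<beta> = card {\<gamma>. supp \<gamma> \<subseteq> V \<and> dl \<gamma> \<beta>}"

lemma rk_less:
  assumes V: "finite V" and "supp \<alpha> \<subseteq> V" and l: "dl \<alpha> \<beta>"
  shows "rk V \<alpha> < rk V \<beta>"
  unfolding rk_def
proof (rule psubset_card_mono)
  show "finite {\<gamma>. supp \<gamma> \<subseteq> V \<and> dl \<gamma> \<beta>}"
    by (rule finite_subset[OF _ finite_deg_le[OF V, of "deg \<beta>"]]) (auto simp: dl_def)
  have "\<alpha> \<in> {\<gamma>. supp \<gamma> \<subseteq> V \<and> dl \<gamma> \<beta>} - {\<gamma>. supp \<gamma> \<subseteq> V \<and> dl \<gamma> \<alpha>}" using assms dl_irrefl by simp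
  thus "{\<gamma>. supp \<gamma> \<subseteq> V \<and> dl \<gamma> \<alpha>} \<subset> {\<gamma>. supp \<gamma> \<subseteq> V \<and> dl \<gamma> \<beta>}" using dl_trans[OF _ l] by blast
qed

text \<open>The kernel of reduction to F_p[[x_i : i in V]].\<close>

definition KV :: "nat => nat set => mps set" where "KV p V = did (int p) {\<alpha>. supp \<alpha> \<subseteq> V}"

lemma ideal_KV: "is_ideal (KV p V)"
  unfolding KV_def by (rule ideal_did) (auto simp: down_closed_def supp_add)

definition init :: "nat => nat set => mps => expo => bool" where
  "init p V g \<alpha> \<longleftrightarrow> supp \<alpha> \<subseteq> V \<and> \<not> int p dvd coef g \<alpha> \<and>
     (\<forall>\<beta>. supp \<beta> \<subseteq> V --> \<not> int p dvd coef g \<beta> --> \<beta> = \<alpha> \<or> dl \<alpha> \<beta>)"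

lemma init_exists:
  assumes V: "finite V" and g: "g \<notin> KV p V"
  obtains \<alpha> where "init p V g \<alpha>"
proof -
  let ?P = "\<lambda>\<alpha>. supp \<alpha> \<subseteq> V \<and> \<not> int p dvd coef g \<alpha>"
  obtain \<alpha>0 where "?P \<alpha>0" using g by (auto simp: KV_def did_def)
  then obtain \<alpha> where a: "?P \<alpha>" and m: "\<And>\<beta>. ?P \<beta> ==> rk V \<alpha> <= rk V \<beta>"
    using ex_has_least_nat[of ?P \<alpha>0 "rk V"] by blast
  have "\<beta> = \<alpha> \<or> dl \<alpha> \<beta>" if b: "?P \<beta>" for \<beta>
    using dl_total[of \<alpha> \<beta>] rk_less[OF V, of \<beta> \<alpha>] m[OF b] b by auto
  thus ?thesis using a that[of \<alpha>] by (simp add: init_def)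
qed

text \<open>Initial terms multiply: in any other pair of exponents with sum \<alpha> + \<beta> one
  member lies below its initial exponent, which makes that factor divisible by
  \<open>p\<close>.\<close>

lemma KV_mult_coef:
  assumes p: "prime p" and g: "init p V g \<alpha>" and h: "init p V h \<beta>"
  shows "\<not> int p dvd coef (g * h) (\<alpha> + \<beta>)"
proof -
  have *: "int p dvd coef g (fst u) * coef h (snd u)" if u: "u \<in> splits (\<alpha> + \<beta>) - {(\<alpha>, \<beta>)}" for u
  proof (rule ccontr)
    assume nd: "\<not> ?thesis"
    have s: "fst u + snd u = \<alpha> + \<beta>" using u by (simp add: splits_def)
    have "supp (fst u) \<union> supp (snd u) \<subseteq> V" using g h unfolding supp_add[symmetric] s by (simp add: supp_add init_def)
    hence 1: "fst u = \<alpha> \<or> dl \<alpha> (fst u)" and 2: "snd u = \<beta> \<or> dl \<beta> (snd u)"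
      using nd g h unfolding init_def by (meson dvd_mult dvd_mult2 Un_subset_iff)+
    show False
    proof (cases "fst u = \<alpha>")
      case True
      hence "snd u = \<beta>" using s by simp
      hence "u = (\<alpha>, \<beta>)" using True by (simp add: prod_eq_iff)
      thus False using u by simp
    next
      case False
      hence l: "dl (\<alpha> + \<beta>) (fst u + \<beta>)" using 1 dl_add[of \<alpha> "fst u" \<beta>] by (simp add: add.commute)
      show False
      proof (cases "snd u = \<beta>")
        case True thus False using l s dl_irrefl by simp
      next
        case False
        hence "dl (fst u + \<beta>) (fst u + snd u)" using 2 dl_add by blast
        from dl_trans[OF l this] show False using s dl_irrefl by simp
      qed
    qed
  qed
  have "coef (g * h) (\<alpha> + \<beta>) = coef g \<alpha> * coef h \<beta> + (\<Sum>u\<in>splits (\<alpha> + \<beta>) - {(\<alpha>, \<beta>)}. coef g (fst u) * coef h (snd u))"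
    unfolding coef_mult using sum.remove[OF finite_splits, of "(\<alpha>, \<beta>)" "\<alpha> + \<beta>" "\<lambda>u. coef g (fst u) * coef h (snd u)"]
    by (simp add: splits_def)
  moreover have "int p dvd (\<Sum>u\<in>splits (\<alpha> + \<beta>) - {(\<alpha>, \<beta>)}. coef g (fst u) * coef h (snd u))" by (rule dvd_sum) (rule *)
  moreover have "\<not> int p dvd coef g \<alpha> * coef h \<beta>" using p g h by (auto simp: init_def prime_dvd_mult_iff)
  ultimately show ?thesis by (simp add: dvd_add_left_iff)
qed

lemma prime_KV:
  assumes p: "prime p" and V: "finite V"
  shows "is_prime (KV p V)"
proof -
  have "1 \<notin> KV p V" using prime_gt_1_nat[OF p] by (auto simp: KV_def did_def coef_1 intro!: exI[of _ 0])
  moreover have "a \<in> KV p V \<or> b \<in> KV p V" if ab: "a * b \<in> KV p V" for a b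
  proof (rule ccontr)
    assume "\<not> ?thesis"
    then obtain \<alpha> \<beta> where i: "init p V a \<alpha>" "init p V b \<beta>" using init_exists[OF V] by metis
    hence "supp (\<alpha> + \<beta>) \<subseteq> V" by (simp add: supp_add init_def)
    thus False using KV_mult_coef[OF p i] ab by (simp add: KV_def did_def)
  qed
  ultimately show ?thesis using ideal_KV by (simp add: is_prime_def)
qed

text \<open>Representatives in [0, p), so that coefficients divisible by \<open>p\<close> are
  literally 0, as the support conditions in \<open>division\<close> require.\<close>

definition rd :: "nat => nat set => mps => mps" where
  "rd p V f = Mps (\<lambda>\<alpha>. if supp \<alpha> \<subseteq> V then coef f \<alpha> mod int p else 0)"

lemma coef_rd: "coef (rd p V f) \<alpha> = (if supp \<alpha> \<subseteq> V then coef f \<alpha> mod int p else 0)" by (simp add: rd_def)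

lemma rd_KV: "f - rd p V f \<in> KV p V"
  by (auto simp: KV_def did_def coef_rd minus_mod_eq_mult_div)

text \<open>Division by finitely many series \<open>w i\<close> with leading coefficient 1 at \<open>m i\<close>; the quotient is
  built by recursion along \<open>rank\<close>. It covers Hironaka division, Weierstrass division and the
  inversion of units.\<close>

lemma division:
  fixes w :: "nat => mps" and rank :: "expo => nat"
  assumes E: "\<And>\<alpha>. \<alpha> \<in> E ==> \<iota> \<alpha> < s \<and> (\<exists>\<gamma>. \<alpha> = m (\<iota> \<alpha>) + \<gamma>)"
    and lead: "\<And>i. i < s ==> coef (w i) (m i) = 1"
    and rank: "\<And>i \<gamma> \<delta>. i < s ==> m i + \<gamma> \<in> E ==> \<iota> (m i + \<gamma>) = i ==> coef (w i) \<delta> \<noteq> 0 ==> \<delta> \<noteq> m i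
        ==> rank (m i + \<gamma>) < rank (\<gamma> + \<delta>)"
    and Z: "\<And>\<beta>. Z \<beta> ==> coef f \<beta> = 0"
    and Zd: "\<And>i \<gamma> \<delta>. i < s ==> coef (w i) \<delta> \<noteq> 0 ==> Z (\<gamma> + \<delta>) ==> Z (m i + \<gamma>)"
  obtains a where "\<And>\<beta>. \<beta> \<in> E ==> coef (f - (\<Sum>i<s. a i * w i)) \<beta> = 0"
    "\<And>i \<gamma>. coef (a i) \<gamma> \<noteq> 0 ==> \<not> Z (m i + \<gamma>)"
proof -
  define act where "act i \<gamma> \<longleftrightarrow> m i + \<gamma> \<in> E \<and> \<iota> (m i + \<gamma>) = i" for i \<gamma>
  \<comment> \<open>For \<beta> in \<open>E\<close>, \<open>b \<beta>\<close> is the coefficient at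
    \<gamma> of the quotient with index i = \<open>\<iota> \<beta>\<close>, where \<beta> = m i +
    \<gamma>. It is the coefficient of \<open>f\<close> at \<beta> less the contributions of
    quotient coefficients of smaller rank.\<close>
  define F where "F b \<beta> = coef f \<beta> - (\<Sum>i<s. \<Sum>u\<in>splits \<beta>.
      (if act i (fst u) \<and> m i + fst u \<noteq> \<beta> \<and> coef (w i) (snd u) \<noteq> 0 then b (m i + fst u) * coef (w i) (snd u) else 0))" for b \<beta>
  define b where "b = wfrec (Wellfounded.measure rank) F"
  have b: "b \<beta> = F b \<beta>" for \<beta>
  proof -
    have "b \<beta> = F (cut b (Wellfounded.measure rank) \<beta>) \<beta>" unfolding b_def by (rule wfrec) simp
    also have "... = F b \<beta>"
    proof -
      have "cut b (Wellfounded.measure rank) \<beta> (m i + fst u) = b (m i + fst u)"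
        if "i < s" "u \<in> splits \<beta>" "act i (fst u)" "m i + fst u \<noteq> \<beta>" "coef (w i) (snd u) \<noteq> 0" for i u
      proof -
        have s: "fst u + snd u = \<beta>" using that by (simp add: splits_def)
        hence "snd u \<noteq> m i" using that by (metis add.commute)
        hence "rank (m i + fst u) < rank \<beta>" using rank[OF that(1) _ _ that(5)] that(3) unfolding act_def s[symmetric] by blast
        thus ?thesis by (simp add: cut_def)
      qed
      thus ?thesis unfolding F_def by (intro arg_cong2[where f = "(-)"] refl sum.cong) (auto split: if_splits)
    qed
    finally show ?thesis .
  qed
  define a where "a i = Mps (\<lambda>\<gamma>. if act i \<gamma> \<and> i < s then b (m i + \<gamma>) else 0)" for i
  have fin: "finite {u. fst u + snd u = \<beta>}" for \<beta> :: expo using finite_splits[of \<beta>] by (simp add: splits_def)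
  have "coef (f - (\<Sum>i<s. a i * w i)) \<beta> = 0" if be: "\<beta> \<in> E" for \<beta>
  proof -
    obtain \<gamma>0 where i0: "\<iota> \<beta> < s" and g0: "\<beta> = m (\<iota> \<beta>) + \<gamma>0" using E[OF be] by blast
    let ?t = "\<lambda>i u. if act i (fst u) \<and> m i + fst u \<noteq> \<beta> \<and> coef (w i) (snd u) \<noteq> 0 then b (m i + fst u) * coef (w i) (snd u) else 0"
    let ?e = "\<lambda>i u. if i = \<iota> \<beta> \<and> u = (\<gamma>0, m i) then b \<beta> else 0"
    have t: "coef (a i) (fst u) * coef (w i) (snd u) = ?t i u + ?e i u"
      if "i < s" "u \<in> splits \<beta>" for i u
    proof (cases "m i + fst u = \<beta>")
      case True
      have su: "snd u = m i" using True that(2) by (simp add: splits_def) (metis add.commute add_left_cancel)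
      have "(i = \<iota> \<beta> \<and> u = (\<gamma>0, m i)) \<longleftrightarrow> act i (fst u)"
        using True be su g0 by (auto simp: act_def prod_eq_iff)
      thus ?thesis using True that su lead[OF that(1)] by (simp add: a_def)
    next
      case False
      hence "\<not> (i = \<iota> \<beta> \<and> u = (\<gamma>0, m i))" using g0 by auto
      thus ?thesis using False that by (auto simp: a_def)
    qed
    have "coef (\<Sum>i<s. a i * w i) \<beta> = (\<Sum>i<s. \<Sum>u\<in>splits \<beta>. ?t i u + ?e i u)"
      unfolding coef_sum coef_mult by (intro sum.cong refl t) auto
    also have "... = (\<Sum>i<s. \<Sum>u\<in>splits \<beta>. ?t i u) + (\<Sum>i<s. \<Sum>u\<in>splits \<beta>. ?e i u)"
      by (simp only: sum.distrib)
    also have "(\<Sum>i<s. \<Sum>u\<in>splits \<beta>. ?e i u) = (\<Sum>i<s. if i = \<iota> \<beta> then b \<beta> else 0)"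
    proof (intro sum.cong refl)
      fix i
      have "(\<gamma>0, m (\<iota> \<beta>)) \<in> splits \<beta>" using g0 by (simp add: splits_def add.commute)
      thus "(\<Sum>u\<in>splits \<beta>. ?e i u) = (if i = \<iota> \<beta> then b \<beta> else 0)" by (cases "i = \<iota> \<beta>") simp_all
    qed
    also have "... = b \<beta>" using i0 by simp
    finally show ?thesis using b[of \<beta>] by (simp add: F_def)
  qed
  \<comment> \<open>Vanishing of \<open>f\<close> on \<open>Z\<close> passes to the quotients. With
    \<open>Z\<close> a degree bound this is the control of orders that Artin-Rees needs.\<close>
  moreover have bZ: "Z \<beta> ==> b \<beta> = 0" for \<beta>
  proof (induction "rank \<beta>" arbitrary: \<beta> rule: less_induct)
    case less
    have "(if act i (fst u) \<and> m i + fst u \<noteq> \<beta> \<and> coef (w i) (snd u) \<noteq> 0 then b (m i + fst u) * coef (w i) (snd u) else 0) = 0"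
      if "i < s" "u \<in> splits \<beta>" for i u
    proof -
      have s: "fst u + snd u = \<beta>" using that by (simp add: splits_def)
      have "b (m i + fst u) = 0" if *: "act i (fst u)" "m i + fst u \<noteq> \<beta>" "coef (w i) (snd u) \<noteq> 0"
      proof (rule less.hyps)
        have "snd u \<noteq> m i" using * s by (metis add.commute)
        thus "rank (m i + fst u) < rank \<beta>" using rank[OF \<open>i < s\<close> _ _ *(3)] *(1) unfolding act_def s[symmetric] by blast
        show "Z (m i + fst u)" using Zd[OF \<open>i < s\<close> *(3), of "fst u"] less.prems by (simp add: s)
      qed
      thus ?thesis by simp
    qed
    thus ?case unfolding b[of \<beta>] F_def using Z[OF less.prems] by simp
  qed
  have "coef (a i) \<gamma> \<noteq> 0 ==> \<not> Z (m i + \<gamma>)" for i \<gamma> using bZ by (auto simp: a_def split: if_splits)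
  ultimately show ?thesis using that by blast
qed

lemma inverse_mod: assumes "prime p" "\<not> int p dvd c" obtains u where "(u * c) mod int p = 1"
proof -
  have "coprime c (int p)" using prime_imp_coprime[of "int p" c] assms by (simp add: coprime_commute)
  then obtain u where "[c * u = 1] (mod int p)" using cong_solve_coprime_int by blast
  hence "(u * c) mod int p = 1 mod int p" by (simp add: cong_def mult.commute)
  thus ?thesis using that prime_gt_1_nat[OF assms(1)] by simp
qed

text \<open>The geometric series, obtained as division of 1 by a single series with leading exponent
  0.\<close>

lemma unit_KV:
  assumes p: "prime p" and V: "finite V" and f: "\<not> int p dvd coef f 0"
  obtains a where "a * f - 1 \<in> KV p V"
proof -
  obtain u where u: "(u * coef f 0) mod int p = 1" using inverse_mod[OF p f] .
  define w where "w = rd p V (of_int u * f)"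
  obtain a :: "nat => mps" where a: "\<And>\<beta>. \<beta> \<in> {\<alpha>. supp \<alpha> \<subseteq> V} ==> coef (1 - (\<Sum>i<Suc 0. a i * w)) \<beta> = 0"
  proof (rule division[where E = "{\<alpha>. supp \<alpha> \<subseteq> V}" and \<iota> = "\<lambda>_. 0" and s = "Suc 0" and m = "\<lambda>_. 0" and w = "\<lambda>_. w" and rank = deg and Z = "\<lambda>_. False" and f = 1])
    show "0 < Suc 0 \<and> (\<exists>\<gamma>. \<alpha> = 0 + \<gamma>)" for \<alpha> :: expo by simp
    show "coef w 0 = 1" unfolding w_def using u by (simp add: coef_rd del: coef_0_mult)
    show "deg (0 + \<gamma>) < deg (\<gamma> + \<delta>)" if "\<delta> \<noteq> 0" for \<gamma> \<delta>
    proof -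
      obtain i where "ex \<delta> i \<noteq> 0" using poly_mapping_eqI[of \<delta> 0] \<open>\<delta> \<noteq> 0\<close> by auto
      hence "deg \<delta> \<noteq> 0" using lookup_le_deg[of \<delta> i] by simp
      thus ?thesis by (simp add: deg_add)
    qed
  qed simp_all
  have "a 0 * w - 1 \<in> KV p V" using a by (simp add: KV_def did_def dvd_diff_commute)
  hence "(a 0 * w - 1) + a 0 * (of_int u * f - w) \<in> KV p V" by (intro ideal_add[OF ideal_KV] ideal_mult[OF ideal_KV]) (simp_all add: w_def rd_KV)
  thus ?thesis using that[of "a 0 * of_int u"] by (simp add: algebra_simps)
qed

text \<open>Induction on the variables. Forgetting \<open>v\<close> leaves finitely many candidates,
  which suffice once the exponent of \<open>v\<close> is large; the finitely many layers with a
  smaller exponent are treated separately.\<close>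

lemma dickson:
  assumes "finite V" "E \<subseteq> {\<alpha>::expo. supp \<alpha> \<subseteq> V}"
  shows "\<exists>F\<subseteq>E. finite F \<and> (\<forall>\<alpha>\<in>E. \<exists>\<mu>\<in>F. \<forall>i. ex \<mu> i <= ex \<alpha> i)"
  using assms
proof (induction V arbitrary: E rule: finite_induct)
  case empty
  hence "E \<subseteq> {0}" by auto
  thus ?case by (intro exI[of _ E]) (auto dest: finite_subset)
next
  case (insert v V)
  define \<pi> where "\<pi> \<alpha> = \<alpha> - sng v (ex \<alpha> v)" for \<alpha> :: expo
  have ex\<pi>: "ex (\<pi> \<alpha>) i = (if i = v then 0 else ex \<alpha> i)" for \<alpha> i by (simp add: \<pi>_def lookup_minus lookup_single when_def)
  have sub: "\<exists>G\<subseteq>D. finite G \<and> (\<forall>\<alpha>\<in>D. \<exists>\<mu>\<in>G. \<forall>i. i \<noteq> v --> ex \<mu> i <= ex \<alpha> i)" if D: "D \<subseteq> E" for D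
  proof -
    have "\<pi> ` D \<subseteq> {\<alpha>. supp \<alpha> \<subseteq> V}"
    proof (intro image_subsetI CollectI subsetI)
      fix \<alpha> i assume a: "\<alpha> \<in> D" "i \<in> supp (\<pi> \<alpha>)"
      hence "i \<noteq> v" "i \<in> supp \<alpha>" by (auto simp: in_keys_iff ex\<pi> split: if_splits)
      thus "i \<in> V" using a D insert.prems by blast
    qed
    from insert.IH[OF this] obtain F where F: "F \<subseteq> \<pi> ` D" "finite F" "\<forall>\<alpha>\<in>\<pi> ` D. \<exists>\<mu>\<in>F. \<forall>i. ex \<mu> i <= ex \<alpha> i" by blast
    obtain G where G: "G \<subseteq> D" "finite G" "F = \<pi> ` G" using finite_subset_image[OF F(2,1)] by blast
    have "\<exists>\<mu>\<in>G. \<forall>i. i \<noteq> v --> ex \<mu> i <= ex \<alpha> i" if "\<alpha> \<in> D" for \<alpha>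
    proof -
      have "\<exists>\<mu>\<in>G. \<forall>i. ex (\<pi> \<mu>) i <= ex (\<pi> \<alpha>) i" using F(3) that unfolding G(3) by blast
      thus ?thesis unfolding ex\<pi> by metis
    qed
    thus ?thesis using G by blast
  qed
  obtain F1 where F1: "F1 \<subseteq> E" "finite F1" "\<forall>\<alpha>\<in>E. \<exists>\<mu>\<in>F1. \<forall>i. i \<noteq> v --> ex \<mu> i <= ex \<alpha> i" using sub[of E] by blast
  define N where "N = Max (insert 0 ((\<lambda>\<mu>. ex \<mu> v) ` F1))"
  have N: "\<mu> \<in> F1 ==> ex \<mu> v <= N" for \<mu> unfolding N_def using F1(2) by simp
  have "\<forall>k. \<exists>G\<subseteq>{\<alpha>\<in>E. ex \<alpha> v = k}. finite G \<and> (\<forall>\<alpha>\<in>{\<alpha>\<in>E. ex \<alpha> v = k}. \<exists>\<mu>\<in>G. \<forall>i. i \<noteq> v --> ex \<mu> i <= ex \<alpha> i)"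
    by (intro allI sub) blast
  from choice[OF this] obtain G where G0: "\<forall>k. G k \<subseteq> {\<alpha>\<in>E. ex \<alpha> v = k} \<and> finite (G k) \<and>
    (\<forall>\<alpha>\<in>{\<alpha>\<in>E. ex \<alpha> v = k}. \<exists>\<mu>\<in>G k. \<forall>i. i \<noteq> v --> ex \<mu> i <= ex \<alpha> i)" ..
  have G: "\<And>k. G k \<subseteq> {\<alpha>\<in>E. ex \<alpha> v = k}" "\<And>k. finite (G k)"
    "\<And>k \<alpha>. \<alpha> \<in> E ==> ex \<alpha> v = k ==> \<exists>\<mu>\<in>G k. \<forall>i. i \<noteq> v --> ex \<mu> i <= ex \<alpha> i" using G0 by simp_all
  have "\<exists>\<mu>\<in>F1 \<union> (\<Union>k<N. G k). \<forall>i. ex \<mu> i <= ex \<alpha> i" if a: "\<alpha> \<in> E" for \<alpha>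
  proof (cases "ex \<alpha> v < N")
    case True
    obtain \<mu> where mu: "\<mu> \<in> G (ex \<alpha> v)" "\<forall>i. i \<noteq> v --> ex \<mu> i <= ex \<alpha> i" using G(3)[OF a refl] by blast
    hence "ex \<mu> v = ex \<alpha> v" using G(1) by blast
    hence "ex \<mu> i <= ex \<alpha> i" for i using mu(2) by (cases "i = v") auto
    thus ?thesis using mu(1) True by blast
  next
    case False
    obtain \<mu> where mu: "\<mu> \<in> F1" "\<forall>i. i \<noteq> v --> ex \<mu> i <= ex \<alpha> i" using F1(3) a by blast
    hence "ex \<mu> v <= ex \<alpha> v" using N[OF mu(1)] False by simp
    hence "ex \<mu> i <= ex \<alpha> i" for i using mu(2) by (cases "i = v") auto
    thus ?thesis using mu(1) by blast
  qed
  moreover have "F1 \<union> (\<Union>k<N. G k) \<subseteq> E" "finite (F1 \<union> (\<Union>k<N. G k))" using F1(1,2) G(1,2) by blast+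
  ultimately show ?case by blast
qed

subsection \<open>Krull dimension\<close>

text \<open>The preimage of the n-th power of the maximal ideal of F_p[[x_i : i in V]].\<close>

definition mI :: "nat => nat set => nat => mps set" where
  "mI p V n = did (int p) {\<alpha>. supp \<alpha> \<subseteq> V \<and> deg \<alpha> < n}"

lemma ideal_mI: "is_ideal (mI p V n)"
  unfolding mI_def by (rule ideal_did) (auto simp: down_closed_def supp_add deg_add)

definition isum :: "'a::comm_ring_1 set => 'a set => 'a set" where
  "isum I J = {y. \<exists>a\<in>I. y - a \<in> J}"

lemma ideal_isum: assumes I: "is_ideal I" and J: "is_ideal J" shows "is_ideal (isum I J)"
proof (rule is_idealI)
  show "0 \<in> isum I J" unfolding isum_def using ideal_0[OF I] ideal_0[OF J] by (intro CollectI bexI[of _ 0]) auto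
  show "x + y \<in> isum I J" if x: "x \<in> isum I J" and y: "y \<in> isum I J" for x y
  proof -
    obtain a b where ab: "a \<in> I" "x - a \<in> J" "b \<in> I" "y - b \<in> J" using x y by (auto simp: isum_def)
    have "(x - a) + (y - b) \<in> J" by (intro ideal_add[OF J] ab)
    hence "x + y - (a + b) \<in> J" by (simp add: algebra_simps)
    thus ?thesis using ideal_add[OF I ab(1,3)] by (auto simp: isum_def)
  qed
  show "r * x \<in> isum I J" if x: "x \<in> isum I J" for r x
  proof -
    obtain a where a: "a \<in> I" "x - a \<in> J" using x by (auto simp: isum_def)
    hence "r * x - r * a \<in> J" using ideal_mult[OF J, of "x - a" r] by (simp add: algebra_simps)
    thus ?thesis using ideal_mult[OF I a(1)] by (auto simp: isum_def)
  qed
qed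

lemma isum_sub1: "is_ideal J ==> I \<subseteq> isum I J"
  unfolding isum_def by (intro subsetI CollectI bexI) (auto intro: ideal_0)
lemma isum_sub2: "is_ideal I ==> J \<subseteq> isum I J" using ideal_0[of I] by (force simp: isum_def)
lemma isum_mono: "I \<subseteq> I' ==> J \<subseteq> J' ==> isum I J \<subseteq> isum I' J'" by (auto simp: isum_def)

text \<open>The standard basis of \<open>P + (x)\<close> controls the orders of the quotients, which gives the
  Artin--Rees property with an explicit constant.\<close>

lemma artin_rees:
  assumes p: "prime p" and V: "finite V" and P: "is_prime P" "KV p V \<subseteq> P" and x: "x \<notin> P"
  obtains c where "\<And>n y. x * y \<in> isum P (mI p V n) ==> y \<in> isum P (mI p V (n - c))"
proof -
  have iP: "is_ideal P" by (rule prime_ideal[OF P(1)])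
  define J where "J = with_gen P x"
  have iJ: "is_ideal J" unfolding J_def by (rule ideal_with_gen[OF iP])
  have PJ: "P \<subseteq> J" unfolding J_def by (rule with_gen_sub[OF iP])
  define E where "E = {\<alpha>. \<exists>g\<in>J. init p V g \<alpha>}"
  have "E \<subseteq> {\<alpha>. supp \<alpha> \<subseteq> V}" by (auto simp: E_def init_def)
  from dickson[OF V this] obtain F where F: "F \<subseteq> E" "finite F" "\<And>\<alpha>. \<alpha> \<in> E ==> \<exists>\<mu>\<in>F. \<forall>i. ex \<mu> i <= ex \<alpha> i" by blast
  obtain m where m: "bij_betw m {0..<card F} F" using ex_bij_betw_nat_finite[OF F(2)] by blast
  define s where "s = card F"
  have mE: "i < s ==> m i \<in> E" for i using m F(1) by (auto simp: s_def bij_betw_def)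
  have "\<exists>w. w \<in> J \<and> coef w (m i) = 1 \<and> (\<forall>\<delta>. coef w \<delta> \<noteq> 0 --> supp \<delta> \<subseteq> V \<and> (\<delta> = m i \<or> dl (m i) \<delta>))" if i: "i < s" for i
  proof -
    obtain g where g: "g \<in> J" "init p V g (m i)" using mE[OF i] by (auto simp: E_def)
    hence nd: "\<not> int p dvd coef g (m i)" by (simp add: init_def)
    obtain u where u: "(u * coef g (m i)) mod int p = 1" using inverse_mod[OF p nd] .
    define w where "w = rd p V (of_int u * g)"
    have "of_int u * g - (of_int u * g - w) \<in> J"
      unfolding w_def by (intro ideal_diff[OF iJ] ideal_mult[OF iJ g(1)] subsetD[OF PJ] subsetD[OF P(2)] rd_KV)
    hence "w \<in> J" by simp
    moreover have "coef w (m i) = 1" using g(2) u by (simp add: w_def coef_rd init_def)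
    moreover have "supp \<delta> \<subseteq> V \<and> (\<delta> = m i \<or> dl (m i) \<delta>)" if "coef w \<delta> \<noteq> 0" for \<delta>
    proof -
      have s: "supp \<delta> \<subseteq> V" "(u * coef g \<delta>) mod int p \<noteq> 0" using that by (auto simp: w_def coef_rd split: if_splits)
      hence "\<not> int p dvd coef g \<delta>" by auto
      thus ?thesis using s g(2) by (simp add: init_def)
    qed
    ultimately show ?thesis by blast
  qed
  then obtain w where w: "\<And>i. i < s ==> w i \<in> J" "\<And>i. i < s ==> coef (w i) (m i) = 1"
    "\<And>i \<delta>. i < s ==> coef (w i) \<delta> \<noteq> 0 ==> supp \<delta> \<subseteq> V \<and> (\<delta> = m i \<or> dl (m i) \<delta>)" by metis
  have "\<forall>i. \<exists>y. i < s --> w i - y * x \<in> P" using w(1) by (auto simp: J_def with_gen_def)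
  then obtain y where y: "\<And>i. i < s ==> w i - y i * x \<in> P" by metis
  have "\<exists>i<s. \<exists>\<gamma>. \<alpha> = m i + \<gamma>" if aE: "\<alpha> \<in> E" for \<alpha>
  proof -
    obtain \<mu> where mu: "\<mu> \<in> F" "\<forall>i. ex \<mu> i <= ex \<alpha> i" using F(3)[OF aE] by blast
    then obtain i where "i < s" "m i = \<mu>" using m unfolding s_def bij_betw_def by (metis atLeastLessThan_iff imageE)
    moreover have "\<alpha> = \<mu> + (\<alpha> - \<mu>)" using mu(2) by (intro poly_mapping_eqI) (simp add: lookup_add lookup_minus)
    ultimately show ?thesis by blast
  qed
  then obtain \<iota> where \<iota>: "\<And>\<alpha>. \<alpha> \<in> E ==> \<iota> \<alpha> < s \<and> (\<exists>\<gamma>. \<alpha> = m (\<iota> \<alpha>) + \<gamma>)" by metis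
  \<comment> \<open>The largest degree of a leading exponent in the basis: division by a basis
    element costs at most this much order.\<close>
  define c where "c = Max (insert 0 ((\<lambda>i. deg (m i)) ` {..<s}))"
  have c: "i < s ==> deg (m i) <= c" for i unfolding c_def by simp
  have "yy \<in> isum P (mI p V (n - c))" if yy: "x * yy \<in> isum P (mI p V n)" for n yy
  proof -
    obtain a0 where a0: "a0 \<in> P" "x * yy - a0 \<in> mI p V n" using yy by (auto simp: isum_def)
    define f where "f = rd p V (x * yy - a0)"
    have fP: "(x * yy - a0) - f \<in> P" using P(2) rd_KV by (auto simp: f_def)
    have "x * yy - a0 - (x * yy - a0 - f) \<in> J" using with_gen_gen[OF iP, of yy x] unfolding J_def[symmetric]
      by (intro ideal_diff[OF iJ ideal_diff[OF iJ]] subsetD[OF PJ a0(1)] subsetD[OF PJ fP]) (simp add: mult.commute)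
    hence fJ: "f \<in> J" by simp
    \<comment> \<open>The remainder lies in \<open>J\<close> but has no initial exponent in
      \<open>E\<close>, so it is 0 modulo \<open>KV\<close>. The second property bounds the orders
      of the quotients from below.\<close>
    obtain a where a: "\<And>\<beta>. \<beta> \<in> E ==> coef (f - (\<Sum>i<s. a i * w i)) \<beta> = 0"
      "\<And>i \<gamma>. coef (a i) \<gamma> \<noteq> 0 ==> \<not> deg (m i + \<gamma>) < n"
    proof (rule division[where E = E and \<iota> = \<iota> and s = s and m = m and w = w and rank = "rk V" and Z = "\<lambda>\<beta>. deg \<beta> < n" and f = f])
      show "\<alpha> \<in> E ==> \<iota> \<alpha> < s \<and> (\<exists>\<gamma>. \<alpha> = m (\<iota> \<alpha>) + \<gamma>)" for \<alpha> by (rule \<iota>)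
      show "i < s ==> coef (w i) (m i) = 1" for i by (rule w)
      show "rk V (m i + \<gamma>) < rk V (\<gamma> + \<delta>)" if "i < s" "m i + \<gamma> \<in> E" "\<iota> (m i + \<gamma>) = i" "coef (w i) \<delta> \<noteq> 0" "\<delta> \<noteq> m i" for i \<gamma> \<delta>
      proof (rule rk_less[OF V])
        show "supp (m i + \<gamma>) \<subseteq> V" using that(2) by (auto simp: E_def init_def)
        have "dl (\<gamma> + m i) (\<gamma> + \<delta>)" using w(3)[OF that(1,4)] that(5) by (intro dl_add) blast
        thus "dl (m i + \<gamma>) (\<gamma> + \<delta>)" by (simp add: add.commute)
      qed
      show "coef f \<beta> = 0" if "deg \<beta> < n" for \<beta> using that a0(2) by (auto simp: f_def coef_rd mI_def did_def)
      show "deg (m i + \<gamma>) < n" if "i < s" "coef (w i) \<delta> \<noteq> 0" "deg (\<gamma> + \<delta>) < n" for i \<gamma> \<delta>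
        using w(3)[OF that(1,2)] that(3) by (auto simp: deg_add dl_def)
    qed (use that in blast)
    have "(\<Sum>i<s. a i * w i) \<in> J" by (intro ideal_sum[OF iJ] ideal_mult[OF iJ] w) auto
    hence "f - (\<Sum>i<s. a i * w i) \<in> J" by (intro ideal_diff[OF iJ] fJ)
    moreover have "\<alpha> \<notin> E" if "init p V (f - (\<Sum>i<s. a i * w i)) \<alpha>" for \<alpha>
      using a(1)[of \<alpha>] that unfolding init_def by (metis dvd_0_right)
    ultimately have "f - (\<Sum>i<s. a i * w i) \<in> KV p V" using init_exists[OF V] unfolding E_def by blast
    hence r: "f - (\<Sum>i<s. a i * w i) \<in> P" using P(2) by blast
    define z where "z = (\<Sum>i<s. a i * y i)"
    have "(\<Sum>i<s. a i * (w i - y i * x)) \<in> P" by (intro ideal_sum[OF iP] ideal_mult[OF iP] y) auto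
    hence "(x * yy - a0 - f) + a0 + (f - (\<Sum>i<s. a i * w i)) + (\<Sum>i<s. a i * (w i - y i * x)) \<in> P" by (intro ideal_add[OF iP] fP a0 r)
    moreover have e: "(\<Sum>i<s. a i * (w i - y i * x)) = (\<Sum>i<s. a i * w i) - z * x"
      unfolding z_def by (simp add: right_diff_distrib sum_subtractf sum_distrib_right mult.assoc)
    have "(x * yy - a0 - f) + a0 + (f - (\<Sum>i<s. a i * w i)) + (\<Sum>i<s. a i * (w i - y i * x)) = x * (yy - z)"
      unfolding e by (simp add: algebra_simps)
    \<comment> \<open>Modulo \<open>P\<close> each basis element is \<open>y i\<close> times
      \<open>x\<close>, so the whole expansion is a multiple of \<open>x\<close>, which the prime
      ideal allows to cancel.\<close>
    ultimately have "x * (yy - z) \<in> P" by simp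
    hence "yy - z \<in> P" using prime_mult[OF P(1)] x by blast
    moreover have "a i \<in> mI p V (n - c)" if i: "i < s" for i unfolding mI_def did_def
    proof (intro CollectI ballI)
      fix \<gamma> assume g: "\<gamma> \<in> {\<alpha>. supp \<alpha> \<subseteq> V \<and> deg \<alpha> < n - c}"
      hence "deg (m i + \<gamma>) < n" using c[OF i] by (auto simp: deg_add)
      thus "int p dvd coef (a i) \<gamma>" using a(2)[of i \<gamma>] by fastforce
    qed
    hence "z \<in> mI p V (n - c)" unfolding z_def by (intro ideal_sum[OF ideal_mI] ideal_mult2[OF ideal_mI]) auto
    ultimately show ?thesis unfolding isum_def by (intro CollectI bexI[of _ "yy - z"]) auto
  qed
  thus ?thesis using that by blast
qed

lemma ind_le:
  assumes "is_ideal I" "is_ideal J" "J \<subseteq> I" "ind UNIV J > 0"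
  shows "ind UNIV I <= ind UNIV J" "ind UNIV I > 0"
proof -
  have "ind UNIV J = ind UNIV I * ind I J" using assms by (intro ind_tower ideal_subgp subgp_UNIV) auto
  thus "ind UNIV I <= ind UNIV J" "ind UNIV I > 0" using assms(4) by (auto simp: Suc_le_eq)
qed

text \<open>A monomial of degree below \<open>n\<close> has all exponents below \<open>n\<close>, so
  the box of side \<open>n\<close> bounds the dimension by n^N.\<close>

lemma ind_isum_mI:
  assumes p: "prime p" and P: "is_ideal P"
  shows "ind UNIV (isum P (mI p {..<N} n)) <= p ^ n ^ N" "ind UNIV (isum P (mI p {..<N} n)) > 0"
proof -
  have b: "ind UNIV (bI p (cV N n)) = p ^ n ^ N" using ind_bI[OF prime_gt_0_nat[OF p], of N "cV N n"] by (simp add: cV_def)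
  have "bI p (cV N n) \<subseteq> mI p {..<N} n" unfolding bI_def mI_def did_def
  proof (intro subsetI CollectI ballI)
    fix f \<alpha> assume f: "f \<in> {f. \<forall>\<alpha>\<in>box (cV N n). int p dvd coef f \<alpha>}" and a: "\<alpha> \<in> {\<alpha>. supp \<alpha> \<subseteq> {..<N} \<and> deg \<alpha> < n}"
    have "ex \<alpha> i < cV N n i" for i
    proof (cases "i < N")
      case True thus ?thesis using a lookup_le_deg[of \<alpha> i] by (simp add: cV_def)
    next
      case False
      hence "i \<notin> supp \<alpha>" using a by auto
      thus ?thesis using False by (simp add: cV_def in_keys_iff)
    qed
    thus "int p dvd coef f \<alpha>" using f by (simp add: box_def)
  qed
  hence s: "bI p (cV N n) \<subseteq> isum P (mI p {..<N} n)" using isum_sub2[OF P] by blast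
  show "ind UNIV (isum P (mI p {..<N} n)) <= p ^ n ^ N" "ind UNIV (isum P (mI p {..<N} n)) > 0"
    using ind_le[OF ideal_isum[OF P ideal_mI] ideal_bI s] b prime_gt_0_nat[OF p] by simp_all
qed

text \<open>Put Q = P + m^n. The index of Q is that of Q + (x) times that of (Q : x). The first
  factor is at least the index of P' + m^n because x lies in P', the second at least that of P +
  m^(n-c) by Artin-Rees.\<close>

lemma ind_drop:
  assumes p: "prime p" and P: "is_prime P" "KV p {..<N} \<subseteq> P" and P': "is_ideal P'" "P \<subseteq> P'" "x \<in> P'" "x \<notin> P"
  obtains c where "\<And>n. ind UNIV (isum P' (mI p {..<N} n)) * ind UNIV (isum P (mI p {..<N} (n - c)))
    <= ind UNIV (isum P (mI p {..<N} n))"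
proof -
  let ?m = "mI p {..<N}"
  have iP: "is_ideal P" by (rule prime_ideal[OF P(1)])
  have iS: "is_ideal (isum P (?m n))" for n by (rule ideal_isum[OF iP ideal_mI])
  have pos: "ind UNIV (isum P (?m n)) > 0" for n by (rule ind_isum_mI[OF p iP])
  obtain c where c: "\<And>n y. x * y \<in> isum P (?m n) ==> y \<in> isum P (?m (n - c))" using artin_rees[OF p _ P P'(4)] by blast
  have "ind UNIV (isum P' (?m n)) * ind UNIV (isum P (?m (n - c))) <= ind UNIV (isum P (?m n))" for n
  proof -
    let ?I = "isum P (?m n)" and ?Q = "with_gen (isum P (?m n)) x"
    have iQ: "is_ideal ?Q" by (rule ideal_with_gen[OF iS])
    define C where "C = {y. x * y \<in> ?I}"
    have iC: "is_ideal C" unfolding C_def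
    proof (rule is_idealI; unfold mem_Collect_eq)
      show "x * 0 \<in> ?I" using ideal_0[OF iS] by simp
      show "x * (a + b) \<in> ?I" if "x * a \<in> ?I" "x * b \<in> ?I" for a b using ideal_add[OF iS that] by (simp add: distrib_left)
      show "x * (r * a) \<in> ?I" if "x * a \<in> ?I" for r a using ideal_mult[OF iS that, of r] by (simp add: ac_simps)
    qed
    have t: "ind UNIV ?I = ind UNIV ?Q * ind ?Q ?I" by (intro ind_tower ideal_subgp iS iQ subgp_UNIV with_gen_sub) simp
    have "ind ?Q ?I = ind UNIV C"
    proof (rule ind_eqI[where \<phi> = "\<lambda>y. x * y", symmetric, OF ideal_subgp[OF iC] ideal_subgp[OF iS]])
      show "x * y \<in> ?Q" for y using with_gen_gen[OF iS, of y x] by (simp add: mult.commute)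
      show "x * y - x * y' \<in> ?I \<longleftrightarrow> y - y' \<in> C" for y y' by (simp add: C_def right_diff_distrib)
      show "\<exists>y\<in>UNIV. z - x * y \<in> ?I" if z: "z \<in> ?Q" for z using z by (auto simp: with_gen_def mult.commute)
    qed
    moreover have Cpos: "ind UNIV C > 0" using t pos[of n] calculation by (metis gr0I mult_0_right)
    have "C \<subseteq> isum P (?m (n - c))" using c unfolding C_def by blast
    hence "ind UNIV (isum P (?m (n - c))) <= ind UNIV C" by (rule ind_le(1)[OF iS iC _ Cpos])
    moreover have "ind UNIV (isum P' (?m n)) <= ind UNIV ?Q"
    proof (rule ind_le(1)[OF ideal_isum[OF P'(1) ideal_mI] iQ])
      show "?Q \<subseteq> isum P' (?m n)"
        using P' by (intro with_gen_least ideal_isum ideal_mI isum_mono subsetD[OF isum_sub1[OF ideal_mI] P'(3)]) auto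
      show "ind UNIV ?Q > 0" using t pos[of n] by (metis gr0I mult_0)
    qed
    ultimately show ?thesis using t by (metis mult_le_mono)
  qed
  thus ?thesis using that by blast
qed

text \<open>Hilbert-Samuel growth: by \<open>ind_drop\<close> the function of the second prime
  bounds the differences of that of the first from below, and Pascal's rule sums binomial
  coefficients of degree j to degree j + 1.\<close>

lemma prime_growth:
  assumes p: "prime p"
    and "\<And>i. i <= j ==> is_prime (P i)" "\<And>i. i < j ==> P i \<subset> P (Suc i)" "KV p {..<N} \<subseteq> P 0"
  shows "\<exists>c>0. \<forall>k. p ^ (k choose j) <= ind UNIV (isum (P 0) (mI p {..<N} (Suc k * c)))"
  using assms(2-)
proof (induction j arbitrary: P)
  case 0
  have P0: "is_prime (P 0)" using 0(1) by simp
  let ?M = "bI p (\<lambda>_. 1)"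
  have box1: "box (\<lambda>_. 1) = {0}" by (auto simp: box_def intro: poly_mapping_eqI)
  have M: "f \<in> ?M \<longleftrightarrow> int p dvd coef f 0" for f by (simp only: bI_def did_def box1) simp
  have PM: "P 0 \<subseteq> ?M"
  proof
    fix f assume f: "f \<in> P 0"
    show "f \<in> ?M"
    proof (rule ccontr)
      assume "f \<notin> ?M"
      then obtain a where "a * f - 1 \<in> KV p {..<N}" using unit_KV[OF p, of "{..<N}" f] M by auto
      hence "a * f - (a * f - 1) \<in> P 0" by (intro ideal_diff[OF prime_ideal[OF P0] ideal_mult[OF prime_ideal[OF P0] f]] subsetD[OF 0(3)])
      thus False using prime_1[OF P0] by simp
    qed
  qed
  have "p ^ (k choose 0) <= ind UNIV (isum (P 0) (mI p {..<N} (Suc k * 1)))" for k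
  proof -
    have "isum (P 0) (mI p {..<N} (Suc k * 1)) \<subseteq> ?M"
    proof
      fix f assume "f \<in> isum (P 0) (mI p {..<N} (Suc k * 1))"
      then obtain a where a: "a \<in> ?M" "f - a \<in> mI p {..<N} (Suc k)" using PM by (auto simp: isum_def)
      have "deg 0 = 0" by (simp add: deg_def)
      hence "int p dvd coef (f - a) 0" using a(2) unfolding mI_def did_def by fastforce
      hence "f - a \<in> ?M" using M by blast
      hence "(f - a) + a \<in> ?M" by (intro ideal_add[OF ideal_bI] a)
      thus "f \<in> ?M" by simp
    qed
    from ind_le(1)[OF ideal_bI ideal_isum[OF prime_ideal[OF P0] ideal_mI] this ind_isum_mI(2)[OF p prime_ideal[OF P0]]]
    show ?thesis using ind_bI_one[OF prime_gt_0_nat[OF p]] by simp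
  qed
  thus ?case by (intro exI[of _ 1]) blast
next
  case (Suc j)
  let ?I = "\<lambda>n. ind UNIV (isum (P 0) (mI p {..<N} n))" and ?I' = "\<lambda>n. ind UNIV (isum (P 1) (mI p {..<N} n))"
  have P0: "is_prime (P 0)" and P1: "is_prime (P 1)" using Suc.prems(1) by auto
  have s01: "P 0 \<subset> P 1" using Suc.prems(2)[of 0] by simp
  have "\<exists>c>0. \<forall>k. p ^ (k choose j) <= ind UNIV (isum (P (Suc 0)) (mI p {..<N} (Suc k * c)))"
    by (rule Suc.IH[of "\<lambda>i. P (Suc i)"]) (use Suc.prems s01 in auto)
  then obtain c' where c': "c' > 0" "\<And>k. p ^ (k choose j) <= ?I' (Suc k * c')" by auto
  obtain x where x: "x \<in> P 1" "x \<notin> P 0" using s01 by blast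
  obtain c where c: "\<And>n. ?I' n * ?I (n - c) <= ?I n" using ind_drop[OF p P0 Suc.prems(3) prime_ideal[OF P1] _ x] s01 by auto
  have mono: "?I n <= ?I m" "?I' n <= ?I' m" if "n <= m" for n m
  proof -
    have "mI p {..<N} m \<subseteq> mI p {..<N} n" using that by (auto simp: mI_def did_def)
    hence "isum Q (mI p {..<N} m) \<subseteq> isum Q (mI p {..<N} n)" for Q by (intro isum_mono) auto
    hence "ind UNIV (isum Q (mI p {..<N} n)) <= ind UNIV (isum Q (mI p {..<N} m))" if "is_ideal Q" for Q
      using that by (intro ind_le(1) ideal_isum ideal_mI ind_isum_mI(2)[OF p])
    thus "?I n <= ?I m" "?I' n <= ?I' m" using prime_ideal[OF P0] prime_ideal[OF P1] by blast+
  qed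
  \<comment> \<open>Dominates both constants, so that one step of size \<open>C\<close> pays for the
    loss \<open>c\<close> in \<open>ind_drop\<close>.\<close>
  define C where "C = (c + 1) * c'"
  have C: "C > 0" "c' <= C" "c <= C"
  proof -
    have "c <= c * c'" "C = c * c' + c'" using c'(1) by (simp_all add: C_def)
    thus "C > 0" "c' <= C" "c <= C" using c'(1) by linarith+
  qed
  have "p ^ (k choose Suc j) <= ?I (Suc k * C)" for k
  proof (induction k)
    case 0
    show ?case using ind_isum_mI(2)[OF p prime_ideal[OF P0], of N "Suc 0 * C"] by simp
  next
    case (Suc k)
    have "p ^ (Suc k choose j) * p ^ (k choose Suc j) <= ?I' (Suc (Suc k) * C) * ?I (Suc k * C)"
      by (intro mult_le_mono order.trans[OF c'(2) mono(2)] mult_le_mono2 C Suc.IH)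
    also have "... <= ?I' (Suc (Suc k) * C) * ?I (Suc (Suc k) * C - c)" using C by (intro mult_le_mono order_refl mono) simp
    also have "... <= ?I (Suc (Suc k) * C)" by (rule c)
    finally have "p ^ ((Suc k choose j) + (k choose Suc j)) <= ?I (Suc (Suc k) * C)" by (simp add: power_add)
    moreover have "Suc k choose Suc j <= (Suc k choose j) + (k choose Suc j)" by (cases j) auto
    hence "p ^ (Suc k choose Suc j) <= p ^ ((Suc k choose j) + (k choose Suc j))" using prime_gt_0_nat[OF p] by (intro power_increasing) auto
    ultimately show ?case by (rule order.trans[rotated])
  qed
  thus ?case using C(1) by blast
qed

text \<open>N + 1 strict inclusions would force growth of degree N + 1, while the quotients by P +
  m^n have dimension at most n^N.\<close>

lemma prime_chain_bound:
  assumes p: "prime p" and P: "\<And>i. i <= j ==> is_prime (P i)" "\<And>i. i < j ==> P i \<subset> P (Suc i)" "KV p {..<N} \<subseteq> P 0"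
  shows "j <= N"
proof (rule ccontr)
  assume "\<not> ?thesis"
  hence j: "N + 1 <= j" by simp
  have "\<exists>c>0. \<forall>k. p ^ (k choose (N + 1)) <= ind UNIV (isum (P 0) (mI p {..<N} (Suc k * c)))"
    by (rule prime_growth[OF p, where P = P]) (use P j in auto)
  then obtain c where c: "\<And>k. p ^ (k choose (N + 1)) <= ind UNIV (isum (P 0) (mI p {..<N} (Suc k * c)))" by blast
  have iP: "is_ideal (P 0)" using P(1)[of 0] by (simp add: prime_ideal)
  have le: "k choose (N + 1) <= (Suc k * c) ^ N" for k
  proof -
    have "p ^ (k choose (N + 1)) <= p ^ ((Suc k * c) ^ N)" using c[of k] ind_isum_mI(1)[OF p iP] order.trans by blast
    thus ?thesis using prime_gt_1_nat[OF p] by (simp add: power_increasing_iff)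
  qed
  \<comment> \<open>At k = (N+1) t the binomial coefficient is at least t^(N+1) and its bound at
    most t^N ((N+2) c)^N; \<open>t\<close> exceeds the last factor by 1.\<close>
  define t where "t = ((N + 2) * c) ^ N + 1"
  have "t ^ (N + 1) <= ((N + 1) * t) choose (N + 1)"
  proof -
    have "N + 1 <= (N + 1) * t" by (simp add: t_def)
    hence "(real ((N + 1) * t) / real (N + 1)) ^ (N + 1) <= real (((N + 1) * t) choose (N + 1))" by (rule binomial_ge_n_over_k_pow_k)
    moreover have "real ((N + 1) * t) / real (N + 1) = real t" unfolding of_nat_mult by simp
    ultimately have "real t ^ (N + 1) <= real (((N + 1) * t) choose (N + 1))" by (simp only:)
    thus ?thesis by (simp only: of_nat_power[symmetric] of_nat_le_iff)
  qed
  also have "... <= (Suc ((N + 1) * t) * c) ^ N" by (rule le)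
  also have "... <= ((N + 2) * t * c) ^ N" by (intro power_mono mult_le_mono order_refl) (simp_all add: t_def)
  also have "... = t ^ N * ((N + 2) * c) ^ N" by (simp only: power_mult_distrib[symmetric] ac_simps)
  finally have "t ^ N * t <= t ^ N * ((N + 2) * c) ^ N" by simp
  moreover have "t ^ N > 0" by (simp add: t_def)
  ultimately have "t <= ((N + 2) * c) ^ N" using nat_mult_le_cancel1 by blast
  thus False by (simp add: t_def)
qed

subsection \<open>The hypersurface \<open>h + z\<^sup>2\<close>\<close>

text \<open>The ring A of the overview, kept over the integers and as an actual subring, so that u +
  v z with u and v in it can serve as a normal form.\<close>

definition A0 :: "nat => mps set" where "A0 d = {f. \<forall>\<alpha>. coef f \<alpha> \<noteq> 0 --> supp \<alpha> \<subseteq> {..<d}}"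

lemma A0_less: "f \<in> A0 d ==> coef f \<alpha> \<noteq> 0 ==> ex \<alpha> i \<noteq> 0 ==> i < d"
proof -
  assume "f \<in> A0 d" "coef f \<alpha> \<noteq> 0" "ex \<alpha> i \<noteq> 0"
  hence "supp \<alpha> \<subseteq> {..<d}" "i \<in> supp \<alpha>" by (simp_all add: A0_def in_keys_iff)
  thus "i < d" by blast
qed

lemma A0_add: "f \<in> A0 d ==> g \<in> A0 d ==> f + g \<in> A0 d"
  unfolding A0_def mem_Collect_eq coef_add by (metis add_0)

lemma A0_uminus: "f \<in> A0 d ==> - f \<in> A0 d" by (simp add: A0_def)

lemma A0_diff: "f \<in> A0 d ==> g \<in> A0 d ==> f - g \<in> A0 d"
  using A0_add[of f d "- g"] A0_uminus by simp

lemma A0_mult: assumes "f \<in> A0 d" "g \<in> A0 d" shows "f * g \<in> A0 d"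
  unfolding A0_def
proof (intro CollectI allI impI)
  fix \<alpha> assume "coef (f * g) \<alpha> \<noteq> 0"
  then obtain u where u: "u \<in> splits \<alpha>" "coef f (fst u) * coef g (snd u) \<noteq> 0" unfolding coef_mult by (meson sum.neutral)
  hence "supp (fst u) \<subseteq> {..<d}" "supp (snd u) \<subseteq> {..<d}" using assms by (auto simp: A0_def)
  thus "supp \<alpha> \<subseteq> {..<d}" using u(1) by (auto simp: splits_def supp_add)
qed

lemma A0_of_int: "of_int c \<in> A0 d" by (simp add: A0_def coef_of_int)
lemma A0_1: "1 \<in> A0 d" using A0_of_int[of 1 d] by simp
lemma A0_0: "0 \<in> A0 d" by (simp add: A0_def)
lemma A0_power: "f \<in> A0 d ==> f ^ n \<in> A0 d" by (induction n) (auto intro: A0_mult A0_1)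

definition r0 :: "nat => mps => mps" where
  "r0 d f = Mps (\<lambda>\<alpha>. if supp \<alpha> \<subseteq> {..<d} then coef f \<alpha> else 0)"

lemma coef_r0: "coef (r0 d f) \<alpha> = (if supp \<alpha> \<subseteq> {..<d} then coef f \<alpha> else 0)" by (simp add: r0_def)

lemma r0_A0: "r0 d f \<in> A0 d" by (simp add: A0_def coef_r0)
lemma r0_diff: "r0 d (f - g) = r0 d f - r0 d g" by (rule mps_eqI) (simp add: coef_r0)
lemma r0_KV: "f - r0 d f \<in> KV p {..<d}" by (simp add: KV_def did_def coef_r0)

lemma A0_KV_iff: "f \<in> A0 d ==> {..<d} \<subseteq> V ==> f \<in> KV p V \<longleftrightarrow> (\<forall>\<alpha>. int p dvd coef f \<alpha>)"
  unfolding A0_def KV_def did_def by (auto) (metis dvd_0_right subset_trans)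

lemma A0_KV_pM: "f \<in> A0 d ==> {..<d} \<subseteq> V ==> f \<in> KV p V \<longleftrightarrow> f \<in> pM p"
  by (simp add: A0_KV_iff pM_def did_def)

lemma pM_KV: "pM p \<subseteq> KV p V" unfolding KV_def by (rule pM_did)

lemma KV_antimono: "W \<subseteq> V ==> KV p V \<subseteq> KV p W"
  by (simp add: KV_def did_def subset_iff)

lemma free_of_A0: assumes "\<And>k. k \<ge> d ==> free_of k f" shows "f \<in> A0 d"
  unfolding A0_def
proof (intro CollectI allI impI subsetI)
  fix \<alpha> i assume c: "coef f \<alpha> \<noteq> 0" and i: "i \<in> supp \<alpha>"
  show "i \<in> {..<d}"
  proof (rule ccontr)
    assume "\<not> ?thesis"
    hence fr: "slice i f = fps_const f" using assms[of i] by (simp add: free_of_def)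
    obtain \<alpha>' where a: "\<alpha> = \<alpha>' + sng i (ex \<alpha> i)" "ex \<alpha>' i = 0" by (rule expo_split)
    have "coef (fps_nth (slice i f) (ex \<alpha> i)) \<alpha>' = coef f \<alpha>" using a by (simp add: coef_slice)
    moreover have "ex \<alpha> i \<noteq> 0" using i by (simp add: in_keys_iff)
    ultimately show False using c by (simp add: fr)
  qed
qed

lemma coef_mult_vr: "coef (f * vr i) (\<alpha> + sng i 1) = coef f \<alpha>"
  using coef_mono_mult[of "sng i (Suc 0)" f \<alpha>] by (simp add: mult.commute add.commute)

lemma coef_mult_vr_0: "ex \<alpha> i = 0 ==> coef (f * vr i) \<alpha> = 0"
proof -
  assume a: "ex \<alpha> i = 0"
  have "\<alpha> \<noteq> sng i (Suc 0) + \<beta>" for \<beta>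
  proof
    assume "\<alpha> = sng i (Suc 0) + \<beta>"
    hence "ex \<alpha> i = Suc (ex \<beta> i)" by (simp add: lookup_add)
    thus False using a by simp
  qed
  thus ?thesis using coef_mono_mult_eq_0[of \<alpha> "sng i (Suc 0)" f] by (simp add: mult.commute)
qed

lemma box_generated:
  assumes f: "f \<in> bI p (cV N q)" "f \<in> A0 N"
  obtains g where "f - (\<Sum>i<N. g i * vr i ^ q) \<in> pM p"
proof -
  \<comment> \<open>Each monomial outside the box is charged to the first variable whose exponent is
    at least \<open>q\<close>.\<close>
  define L where "L \<alpha> = (LEAST i. i < N \<and> q <= ex \<alpha> i)" for \<alpha> :: expo
  define g where "g i = Mps (\<lambda>\<beta>. if L (sng i q + \<beta>) = i then coef f (sng i q + \<beta>) else 0)" for i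
  have "f - (\<Sum>i<N. g i * vr i ^ q) \<in> pM p" unfolding pM_def did_def
  proof (intro CollectI ballI)
    fix \<alpha>
    have t: "coef (g i * vr i ^ q) \<alpha> = (if i = L \<alpha> \<and> q <= ex \<alpha> i then coef f \<alpha> else 0)" for i
    proof (cases "q <= ex \<alpha> i")
      case True
      hence e: "\<alpha> = sng i q + (\<alpha> - sng i q)" by (intro poly_mapping_eqI) (auto simp: lookup_add lookup_minus lookup_single when_def)
      have "coef (g i * vr i ^ q) \<alpha> = coef (g i) (\<alpha> - sng i q)"
        using coef_mono_mult[of "sng i q" "g i" "\<alpha> - sng i q"] e by (simp add: mult.commute vr_power)
      thus ?thesis using True e by (auto simp: g_def)
    next
      case False
      have "\<alpha> \<noteq> sng i q + \<beta>" for \<beta>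
      proof
        assume "\<alpha> = sng i q + \<beta>"
        hence "ex \<alpha> i = q + ex \<beta> i" by (simp add: lookup_add)
        thus False using False by simp
      qed
      thus ?thesis using False coef_mono_mult_eq_0[of \<alpha> "sng i q" "g i"] by (simp add: mult.commute vr_power)
    qed
    show "int p dvd coef (f - (\<Sum>i<N. g i * vr i ^ q)) \<alpha>"
    proof (cases "\<exists>i<N. q <= ex \<alpha> i")
      case True
      hence "L \<alpha> < N \<and> q <= ex \<alpha> (L \<alpha>)" unfolding L_def by (rule LeastI_ex)
      moreover have "(\<Sum>i<N. if i = L \<alpha> \<and> q <= ex \<alpha> i then coef f \<alpha> else 0) = (\<Sum>i<N. if i = L \<alpha> then coef f \<alpha> else 0)"
        using calculation by (intro sum.cong) auto
      ultimately show ?thesis by (simp add: t)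
    next
      case False
      hence z: "(if i = L \<alpha> \<and> q <= ex \<alpha> i then coef f \<alpha> else 0) = 0" if "i < N" for i using that by auto
      have "int p dvd coef f \<alpha>"
      proof (cases "coef f \<alpha> = 0")
        case nz: False
        have "ex \<alpha> i < cV N q i" for i
        proof (cases "i < N")
          case True thus ?thesis using False by (auto simp: cV_def)
        next
          case F: False
          hence "ex \<alpha> i = 0" using A0_less[OF f(2) nz, of i] by auto
          thus ?thesis using F by (simp add: cV_def)
        qed
        thus ?thesis using f(1) by (simp add: bI_def did_def box_def)
      qed simp
      moreover have "(\<Sum>i<N. coef (g i * vr i ^ q) \<alpha>) = 0" unfolding t by (rule sum.neutral) (use z in auto)
      ultimately show ?thesis by simp
    qed
  qed
  thus ?thesis by (rule that)
qed

lemma KV_bI: "KV p {..<N} \<subseteq> bI p (cV N q)"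
  unfolding KV_def bI_def did_def
proof (intro subsetI CollectI ballI)
  fix f \<alpha> assume f: "f \<in> {f. \<forall>\<alpha>\<in>{\<alpha>. supp \<alpha> \<subseteq> {..<N}}. int p dvd coef f \<alpha>}" and a: "\<alpha> \<in> box (cV N q)"
  have "supp \<alpha> \<subseteq> {..<N}"
  proof
    fix i assume "i \<in> supp \<alpha>"
    moreover have "ex \<alpha> i < cV N q i" using a by (simp add: box_def)
    ultimately show "i \<in> {..<N}" by (simp add: cV_def in_keys_iff split: if_splits)
  qed
  thus "int p dvd coef f \<alpha>" using f by blast
qed

lemma box_ideal_generated:
  assumes I: "is_ideal I" and K: "KV p {..<N} \<subseteq> I" and v: "\<And>i. i < N ==> vr i ^ q \<in> I"
  shows "bI p (cV N q) \<subseteq> I"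
proof
  fix f assume f: "f \<in> bI p (cV N q)"
  have r: "f - r0 N f \<in> KV p {..<N}" by (rule r0_KV)
  have "f - (f - r0 N f) \<in> bI p (cV N q)" using f subsetD[OF KV_bI r] by (rule ideal_diff[OF ideal_bI])
  hence "r0 N f \<in> bI p (cV N q)" by simp
  from box_generated[OF this r0_A0] obtain g where g: "r0 N f - (\<Sum>i<N. g i * vr i ^ q) \<in> pM p" .
  have "(\<Sum>i<N. g i * vr i ^ q) \<in> I" by (intro ideal_sum[OF I] ideal_mult[OF I] v) auto
  hence "(f - r0 N f) + (r0 N f - (\<Sum>i<N. g i * vr i ^ q)) + (\<Sum>i<N. g i * vr i ^ q) \<in> I"
    by (rule ideal_add[OF I ideal_add[OF I subsetD[OF K r] subsetD[OF K subsetD[OF pM_KV g]]]])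
  thus "f \<in> I" by simp
qed

text \<open>An ideal maximal among those disjoint from a multiplicative set is prime. It provides
  the lying-over argument in \<open>going_up\<close>.\<close>

lemma prime_avoiding:
  fixes Q :: "'m::comm_ring_1 set"
  assumes Q: "is_ideal Q" and S: "1 \<in> S" "\<And>a b. a \<in> S ==> b \<in> S ==> a * b \<in> S" and QS: "Q \<inter> S = {}"
  obtains P where "is_prime P" "Q \<subseteq> P" "P \<inter> S = {}"
proof -
  let ?A = "{I. is_ideal I \<and> Q \<subseteq> I \<and> I \<inter> S = {}}"
  have "\<exists>M\<in>?A. \<forall>X\<in>?A. M \<subseteq> X --> X = M"
  proof (rule subset_Zorn_nonempty)
    show "?A \<noteq> {}" using Q QS by blast
    fix C assume C: "C \<noteq> {}" "subset.chain ?A C"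
    have ch: "X \<subseteq> Y \<or> Y \<subseteq> X" if "X \<in> C" "Y \<in> C" for X Y using C(2) that unfolding subset.chain_def by blast
    have CA: "C \<subseteq> ?A" using C(2) by (auto simp: subset.chain_def)
    have "is_ideal (\<Union>C)"
    proof (rule is_idealI)
      show "0 \<in> \<Union>C" using C(1) CA ideal_0 by blast
      show "x + y \<in> \<Union>C" if xy: "x \<in> \<Union>C" "y \<in> \<Union>C" for x y
      proof -
        obtain X Y where XY: "X \<in> C" "Y \<in> C" "x \<in> X" "y \<in> Y" using xy by blast
        then obtain Z where "Z \<in> C" "x \<in> Z" "y \<in> Z" using ch[OF XY(1,2)] by blast
        thus ?thesis using CA ideal_add by blast
      qed
      show "r * x \<in> \<Union>C" if "x \<in> \<Union>C" for r x using that CA ideal_mult by blast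
    qed
    thus "\<Union>C \<in> ?A" using C(1) CA by blast
  qed
  then obtain P where P: "is_ideal P" "Q \<subseteq> P" "P \<inter> S = {}" and max: "\<And>X. is_ideal X ==> P \<subseteq> X ==> X \<inter> S = {} ==> X = P"
    by auto
  have "a \<in> P \<or> b \<in> P" if ab: "a * b \<in> P" for a b
  proof (rule ccontr)
    assume n: "\<not> ?thesis"
    have hit: "\<exists>s\<in>S. \<exists>r. s - r * x \<in> P" if "x \<notin> P" for x
    proof -
      have "with_gen P x \<noteq> P" using with_gen_gen[OF P(1), of 1 x] that by auto
      hence "with_gen P x \<inter> S \<noteq> {}" using max[OF ideal_with_gen[OF P(1)] with_gen_sub[OF P(1)]] by blast
      thus ?thesis by (auto simp: with_gen_def)
    qed
    obtain s r s' r' where s: "s \<in> S" "s - r * a \<in> P" "s' \<in> S" "s' - r' * b \<in> P" using hit n by metis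
    have "(s - r * a) * s' + r * a * (s' - r' * b) + r * r' * (a * b) \<in> P"
      by (intro ideal_add[OF P(1)] ideal_mult[OF P(1)] ideal_mult2[OF P(1)] s ab)
    hence "s * s' \<in> P" by (simp add: algebra_simps)
    thus False using S(2)[OF s(1,3)] P(3) by blast
  qed
  moreover have "1 \<notin> P" using P(3) S(1) by blast
  ultimately show ?thesis using that[of P] P by (simp add: is_prime_def)
qed

text \<open>\<open>h0\<close> puts \<open>h\<close> into the maximal ideal, which allows Weierstrass
  division by h + z^2; \<open>hK\<close> says that \<open>h\<close> is nonzero modulo
  \<open>p\<close>, which gives reducedness.\<close>

locale hyp =
  fixes p d :: nat and h :: mps
  assumes pp: "prime p" and p2: "p > 2" and hA: "h \<in> A0 d" and h0: "int p dvd coef h 0" and hK: "h \<notin> KV p {..<d}"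
begin

abbreviation z :: mps where "z \<equiv> vr d"
abbreviation K :: "mps set" where "K \<equiv> KV p {..<Suc d}"
definition f :: mps where "f = h + z ^ 2"
definition aa :: "mps set" where "aa = with_gen K f"
abbreviation mm :: "mps set" where "mm \<equiv> bI p (\<lambda>_. 1)"

lemma ideal_aa: "is_ideal aa" unfolding aa_def by (rule ideal_with_gen[OF ideal_KV])
lemmas aa_add = ideal_add[OF ideal_aa]
  and aa_diff = ideal_diff[OF ideal_aa]
  and aa_mult = ideal_mult[OF ideal_aa]
  and aa_mult2 = ideal_mult2[OF ideal_aa]

lemma K_aa: "K \<subseteq> aa" unfolding aa_def by (rule with_gen_sub[OF ideal_KV])
lemma f_aa: "f \<in> aa" unfolding aa_def using with_gen_gen[OF ideal_KV, of 1] by simp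

lemma mm_iff: "g \<in> mm \<longleftrightarrow> int p dvd coef g 0"
proof -
  have "box (\<lambda>_. 1) = {0}" by (auto simp: box_def intro: poly_mapping_eqI)
  thus ?thesis by (simp add: bI_def did_def del: One_nat_def)
qed

lemma K_prime: "is_prime K" by (rule prime_KV[OF pp]) simp

lemma z2: "coef (z ^ 2) \<alpha> = (if \<alpha> = sng d 2 then 1 else 0)" by (simp add: vr_power coef_mono)

lemma f_nK: "f \<notin> K"
proof -
  have "supp (sng d 2) \<subseteq> {..<Suc d}" by simp
  moreover have "coef f (sng d 2) = 1"
  proof -
    have "\<not> supp (sng d 2) \<subseteq> {..<d}" by simp
    hence "coef h (sng d 2) = 0" using hA unfolding A0_def by blast
    thus ?thesis unfolding f_def coef_add z2 by simp
  qed
  ultimately show ?thesis using prime_gt_1_nat[OF pp] by (auto simp: KV_def did_def intro!: exI[of _ "sng d 2"])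
qed

lemma aa_mm: "aa \<subseteq> mm"
  unfolding aa_def
proof (rule with_gen_least[OF ideal_bI])
  show "K \<subseteq> mm" unfolding subset_iff mm_iff by (auto simp: KV_def did_def)
  have "sng d 2 \<noteq> 0" by (metis lookup_single_eq lookup_zero zero_neq_numeral)
  hence "coef f 0 = coef h 0" unfolding f_def coef_add z2 by simp
  thus "f \<in> mm" using h0 unfolding mm_iff by simp
qed

lemma unit: assumes "g \<notin> mm" obtains a where "a * g - 1 \<in> aa"
  using unit_KV[OF pp _ assms[unfolded mm_iff], of "{..<Suc d}"] K_aa by blast

text \<open>Weierstrass division by h + z^2, which has degree 2 in z. Replacing z^2 by -h strictly
  raises the degree in x_0, ..., x_(d-1), and this degree is the rank of the recursion.\<close>

lemma repr: obtains u v where "u \<in> A0 d" "v \<in> A0 d" "r - (u + v * z) \<in> aa"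
proof -
  define w where "w = rd p {..<Suc d} f"
  let ?E = "{\<alpha>. supp \<alpha> \<subseteq> {..<Suc d} \<and> 2 <= ex \<alpha> d}"
  let ?e = "\<lambda>\<alpha>. sum (ex \<alpha>) {..<d}"
  have w0: "\<delta> = sng d 2 \<or> ?e \<delta> > 0" if "coef w \<delta> \<noteq> 0" for \<delta>
  proof (cases "\<delta> = sng d 2")
    case False
    hence c: "coef h \<delta> mod int p \<noteq> 0" using that by (auto simp: w_def coef_rd f_def z2 simp del: coef_0_mult split: if_splits)
    hence "\<delta> \<noteq> 0" using h0 by auto
    then obtain i where i: "ex \<delta> i \<noteq> 0" using poly_mapping_eqI[of \<delta> 0] by auto
    have "coef h \<delta> \<noteq> 0" using c by auto
    hence "i < d" by (rule A0_less[OF hA _ i])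
    hence "ex \<delta> i <= ?e \<delta>" by (intro member_le_sum) auto
    thus ?thesis using i by simp
  qed simp
  obtain a :: "nat => mps" where a: "\<And>\<beta>. \<beta> \<in> ?E ==> coef (r - (\<Sum>i<Suc 0. a i * w)) \<beta> = 0"
  proof (rule division[where E = ?E and \<iota> = "\<lambda>_. 0" and s = "Suc 0" and m = "\<lambda>_. sng d 2" and w = "\<lambda>_. w" and rank = ?e and Z = "\<lambda>_. False" and f = r])
    show "0 < Suc 0 \<and> (\<exists>\<gamma>. \<alpha> = sng d 2 + \<gamma>)" if "\<alpha> \<in> ?E" for \<alpha> :: expo
    proof -
      have "\<alpha> = sng d 2 + (\<alpha> - sng d 2)"
        using that by (intro poly_mapping_eqI) (auto simp: lookup_add lookup_minus lookup_single when_def)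
      thus ?thesis by blast
    qed
    show "coef w (sng d 2) = 1"
    proof -
      have "\<not> supp (sng d 2) \<subseteq> {..<d}" by simp
      hence "coef h (sng d 2) = 0" using hA unfolding A0_def by blast
      thus ?thesis using prime_gt_1_nat[OF pp] by (simp add: w_def coef_rd f_def z2)
    qed
    show "?e (sng d 2 + \<gamma>) < ?e (\<gamma> + \<delta>)" if "coef w \<delta> \<noteq> 0" "\<delta> \<noteq> sng d 2" for \<gamma> \<delta>
      using w0[OF that(1)] that(2) by (simp add: lookup_add sum.distrib lookup_single)
  qed simp_all
  define g where "g = r - a 0 * w"
  have g0: "coef g \<alpha> = 0" if "\<alpha> \<in> ?E" for \<alpha> using a[OF that] by (simp add: g_def)
  define u where "u = r0 d g"
  define v where "v = r0 d (Mps (\<lambda>\<alpha>. coef g (\<alpha> + sng d 1)))"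
  have "g - (u + v * z) \<in> K" unfolding KV_def did_def
  proof (intro CollectI ballI)
    fix \<alpha> assume a: "\<alpha> \<in> {\<alpha>. supp \<alpha> \<subseteq> {..<Suc d}}"
    obtain \<alpha>' where al: "\<alpha> = \<alpha>' + sng d (ex \<alpha> d)" "ex \<alpha>' d = 0" by (rule expo_split)
    have sa: "supp \<alpha>' \<subseteq> {..<d}"
    proof
      fix i assume "i \<in> supp \<alpha>'"
      moreover have "supp \<alpha>' \<subseteq> supp \<alpha>" by (metis al(1) supp_add Un_upper1)
      ultimately have "i \<in> supp \<alpha>" "i \<noteq> d" using al(2) in_keys_iff[of i \<alpha>'] by blast+
      thus "i \<in> {..<d}" using a by auto
    qed
    consider "ex \<alpha> d = 0" | "ex \<alpha> d = 1" | "ex \<alpha> d \<ge> 2" by linarith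
    thus "int p dvd coef (g - (u + v * z)) \<alpha>"
    proof cases
      case 1
      hence "\<alpha> = \<alpha>'" using al by simp
      thus ?thesis using 1 sa coef_mult_vr_0[OF 1, of v] by (simp add: u_def coef_r0)
    next
      case 2
      have "d \<in> supp \<alpha>" using 2 by (simp add: in_keys_iff)
      hence "\<not> supp \<alpha> \<subseteq> {..<d}" by auto
      hence "coef u \<alpha> = 0" by (simp add: u_def coef_r0)
      moreover have "coef (v * z) \<alpha> = coef g \<alpha>" using coef_mult_vr[of v d \<alpha>'] al 2 sa by (simp add: v_def coef_r0)
      ultimately show ?thesis by simp
    next
      case 3
      have "d \<in> supp \<alpha>" using 3 by (simp add: in_keys_iff)
      hence "coef u \<alpha> = 0" by (auto simp: u_def coef_r0)
      moreover have "coef (v * z) \<alpha> = 0"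
      proof -
        define \<beta> where "\<beta> = \<alpha>' + sng d (ex \<alpha> d - 1)"
        have "sng d (ex \<alpha> d - 1) + sng d 1 = sng d (ex \<alpha> d)" using 3 by (simp flip: single_add)
        hence "\<alpha> = \<beta> + sng d 1" using al(1) by (simp add: \<beta>_def add.assoc)
        moreover have "d \<in> supp \<beta>" using 3 by (simp add: \<beta>_def in_keys_iff lookup_add)
        ultimately show ?thesis using coef_mult_vr[of v d \<beta>] by (auto simp: v_def coef_r0)
      qed
      ultimately show ?thesis using g0[of \<alpha>] a 3 by simp
    qed
  qed
  hence "(g - (u + v * z)) + a 0 * f - a 0 * (f - w) \<in> aa" unfolding w_def by (intro aa_diff[OF aa_add] aa_mult f_aa subsetD[OF K_aa] rd_KV)
  hence "r - (u + v * z) \<in> aa" by (simp add: g_def algebra_simps)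
  thus ?thesis using that[of u v] by (simp add: u_def v_def r0_A0)
qed

text \<open>If u + v z = g f, compare coefficients at x^\<alpha> z^2. The left side has none, g z^2
  contributes that of \<open>g\<close> at \<alpha>, and g h only coefficients of \<open>g\<close> of
  smaller degree in x_0, ..., x_(d-1); so \<open>g\<close> vanishes modulo \<open>p\<close> by
  induction.\<close>

lemma uniq:
  assumes u: "u \<in> A0 d" and v: "v \<in> A0 d" and uv: "u + v * z \<in> aa"
  shows "u \<in> pM p" "v \<in> pM p"
proof -
  obtain g where g: "u + v * z - g * f \<in> K" using uv by (auto simp: aa_def with_gen_def)
  let ?e = "\<lambda>\<alpha>. sum (ex \<alpha>) {..<d}"
  have "int p dvd coef g \<alpha>" if "supp \<alpha> \<subseteq> {..<Suc d}" for \<alpha> using that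
  proof (induction "?e \<alpha>" arbitrary: \<alpha> rule: less_induct)
    case less
    let ?\<beta> = "\<alpha> + sng d 2"
    have sb: "supp ?\<beta> \<subseteq> {..<Suc d}" using less.prems by (auto simp: supp_add split: if_splits)
    have nd: "\<not> supp (\<alpha> + sng d 1) \<subseteq> {..<d}" "\<not> supp ?\<beta> \<subseteq> {..<d}" by (auto simp: supp_add)
    have "coef u ?\<beta> = 0" using nd(2) u unfolding A0_def by blast
    moreover have "coef (v * z) ?\<beta> = 0"
    proof -
      have "?\<beta> = (\<alpha> + sng d 1) + sng d 1" by (intro poly_mapping_eqI) (simp add: lookup_add lookup_single when_def)
      moreover have "coef v (\<alpha> + sng d 1) = 0" using nd(1) v unfolding A0_def by blast
      ultimately show ?thesis using coef_mult_vr[of v d "\<alpha> + sng d 1"] by simp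
    qed
    moreover have "coef (g * z ^ 2) ?\<beta> = coef g \<alpha>"
      using coef_mono_mult[of "sng d 2" g \<alpha>] by (simp add: vr_power mult.commute add.commute)
    moreover have "int p dvd coef (g * h) ?\<beta>" unfolding coef_mult
    proof (rule dvd_sum)
      fix w assume w: "w \<in> splits ?\<beta>"
      hence s: "fst w + snd w = ?\<beta>" by (simp add: splits_def)
      show "int p dvd coef g (fst w) * coef h (snd w)"
      proof (cases "int p dvd coef h (snd w)")
        case False
        hence "snd w \<noteq> 0" using h0 by auto
        then obtain i where i: "ex (snd w) i \<noteq> 0" using poly_mapping_eqI[of "snd w" 0] by auto
        have "coef h (snd w) \<noteq> 0" using False by auto
        hence "i < d" by (rule A0_less[OF hA _ i])
        hence "ex (snd w) i <= ?e (snd w)" by (intro member_le_sum) auto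
        moreover have "?e (fst w) + ?e (snd w) = ?e \<alpha>" using arg_cong[OF s, of ?e] by (simp add: lookup_add sum.distrib lookup_single)
        ultimately have "?e (fst w) < ?e \<alpha>" using i by simp
        moreover have "supp (fst w) \<subseteq> {..<Suc d}" using sb unfolding s[symmetric] by (simp add: supp_add)
        ultimately show ?thesis using less.hyps by simp
      qed simp
    qed
    moreover have "int p dvd coef (u + v * z - g * f) ?\<beta>" using g sb by (simp add: KV_def did_def)
    hence "int p dvd coef (u + v * z) ?\<beta> - (coef (g * h) ?\<beta> + coef (g * z ^ 2) ?\<beta>)" by (simp add: f_def distrib_left)
    ultimately have "int p dvd - (coef (g * h) ?\<beta> + coef g \<alpha>)" "int p dvd coef (g * h) ?\<beta>" by simp_all
    thus ?case by (simp only: dvd_minus_iff dvd_add_right_iff)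
  qed
  hence "g \<in> K" by (simp add: KV_def did_def)
  hence "(u + v * z - g * f) + g * f \<in> K" by (intro ideal_add[OF ideal_KV] ideal_mult2[OF ideal_KV] g)
  hence uvK: "u + v * z \<in> K" by simp
  show "u \<in> pM p" unfolding pM_def did_def
  proof (intro CollectI ballI)
    fix \<alpha> show "int p dvd coef u \<alpha>"
    proof (cases "supp \<alpha> \<subseteq> {..<d}")
      case True
      hence "d \<notin> supp \<alpha>" "supp \<alpha> \<subseteq> {..<Suc d}" by auto
      hence "ex \<alpha> d = 0" "supp \<alpha> \<subseteq> {..<Suc d}" by (simp_all add: in_keys_iff)
      thus ?thesis using uvK coef_mult_vr_0[of \<alpha> d v] by (auto simp: KV_def did_def)
    next
      case False
      hence "coef u \<alpha> = 0" using u unfolding A0_def by blast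
      thus ?thesis by simp
    qed
  qed
  show "v \<in> pM p" unfolding pM_def did_def
  proof (intro CollectI ballI)
    fix \<alpha> show "int p dvd coef v \<alpha>"
    proof (cases "supp \<alpha> \<subseteq> {..<d}")
      case True
      hence "supp (\<alpha> + sng d 1) \<subseteq> {..<Suc d}" "\<not> supp (\<alpha> + sng d 1) \<subseteq> {..<d}" by (auto simp: supp_add)
      moreover from this have "coef u (\<alpha> + sng d 1) = 0" using u unfolding A0_def by blast
      ultimately show ?thesis using uvK coef_mult_vr[of v d \<alpha>] by (auto simp: KV_def did_def)
    next
      case False
      hence "coef v \<alpha> = 0" using v unfolding A0_def by blast
      thus ?thesis by simp
    qed
  qed
qed


text \<open>The set Q + I + J z, with separate conditions on the two components over A. For I = J it
  is an ideal; for different components that has to be known otherwise.\<close>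

definition pr :: "mps set => mps set => mps set => mps set" where
  "pr Q I J = {r. \<exists>u\<in>A0 d \<inter> I. \<exists>v\<in>A0 d \<inter> J. r - (u + v * z) \<in> Q}"

lemma z_sq: "z * z + h \<in> aa" using f_aa by (simp add: f_def power2_eq_square add.commute)

lemma pr_sub: assumes "is_ideal Q" "is_ideal I" "is_ideal J" shows "Q \<subseteq> pr Q I J"
  using A0_0 ideal_0[OF assms(2)] ideal_0[OF assms(3)] unfolding pr_def by force

lemma pr_in: assumes "is_ideal Q" "u \<in> A0 d \<inter> I" "v \<in> A0 d \<inter> J" shows "u + v * z \<in> pr Q I J"
  using assms ideal_0[OF assms(1)] unfolding pr_def by (intro CollectI bexI) auto

lemma pr_sum:
  assumes Q: "is_ideal Q" and I: "is_ideal I" and J: "is_ideal J" and x: "x \<in> pr Q I J" and y: "y \<in> pr Q I J"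
  shows "x + y \<in> pr Q I J"
proof -
  obtain u v u' v' where *: "u \<in> A0 d" "u \<in> I" "v \<in> A0 d" "v \<in> J" "x - (u + v * z) \<in> Q"
    "u' \<in> A0 d" "u' \<in> I" "v' \<in> A0 d" "v' \<in> J" "y - (u' + v' * z) \<in> Q" using x y by (auto simp: pr_def)
  have "(x - (u + v * z)) + (y - (u' + v' * z)) \<in> Q" by (intro ideal_add[OF Q] *)
  hence "x + y - ((u + u') + (v + v') * z) \<in> Q" by (simp add: algebra_simps)
  thus ?thesis unfolding pr_def by (intro CollectI bexI[of _ "u + u'"] bexI[of _ "v + v'"]) (auto intro: A0_add ideal_add[OF I] ideal_add[OF J] *)
qed

lemma pr_ideal: assumes Q: "is_ideal Q" "aa \<subseteq> Q" and I: "is_ideal I" shows "is_ideal (pr Q I I)"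
proof (rule is_idealI)
  show "0 \<in> pr Q I I" using pr_sub[OF Q(1) I I] ideal_0[OF Q(1)] by blast
  show "x + y \<in> pr Q I I" if "x \<in> pr Q I I" "y \<in> pr Q I I" for x y by (rule pr_sum[OF Q(1) I I that])
  show "r * x \<in> pr Q I I" if x: "x \<in> pr Q I I" for r x
  proof -
    obtain u v where x: "u \<in> A0 d" "u \<in> I" "v \<in> A0 d" "v \<in> I" "x - (u + v * z) \<in> Q" using x by (auto simp: pr_def)
    obtain a b where ab: "a \<in> A0 d" "b \<in> A0 d" "r - (a + b * z) \<in> aa" by (rule repr)
    define U where "U = a * u - h * (b * v)"
    define V where "V = a * v + b * u"
    have "r * (x - (u + v * z)) + (r - (a + b * z)) * (u + v * z) + b * v * (z * z + h) \<in> Q"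
      by (intro ideal_add[OF Q(1)] ideal_mult[OF Q(1)] ideal_mult2[OF Q(1)] x subsetD[OF Q(2)] ab z_sq)
    hence "r * x - (U + V * z) \<in> Q" by (simp add: U_def V_def algebra_simps)
    moreover have "U \<in> A0 d \<inter> I" "V \<in> A0 d \<inter> I" unfolding U_def V_def
      by (auto intro!: A0_diff A0_add A0_mult hA x ab ideal_diff[OF I] ideal_add[OF I] ideal_mult[OF I])
    ultimately show ?thesis unfolding pr_def by blast
  qed
qed

lemma pr_iff:
  assumes I: "is_ideal I" "pM p \<subseteq> I" and J: "is_ideal J" "pM p \<subseteq> J" and u: "u \<in> A0 d" and v: "v \<in> A0 d"
  shows "u + v * z \<in> pr aa I J \<longleftrightarrow> u \<in> I \<and> v \<in> J"
proof
  assume "u + v * z \<in> pr aa I J"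
  then obtain u' v' where *: "u' \<in> A0 d" "u' \<in> I" "v' \<in> A0 d" "v' \<in> J" "u + v * z - (u' + v' * z) \<in> aa" by (auto simp: pr_def)
  hence "(u - u') + (v - v') * z \<in> aa" by (simp add: algebra_simps)
  from uniq[OF A0_diff[OF u *(1)] A0_diff[OF v *(3)] this]
  have "(u - u') + u' \<in> I" "(v - v') + v' \<in> J" using I(2) J(2) by (intro ideal_add[OF I(1)] ideal_add[OF J(1)] *; blast)+
  thus "u \<in> I \<and> v \<in> J" by simp
next
  assume "u \<in> I \<and> v \<in> J"
  thus "u + v * z \<in> pr aa I J" using pr_in[OF ideal_aa] u v by blast
qed

text \<open>R is free over A on 1 and z, so the index is a product over the two components. The
  pairs are stored as the first two coefficients of an \<open>fps\<close>, to reuse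
  \<open>ind_coordinates\<close>.\<close>

lemma ind_pr:
  assumes I: "is_ideal I" "KV p {..<d} \<subseteq> I" and J: "is_ideal J" "KV p {..<d} \<subseteq> J" and X: "is_ideal X" "X = pr aa I J"
  shows "ind UNIV X = ind UNIV I * ind UNIV J"
proof -
  define II where "II r = (if r = 0 then I else J)" for r :: nat
  have II: "is_subgp (II r)" for r using I J by (simp add: II_def ideal_subgp)
  let ?G = "{G :: mps fps. \<forall>r<2. fps_nth G r \<in> II r}"
  have "ind UNIV ?G = (\<Prod>r<2. ind UNIV (II r))"
    by (rule ind_coordinates[where e = "\<lambda>k x. fps_const x * fps_X ^ k"]) (auto simp: II fps_X_power_iff)
  also have "... = ind UNIV I * ind UNIV J" by (simp add: II_def numeral_2_eq_2 lessThan_Suc)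
  also have "ind UNIV ?G = ind UNIV X"
  proof (rule ind_eqI[where \<phi> = "\<lambda>G. r0 d (fps_nth G 0) + r0 d (fps_nth G 1) * z"])
    show "is_subgp ?G" by (rule is_subgpI) (auto intro: subgp_diff[OF II] subgp_0[OF II])
    show "is_subgp X" by (rule ideal_subgp[OF X(1)])
    have r0: "r0 d g \<in> L \<longleftrightarrow> g \<in> L" if L: "is_ideal L" "KV p {..<d} \<subseteq> L" for g L
      using ideal_diff_iff[OF L(1), of g "r0 d g"] r0_KV[of g d p] L(2) by blast
    have pM: "pM p \<subseteq> I" "pM p \<subseteq> J" using pM_KV I(2) J(2) by blast+
    show "(r0 d (fps_nth G 0) + r0 d (fps_nth G 1) * z) - (r0 d (fps_nth H 0) + r0 d (fps_nth H 1) * z) \<in> X \<longleftrightarrow> G - H \<in> ?G" for G H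
    proof -
      have "(r0 d (fps_nth G 0) + r0 d (fps_nth G 1) * z) - (r0 d (fps_nth H 0) + r0 d (fps_nth H 1) * z)
        = r0 d (fps_nth (G - H) 0) + r0 d (fps_nth (G - H) 1) * z" by (simp add: r0_diff algebra_simps)
      thus ?thesis unfolding X(2) using pr_iff[OF I(1) pM(1) J(1) pM(2) r0_A0 r0_A0] r0[OF I] r0[OF J] by (auto simp: II_def less_2_cases_iff)
    qed
    show "\<exists>G\<in>UNIV. y - (r0 d (fps_nth G 0) + r0 d (fps_nth G 1) * z) \<in> X" for y
    proof -
      obtain u v where *: "u \<in> A0 d" "v \<in> A0 d" "y - (u + v * z) \<in> aa" by (rule repr)
      have "r0 d w = w" if "w \<in> A0 d" for w using that by (intro mps_eqI) (auto simp: coef_r0 A0_def)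
      thus ?thesis using * pr_sub[OF ideal_aa I(1) J(1)] unfolding X(2) by (intro bexI[of _ "fps_const u + fps_const v * fps_X"]) auto
    qed
  qed simp
  finally show ?thesis .
qed

text \<open>Disjointness rests on the norm from R to A: if r in A equals u + v z modulo Q, then (r -
  u)^2 + h v^2 lies in Q and in A, hence in the prime below, and therefore so does r.\<close>

lemma going_up:
  assumes Q: "is_ideal Q" "aa \<subseteq> Q" and QA: "Q \<inter> A0 d \<subseteq> KV p {..<i}"
  obtains P where "is_prime P" "pr Q (KV p {..<i}) (KV p {..<i}) \<subseteq> P" "P \<inter> A0 d \<subseteq> KV p {..<i}"
proof -
  let ?I = "KV p {..<i}"
  have Ip: "is_prime ?I" by (rule prime_KV[OF pp]) simp
  have I: "is_ideal ?I" by (rule ideal_KV)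
  let ?S = "A0 d - ?I"
  have "pr Q ?I ?I \<inter> ?S = {}"
  proof (rule ccontr)
    assume "pr Q ?I ?I \<inter> ?S \<noteq> {}"
    then obtain r u v where *: "r \<in> A0 d" "r \<notin> ?I" "u \<in> A0 d" "u \<in> ?I" "v \<in> A0 d" "v \<in> ?I" "r - (u + v * z) \<in> Q" by (auto simp: pr_def)
    have "(r - (u + v * z)) * (r - u + v * z) + v * v * (z * z + h) \<in> Q"
      by (intro ideal_add[OF Q(1)] ideal_mult[OF Q(1)] ideal_mult2[OF Q(1)] * subsetD[OF Q(2)] z_sq)
    hence "(r - u) * (r - u) + h * (v * v) \<in> Q" by (simp add: algebra_simps)
    moreover have "(r - u) * (r - u) + h * (v * v) \<in> A0 d" by (intro A0_add A0_mult A0_diff * hA)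
    ultimately have "(r - u) * (r - u) + h * (v * v) \<in> ?I" using QA by blast
    hence "(r - u) * (r - u) + h * (v * v) - h * (v * v) \<in> ?I" by (intro ideal_diff[OF I] ideal_mult[OF I] *)
    hence "r - u \<in> ?I" using prime_mult[OF Ip, of "r - u" "r - u"] by simp
    hence "(r - u) + u \<in> ?I" by (intro ideal_add[OF I] *)
    thus False using * by simp
  qed
  moreover have "1 \<in> ?S" using A0_1 prime_1[OF Ip] by blast
  moreover have "a * b \<in> ?S" if "a \<in> ?S" "b \<in> ?S" for a b using that A0_mult prime_mult[OF Ip] by blast
  ultimately obtain P where "is_prime P" "pr Q ?I ?I \<subseteq> P" "P \<inter> ?S = {}" using prime_avoiding[OF pr_ideal[OF Q I], of ?S] by blast
  thus ?thesis using that by blast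
qed

text \<open>The variables x_(d-1), x_(d-2), ... are killed in A one at a time and each prime is
  lifted; the variable just killed witnesses strictness.\<close>

lemma prime_chain_exists:
  "\<exists>P. (\<forall>i\<le>n. is_prime (P i) \<and> aa \<subseteq> P i) \<and> (\<forall>i<n. P i \<subset> P (Suc i)) \<and>
    P n \<inter> A0 d \<subseteq> KV p {..<d - n} \<and> A0 d \<inter> KV p {..<d - n} \<subseteq> P n" if "n <= d" using that
proof (induction n)
  case 0
  have "aa \<inter> A0 d \<subseteq> KV p {..<d}"
  proof
    fix r assume "r \<in> aa \<inter> A0 d"
    hence "r \<in> pM p" using uniq(1)[of r 0] A0_0 by simp
    thus "r \<in> KV p {..<d}" using pM_KV by blast
  qed
  from going_up[OF ideal_aa order_refl this] obtain P where P: "is_prime P" "pr aa (KV p {..<d}) (KV p {..<d}) \<subseteq> P" "P \<inter> A0 d \<subseteq> KV p {..<d}" .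
  moreover have "x \<in> P" if "x \<in> A0 d \<inter> KV p {..<d}" for x using pr_in[OF ideal_aa that, of 0] A0_0 ideal_0[OF ideal_KV] P(2) by auto
  moreover have "aa \<subseteq> P" using pr_sub[OF ideal_aa ideal_KV ideal_KV] P(2) by blast
  ultimately show ?case by (intro exI[of _ "\<lambda>_. P"]) auto
next
  case (Suc n)
  then obtain P where P: "\<And>i. i <= n ==> is_prime (P i) \<and> aa \<subseteq> P i" "\<And>i. i < n ==> P i \<subset> P (Suc i)"
    "P n \<inter> A0 d \<subseteq> KV p {..<d - n}" "A0 d \<inter> KV p {..<d - n} \<subseteq> P n" by auto
  let ?I = "KV p {..<d - Suc n}"
  have "{..<d - Suc n} \<subseteq> {..<d - n}" by auto
  hence sub: "KV p {..<d - n} \<subseteq> ?I" by (rule KV_antimono)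
  have iP: "is_ideal (P n)" "aa \<subseteq> P n" using P(1)[of n] by (auto intro: prime_ideal)
  have "P n \<inter> A0 d \<subseteq> ?I" using P(3) sub by blast
  from going_up[OF iP(1,2) this] obtain P' where P': "is_prime P'" "pr (P n) ?I ?I \<subseteq> P'" "P' \<inter> A0 d \<subseteq> ?I" .
  have PP: "P n \<subseteq> P'" using pr_sub[OF iP(1) ideal_KV ideal_KV] P'(2) by blast
  have in': "A0 d \<inter> ?I \<subseteq> P'"
  proof
    fix x assume "x \<in> A0 d \<inter> ?I"
    thus "x \<in> P'" using pr_in[OF iP(1), of x ?I 0 ?I] A0_0 ideal_0[OF ideal_KV] P'(2) by auto
  qed
  let ?x = "vr (d - Suc n)"
  have ld: "d - Suc n < d" using Suc.prems by simp
  have "?x \<in> A0 d" using ld by (auto simp: A0_def coef_mono)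
  moreover have "?x \<in> ?I" by (auto simp: KV_def did_def coef_mono)
  moreover have "?x \<notin> KV p {..<d - n}"
  proof
    have "supp (sng (d - Suc n) (Suc 0)) \<subseteq> {..<d - n}" using Suc.prems by auto
    moreover assume "?x \<in> KV p {..<d - n}"
    ultimately have "int p dvd coef ?x (sng (d - Suc n) (Suc 0))" unfolding KV_def did_def by blast
    thus False using prime_gt_1_nat[OF pp] by (simp add: coef_mono)
  qed
  ultimately have "P n \<subset> P'" using in' P(3) PP by blast
  moreover have "aa \<subseteq> P'" using PP iP(2) by (rule order.trans[rotated])
  ultimately show ?case using P P'(1,3) in' by (intro exI[of _ "\<lambda>i. if i = Suc n then P' else P i"]) (auto simp: less_Suc_eq le_Suc_eq)
qed

lemma dim_ge: "\<exists>P. (\<forall>i\<le>d. is_prime (P i) \<and> aa \<subseteq> P i) \<and> (\<forall>i<d. P i \<subset> P (Suc i))"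
  using prime_chain_exists[of d] by blast

text \<open>The prime \<open>K\<close> of the ambient ring lies strictly below the chain, so a chain
  with one more step arises in d + 1 variables.\<close>

lemma dim_le:
  assumes P: "\<And>i. i <= n ==> is_prime (P i)" "aa \<subseteq> P 0" "\<And>i. i < n ==> P i \<subset> P (Suc i)"
  shows "n <= d"
proof -
  define P' where "P' i = (case i of 0 => K | Suc j => P j)" for i
  have "Suc n <= Suc d"
  proof (rule prime_chain_bound[OF pp, where P = P'])
    show "is_prime (P' i)" if "i <= Suc n" for i using that P(1) K_prime by (auto simp: P'_def split: nat.split)
    show "P' i \<subset> P' (Suc i)" if "i < Suc n" for i
    proof (cases i)
      case 0
      have "K \<subset> P 0" using K_aa P(2) f_aa f_nK by blast
      thus ?thesis using 0 by (simp add: P'_def)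
    qed (use P(3) that in \<open>auto simp: P'_def\<close>)
    show "K \<subseteq> P' 0" by (simp add: P'_def)
  qed
  thus ?thesis by simp
qed

end

subsection \<open>Length and free rank\<close>

lemma FF_add: "FF q (f + g) = FF q f + FF q g" by (rule mps_eqI) (simp add: coef_FF)
lemma FF_diff: "FF q (f - g) = FF q f - FF q g" by (rule mps_eqI) (simp add: coef_FF)
lemma FF_0: "FF q 0 = 0" by (rule mps_eqI) (simp add: coef_FF)
lemma FF_sum: "FF q (\<Sum>i\<in>S. g i) = (\<Sum>i\<in>S. FF q (g i))"
  by (induction S rule: infinite_finite_induct) (simp_all add: FF_0 FF_add)

lemma frob_diff_sum:
  assumes p: "prime p" and q: "q = p ^ e"
  shows "(x - (\<Sum>i\<in>S. y i)) ^ q - (x ^ q - (\<Sum>i\<in>S. y i ^ q)) \<in> pM p"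
proof -
  have F: "g ^ q - FF q g \<in> pM p" for g unfolding q by (rule frobenius_FF[OF p])
  have s: "(\<Sum>i\<in>S. y i ^ q - FF q (y i)) \<in> pM p" by (intro ideal_sum[OF ideal_pM] F)
  have "((x - (\<Sum>i\<in>S. y i)) ^ q - FF q (x - (\<Sum>i\<in>S. y i))) - (x ^ q - FF q x) + (\<Sum>i\<in>S. y i ^ q - FF q (y i)) \<in> pM p"
    by (rule ideal_add[OF ideal_pM ideal_diff[OF ideal_pM F F] s])
  moreover have "((x - (\<Sum>i\<in>S. y i)) ^ q - FF q (x - (\<Sum>i\<in>S. y i))) - (x ^ q - FF q x) + (\<Sum>i\<in>S. y i ^ q - FF q (y i))
    = (x - (\<Sum>i\<in>S. y i)) ^ q - (x ^ q - (\<Sum>i\<in>S. y i ^ q))" unfolding sum_subtractf FF_diff FF_sum by simp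
  ultimately show ?thesis by simp
qed

lemma frob_add:
  assumes p: "prime p" and q: "q = p ^ e"
  shows "(x + y) ^ q - (x ^ q + y ^ q) \<in> pM p"
proof -
  have F: "g ^ q - FF q g \<in> pM p" for g unfolding q by (rule frobenius_FF[OF p])
  have "((x + y) ^ q - FF q (x + y)) - (x ^ q - FF q x) - (y ^ q - FF q y) \<in> pM p" by (intro ideal_diff[OF ideal_pM ideal_diff[OF ideal_pM]] F)
  thus ?thesis unfolding FF_add by (simp add: algebra_simps)
qed

lemma frob_of_int:
  assumes p: "prime p" and q: "q = p ^ e"
  shows "of_int c ^ q - of_int c \<in> pM p"
proof -
  have "FF q (of_int c) = of_int c"
  proof (rule mps_eqI)
    fix \<alpha> show "coef (FF q (of_int c)) \<alpha> = coef (of_int c) \<alpha>"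
    proof (cases "\<forall>i. q dvd ex \<alpha> i")
      case True
      have "q > 0" using prime_gt_0_nat[OF p] q by simp
      have a: "\<alpha> = sc q (dv q \<alpha>)" by (rule dvd_sc[OF True])
      have "sc q 0 = 0" by (rule poly_mapping_eqI) simp
      hence "dv q \<alpha> = 0 \<longleftrightarrow> \<alpha> = 0" using a by (metis dv_sc \<open>q > 0\<close>)
      thus ?thesis using True by (simp add: coef_FF coef_of_int)
    next
      case False
      hence "\<alpha> \<noteq> 0" by auto
      moreover have "coef (FF q (of_int c)) \<alpha> = 0" unfolding coef_FF by (rule if_not_P[OF False])
      ultimately show ?thesis by (simp add: coef_of_int)
    qed
  qed
  thus ?thesis using frobenius_FF[OF p, of "of_int c" e] by (simp add: q)
qed

lemma power_q_bI:
  assumes p: "prime p" and q: "q = p ^ e" and u: "int p dvd coef u 0"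
  shows "u ^ q \<in> bI p (cV d q)"
proof -
  have q0: "q > 0" using prime_gt_0_nat[OF p] q by simp
  have "FF q u \<in> bI p (cV d q)" unfolding bI_def did_def
  proof (intro CollectI ballI)
    fix \<alpha> assume a: "\<alpha> \<in> box (cV d q)"
    show "int p dvd coef (FF q u) \<alpha>"
    proof (cases "\<forall>i. q dvd ex \<alpha> i")
      case True
      have "ex \<alpha> i = 0" for i
      proof -
        have "ex \<alpha> i < cV d q i" using a by (simp add: box_def)
        hence "ex \<alpha> i < q" using q0 by (simp add: cV_def split: if_splits)
        thus ?thesis using True by (metis nat_dvd_not_less neq0_conv)
      qed
      hence "\<alpha> = 0" by (intro poly_mapping_eqI) simp
      moreover have "dv q 0 = 0" by (rule poly_mapping_eqI) simp
      ultimately show ?thesis using u by (simp add: coef_FF)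
    next
      case False
      have "coef (FF q u) \<alpha> = 0" unfolding coef_FF by (rule if_not_P[OF False])
      thus ?thesis by simp
    qed
  qed
  moreover have "u ^ q - FF q u \<in> bI p (cV d q)" using frobenius_FF[OF p] pM_bI unfolding q by blast
  ultimately have "(u ^ q - FF q u) + FF q u \<in> bI p (cV d q)" by (intro ideal_add[OF ideal_bI])
  thus ?thesis by simp
qed

lemma ind_card_le:
  assumes J: "is_subgp J" and pos: "ind X J > 0" and fin: "finite C"
    and in': "\<And>c. c \<in> C ==> F c \<in> X" and inj: "\<And>c c'. c \<in> C ==> c' \<in> C ==> F c - F c' \<in> J ==> c = c'"
  shows "card C <= ind X J"
proof -
  have "finite ((\<lambda>x. {y. y - x \<in> J}) ` X)" using pos unfolding ind_def by (rule card_ge_0_finite)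
  moreover have "inj_on (\<lambda>c. {y. y - F c \<in> J}) C" using inj by (auto simp: inj_on_def coset_eq_iff[OF J])
  ultimately show ?thesis unfolding ind_def using in' by (intro card_inj_on_le[of "\<lambda>c. {y. y - F c \<in> J}"]) auto
qed

lemma ind_le_card:
  assumes J: "is_subgp J" and fin: "finite C" and cov: "\<And>x. \<exists>c\<in>C. x - F c \<in> J"
  shows "ind UNIV J <= card C"
proof -
  have "(\<lambda>x. {y. y - x \<in> J}) ` UNIV \<subseteq> (\<lambda>c. {y. y - F c \<in> J}) ` C"
  proof (rule image_subsetI)
    fix x
    obtain c where c: "c \<in> C" "x - F c \<in> J" using cov by blast
    hence "{y. y - x \<in> J} = {y. y - F c \<in> J}" by (simp add: coset_eq_iff[OF J])
    thus "{y. y - x \<in> J} \<in> (\<lambda>c. {y. y - F c \<in> J}) ` C" using c by blast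
  qed
  hence "ind UNIV J <= card ((\<lambda>c. {y. y - F c \<in> J}) ` C)" unfolding ind_def using fin by (intro card_mono) auto
  also have "... <= card C" by (rule card_image_le[OF fin])
  finally show ?thesis .
qed

section \<open>Length as the logarithm of an index\<close>

context hyp
begin

lemma pM_aa: "pM p \<subseteq> aa" using pM_KV K_aa by blast

lemma p_dvd_cancel:
  assumes I: "is_ideal I" "pM p \<subseteq> I" and x: "of_int c * x \<in> I" and c: "\<not> int p dvd c"
  shows "x \<in> I"
proof -
  obtain u where u: "(u * c) mod int p = 1" using inverse_mod[OF pp c] .
  have "int p dvd u * c - 1" using u by (metis dvd_minus_mod)
  hence "of_int (u * c - 1) * x \<in> pM p" unfolding pM_def did_def mem_Collect_eq coef_of_int_mult by simp
  hence "of_int u * (of_int c * x) - of_int (u * c - 1) * x \<in> I" by (rule ideal_diff[OF I(1) ideal_mult[OF I(1) x] subsetD[OF I(2)]])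
  thus ?thesis by (simp add: algebra_simps)
qed

lemma ind_ge_p:
  assumes I: "is_ideal I" "pM p \<subseteq> I" and I': "is_ideal I'" "I \<subset> I'" and pos: "ind I' I > 0"
  shows "p <= ind I' I"
proof -
  obtain x where x: "x \<in> I'" "x \<notin> I" using I'(2) by blast
  have "card {..<p} <= ind I' I"
  proof (rule ind_card_le[OF ideal_subgp[OF I(1)] pos, of _ "\<lambda>k. of_nat k * x"])
    show "of_nat k * x \<in> I'" for k by (rule ideal_mult[OF I'(1) x(1)])
    fix k l assume kl: "k \<in> {..<p}" "l \<in> {..<p}" and "of_nat k * x - of_nat l * x \<in> I"
    hence "of_int (int k - int l) * x \<in> I" by (simp add: left_diff_distrib)
    hence "int p dvd int k - int l" using p_dvd_cancel[OF I] x(2) by blast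
    thus "k = l" using kl by (auto dest!: zdvd_imp_le[rotated] simp: dvd_diff_commute)
       (metis diff_0_right int_ops(1) lessThan_iff mod_eq_dvd_iff mod_less of_nat_eq_iff zmod_int)
  qed simp
  thus ?thesis by simp
qed

lemma length_upper:
  assumes "\<And>i. i <= n ==> is_ideal (I i)" "\<And>i. i < n ==> I i \<subset> I (Suc i)" "pM p \<subseteq> I 0" "ind UNIV (I 0) > 0"
  shows "p ^ n <= ind UNIV (I 0)"
  using assms
proof (induction n arbitrary: I)
  case 0 thus ?case by simp
next
  case (Suc n)
  have I01: "is_ideal (I 0)" "is_ideal (I 1)" "I 0 \<subset> I 1" using Suc.prems(1)[of 0] Suc.prems(1)[of 1] Suc.prems(2)[of 0] by auto
  have t: "ind UNIV (I 0) = ind UNIV (I 1) * ind (I 1) (I 0)" using I01 by (intro ind_tower ideal_subgp subgp_UNIV) auto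
  have pos: "ind UNIV (I 1) > 0" "ind (I 1) (I 0) > 0" using t Suc.prems(4) by (metis gr0I mult_0 mult_0_right)+
  have "p ^ n <= ind UNIV (I (Suc 0))" by (rule Suc.IH[of "\<lambda>i. I (Suc i)"]) (use Suc.prems pos I01 in auto)
  hence "p ^ n * p <= ind UNIV (I 1) * ind (I 1) (I 0)" using ind_ge_p[OF I01(1) Suc.prems(3) I01(2,3) pos(2)] by (intro mult_le_mono) auto
  thus ?case using t by (simp add: mult.commute)
qed

lemma mm_generated:
  assumes I: "is_ideal I" "aa \<subseteq> I" and v: "\<And>i. i <= d ==> vr i \<in> I"
  shows "mm \<subseteq> I"
proof -
  have "bI p (cV (Suc d) 1) \<subseteq> I" using K_aa I v by (intro box_ideal_generated) auto
  moreover have "cV (Suc d) 1 = (\<lambda>_. 1)" by (auto simp: cV_def fun_eq_iff)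
  ultimately show ?thesis by simp
qed

text \<open>Multiplying 1 by as high a power of each variable in turn as stays outside
  \<open>J\<close> yields an element killed by the maximal ideal. Adjoining it adds one copy of the
  residue field, which has \<open>p\<close> elements.\<close>

lemma socle_step:
  assumes J: "is_ideal J" "aa \<subseteq> J" "1 \<notin> J" and n: "\<And>i. i <= d ==> vr i ^ N \<in> J"
  obtains J' where "is_ideal J'" "J \<subset> J'" "ind J' J = p"
proof -
  have "\<exists>y. y \<notin> J \<and> (\<forall>i<k. vr i * y \<in> J)" if "k <= Suc d" for k using that
  proof (induction k)
    case 0 thus ?case using J(3) by auto
  next
    case (Suc k)
    then obtain y where y: "y \<notin> J" "\<And>i. i < k ==> vr i * y \<in> J" by auto
    define a where "a = (LEAST a. vr k ^ a * y \<in> J)"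
    have "vr k ^ N * y \<in> J" using n[of k] Suc.prems by (intro ideal_mult2[OF J(1)]) simp
    hence a: "vr k ^ a * y \<in> J" unfolding a_def by (rule LeastI)
    have "a \<noteq> 0" using a y(1) by (auto intro: ccontr)
    then obtain b where b: "a = Suc b" by (cases a) auto
    have "vr k ^ b * y \<notin> J" using not_less_Least[of b "\<lambda>a. vr k ^ a * y \<in> J"] b by (simp add: a_def)
    moreover have "vr i * (vr k ^ b * y) \<in> J" if "i < Suc k" for i
    proof (cases "i = k")
      case True thus ?thesis using a b by (simp add: mult.assoc)
    next
      case False
      hence "vr k ^ b * (vr i * y) \<in> J" using that by (intro ideal_mult[OF J(1)] y) simp
      thus ?thesis by (simp add: ac_simps)
    qed
    ultimately show ?case by blast
  qed
  from this[of "Suc d"] obtain y where y: "y \<notin> J" "\<And>i. i <= d ==> vr i * y \<in> J" by (auto simp: less_Suc_eq_le)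
  define C where "C = {r. r * y \<in> J}"
  have C: "is_ideal C" unfolding C_def by (rule is_idealI; unfold mem_Collect_eq)
      (simp_all add: ideal_0[OF J(1)] distrib_right ideal_add[OF J(1)] mult.assoc ideal_mult[OF J(1)])
  have mC: "mm \<subseteq> C" using J(2) y(2) by (intro mm_generated[OF C]) (auto simp: C_def intro: ideal_mult2[OF J(1)])
  have Cm: "C \<subseteq> mm"
  proof
    fix r assume r: "r \<in> C"
    show "r \<in> mm"
    proof (rule ccontr)
      assume "r \<notin> mm"
      then obtain b where "b * r - 1 \<in> aa" by (rule unit)
      hence "b * (r * y) - (b * r - 1) * y \<in> J" using r J(2) unfolding C_def
        by (intro ideal_diff[OF J(1) ideal_mult[OF J(1)] ideal_mult2[OF J(1)]]) auto
      thus False using y(1) by (simp add: algebra_simps)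
    qed
  qed
  have "ind UNIV mm = ind (with_gen J y) J"
  proof (rule ind_eqI[where \<phi> = "\<lambda>r. r * y", OF ideal_subgp[OF ideal_bI] ideal_subgp[OF J(1)]])
    show "r * y \<in> with_gen J y" for r by (rule with_gen_gen[OF J(1)])
    show "r * y - r' * y \<in> J \<longleftrightarrow> r - r' \<in> mm" for r r' using mC Cm unfolding left_diff_distrib[symmetric] C_def by blast
    show "\<exists>x\<in>UNIV. w - x * y \<in> J" if "w \<in> with_gen J y" for w using that by (auto simp: with_gen_def)
  qed
  hence "ind (with_gen J y) J = p" using ind_bI_one[OF prime_gt_0_nat[OF pp]] by simp
  moreover have "J \<subset> with_gen J y" using with_gen_sub[OF J(1), of y] with_gen_gen[OF J(1), of 1 y] y(1) by auto
  ultimately show ?thesis using that[OF ideal_with_gen[OF J(1)]] by blast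
qed

lemma length_lower:
  assumes "is_ideal J" "aa \<subseteq> J" "ind UNIV J > 0" "\<And>i. i <= d ==> vr i ^ N \<in> J"
  shows "\<exists>L I. p ^ L = ind UNIV J \<and> I 0 = J \<and> (\<forall>i\<le>L. is_ideal (I i)) \<and> (\<forall>i<L. I i \<subset> I (Suc i))"
  using assms
proof (induction "ind UNIV J" arbitrary: J rule: less_induct)
  case less
  show ?case
  proof (cases "1 \<in> J")
    case True
    hence "J = UNIV" using ideal_UNIV_iff[OF less.prems(1)] by simp
    hence "ind UNIV J = 1" using ind_self[OF subgp_UNIV] by simp
    thus ?thesis using less.prems(1) by (intro exI[of _ 0] exI[of _ "\<lambda>_. J"]) auto
  next
    case False
    obtain J' where J': "is_ideal J'" "J \<subset> J'" "ind J' J = p" using socle_step[OF less.prems(1,2) False less.prems(4)] .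
    have t: "ind UNIV J = ind UNIV J' * p" using ind_tower[OF ideal_subgp[OF less.prems(1)] ideal_subgp[OF J'(1)] subgp_UNIV] J'(2,3) by auto
    have pos: "ind UNIV J' > 0" using t less.prems(3) by (metis gr0I mult_0)
    have "ind UNIV J' < ind UNIV J" unfolding t using pos prime_gt_1_nat[OF pp] by simp
    moreover have "aa \<subseteq> J'" "\<And>i. i <= d ==> vr i ^ N \<in> J'" using less.prems(2,4) J'(2) by blast+
    ultimately obtain L I where I: "p ^ L = ind UNIV J'" "I 0 = J'" "\<And>i. i <= L ==> is_ideal (I i)" "\<And>i. i < L ==> I i \<subset> I (Suc i)"
      using less.hyps[OF _ J'(1) _ pos] by blast
    have "p ^ Suc L = ind UNIV J" using t I(1) by (simp add: mult.commute)
    moreover have "is_ideal (case i of 0 => J | Suc k => I k)" if "i <= Suc L" for i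
      using that I(3) less.prems(1) by (auto split: nat.split)
    moreover have "(case i of 0 => J | Suc k => I k) \<subset> (case Suc i of 0 => J | Suc k => I k)" if "i < Suc L" for i
      using that I(2,4) J'(2) by (auto split: nat.split)
    ultimately show ?thesis by (intro exI[of _ "Suc L"] exI[of _ "\<lambda>i. case i of 0 => J | Suc k => I k"]) auto
  qed
qed

text \<open>The ideal (x_0^q, ..., x_(d-1)^q) of R; after adding z^q it becomes the Frobenius power
  of the maximal ideal.\<close>

definition Jq :: "nat => mps set" where "Jq q = pr aa (bI p (cV d q)) (bI p (cV d q))"
definition Mq :: "nat => mps set" where "Mq q = with_gen (Jq q) (z ^ q)"

lemma ideal_Jq: "is_ideal (Jq q)" unfolding Jq_def by (rule pr_ideal[OF ideal_aa order_refl ideal_bI])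
lemma ideal_Mq: "is_ideal (Mq q)" unfolding Mq_def by (rule ideal_with_gen[OF ideal_Jq])
lemma aa_Jq: "aa \<subseteq> Jq q" unfolding Jq_def by (rule pr_sub[OF ideal_aa ideal_bI ideal_bI])
lemma Jq_Mq: "Jq q \<subseteq> Mq q" unfolding Mq_def by (rule with_gen_sub[OF ideal_Jq])
lemma aa_Mq: "aa \<subseteq> Mq q" using aa_Jq Jq_Mq by blast

lemma Jq_iff: "u \<in> A0 d ==> v \<in> A0 d ==> u + v * z \<in> Jq q \<longleftrightarrow> u \<in> bI p (cV d q) \<and> v \<in> bI p (cV d q)"
  unfolding Jq_def by (rule pr_iff[OF ideal_bI pM_bI ideal_bI pM_bI])

lemma Jq_A0: "u \<in> A0 d ==> u \<in> bI p (cV d q) ==> u \<in> Jq q"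
  using Jq_iff[of u 0 q] A0_0 ideal_0[OF ideal_bI] by simp

lemma Jq_generated:
  assumes "r \<in> Jq q" obtains g where "r - (\<Sum>j<d. g j * vr j ^ q) \<in> aa"
proof -
  obtain u v where *: "u \<in> A0 d" "u \<in> bI p (cV d q)" "v \<in> A0 d" "v \<in> bI p (cV d q)" "r - (u + v * z) \<in> aa"
    using assms by (auto simp: Jq_def pr_def)
  obtain g where g1: "u - (\<Sum>j<d. g j * vr j ^ q) \<in> pM p" by (rule box_generated[OF *(2,1)])
  obtain g' where g2: "v - (\<Sum>j<d. g' j * vr j ^ q) \<in> pM p" by (rule box_generated[OF *(4,3)])
  note g = g1 g2
  have "(r - (u + v * z)) + (u - (\<Sum>j<d. g j * vr j ^ q)) + (v - (\<Sum>j<d. g' j * vr j ^ q)) * z \<in> aa"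
    by (rule aa_add[OF aa_add[OF *(5) subsetD[OF pM_aa g(1)]] aa_mult2[OF subsetD[OF pM_aa g(2)]]])
  moreover have "(\<Sum>j<d. (g j + g' j * z) * vr j ^ q) = (\<Sum>j<d. g j * vr j ^ q) + (\<Sum>j<d. g' j * vr j ^ q) * z"
    unfolding sum_distrib_right sum.distrib[symmetric] by (intro sum.cong refl) (simp add: algebra_simps)
  ultimately show ?thesis using that[of "\<lambda>j. g j + g' j * z"] by (simp add: algebra_simps)
qed

lemma vr_A0: "j < d ==> vr j \<in> A0 d" by (auto simp: A0_def coef_mono)

lemma vr_Jq: assumes "j < d" "q > 0" shows "vr j ^ q \<in> Jq q"
proof (rule Jq_A0)
  show "vr j ^ q \<in> A0 d" by (intro A0_power vr_A0 assms)
  have "sng j q \<notin> box (cV d q)" using assms by (auto simp: box_def cV_def intro!: exI[of _ j])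
  thus "vr j ^ q \<in> bI p (cV d q)" by (auto simp: vr_power bI_def did_def coef_mono)
qed

lemma ind_Bq: "ind UNIV (bI p (cV d q)) = p ^ q ^ d" by (rule ind_cV[OF prime_gt_0_nat[OF pp]])

lemma ind_Jq: "ind UNIV (Jq q) = p ^ (2 * q ^ d)"
proof -
  have "ind UNIV (Jq q) = ind UNIV (bI p (cV d q)) * ind UNIV (bI p (cV d q))" using ideal_Jq by (intro ind_pr ideal_bI KV_bI) (auto simp: Jq_def)
  thus ?thesis by (simp add: ind_Bq mult_2 power_add)
qed

lemma z_pow: assumes "q = 2 * m + 1" shows "z ^ q - (-h) ^ m * z \<in> aa"
proof -
  have "z * z - (- h) \<in> aa" using z_sq by simp
  from aa_mult2[OF power_cong[OF ideal_aa this, of m], of z] show ?thesis by (simp add: assms power_mult power2_eq_square algebra_simps)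
qed

text \<open>With q = p^n > n also w^q = 0, and w^q = u^q + v^q (-h)^m z for w = u + v z. Since A
  modulo \<open>p\<close> is a domain in which \<open>h\<close> is nonzero, both components
  vanish.\<close>

lemma reduced: assumes w: "w ^ n \<in> aa" shows "w \<in> aa"
proof -
  let ?N = "KV p {..<d}"
  have Np: "is_prime ?N" by (rule prime_KV[OF pp]) simp
  obtain u v where uv: "u \<in> A0 d" "v \<in> A0 d" "w - (u + v * z) \<in> aa" by (rule repr)
  define q where "q = p ^ n"
  have "odd q" unfolding q_def using prime_odd_nat[OF pp p2] by simp
  then obtain m where m: "q = 2 * m + 1" by (rule oddE)
  let ?H = "(- h) ^ m"
  have HA: "?H \<in> A0 d" by (intro A0_power A0_uminus hA)
  have "n < q" unfolding q_def using power_gt_expt[of p n] prime_gt_1_nat[OF pp] by simp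
  hence "w ^ q = w ^ (q - n) * w ^ n" by (simp flip: power_add)
  hence wq: "w ^ q \<in> aa" using aa_mult[OF w] by simp
  note 1 = power_cong[OF ideal_aa uv(3), of q] and 2 = subsetD[OF pM_aa frob_add[OF pp q_def, of u "v * z"]]
    and 3 = aa_mult[OF z_pow[OF m], of "v ^ q"]
  from aa_diff[OF aa_diff[OF aa_diff[OF wq 1] 2] 3]
  have "u ^ q + (v ^ q * ?H) * z \<in> aa" by (simp add: power_mult_distrib algebra_simps)
  from uniq[OF A0_power[OF uv(1)] A0_mult[OF A0_power[OF uv(2)] HA] this]
  have "u ^ q \<in> ?N" "v ^ q * ?H \<in> ?N" using pM_KV by blast+
  moreover have "h \<in> ?N" if "- h \<in> ?N" using ideal_minus[OF ideal_KV that] by simp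
  ultimately have "u \<in> ?N" "v \<in> ?N" using prime_mult[OF Np] prime_power[OF Np] hK by blast+
  hence "u \<in> aa" "v \<in> aa" using A0_KV_pM[OF uv(1), of "{..<d}" p] A0_KV_pM[OF uv(2), of "{..<d}" p] pM_aa by auto
  from aa_add[OF uv(3) aa_add[OF this(1) aa_mult2[OF this(2), of z]]]
  show ?thesis by simp
qed

lemma h_sign: "(- h) ^ m = h ^ m \<or> (- h) ^ m = - (h ^ m)" by (cases "even m") auto

lemma with_gen_minus: "is_ideal I ==> with_gen I (- x) = with_gen I (x :: mps)"
  by (intro equalityI with_gen_least ideal_with_gen with_gen_sub; assumption?)
    (use with_gen_gen[of I "-1" x] with_gen_gen[of I "-1" "-x"] in simp_all)

text \<open>In R one has z^q = (-h)^m z, and z times this is -h (-h)^m. So the two components of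
  \<open>Mq q\<close> over A are generated, besides the box ideal, by h^(m+1) and h^m.\<close>

lemma ind_Mq:
  assumes q: "q = 2 * m + 1"
  shows "ind UNIV (Mq q) = ind UNIV (with_gen (bI p (cV d q)) (h ^ (m + 1))) * ind UNIV (with_gen (bI p (cV d q)) (h ^ m))"
proof -
  let ?B = "bI p (cV d q)" and ?H = "(- h) ^ m"
  have HA: "?H \<in> A0 d" by (intro A0_power A0_uminus hA)
  have "Mq q = pr aa (with_gen ?B (h * ?H)) (with_gen ?B ?H)"
  proof (intro equalityI subsetI)
    fix r assume "r \<in> Mq q"
    then obtain s where s: "r - s * z ^ q \<in> Jq q" by (auto simp: Mq_def with_gen_def)
    then obtain u v where uv: "u \<in> A0 d" "u \<in> ?B" "v \<in> A0 d" "v \<in> ?B" "r - s * z ^ q - (u + v * z) \<in> aa"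
      by (auto simp: Jq_def pr_def)
    obtain a b where ab: "a \<in> A0 d" "b \<in> A0 d" "s - (a + b * z) \<in> aa" by (rule repr)
    define U where "U = u + (- b) * (h * ?H)"
    define V where "V = v + a * ?H"
    have "(r - s * z ^ q - (u + v * z)) + s * (z ^ q - ?H * z) + (s - (a + b * z)) * (?H * z) + b * ?H * (z * z + h) \<in> aa"
      by (intro aa_add aa_mult aa_mult2 uv ab z_pow[OF q] z_sq)
    hence "r - (U + V * z) \<in> aa" by (simp add: U_def V_def algebra_simps)
    moreover have "U \<in> A0 d" "V \<in> A0 d" unfolding U_def V_def by (intro A0_add A0_mult A0_uminus uv ab hA HA)+
    moreover have "U \<in> with_gen ?B (h * ?H)" unfolding with_gen_def mem_Collect_eq by (rule exI[of _ "- b"]) (simp add: U_def uv)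
    moreover have "V \<in> with_gen ?B ?H" unfolding with_gen_def mem_Collect_eq by (rule exI[of _ a]) (simp add: V_def uv)
    ultimately show "r \<in> pr aa (with_gen ?B (h * ?H)) (with_gen ?B ?H)" unfolding pr_def by blast
  next
    fix r assume "r \<in> pr aa (with_gen ?B (h * ?H)) (with_gen ?B ?H)"
    then obtain u v where uv: "u \<in> A0 d" "u \<in> with_gen ?B (h * ?H)" "v \<in> A0 d" "v \<in> with_gen ?B ?H" "r - (u + v * z) \<in> aa"
      by (auto simp: pr_def)
    obtain b a where ba: "u - b * (h * ?H) \<in> ?B" "v - a * ?H \<in> ?B" using uv by (auto simp: with_gen_def)
    have r0B: "r0 d x \<in> ?B" if "x \<in> ?B" for x
    proof -
      have "x - (x - r0 d x) \<in> ?B" by (rule ideal_diff[OF ideal_bI that subsetD[OF KV_bI r0_KV]])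
      thus ?thesis by simp
    qed
    have r0id: "r0 d w = w" if "w \<in> A0 d" for w using that by (intro mps_eqI) (auto simp: coef_r0 A0_def)
    have cong: "x - r0 d y * w \<in> ?B" if x: "x \<in> A0 d" "w \<in> A0 d" "x - y * w \<in> ?B" for x y w
    proof -
      have "(x - y * w) + (y - r0 d y) * w \<in> ?B" by (intro ideal_add[OF ideal_bI] x ideal_mult2[OF ideal_bI] subsetD[OF KV_bI r0_KV])
      thus ?thesis by (simp add: algebra_simps)
    qed
    define b' where "b' = r0 d b"
    define a' where "a' = r0 d a"
    have A: "a' \<in> A0 d" "b' \<in> A0 d" by (simp_all add: a'_def b'_def r0_A0)
    have B: "u - b' * (h * ?H) \<in> ?B" "v - a' * ?H \<in> ?B" unfolding a'_def b'_def by (intro cong uv A0_mult hA HA ba)+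
    have "(u - b' * (h * ?H)) + (v - a' * ?H) * z \<in> Jq q"
      using B Jq_iff[of "u - b' * (h * ?H)" "v - a' * ?H" q] A0_diff[OF uv(1) A0_mult[OF A(2) A0_mult[OF hA HA]]] A0_diff[OF uv(3) A0_mult[OF A(1) HA]] by blast
    moreover have "(r - (u + v * z)) - (a' - b' * z) * (z ^ q - ?H * z) + b' * ?H * (z * z + h) \<in> Jq q"
      by (rule subsetD[OF aa_Jq aa_add[OF aa_diff[OF uv(5) aa_mult[OF z_pow[OF q]]] aa_mult[OF z_sq]]])
    ultimately have "((u - b' * (h * ?H)) + (v - a' * ?H) * z) + ((r - (u + v * z)) - (a' - b' * z) * (z ^ q - ?H * z) + b' * ?H * (z * z + h)) \<in> Jq q"
      by (rule ideal_add[OF ideal_Jq])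
    hence "r - (a' - b' * z) * z ^ q \<in> Jq q" by (simp add: algebra_simps)
    thus "r \<in> Mq q" by (auto simp: Mq_def with_gen_def)
  qed
  hence "ind UNIV (Mq q) = ind UNIV (with_gen ?B (h * ?H)) * ind UNIV (with_gen ?B ?H)"
    using KV_bI with_gen_sub[OF ideal_bI] by (intro ind_pr ideal_with_gen ideal_bI ideal_Mq) blast+
  moreover have "with_gen ?B ?H = with_gen ?B (h ^ m)" "with_gen ?B (h * ?H) = with_gen ?B (h ^ (m + 1))"
    using h_sign[of m] with_gen_minus[OF ideal_bI, of p "cV d q"] by auto
  ultimately show ?thesis by simp
qed

end

section \<open>Free summands of R^(1/q)\<close>

locale hyp_q = hyp +
  fixes e q m :: nat
  assumes q: "q = p ^ e" and qm: "q = 2 * m + 1"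
begin

lemma q0: "q > 0" by (simp add: qm)

lemma vr_mm: "vr i \<in> mm"
proof -
  have "sng i (Suc 0) \<noteq> 0" by (metis lookup_single_eq lookup_zero nat.distinct(1))
  thus ?thesis unfolding mm_iff by (simp add: coef_mono)
qed

lemma mm_power:
  assumes "x \<in> mm"
  obtains u v where "u \<in> A0 d" "v \<in> A0 d" "u ^ q \<in> Jq q" "x ^ q - (u ^ q + v ^ q * z ^ q) \<in> aa"
proof -
  obtain u v where uv: "u \<in> A0 d" "v \<in> A0 d" "x - (u + v * z) \<in> aa" by (rule repr)
  have "v * z \<in> mm" by (rule ideal_mult[OF ideal_bI vr_mm])
  hence "x - (x - (u + v * z)) - v * z \<in> mm" by (rule ideal_diff[OF ideal_bI ideal_diff[OF ideal_bI assms subsetD[OF aa_mm uv(3)]]])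
  hence "int p dvd coef u 0" unfolding mm_iff by simp
  hence uJ: "u ^ q \<in> Jq q" by (intro Jq_A0 A0_power uv power_q_bI[OF pp q])
  have "(x ^ q - (u + v * z) ^ q) + ((u + v * z) ^ q - (u ^ q + (v * z) ^ q)) \<in> aa"
    by (rule aa_add[OF power_cong[OF ideal_aa uv(3)] subsetD[OF pM_aa frob_add[OF pp q]]])
  hence "x ^ q - (u ^ q + v ^ q * z ^ q) \<in> aa" by (simp add: power_mult_distrib algebra_simps)
  thus ?thesis using that uv uJ by blast
qed

lemma power_mm_Mq: "x \<in> mm ==> x ^ q \<in> Mq q"
proof -
  assume "x \<in> mm"
  then obtain u v where uv: "u ^ q \<in> Jq q" "x ^ q - (u ^ q + v ^ q * z ^ q) \<in> aa" using mm_power by metis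
  have "(x ^ q - (u ^ q + v ^ q * z ^ q)) + (u ^ q + v ^ q * z ^ q) \<in> Mq q"
    by (rule ideal_add[OF ideal_Mq subsetD[OF aa_Mq uv(2)] ideal_add[OF ideal_Mq subsetD[OF Jq_Mq uv(1)]]])
       (simp add: Mq_def with_gen_gen[OF ideal_Jq])
  thus "x ^ q \<in> Mq q" by simp
qed

lemma Jq_least:
  assumes I: "is_ideal I" "aa \<subseteq> I" and v: "\<And>j. j < d ==> vr j ^ q \<in> I"
  shows "Jq q \<subseteq> I"
proof
  fix r assume "r \<in> Jq q"
  then obtain g where g: "r - (\<Sum>j<d. g j * vr j ^ q) \<in> aa" by (rule Jq_generated)
  have "(\<Sum>j<d. g j * vr j ^ q) \<in> I" by (intro ideal_sum[OF I(1)] ideal_mult[OF I(1)] v) auto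
  from ideal_add[OF I(1) subsetD[OF I(2) g] this] show "r \<in> I" by simp
qed

lemma Mq_least:
  assumes I: "is_ideal I" "aa \<subseteq> I" and v: "\<And>x. x \<in> mm ==> x ^ q \<in> I"
  shows "Mq q \<subseteq> I"
  unfolding Mq_def by (intro with_gen_least I Jq_least v vr_mm)

text \<open>Together with \<open>mm_power\<close> this shows that q-th powers of elements of the
  maximal ideal multiply z^q into \<open>Jq q\<close>.\<close>

lemma z2q: "z ^ q * z ^ q \<in> Jq q"
proof -
  have "z * z - (- h) \<in> aa" using z_sq by simp
  from power_cong[OF ideal_aa this, of q] have 1: "z ^ q * z ^ q - (- h) ^ q \<in> aa" by (simp add: power_mult_distrib)
  have "int p dvd coef (- h) 0" using h0 by simp
  hence "(- h) ^ q \<in> Jq q" by (intro Jq_A0 A0_power A0_uminus hA power_q_bI[OF pp q])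
  from ideal_add[OF ideal_Jq subsetD[OF aa_Jq 1] this] show ?thesis by simp
qed

text \<open>A splitting of R^(1/q) into a free module on \<open>b\<close> and a complement
  \<open>N\<close>, written with representatives: scalars act through their q-th powers, and
  \<open>N\<close> is a full preimage because it contains \<open>aa\<close>.\<close>

definition frk :: "nat => (nat => mps) => mps set => bool" where
  "frk a b N \<longleftrightarrow> is_subgp N \<and> aa \<subseteq> N \<and> (\<forall>r. \<forall>n\<in>N. r ^ q * n \<in> N) \<and>
    (\<forall>g. \<exists>e. g - (\<Sum>i<a. e i ^ q * b i) \<in> N) \<and>
    (\<forall>e. (\<Sum>i<a. e i ^ q * b i) \<in> N --> (\<forall>i<a. e i \<in> aa))"

lemma frk_0: "frk 0 b UNIV" by (simp add: frk_def)

lemma ind_Mq_Jq: "ind UNIV (Jq q) = ind UNIV (Mq q) * ind (Mq q) (Jq q)" "ind (Mq q) (Jq q) > 0" "ind UNIV (Mq q) > 0"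
proof -
  show t: "ind UNIV (Jq q) = ind UNIV (Mq q) * ind (Mq q) (Jq q)" by (intro ind_tower ideal_subgp ideal_Jq ideal_Mq subgp_UNIV Jq_Mq) simp
  have "ind UNIV (Jq q) > 0" using prime_gt_0_nat[OF pp] by (simp add: ind_Jq)
  thus "ind (Mq q) (Jq q) > 0" "ind UNIV (Mq q) > 0" using t by (metis gr0I mult_0 mult_0_right)+
qed

text \<open>The p^a combinations of the elements z^q \<open>b i\<close> with coefficients in F_p are
  distinct modulo \<open>Jq q\<close>. Freeness turns a relation into \<delta>_i z in (x_0, ...,
  x_(d-1)) R, and this forces \<delta>_i = 0 because 1, z is a basis over A.\<close>

lemma frk_upper:
  assumes "frk a b N" shows "p ^ a <= ind (Mq q) (Jq q)"
proof -
  have N: "is_subgp N" "aa \<subseteq> N" "\<And>r n. n \<in> N ==> r ^ q * n \<in> N" "\<And>g. \<exists>e. g - (\<Sum>i<a. e i ^ q * b i) \<in> N"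
    and indep: "\<And>e i. (\<Sum>i<a. e i ^ q * b i) \<in> N ==> i < a ==> e i \<in> aa" using assms by (auto simp: frk_def)
  let ?F = "\<lambda>c. \<Sum>i<a. of_nat (c i) * z ^ q * b i"
  have "card ({..<a} \<rightarrow>\<^sub>E {..<p}) <= ind (Mq q) (Jq q)"
  proof (rule ind_card_le[OF ideal_subgp[OF ideal_Jq] ind_Mq_Jq(2), of _ ?F])
    show "?F c \<in> Mq q" for c
    proof (rule ideal_sum[OF ideal_Mq])
      fix i
      have "of_nat (c i) * b i * z ^ q \<in> Mq q" unfolding Mq_def by (rule with_gen_gen[OF ideal_Jq])
      thus "of_nat (c i) * z ^ q * b i \<in> Mq q" by (simp add: ac_simps)
    qed
    fix c c' assume c: "c \<in> {..<a} \<rightarrow>\<^sub>E {..<p}" "c' \<in> {..<a} \<rightarrow>\<^sub>E {..<p}" and J: "?F c - ?F c' \<in> Jq q"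
    define \<delta> where "\<delta> i = int (c i) - int (c' i)" for i
    have d: "?F c - ?F c' = (\<Sum>i<a. of_int (\<delta> i) * z ^ q * b i)"
      unfolding sum_subtractf[symmetric] \<delta>_def by (intro sum.cong refl) (simp add: algebra_simps)
    obtain g where g: "(\<Sum>i<a. of_int (\<delta> i) * z ^ q * b i) - (\<Sum>j<d. g j * vr j ^ q) \<in> aa" by (rule Jq_generated[OF J[unfolded d]])
    have "\<forall>j. \<exists>E. g j - (\<Sum>i<a. E i ^ q * b i) \<in> N" using N(4) by blast
    then obtain E where E: "\<And>j. g j - (\<Sum>i<a. E j i ^ q * b i) \<in> N" by metis
    \<comment> \<open>The i-th coordinate of the relation after extracting q-th roots; integers are
      their own q-th powers modulo \<open>p\<close>.\<close>
    define w where "w i = of_int (\<delta> i) * z - (\<Sum>j<d. vr j * E j i)" for i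
    have w: "w i ^ q - (of_int (\<delta> i) * z ^ q - (\<Sum>j<d. vr j ^ q * E j i ^ q)) \<in> aa" for i
    proof -
      have "(w i ^ q - ((of_int (\<delta> i) * z) ^ q - (\<Sum>j<d. (vr j * E j i) ^ q))) + (of_int (\<delta> i) ^ q - of_int (\<delta> i)) * z ^ q \<in> aa"
        unfolding w_def by (rule subsetD[OF pM_aa ideal_add[OF ideal_pM frob_diff_sum[OF pp q] ideal_mult2[OF ideal_pM frob_of_int[OF pp q]]]])
      thus ?thesis by (simp add: power_mult_distrib algebra_simps)
    qed
    have "(\<Sum>i<a. w i ^ q * b i) \<in> N"
    proof -
      have 1: "(\<Sum>i<a. (w i ^ q - (of_int (\<delta> i) * z ^ q - (\<Sum>j<d. vr j ^ q * E j i ^ q))) * b i) \<in> N"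
        by (rule subsetD[OF N(2)]) (intro ideal_sum[OF ideal_aa] aa_mult2 w)
      have 2: "(\<Sum>j<d. vr j ^ q * (g j - (\<Sum>i<a. E j i ^ q * b i))) \<in> N" by (intro subgp_sum[OF N(1)] N(3) E)
      have s: "(\<Sum>j<d. vr j ^ q * (\<Sum>i<a. E j i ^ q * b i)) = (\<Sum>i<a. (\<Sum>j<d. vr j ^ q * E j i ^ q) * b i)"
        unfolding sum_distrib_left sum_distrib_right by (subst sum.swap) (simp add: mult.assoc)
      have "(\<Sum>i<a. (w i ^ q - (of_int (\<delta> i) * z ^ q - (\<Sum>j<d. vr j ^ q * E j i ^ q))) * b i)
        = (\<Sum>i<a. w i ^ q * b i) - (\<Sum>i<a. of_int (\<delta> i) * z ^ q * b i) + (\<Sum>i<a. (\<Sum>j<d. vr j ^ q * E j i ^ q) * b i)"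
        unfolding sum_subtractf[symmetric] sum.distrib[symmetric] by (intro sum.cong refl) (simp add: algebra_simps)
      moreover have "(\<Sum>j<d. vr j ^ q * (g j - (\<Sum>i<a. E j i ^ q * b i))) = (\<Sum>j<d. g j * vr j ^ q) - (\<Sum>i<a. (\<Sum>j<d. vr j ^ q * E j i ^ q) * b i)"
        unfolding right_diff_distrib sum_subtractf s by (simp add: mult.commute)
      ultimately have "(\<Sum>i<a. w i ^ q * b i) = (\<Sum>i<a. (w i ^ q - (of_int (\<delta> i) * z ^ q - (\<Sum>j<d. vr j ^ q * E j i ^ q))) * b i)
        + (\<Sum>j<d. vr j ^ q * (g j - (\<Sum>i<a. E j i ^ q * b i))) + ((\<Sum>i<a. of_int (\<delta> i) * z ^ q * b i) - (\<Sum>j<d. g j * vr j ^ q))" by simp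
      thus ?thesis using subgp_add[OF N(1) subgp_add[OF N(1) 1 2] subsetD[OF N(2) g]] by simp
    qed
    hence waa: "w i \<in> aa" if "i < a" for i using indep that by blast
    have "c i = c' i" if i: "i < a" for i
    proof -
      \<comment> \<open>The ideal (x_0, ..., x_(d-1)) R, modulo which no integer multiple of z
        vanishes unless \<open>p\<close> divides the integer.\<close>
      let ?I = "pr aa (bI p (cV d 1)) (bI p (cV d 1))"
      have I: "is_ideal ?I" by (rule pr_ideal[OF ideal_aa order_refl ideal_bI])
      have "vr j \<in> ?I" if "j < d" for j using vr_Jq[OF that, of 1] by (simp add: Jq_def)
      hence "(\<Sum>j<d. vr j * E j i) \<in> ?I" by (intro ideal_sum[OF I] ideal_mult2[OF I]) auto
      hence "w i + (\<Sum>j<d. vr j * E j i) \<in> ?I" by (rule ideal_add[OF I subsetD[OF pr_sub[OF ideal_aa ideal_bI ideal_bI] waa[OF i]]])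
      hence "0 + of_int (\<delta> i) * z \<in> ?I" by (simp add: w_def)
      hence "of_int (\<delta> i) \<in> bI p (cV d 1)" using pr_iff[OF ideal_bI pM_bI ideal_bI pM_bI A0_0 A0_of_int] by blast
      moreover have "0 \<in> box (cV d 1)" by (auto simp: box_def cV_def)
      ultimately have "int p dvd coef (of_int (\<delta> i)) 0" unfolding bI_def did_def by blast
      hence "int p dvd int (c i) - int (c' i)" unfolding coef_of_int by (simp add: \<delta>_def)
      moreover have "c i < p" "c' i < p" using c i by (auto simp: PiE_iff)
      ultimately show ?thesis by (metis mod_eq_dvd_iff mod_less of_nat_eq_iff zmod_int)
    qed
    thus "c = c'" using c by (intro PiE_ext) auto
  qed (simp add: finite_PiE)
  thus ?thesis by (simp add: card_PiE)
qed

lemma coord_exists: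
  obtains U W where "\<And>x. U x \<in> A0 d" "\<And>x. W x \<in> A0 d" "\<And>x. x - (U x + W x * z) \<in> aa"
proof -
  have "\<forall>x. \<exists>w. fst w \<in> A0 d \<and> snd w \<in> A0 d \<and> x - (fst w + snd w * z) \<in> aa"
  proof
    fix x
    obtain u v where "u \<in> A0 d" "v \<in> A0 d" "x - (u + v * z) \<in> aa" by (rule repr)
    thus "\<exists>w. fst w \<in> A0 d \<and> snd w \<in> A0 d \<and> x - (fst w + snd w * z) \<in> aa" by (intro exI[of _ "(u, v)"]) simp
  qed
  from choice[OF this] obtain w where "\<forall>x. fst (w x) \<in> A0 d \<and> snd (w x) \<in> A0 d \<and> x - (fst (w x) + snd (w x) * z) \<in> aa" ..
  thus ?thesis using that[of "\<lambda>x. fst (w x)" "\<lambda>x. snd (w x)"] by simp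
qed

text \<open>A-linearity only up to multiples of \<open>p\<close>, because the coordinates of an
  element over 1, z are determined only modulo \<open>p\<close>.\<close>

definition linear0 :: "(mps => mps) => bool" where
  "linear0 C \<longleftrightarrow> (\<forall>x. C x \<in> A0 d) \<and> (\<forall>x y. C (x - y) - (C x - C y) \<in> pM p) \<and> (\<forall>x\<in>aa. C x \<in> pM p) \<and>
    (\<forall>s\<in>A0 d. \<forall>x. C (s * x) - s * C x \<in> pM p)"

lemma coord_linear:
  assumes UW: "\<And>x. U x \<in> A0 d" "\<And>x. W x \<in> A0 d" "\<And>x. x - (U x + W x * z) \<in> aa"
  shows "linear0 U" "linear0 W"
proof -
  have un: "U x - s \<in> pM p" "W x - t \<in> pM p" if "s \<in> A0 d" "t \<in> A0 d" "x - (s + t * z) \<in> aa" for x s t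
  proof -
    have "(x - (s + t * z)) - (x - (U x + W x * z)) \<in> aa" by (rule aa_diff[OF that(3) UW(3)])
    hence "(U x - s) + (W x - t) * z \<in> aa" by (simp add: algebra_simps)
    from uniq[OF A0_diff[OF UW(1) that(1)] A0_diff[OF UW(2) that(2)] this] show "U x - s \<in> pM p" "W x - t \<in> pM p" .
  qed
  have 1: "U (x - y) - (U x - U y) \<in> pM p" "W (x - y) - (W x - W y) \<in> pM p" for x y
  proof -
    have "(x - (U x + W x * z)) - (y - (U y + W y * z)) \<in> aa" by (intro aa_diff[OF UW(3) UW(3)])
    hence "x - y - ((U x - U y) + (W x - W y) * z) \<in> aa" by (simp add: algebra_simps)
    from un[OF A0_diff[OF UW(1) UW(1)] A0_diff[OF UW(2) UW(2)] this]
    show "U (x - y) - (U x - U y) \<in> pM p" "W (x - y) - (W x - W y) \<in> pM p" .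
  qed
  have 2: "U x \<in> pM p" "W x \<in> pM p" if "x \<in> aa" for x using un[OF A0_0 A0_0, of x] that by simp_all
  have 3: "U (s * x) - s * U x \<in> pM p" "W (s * x) - s * W x \<in> pM p" if "s \<in> A0 d" for s x
  proof -
    have "s * (x - (U x + W x * z)) \<in> aa" by (intro aa_mult[OF UW(3)])
    hence "s * x - (s * U x + s * W x * z) \<in> aa" by (simp add: algebra_simps)
    from un[OF A0_mult[OF that UW(1)] A0_mult[OF that UW(2)] this]
    show "U (s * x) - s * U x \<in> pM p" "W (s * x) - s * W x \<in> pM p" .
  qed
  show "linear0 U" "linear0 W" using UW 1 2 3 by (simp_all add: linear0_def)
qed

text \<open>A functional \<open>T\<close> that is \<open>A\<close>-linear for the \<open>q\<close>-th power action extends to the \<open>R\<close>-linear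
  functional \<open>x \<mapsto> T (z\<^sup>q x) + T x z\<close>.\<close>

lemma functional_exists:
  assumes v: "z ^ q * v \<notin> Jq q"
  obtains \<phi> where "\<And>x y. \<phi> (x - y) - (\<phi> x - \<phi> y) \<in> aa" "\<And>x. x \<in> aa ==> \<phi> x \<in> aa"
    "\<And>r x. \<phi> (r ^ q * x) - r * \<phi> x \<in> aa" "\<phi> v \<notin> mm"
proof -
  obtain U W where UW: "\<And>x. U x \<in> A0 d" "\<And>x. W x \<in> A0 d" "\<And>x. x - (U x + W x * z) \<in> aa" by (rule coord_exists) blast
  have "\<not> (U (z ^ q * v) \<in> bI p (cV d q) \<and> W (z ^ q * v) \<in> bI p (cV d q))"
  proof
    assume "U (z ^ q * v) \<in> bI p (cV d q) \<and> W (z ^ q * v) \<in> bI p (cV d q)"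
    hence "U (z ^ q * v) + W (z ^ q * v) * z \<in> Jq q" using Jq_iff UW by blast
    from ideal_add[OF ideal_Jq subsetD[OF aa_Jq UW(3)[of "z ^ q * v"]] this] show False using v by simp
  qed
  then obtain C where C: "linear0 C" "C (z ^ q * v) \<notin> bI p (cV d q)" using coord_linear[OF UW] by blast
  \<comment> \<open>A monomial of the box that occurs in a component of z^q v modulo
    \<open>p\<close>. Its coefficient becomes the constant term of T(z^q v), which makes \<phi>(v) a
    unit.\<close>
  then obtain \<mu> where mu: "\<mu> \<in> box (cV d q)" "\<not> int p dvd coef (C (z ^ q * v)) \<mu>" by (auto simp: bI_def did_def)
  have muq: "ex \<mu> i < p ^ e" for i
  proof -
    have "ex \<mu> i < cV d q i" using mu(1) by (simp add: box_def)
    thus ?thesis using q0 q by (simp add: cV_def split: if_splits)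
  qed
  define T where "T x = lam q \<mu> (C x)" for x
  have CA: "C x \<in> A0 d" for x using C(1) by (simp add: linear0_def)
  have Tdiff: "T (x - y) - (T x - T y) \<in> pM p" for x y
    using C(1) lam_pM[of "C (x - y) - (C x - C y)" p q \<mu>] by (simp add: T_def linear0_def lam_diff)
  have T0: "T x \<in> pM p" if "x \<in> aa" for x using C(1) lam_pM that by (simp add: T_def linear0_def)
  have Tcong: "T x - T y \<in> pM p" if "x - y \<in> aa" for x y using ideal_diff[OF ideal_pM T0[OF that] Tdiff[of x y]] by simp
  have Tlin: "T (s ^ q * x) - s * T x \<in> pM p" if s: "s \<in> A0 d" for s x
  proof -
    have "C (s ^ q * x) - s ^ q * C x \<in> pM p" using C(1) A0_power[OF s] by (simp add: linear0_def)
    hence "lam q \<mu> (C (s ^ q * x)) - lam q \<mu> (C x * s ^ q) \<in> pM p" using lam_pM by (metis lam_diff mult.commute)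
    from ideal_add[OF ideal_pM this lam_power_mult[OF pp muq, of "C x" s, folded q]]
    show ?thesis by (simp add: T_def mult.commute)
  qed
  have TA: "T x \<in> A0 d" for x unfolding A0_def
  proof (intro CollectI allI impI)
    fix \<alpha> assume "coef (T x) \<alpha> \<noteq> 0"
    hence "coef (C x) (\<mu> + sc q \<alpha>) \<noteq> 0" by (simp add: T_def)
    hence "supp (\<mu> + sc q \<alpha>) \<subseteq> {..<d}" using CA unfolding A0_def by blast
    moreover have "supp \<alpha> \<subseteq> supp (\<mu> + sc q \<alpha>)" using q0 by (auto simp: in_keys_iff lookup_add)
    ultimately show "supp \<alpha> \<subseteq> {..<d}" by blast
  qed
  define \<phi> where "\<phi> x = T (z ^ q * x) + T x * z" for x
  have P1: "\<phi> (x - y) - (\<phi> x - \<phi> y) \<in> aa" for x y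
  proof -
    have "(T (z ^ q * x - z ^ q * y) - (T (z ^ q * x) - T (z ^ q * y))) + (T (x - y) - (T x - T y)) * z \<in> aa"
      by (rule aa_add[OF subsetD[OF pM_aa Tdiff] aa_mult2[OF subsetD[OF pM_aa Tdiff]]])
    thus ?thesis by (simp add: \<phi>_def algebra_simps)
  qed
  have P2: "\<phi> x \<in> aa" if "x \<in> aa" for x unfolding \<phi>_def
    by (rule aa_add[OF subsetD[OF pM_aa T0[OF aa_mult[OF that]]] aa_mult2[OF subsetD[OF pM_aa T0[OF that]]]])
  have Pcong: "\<phi> x - \<phi> y \<in> aa" if "x - y \<in> aa" for x y using aa_diff[OF P2[OF that] P1[of x y]] by simp
  have Padd: "\<phi> (x + y) - (\<phi> x + \<phi> y) \<in> aa" for x y using ideal_minus[OF ideal_aa P1[of "x + y" y]] by (simp add: algebra_simps)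
  have PA: "\<phi> (s ^ q * x) - s * \<phi> x \<in> aa" if s: "s \<in> A0 d" for s x
  proof -
    have "(T (s ^ q * (z ^ q * x)) - s * T (z ^ q * x)) + (T (s ^ q * x) - s * T x) * z \<in> aa"
      by (rule aa_add[OF subsetD[OF pM_aa Tlin[OF s]] aa_mult2[OF subsetD[OF pM_aa Tlin[OF s]]]])
    thus ?thesis by (simp add: \<phi>_def algebra_simps)
  qed
  \<comment> \<open>The reason for the form of \<open>\<phi>\<close>: multiplication by z exchanges
    the two components, since T(z^(2q) x) = -h T(x).\<close>
  have Pz: "\<phi> (z ^ q * x) - z * \<phi> x \<in> aa" for x
  proof -
    have "z * z - (- h) \<in> aa" using z_sq by simp
    from aa_mult2[OF power_cong[OF ideal_aa this, of q], of x]
    have "z ^ q * (z ^ q * x) - (- h) ^ q * x \<in> aa" by (simp add: power_mult_distrib algebra_simps)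
    hence 1: "T (z ^ q * (z ^ q * x)) - T ((- h) ^ q * x) \<in> aa" using Tcong pM_aa by blast
    have 2: "T ((- h) ^ q * x) - (- h) * T x \<in> aa" using Tlin[OF A0_uminus[OF hA]] pM_aa by blast
    have "(T (z ^ q * (z ^ q * x)) - T ((- h) ^ q * x)) + (T ((- h) ^ q * x) - (- h) * T x) - T x * (z * z + h) \<in> aa"
      by (rule aa_diff[OF aa_add[OF 1 2] aa_mult[OF z_sq]])
    thus ?thesis by (simp add: \<phi>_def algebra_simps)
  qed
  have P3: "\<phi> (r ^ q * x) - r * \<phi> x \<in> aa" for r x
  proof -
    obtain s t where st: "s \<in> A0 d" "t \<in> A0 d" "r - (s + t * z) \<in> aa" by (rule repr)
    have "(r ^ q - (s + t * z) ^ q) + ((s + t * z) ^ q - (s ^ q + (t * z) ^ q)) \<in> aa"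
      by (rule aa_add[OF power_cong[OF ideal_aa st(3)] subsetD[OF pM_aa frob_add[OF pp q]]])
    from aa_mult2[OF this, of x]
    have "r ^ q * x - (s ^ q * x + t ^ q * (z ^ q * x)) \<in> aa" by (simp add: power_mult_distrib algebra_simps)
    note 1 = Pcong[OF this] and 2 = Padd[of "s ^ q * x" "t ^ q * (z ^ q * x)"] and 3 = PA[OF st(1), of x]
      and 4 = PA[OF st(2), of "z ^ q * x"] and 5 = aa_mult[OF Pz[of x], of t]
    have 6: "(r - (s + t * z)) * \<phi> x \<in> aa" by (rule aa_mult2[OF st(3)])
    from aa_diff[OF aa_add[OF aa_add[OF aa_add[OF aa_add[OF 1 2] 3] 4] 5] 6]
    show ?thesis by (simp add: algebra_simps)
  qed
  have "\<phi> v \<notin> mm"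
  proof
    assume "\<phi> v \<in> mm"
    hence "int p dvd coef (T (z ^ q * v)) 0" using vr_mm[of d] unfolding mm_iff by (simp add: \<phi>_def dvd_add_left_iff)
    moreover have "sc q 0 = 0" by (rule poly_mapping_eqI) simp
    ultimately show False using mu(2) by (simp add: T_def)
  qed
  thus ?thesis using that P1 P2 P3 by blast
qed

text \<open>If z^q multiplied \<open>N\<close> into \<open>Jq q\<close>, the \<open>b i\<close>
  would span R/(Jq : z^q) over F_p and its index would be at most p^a. Hence some \<open>n\<close>
  in \<open>N\<close> admits a functional with unit value, and that splits a free summand off
  \<open>N\<close>.\<close>

lemma frk_step:
  assumes F: "frk a b N" and lt: "p ^ a < ind (Mq q) (Jq q)"
  shows "\<exists>b N. frk (Suc a) b N"
proof -
  have N: "is_subgp N" "aa \<subseteq> N" "\<And>r n. n \<in> N ==> r ^ q * n \<in> N" and gen: "\<And>g. \<exists>e. g - (\<Sum>i<a. e i ^ q * b i) \<in> N"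
    and indep: "\<And>e i. (\<Sum>i<a. e i ^ q * b i) \<in> N ==> i < a ==> e i \<in> aa" using F by (auto simp: frk_def)
  define Ie where "Ie = {v. z ^ q * v \<in> Jq q}"
  have Ie: "is_ideal Ie" unfolding Ie_def by (rule is_idealI; unfold mem_Collect_eq)
      (simp_all add: ideal_0[OF ideal_Jq] distrib_left ideal_add[OF ideal_Jq] mult.left_commute ideal_mult[OF ideal_Jq])
  have indIe: "ind UNIV Ie = ind (Mq q) (Jq q)"
  proof (rule ind_eqI[where \<phi> = "\<lambda>x. z ^ q * x", OF ideal_subgp[OF Ie] ideal_subgp[OF ideal_Jq]])
    show "z ^ q * x \<in> Mq q" for x using with_gen_gen[OF ideal_Jq, of x "z ^ q" q] by (simp add: Mq_def mult.commute)
    show "z ^ q * x - z ^ q * y \<in> Jq q \<longleftrightarrow> x - y \<in> Ie" for x y by (simp add: Ie_def right_diff_distrib)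
    show "\<exists>x\<in>UNIV. w - z ^ q * x \<in> Jq q" if "w \<in> Mq q" for w using that by (auto simp: Mq_def with_gen_def mult.commute)
  qed
  have "\<not> N \<subseteq> Ie"
  proof
    assume NI: "N \<subseteq> Ie"
    \<comment> \<open>Modulo (Jq : z^q) a scalar acts only through its constant term, which is why
      F_p-combinations are enough below.\<close>
    have mmI: "x ^ q \<in> Ie" if x: "x \<in> mm" for x
    proof -
      obtain u v where uv: "u ^ q \<in> Jq q" "x ^ q - (u ^ q + v ^ q * z ^ q) \<in> aa" using mm_power[OF x] by metis
      have "z ^ q * (x ^ q - (u ^ q + v ^ q * z ^ q)) + z ^ q * u ^ q + v ^ q * (z ^ q * z ^ q) \<in> Jq q"
        by (intro ideal_add[OF ideal_Jq] ideal_mult[OF ideal_Jq] subsetD[OF aa_Jq uv(2)] uv(1) z2q)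
      thus ?thesis by (simp add: Ie_def algebra_simps)
    qed
    have "ind UNIV Ie <= card ({..<a} \<rightarrow>\<^sub>E {..<p})"
    proof (rule ind_le_card[OF ideal_subgp[OF Ie], of _ "\<lambda>c. \<Sum>i<a. of_nat (c i) * b i"])
      fix x
      obtain E where E: "x - (\<Sum>i<a. E i ^ q * b i) \<in> N" using gen by blast
      define c where "c = (\<lambda>i\<in>{..<a}. nat (coef (E i) 0 mod int p))"
      have p0: "int p > 0" using prime_gt_0_nat[OF pp] by simp
      have c: "c \<in> {..<a} \<rightarrow>\<^sub>E {..<p}" using p0 by (auto simp: c_def nat_less_iff)
      have ci: "E i ^ q - of_nat (c i) \<in> Ie" if i: "i < a" for i
      proof -
        let ?k = "of_int (int (c i)) :: mps"
        have "int (c i) = coef (E i) 0 mod int p" using i p0 by (simp add: c_def)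
        hence "int p dvd coef (E i - ?k) 0" by (simp add: coef_of_int del: of_int_of_nat_eq)
        hence "(E i - ?k) ^ q \<in> Ie" by (intro mmI) (simp only: mm_iff)
        moreover have "(E i - ?k + ?k) ^ q - ((E i - ?k) ^ q + ?k ^ q) \<in> Ie"
          by (rule subsetD[OF _ frob_add[OF pp q]]) (use pM_aa N(2) NI in blast)
        moreover have "?k ^ q - ?k \<in> Ie" by (rule subsetD[OF _ frob_of_int[OF pp q]]) (use pM_aa N(2) NI in blast)
        ultimately have "(E i - ?k) ^ q + ((E i - ?k + ?k) ^ q - ((E i - ?k) ^ q + ?k ^ q)) + (?k ^ q - ?k) \<in> Ie" by (intro ideal_add[OF Ie])
        thus ?thesis by simp
      qed
      have "(x - (\<Sum>i<a. E i ^ q * b i)) + (\<Sum>i<a. (E i ^ q - of_nat (c i)) * b i) \<in> Ie"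
        using E NI ci by (intro ideal_add[OF Ie] ideal_sum[OF Ie] ideal_mult2[OF Ie]) auto
      hence "x - (\<Sum>i<a. of_nat (c i) * b i) \<in> Ie" by (simp add: left_diff_distrib sum_subtractf)
      thus "\<exists>c\<in>{..<a} \<rightarrow>\<^sub>E {..<p}. x - (\<Sum>i<a. of_nat (c i) * b i) \<in> Ie" using c by blast
    qed (simp add: finite_PiE)
    thus False using lt indIe by (simp add: card_PiE)
  qed
  then obtain n where n: "n \<in> N" "z ^ q * n \<notin> Jq q" by (auto simp: Ie_def)
  obtain \<phi> where \<phi>: "\<And>x y. \<phi> (x - y) - (\<phi> x - \<phi> y) \<in> aa" "\<And>x. x \<in> aa ==> \<phi> x \<in> aa"
    "\<And>r x. \<phi> (r ^ q * x) - r * \<phi> x \<in> aa" "\<phi> n \<notin> mm" by (rule functional_exists[OF n(2)]) blast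
  obtain s where s: "s * \<phi> n - 1 \<in> aa" using unit[OF \<phi>(4)] .
  define N' where "N' = {x \<in> N. \<phi> x \<in> aa}"
  have diff: "\<phi> (x - y) \<in> aa \<longleftrightarrow> \<phi> x - \<phi> y \<in> aa" for x y using ideal_diff_iff[OF ideal_aa \<phi>(1)] .
  have phin: "x \<in> aa" if "\<phi> (x ^ q * n) \<in> aa" for x
  proof -
    have "\<phi> (x ^ q * n) - (\<phi> (x ^ q * n) - x * \<phi> n) \<in> aa" by (rule aa_diff[OF that \<phi>(3)])
    hence "x * \<phi> n \<in> aa" by simp
    from aa_diff[OF aa_mult[OF this, of s] aa_mult[OF s, of x]]
    show ?thesis by (simp add: algebra_simps)
  qed
  define b' where "b' i = (if i = a then n else b i)" for i
  have sum': "(\<Sum>i<Suc a. E i ^ q * b' i) = (\<Sum>i<a. E i ^ q * b i) + E a ^ q * n" for E by (simp add: b'_def)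
  have "frk (Suc a) b' N'" unfolding frk_def
  proof (intro conjI allI impI ballI)
    show "is_subgp N'"
    proof (rule is_subgpI)
      show "0 \<in> N'" using subgp_0[OF N(1)] \<phi>(2)[OF ideal_0[OF ideal_aa]] by (simp add: N'_def)
      show "x - y \<in> N'" if "x \<in> N'" "y \<in> N'" for x y using that subgp_diff[OF N(1)] diff aa_diff by (simp add: N'_def)
    qed
    show "aa \<subseteq> N'" using N(2) \<phi>(2) by (auto simp: N'_def)
    show "r ^ q * x \<in> N'" if "x \<in> N'" for r x
    proof -
      have "(\<phi> (r ^ q * x) - r * \<phi> x) + r * \<phi> x \<in> aa" using that by (intro aa_add[OF \<phi>(3)] aa_mult) (simp add: N'_def)
      thus ?thesis using N(3) that by (simp add: N'_def)
    qed
    show "\<exists>E. g - (\<Sum>i<Suc a. E i ^ q * b' i) \<in> N'" for g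
    proof -
      obtain E where E: "g - (\<Sum>i<a. E i ^ q * b i) \<in> N" using gen by blast
      define y where "y = g - (\<Sum>i<a. E i ^ q * b i)"
      \<comment> \<open>The coefficient of \<open>n\<close> is chosen so that \<open>\<phi>\<close>
        vanishes on the remainder; \<open>s\<close> inverts the unit
        \<open>\<phi> n\<close>.\<close>
      define E' where "E' i = (if i = a then s * \<phi> y else E i)" for i
      have "(\<Sum>i<Suc a. E' i ^ q * b' i) = (\<Sum>i<a. E i ^ q * b i) + (s * \<phi> y) ^ q * n" unfolding sum' by (simp add: E'_def)
      hence r: "g - (\<Sum>i<Suc a. E' i ^ q * b' i) = y - (s * \<phi> y) ^ q * n" by (simp add: y_def)
      have "y - (s * \<phi> y) ^ q * n \<in> N" using E n N(1,3) by (intro subgp_diff[OF N(1)]) (simp_all add: y_def)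
      moreover have "\<phi> y - \<phi> ((s * \<phi> y) ^ q * n) \<in> aa"
      proof -
        have "- (\<phi> ((s * \<phi> y) ^ q * n) - (s * \<phi> y) * \<phi> n) - \<phi> y * (s * \<phi> n - 1) \<in> aa"
          by (intro aa_diff[OF ideal_minus[OF ideal_aa \<phi>(3)] aa_mult[OF s]])
        thus ?thesis by (simp add: algebra_simps)
      qed
      ultimately have "g - (\<Sum>i<Suc a. E' i ^ q * b' i) \<in> N'" unfolding r N'_def using diff by blast
      thus ?thesis by blast
    qed
    show "E i \<in> aa" if E: "(\<Sum>i<Suc a. E i ^ q * b' i) \<in> N'" and i: "i < Suc a" for E i
    proof -
      have E': "(\<Sum>i<a. E i ^ q * b i) + E a ^ q * n \<in> N" "\<phi> ((\<Sum>i<a. E i ^ q * b i) + E a ^ q * n) \<in> aa"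
        using E unfolding sum' by (simp_all add: N'_def)
      have "((\<Sum>i<a. E i ^ q * b i) + E a ^ q * n) - E a ^ q * n \<in> N" by (intro subgp_diff[OF N(1)] E' N(3) n)
      hence ba: "(\<Sum>i<a. E i ^ q * b i) \<in> N" by simp
      hence Ei: "E i \<in> aa" if "i < a" for i using indep that by blast
      have saa: "(\<Sum>i<a. E i ^ q * b i) \<in> aa" using Ei q0 by (intro ideal_sum[OF ideal_aa] aa_mult2 ideal_power[OF ideal_aa]) auto
      have "\<phi> (((\<Sum>i<a. E i ^ q * b i) + E a ^ q * n) - (\<Sum>i<a. E i ^ q * b i)) \<in> aa"
        unfolding diff by (rule aa_diff[OF E'(2) \<phi>(2)[OF saa]])
      hence "E a \<in> aa" using phin by simp
      thus ?thesis using Ei i by (auto simp: less_Suc_eq)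
    qed
  qed
  thus ?thesis by blast
qed

lemma max_frk:
  obtains a where "p ^ a = ind (Mq q) (Jq q)" "\<exists>b N. frk a b N" "\<And>a' b N. frk a' b N ==> a' <= a"
proof -
  let ?P = "\<lambda>a. \<exists>b N. frk a b N"
  have up: "p ^ a <= ind (Mq q) (Jq q)" if "?P a" for a using that frk_upper by blast
  have bd: "a <= ind (Mq q) (Jq q)" if "?P a" for a
  proof -
    have "a < p ^ a" using power_gt_expt[of p a] prime_gt_1_nat[OF pp] by simp
    thus ?thesis using up[OF that] by simp
  qed
  define a where "a = (GREATEST a. ?P a)"
  have "?P 0" using frk_0 by blast
  hence Pa: "?P a" unfolding a_def using bd by (rule GreatestI_nat)
  have max: "a' <= a" if "?P a'" for a' unfolding a_def using that bd by (rule Greatest_le_nat)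
  have "\<not> p ^ a < ind (Mq q) (Jq q)"
  proof
    assume "p ^ a < ind (Mq q) (Jq q)"
    hence "?P (Suc a)" using frk_step Pa by blast
    thus False using max by fastforce
  qed
  hence "p ^ a = ind (Mq q) (Jq q)" using up[OF Pa] by simp
  thus ?thesis using that[of a] Pa max by blast
qed

end

subsection \<open>Rings presented as quotients\<close>

lemma subgroup_cong:
  fixes G :: "('a, 'b) monoid_scheme" and G' :: "('a, 'c) monoid_scheme"
  assumes "carrier G = carrier G'" "mult G = mult G'" "one G = one G'"
  shows "subgroup H G \<longleftrightarrow> subgroup H G'"
proof -
  have "m_inv G = m_inv G'" by (intro ext) (simp add: m_inv_def assms)
  thus ?thesis by (simp add: subgroup_def assms)
qed

text \<open>The bridge to carrier-based algebra: \<open>R\<close> is the image of a type-class ring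
  with kernel \<open>aa\<close>. The ring axioms of \<open>R\<close> follow from the presentation,
  so iterated quotients need no further verification.\<close>

locale presented =
  fixes R :: "('a, 'r) ring_scheme" (structure) and \<pi> :: "'m::comm_ring_1 => 'a" and aa :: "'m set"
  assumes surj: "range \<pi> = carrier R"
    and hom_add: "\<pi> (x + y) = \<pi> x \<oplus> \<pi> y"
    and hom_mult: "\<pi> (x * y) = \<pi> x \<otimes> \<pi> y"
    and hom_1: "\<pi> 1 = \<one>" and hom_0: "\<pi> 0 = \<zero>"
    and ker: "\<pi> x = \<pi> y \<longleftrightarrow> x - y \<in> aa"
begin

lemma closed: "\<pi> x \<in> carrier R" using surj by blast

lemma lift: assumes "a \<in> carrier R" obtains x where "a = \<pi> x" using assms surj by blast

lemma ker_0: "\<pi> x = \<zero> \<longleftrightarrow> x \<in> aa" using ker[of x 0] by (simp add: hom_0)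

lemma cring: "cring R"
proof (rule cringI)
  show "abelian_group R"
  proof (rule abelian_groupI)
    fix a b c assume a: "a \<in> carrier R" and b: "b \<in> carrier R" and c: "c \<in> carrier R"
    obtain x y z where [simp]: "a = \<pi> x" "b = \<pi> y" "c = \<pi> z" using a b c lift by metis
    show "a \<oplus> b \<in> carrier R" "a \<oplus> b = b \<oplus> a" "a \<oplus> b \<oplus> c = a \<oplus> (b \<oplus> c)" "\<zero> \<oplus> a = a"
      by (simp_all add: closed ac_simps flip: hom_add hom_0)
    show "\<exists>b\<in>carrier R. b \<oplus> a = \<zero>" by (rule bexI[of _ "\<pi> (- x)"]) (simp_all add: closed flip: hom_add hom_0)
  qed (simp_all add: closed flip: hom_0)
  show "comm_monoid R"
  proof (rule comm_monoidI)
    fix a b c assume a: "a \<in> carrier R" and b: "b \<in> carrier R" and c: "c \<in> carrier R"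
    obtain x y z where [simp]: "a = \<pi> x" "b = \<pi> y" "c = \<pi> z" using a b c lift by metis
    show "a \<otimes> b \<in> carrier R" "a \<otimes> b = b \<otimes> a" "a \<otimes> b \<otimes> c = a \<otimes> (b \<otimes> c)" "\<one> \<otimes> a = a"
      by (simp_all add: closed ac_simps flip: hom_mult hom_1)
  qed (simp_all add: closed flip: hom_1)
  fix a b c assume a: "a \<in> carrier R" and b: "b \<in> carrier R" and c: "c \<in> carrier R"
  obtain x y z where [simp]: "a = \<pi> x" "b = \<pi> y" "c = \<pi> z" using a b c lift by metis
  show "(a \<oplus> b) \<otimes> c = a \<otimes> c \<oplus> b \<otimes> c" by (simp add: distrib_right flip: hom_mult hom_add)
qed

sublocale R: cring R by (rule cring)

lemma hom_minus: "\<pi> (- x) = \<ominus> \<pi> x"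
  by (rule R.minus_equality[symmetric]) (simp_all add: closed flip: hom_add hom_0)

lemma hom_diff: "\<pi> (x - y) = \<pi> x \<ominus> \<pi> y"
  using hom_add[of x "- y"] by (simp add: hom_minus a_minus_def)

lemma hom_power: "\<pi> x [^] (n::nat) = \<pi> (x ^ n)"
  by (induction n) (simp_all add: hom_1 hom_mult closed R.m_comm)

lemma ideal_aa: "is_ideal aa"
proof (rule is_idealI)
  show "0 \<in> aa" using ker[of 0 0] by simp
  show "x + y \<in> aa" if "x \<in> aa" "y \<in> aa" for x y using that by (simp add: hom_add flip: ker_0)
  show "r * x \<in> aa" if "x \<in> aa" for r x using that closed by (simp add: hom_mult flip: ker_0)
qed

lemma subgroup_pre:
  assumes "subgroup H (add_monoid R)"
  shows "is_subgp {x. \<pi> x \<in> H}" "aa \<subseteq> {x. \<pi> x \<in> H}" "\<pi> ` {x. \<pi> x \<in> H} = H"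
proof -
  interpret H: additive_subgroup H R by (rule additive_subgroup.intro[OF assms])
  show "is_subgp {x. \<pi> x \<in> H}" by (rule is_subgpI) (simp_all add: hom_0 hom_diff a_minus_def)
  show "aa \<subseteq> {x. \<pi> x \<in> H}" by (auto simp flip: ker_0)
  have "H \<subseteq> range \<pi>" using H.a_subset surj by simp
  thus "\<pi> ` {x. \<pi> x \<in> H} = H" by blast
qed

lemma subgroup_image:
  assumes J: "is_subgp J" shows "subgroup (\<pi> ` J) (add_monoid R)"
proof
  show "\<pi> ` J \<subseteq> carrier (add_monoid R)" by (auto simp: closed)
  show "x \<otimes>\<^bsub>add_monoid R\<^esub> y \<in> \<pi> ` J" if "x \<in> \<pi> ` J" "y \<in> \<pi> ` J" for x y
    using that subgp_add[OF J] by (auto simp flip: hom_add)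
  show "\<one>\<^bsub>add_monoid R\<^esub> \<in> \<pi> ` J" using subgp_0[OF J] by (auto simp flip: hom_0)
  show "inv\<^bsub>add_monoid R\<^esub> x \<in> \<pi> ` J" if "x \<in> \<pi> ` J" for x
    using that subgp_minus[OF J] by (auto simp flip: hom_minus a_inv_def)
qed

lemma image_iff: assumes "is_subgp J" "aa \<subseteq> J" shows "\<pi> x \<in> \<pi> ` J \<longleftrightarrow> x \<in> J"
proof
  assume "\<pi> x \<in> \<pi> ` J"
  then obtain y where y: "y \<in> J" "x - y \<in> aa" by (auto simp: ker)
  hence "(x - y) + y \<in> J" using assms by (intro subgp_add) auto
  thus "x \<in> J" by simp
qed simp

lemma ideal_pre:
  assumes "ideal I R" shows "is_ideal {x. \<pi> x \<in> I}" "aa \<subseteq> {x. \<pi> x \<in> I}" "\<pi> ` {x. \<pi> x \<in> I} = I"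
proof -
  interpret I: ideal I R by fact
  show "is_ideal {x. \<pi> x \<in> I}" by (rule is_idealI) (simp_all add: hom_0 hom_add hom_mult closed I.I_l_closed)
qed (use subgroup_pre[OF additive_subgroup.a_subgroup[OF ideal.axioms(1)[OF assms]]] in blast)+

lemma ideal_image: assumes J: "is_ideal J" shows "ideal (\<pi> ` J) R"
proof (rule idealI[OF R.ring_axioms subgroup_image[OF ideal_subgp[OF J]]])
  fix a x assume "a \<in> \<pi> ` J" and x: "x \<in> carrier R"
  then obtain b where [simp]: "a = \<pi> b" and b: "b \<in> J" by blast
  obtain y where [simp]: "x = \<pi> y" using x by (rule lift)
  show "x \<otimes> a \<in> \<pi> ` J" "a \<otimes> x \<in> \<pi> ` J" using ideal_mult[OF J b] ideal_mult2[OF J b] by (auto simp flip: hom_mult)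
qed

lemma prime_pre: assumes "primeideal P R" shows "is_prime {x. \<pi> x \<in> P}"
proof -
  interpret P: primeideal P R by fact
  have "\<pi> 1 \<notin> P" using P.I_notcarr P.one_imp_carrier by (auto simp: hom_1)
  moreover have "\<pi> a \<in> P \<or> \<pi> b \<in> P" if "\<pi> (a * b) \<in> P" for a b
    using that P.I_prime[OF closed closed] by (simp add: hom_mult)
  ultimately show ?thesis using ideal_pre(1)[OF P.is_ideal] by (simp add: is_prime_def)
qed

lemma prime_image: assumes P: "is_prime P" "aa \<subseteq> P" shows "primeideal (\<pi> ` P) R"
proof (rule primeidealI[OF ideal_image[OF prime_ideal[OF P(1)]] cring])
  note iff = image_iff[OF ideal_subgp[OF prime_ideal[OF P(1)]] P(2)]
  show "carrier R \<noteq> \<pi> ` P" using iff[of 1] prime_1[OF P(1)] closed by blast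
  fix a b assume "a \<in> carrier R" "b \<in> carrier R" and ab: "a \<otimes> b \<in> \<pi> ` P"
  then obtain x y where [simp]: "a = \<pi> x" "b = \<pi> y" using lift by metis
  have "x * y \<in> P" using ab iff by (simp flip: hom_mult)
  thus "a \<in> \<pi> ` P \<or> b \<in> \<pi> ` P" using prime_mult[OF P(1)] by auto
qed

lemma krull_dim_eq:
  assumes ex: "\<exists>P. (\<forall>i\<le>n. is_prime (P i) \<and> aa \<subseteq> P i) \<and> (\<forall>i<n. P i \<subset> P (Suc i))"
    and bound: "\<And>k P. \<forall>i\<le>k. is_prime (P i) ==> aa \<subseteq> P 0 ==> \<forall>i<k. P i \<subset> P (Suc i) ==> k <= n"
  shows "krull_dim R = enat n"
  unfolding krull_dim_def
proof (rule antisym)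
  obtain P where P: "\<And>i. i <= n ==> is_prime (P i)" "\<And>i. i <= n ==> aa \<subseteq> P i" "\<And>i. i < n ==> P i \<subset> P (Suc i)" using ex by blast
  have "\<pi> ` P i \<subset> \<pi> ` P (Suc i)" if i: "i < n" for i
  proof -
    obtain x where "x \<in> P (Suc i)" "x \<notin> P i" using P(3)[OF i] by blast
    moreover from this have "\<pi> x \<notin> \<pi> ` P i" using image_iff[OF ideal_subgp[OF prime_ideal[OF P(1)]] P(2)] i by simp
    ultimately show ?thesis using P(3)[OF i] by blast
  qed
  hence "\<exists>P. (\<forall>i\<le>n. primeideal (P i) R) \<and> (\<forall>i<n. P i \<subset> P (Suc i))"
    using prime_image[OF P(1,2)] by (intro exI[of _ "\<lambda>i. \<pi> ` P i"]) auto
  thus "enat n <= Sup {enat n |n. \<exists>P. (\<forall>i\<le>n. primeideal (P i) R) \<and> (\<forall>i<n. P i \<subset> P (Suc i))}"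
    by (intro Sup_upper) blast
  show "Sup {enat n |n. \<exists>P. (\<forall>i\<le>n. primeideal (P i) R) \<and> (\<forall>i<n. P i \<subset> P (Suc i))} <= enat n"
  proof (rule Sup_least, safe)
    fix k P assume P: "\<forall>i\<le>k. primeideal (P i) R" "\<forall>i<k. P i \<subset> P (Suc i)"
    have id: "ideal (P i) R" if "i <= k" for i using P(1) that by (simp add: primeideal.axioms(1))
    have "k <= n"
    proof (rule bound)
      show "\<forall>i\<le>k. is_prime {x. \<pi> x \<in> P i}" using P(1) prime_pre by blast
      show "aa \<subseteq> {x. \<pi> x \<in> P 0}" using ideal_pre(2)[OF id[of 0]] by simp
      show "\<forall>i<k. {x. \<pi> x \<in> P i} \<subset> {x. \<pi> x \<in> P (Suc i)}"
      proof (intro allI impI)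
        fix i assume i: "i < k"
        have "\<pi> ` {x. \<pi> x \<in> P i} \<subset> \<pi> ` {x. \<pi> x \<in> P (Suc i)}"
          using P(2) i ideal_pre(3)[OF id, of i] ideal_pre(3)[OF id, of "Suc i"] by simp
        thus "{x. \<pi> x \<in> P i} \<subset> {x. \<pi> x \<in> P (Suc i)}" using P(2) i by blast
      qed
    qed
    thus "enat k <= enat n" by simp
  qed
qed

lemma characteristic_eq:
  assumes n: "\<And>k. of_nat k \<in> aa \<longleftrightarrow> n dvd k"
  shows "ring_characteristic R = n"
proof -
  have "\<one> [^]\<^bsub>add_monoid R\<^esub> k = \<pi> (of_nat k)" for k :: nat by (induction k) (simp_all add: hom_0 hom_1 hom_add closed R.a_comm)
  hence "\<one> [^]\<^bsub>add_monoid R\<^esub> k = \<one>\<^bsub>add_monoid R\<^esub> \<longleftrightarrow> n dvd k" for k :: nat using n ker_0 by simp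
  thus ?thesis unfolding ring_characteristic_def using group.ord_unique[OF R.add.is_group, of \<one> n] by simp
qed

lemma max_ideal_eq:
  assumes mm: "is_ideal mm" "aa \<subseteq> mm" "1 \<notin> mm" and unit: "\<And>x. x \<notin> mm ==> \<exists>a. a * x - 1 \<in> aa"
  shows "max_ideal R = \<pi> ` mm"
proof -
  note iff = image_iff[OF ideal_subgp[OF mm(1)] mm(2)]
  have sub: "I = carrier R \<or> I \<subseteq> \<pi> ` mm" if I: "ideal I R" for I
  proof (rule ccontr)
    assume "\<not> ?thesis"
    then obtain a where a: "a \<in> I" "a \<notin> \<pi> ` mm" and ne: "I \<noteq> carrier R" by blast
    obtain x where x: "a = \<pi> x" using a ideal.axioms(1)[OF I] additive_subgroup.a_Hcarr lift by metis
    obtain b where b: "b * x - 1 \<in> aa" using unit a x by blast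
    hence "\<pi> b \<otimes> a = \<one>" using ker by (simp add: x flip: hom_mult hom_1)
    hence "\<one> \<in> I" using ideal.I_l_closed[OF I a(1) closed] by metis
    thus False using ideal.one_imp_carrier[OF I] ne by blast
  qed
  have m: "maximalideal (\<pi> ` mm) R"
  proof (rule maximalidealI[OF ideal_image[OF mm(1)]])
    show "carrier R \<noteq> \<pi> ` mm" using iff[of 1] mm(3) closed by blast
    show "J = \<pi> ` mm \<or> J = carrier R" if "ideal J R" "\<pi> ` mm \<subseteq> J" for J using sub that by blast
  qed
  have "I = \<pi> ` mm" if "maximalideal I R" for I
  proof -
    interpret I: maximalideal I R by fact
    have "I \<subseteq> \<pi> ` mm" using sub[OF I.is_ideal] I.I_notcarr by blast
    moreover have "\<pi> ` mm \<subseteq> carrier R" using closed by blast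
    ultimately show ?thesis using I.I_maximal[OF ideal_image[OF mm(1)]] maximalideal.I_notcarr[OF m] by blast
  qed
  thus ?thesis unfolding max_ideal_def using m by (intro the_equality)
qed

lemma genideal_eq:
  assumes J: "is_ideal J" "aa \<subseteq> J" and S: "S \<subseteq> J" and least: "\<And>I. is_ideal I ==> aa \<subseteq> I ==> S \<subseteq> I ==> J \<subseteq> I"
  shows "Idl (\<pi> ` S) = \<pi> ` J"
proof (rule antisym)
  show "Idl (\<pi> ` S) \<subseteq> \<pi> ` J" by (rule R.genideal_minimal[OF ideal_image[OF J(1)]]) (use S in blast)
  have SR: "\<pi> ` S \<subseteq> carrier R" using closed by blast
  note I = ideal_pre[OF R.genideal_ideal[OF SR]]
  have "J \<subseteq> {x. \<pi> x \<in> Idl (\<pi> ` S)}" using R.genideal_self[OF SR] by (intro least I) blast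
  thus "\<pi> ` J \<subseteq> Idl (\<pi> ` S)" by blast
qed

lemma frobenius_power_eq:
  assumes J: "is_ideal J" "aa \<subseteq> J" and S: "\<And>x. x \<in> mm ==> x ^ q \<in> J"
    and least: "\<And>I. is_ideal I ==> aa \<subseteq> I ==> (\<And>x. x \<in> mm ==> x ^ q \<in> I) ==> J \<subseteq> I"
  shows "frobenius_power R (\<pi> ` mm) q = \<pi> ` J"
proof -
  have "(\<lambda>x. x [^] q) ` \<pi> ` mm = \<pi> ` (\<lambda>x. x ^ q) ` mm" by (simp add: image_image hom_power)
  thus ?thesis unfolding frobenius_power_def using genideal_eq[OF J, of "(\<lambda>x. x ^ q) ` mm"] S least by (simp add: image_subset_iff)
qed

text \<open>Serves twice: to pass from power series to the hypersurface ring, and from that ring to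
  the quotient whose length is taken.\<close>

lemma quotient_presented:
  assumes J: "is_ideal J" "aa \<subseteq> J"
  shows "presented (R Quot (\<pi> ` J)) (\<lambda>x. \<pi> ` J +> \<pi> x) J"
proof -
  interpret I: ideal "\<pi> ` J" R by (rule ideal_image[OF J(1)])
  note iff = image_iff[OF ideal_subgp[OF J(1)] J(2)]
  have coset: "\<pi> w \<in> \<pi> ` J +> \<pi> x \<longleftrightarrow> w - x \<in> J" for w x
  proof -
    have "\<pi> w \<in> \<pi> ` J +> \<pi> x \<longleftrightarrow> (\<exists>j\<in>J. \<pi> w = \<pi> (j + x))" by (auto simp: a_r_coset_def' hom_add)
    also have "... \<longleftrightarrow> w - x \<in> J"
    proof
      assume "\<exists>j\<in>J. \<pi> w = \<pi> (j + x)"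
      then obtain j where j: "j \<in> J" "w - (j + x) \<in> aa" by (auto simp: ker)
      hence "(w - (j + x)) + j \<in> J" using J by (intro ideal_add) auto
      thus "w - x \<in> J" by simp
    qed (auto intro!: bexI[of _ "w - x"])
    finally show ?thesis .
  qed
  show ?thesis
  proof
    show "range (\<lambda>x. \<pi> ` J +> \<pi> x) = carrier (R Quot \<pi> ` J)" by (auto simp: FactRing_def A_RCOSETS_def' surj[symmetric])
    show "\<pi> ` J +> \<pi> (x + y) = (\<pi> ` J +> \<pi> x) \<oplus>\<^bsub>R Quot \<pi> ` J\<^esub> (\<pi> ` J +> \<pi> y)" for x y
      by (simp add: FactRing_def I.a_rcos_sum closed hom_add)
    show "\<pi> ` J +> \<pi> (x * y) = (\<pi> ` J +> \<pi> x) \<otimes>\<^bsub>R Quot \<pi> ` J\<^esub> (\<pi> ` J +> \<pi> y)" for x y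
      by (simp add: FactRing_def I.rcoset_mult_add closed hom_mult)
    show "\<pi> ` J +> \<pi> 1 = \<one>\<^bsub>R Quot \<pi> ` J\<^esub>" by (simp add: FactRing_def hom_1)
    show "\<pi> ` J +> \<pi> 0 = \<zero>\<^bsub>R Quot \<pi> ` J\<^esub>" by (simp add: FactRing_def hom_0 R.a_coset_add_zero[OF I.a_subset])
    show "(\<pi> ` J +> \<pi> x = \<pi> ` J +> \<pi> y) \<longleftrightarrow> x - y \<in> J" for x y
    proof
      assume "\<pi> ` J +> \<pi> x = \<pi> ` J +> \<pi> y"
      thus "x - y \<in> J" using coset[of x x] coset[of x y] ideal_0[OF J(1)] by simp
    next
      assume xy: "x - y \<in> J"
      have sub: "\<pi> ` J +> \<pi> x \<subseteq> range \<pi>" for x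
        unfolding surj using R.a_r_coset_subset_G[of "\<pi> ` J" "\<pi> x"] I.a_subset closed by simp
      have "w - x \<in> J \<longleftrightarrow> w - y \<in> J" for w using ideal_diff_iff[OF J(1), of "w - y" "w - x"] xy by simp
      thus "\<pi> ` J +> \<pi> x = \<pi> ` J +> \<pi> y" using coset sub by blast
    qed
  qed
qed

lemma length_eq:
  assumes J: "is_ideal J" "aa \<subseteq> J"
    and ex: "\<exists>I. I 0 = J \<and> (\<forall>i\<le>L. is_ideal (I i)) \<and> (\<forall>i<L. I i \<subset> I (Suc i))"
    and bound: "\<And>k I. \<forall>i\<le>k. is_ideal (I i) ==> J \<subseteq> I 0 ==> \<forall>i<k. I i \<subset> I (Suc i) ==> k <= L"
  shows "module_length R (quotient_module R (\<pi> ` J)) = enat L"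
proof -
  let ?Q = "R Quot (\<pi> ` J)" and ?M = "quotient_module R (\<pi> ` J)" and ?T = "\<lambda>x. \<pi> ` J +> \<pi> x"
  interpret Q: presented ?Q ?T J by (rule quotient_presented[OF J])
  have am: "subgroup N (add_monoid ?M) \<longleftrightarrow> subgroup N (add_monoid ?Q)" for N
    by (rule subgroup_cong) (simp_all add: quotient_module_def)
  have sm: "\<pi> r \<odot>\<^bsub>?M\<^esub> ?T x = ?T (r * x)" for r x by (simp add: quotient_module_def Q.hom_mult)
  have image: "submodule (?T ` I) R ?M" if I: "is_ideal I" for I
  proof (intro submodule.intro submodule_axioms.intro)
    show "subgroup (?T ` I) (add_monoid ?M)" unfolding am by (rule Q.subgroup_image[OF ideal_subgp[OF I]])
    fix a x assume a: "a \<in> carrier R" and "x \<in> ?T ` I"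
    then obtain y where [simp]: "x = ?T y" and y: "y \<in> I" by blast
    obtain r where [simp]: "a = \<pi> r" using a by (rule lift)
    show "a \<odot>\<^bsub>?M\<^esub> x \<in> ?T ` I" using ideal_mult[OF I y] by (simp add: sm)
  qed
  have pre: "is_ideal {x. ?T x \<in> N}" "J \<subseteq> {x. ?T x \<in> N}" "?T ` {x. ?T x \<in> N} = N" if N: "submodule N R ?M" for N
  proof -
    have sg: "subgroup N (add_monoid ?Q)" using submodule.axioms(1)[OF N] by (simp add: am)
    note Q.subgroup_pre[OF sg]
    thus "J \<subseteq> {x. ?T x \<in> N}" "?T ` {x. ?T x \<in> N} = N" by blast+
    show "is_ideal {x. ?T x \<in> N}"
    proof (rule is_idealI; unfold mem_Collect_eq)
      have sp: "is_subgp {x. ?T x \<in> N}" by (rule Q.subgroup_pre(1)[OF sg])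
      show "?T 0 \<in> N" using subgp_0[OF sp] by simp
      show "?T (x + y) \<in> N" if "?T x \<in> N" "?T y \<in> N" for x y using subgp_add[OF sp, of x y] that by simp
      show "?T (r * x) \<in> N" if "?T x \<in> N" for r x using submodule.smult_closed[OF N closed that, of r] by (simp add: sm)
    qed
  qed
  show ?thesis unfolding module_length_def
  proof (rule antisym)
    obtain I where I: "I 0 = J" "\<And>i. i <= L ==> is_ideal (I i)" "\<And>i. i < L ==> I i \<subset> I (Suc i)" using ex by blast
    have JI: "J \<subseteq> I i" if "i <= L" for i using that
    proof (induction i)
      case (Suc i) thus ?case using I(3)[of i] by auto
    qed (simp add: I(1))
    have "?T ` I i \<subset> ?T ` I (Suc i)" if i: "i < L" for i
    proof -
      obtain x where "x \<in> I (Suc i)" "x \<notin> I i" using I(3)[OF i] by blast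
      moreover from this have "?T x \<notin> ?T ` I i" using Q.image_iff[OF ideal_subgp[OF I(2)] JI] i by simp
      ultimately show ?thesis using I(3)[OF i] by blast
    qed
    hence "\<exists>N. (\<forall>i\<le>L. submodule (N i) R ?M) \<and> (\<forall>i<L. N i \<subset> N (Suc i))"
      using image[OF I(2)] by (intro exI[of _ "\<lambda>i. ?T ` I i"]) auto
    thus "enat L <= Sup {enat n |n. \<exists>N. (\<forall>i\<le>n. submodule (N i) R ?M) \<and> (\<forall>i<n. N i \<subset> N (Suc i))}"
      by (intro Sup_upper) blast
    show "Sup {enat n |n. \<exists>N. (\<forall>i\<le>n. submodule (N i) R ?M) \<and> (\<forall>i<n. N i \<subset> N (Suc i))} <= enat L"
    proof (rule Sup_least, safe)
      fix k N assume N: "\<forall>i\<le>k. submodule (N i) R ?M" "\<forall>i<k. N i \<subset> N (Suc i)"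
      have "k <= L"
      proof (rule bound)
        show "\<forall>i\<le>k. is_ideal {x. ?T x \<in> N i}" using N(1) pre(1) by blast
        show "J \<subseteq> {x. ?T x \<in> N 0}" using N(1) pre(2) by blast
        show "\<forall>i<k. {x. ?T x \<in> N i} \<subset> {x. ?T x \<in> N (Suc i)}"
        proof (intro allI impI)
          fix i assume i: "i < k"
          have "?T ` {x. ?T x \<in> N i} \<subset> ?T ` {x. ?T x \<in> N (Suc i)}" using N i pre(3)[of "N i"] pre(3)[of "N (Suc i)"] by simp
          thus "{x. ?T x \<in> N i} \<subset> {x. ?T x \<in> N (Suc i)}" using N(2) i by blast
        qed
      qed
      thus "enat k <= enat L" by simp
    qed
  qed
qed

lemma reduced_eq: "(\<And>x n. x ^ n \<in> aa ==> x \<in> aa) ==> reduced_ring R"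
  unfolding reduced_ring_def
proof (intro ballI allI impI)
  fix a and n :: nat assume r: "\<And>x n. x ^ n \<in> aa ==> x \<in> aa" and a: "a \<in> carrier R" "a [^] n = \<zero>"
  obtain x where x: "a = \<pi> x" using lift[OF a(1)] .
  have "x ^ n \<in> aa" using a(2) by (simp add: x hom_power ker_0)
  thus "a = \<zero>" using r by (simp add: x ker_0)
qed

text \<open>The hypothesis \<open>frob\<close> makes the sums of e_i^q b_i closed under addition, so
  that they form a submodule for the twisted action.\<close>

lemma free_summand_iff:
  assumes q: "q > 0" and frob: "\<And>x y. (x + y) ^ q - (x ^ q + y ^ q) \<in> aa"
  shows "has_free_direct_summand R (root_module R q) a \<longleftrightarrow>
    (\<exists>b N. is_subgp N \<and> aa \<subseteq> N \<and> (\<forall>r. \<forall>n\<in>N. r ^ q * n \<in> N) \<and>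
    (\<forall>g. \<exists>e. g - (\<Sum>i<a. e i ^ q * b i) \<in> N) \<and>
    (\<forall>e. (\<Sum>i<a. e i ^ q * b i) \<in> N --> (\<forall>i<a. e i \<in> aa)))" (is "?l \<longleftrightarrow> ?r")
proof -
  let ?M = "root_module R q"
  let ?L = "\<lambda>c b. \<Oplus>\<^bsub>?M\<^esub>i\<in>{..<a}. c i \<odot>\<^bsub>?M\<^esub> b i" and ?E = "{..<a} \<rightarrow>\<^sub>E carrier R"
  have am: "subgroup N (add_monoid ?M) \<longleftrightarrow> subgroup N (add_monoid R)" for N by (rule subgroup_cong) (simp_all add: root_module_def)
  have sm: "\<pi> r \<odot>\<^bsub>?M\<^esub> \<pi> x = \<pi> (r ^ q * x)" for r x by (simp add: root_module_def hom_power hom_mult)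
  have zm: "\<zero>\<^bsub>?M\<^esub> = \<zero>" and cm: "carrier ?M = carrier R" by (simp_all add: root_module_def)
  have pm: "F <+>\<^bsub>?M\<^esub> N = F <+> N" for F N by (simp add: set_add_def' root_module_def)
  interpret M: abelian_monoid ?M by (rule abelian_monoidI) (simp_all add: root_module_def R.a_ac)
  have fm: "(\<Oplus>\<^bsub>?M\<^esub>i\<in>{..<a}. \<pi> (f i)) = \<pi> (\<Sum>i<a. f i)" for f
  proof -
    have "finite A ==> (\<Oplus>\<^bsub>?M\<^esub>i\<in>A. \<pi> (f i)) = \<pi> (\<Sum>i\<in>A. f i)" for A :: "nat set"
      by (induction A rule: finite_induct) (simp_all add: zm cm hom_0 closed Pi_def, simp add: root_module_def hom_add)
    thus ?thesis by simp
  qed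
  have frob_diff: "(x - y) ^ q - (x ^ q - y ^ q) \<in> aa" for x y using ideal_minus[OF ideal_aa frob[of "x - y" y]] by (simp add: algebra_simps)
  have fsum: "?L c (\<lambda>i. \<pi> (b i)) = \<pi> (\<Sum>i<a. E i ^ q * b i)"
    if "\<And>i. i < a ==> c i = \<pi> (E i)" for c b E
  proof -
    have "?L c (\<lambda>i. \<pi> (b i)) = (\<Oplus>\<^bsub>?M\<^esub>i\<in>{..<a}. \<pi> (E i ^ q * b i))"
      by (rule M.finsum_cong') (auto simp: that sm cm closed)
    thus ?thesis by (simp add: fm)
  qed
  show ?thesis
  proof
    assume ?l
    then obtain F N where F: "submodule F R ?M" and N: "submodule N R ?M" and FN: "F \<inter> N = {\<zero>}" "F <+> N = carrier R"
      and fr: "free_of_rank R ?M F a" unfolding has_free_direct_summand_def zm pm cm by blast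
    from fr obtain b where b: "b \<in> {..<a} \<rightarrow> F"
      and free0: "\<forall>x\<in>F. \<exists>!c. c \<in> ?E \<and> x = ?L c b" unfolding free_of_rank_def by (elim bexE)
    note free = bspec[OF free0]
    have sF: "subgroup F (add_monoid R)" and sN: "subgroup N (add_monoid R)"
      using submodule.axioms(1)[OF F] submodule.axioms(1)[OF N] by (simp_all add: am)
    note F' = subgroup_pre[OF sF] and N' = subgroup_pre[OF sN]
    have "\<forall>i. \<exists>y. i < a --> b i = \<pi> y" using b F'(3) by (auto simp: Pi_iff)
    then obtain b' where b': "\<And>i. i < a ==> b i = \<pi> (b' i)" by metis
    let ?S' = "\<lambda>E. \<Sum>i<a. E i ^ q * b' i"
    have fsum': "?L c b = \<pi> (?S' E)"
      if "\<And>i. i < a ==> c i = \<pi> (E i)" for c E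
    proof -
      have "?L c b = ?L c (\<lambda>i. \<pi> (b' i))" by (rule M.finsum_cong') (auto simp: that sm cm closed b')
      thus ?thesis by (simp add: fsum[OF that])
    qed
    let ?N = "{x. \<pi> x \<in> N}"
    have inF: "\<pi> (?S' E) \<in> F" for E
    proof -
      have "(?S' E) \<in> {x. \<pi> x \<in> F}"
      proof (rule subgp_sum[OF F'(1)])
        fix i assume "i \<in> {..<a}"
        hence "\<pi> (E i) \<odot>\<^bsub>?M\<^esub> b i \<in> F" using b submodule.smult_closed[OF F closed] by auto
        thus "E i ^ q * b' i \<in> {x. \<pi> x \<in> F}" using b' \<open>i \<in> {..<a}\<close> by (simp add: sm)
      qed
      thus ?thesis by simp
    qed
    have "is_subgp ?N \<and> aa \<subseteq> ?N \<and> (\<forall>r. \<forall>n\<in>?N. r ^ q * n \<in> ?N) \<and>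
      (\<forall>g. \<exists>e. g - (\<Sum>i<a. e i ^ q * b' i) \<in> ?N) \<and>
      (\<forall>e. (\<Sum>i<a. e i ^ q * b' i) \<in> ?N --> (\<forall>i<a. e i \<in> aa))"
    proof (intro conjI allI ballI impI)
      show "is_subgp ?N" "aa \<subseteq> ?N" by (rule N')+
      show "r ^ q * n \<in> ?N" if "n \<in> ?N" for r n using submodule.smult_closed[OF N closed, of "\<pi> n" r] that by (simp add: sm)
      show "\<exists>e. g - (\<Sum>i<a. e i ^ q * b' i) \<in> ?N" for g
      proof -
        have "\<pi> g \<in> F <+> N" using FN(2) closed by simp
        then obtain f n where fn: "f \<in> F" "n \<in> N" "\<pi> g = f \<oplus> n" by (auto simp: set_add_def')
        obtain c where c: "c \<in> ?E" "f = ?L c b" using free[OF fn(1)] by blast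
        have "\<forall>i. \<exists>y. i < a --> c i = \<pi> y" using c(1) lift by (metis PiE_mem lessThan_iff)
        then obtain E where E: "\<And>i. i < a ==> c i = \<pi> (E i)" by metis
        have fE: "f = \<pi> (?S' E)" unfolding c(2) by (rule fsum'[OF E])
        obtain n' where n': "n = \<pi> n'" using fn(2) N'(3) by blast
        have "\<pi> (g - (?S' E)) = \<pi> n'" using fn(3) unfolding fE n' hom_add[symmetric] ker by (simp add: algebra_simps)
        thus ?thesis using fn(2) n' by (intro exI[of _ E]) simp
      qed
      \<comment> \<open>Independence is the uniqueness of the expansion of 0, compared with the
        expansion that has all coefficients 0.\<close>
      fix E i assume "(?S' E) \<in> ?N" and i: "i < a"
      hence z: "\<pi> (?S' E) = \<zero>" using inF FN(1) by auto
      have "\<zero> \<in> F" using FN(1) by blast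
      note u = free[OF this]
      let ?c = "\<lambda>i\<in>{..<a}. \<pi> (E i)" and ?c' = "\<lambda>i\<in>{..<a}. \<pi> 0"
      have "\<zero> = ?L ?c b" using fsum'[of ?c E] z by simp
      moreover have "\<zero> = ?L ?c' b" using fsum'[of ?c' "\<lambda>_. 0"] q by (simp add: hom_0 power_0_left)
      moreover have "?c \<in> ?E" "?c' \<in> ?E" using closed by auto
      ultimately have "?c = ?c'" using u by blast
      hence "?c i = ?c' i" by simp
      thus "E i \<in> aa" using i by (simp add: ker)
    qed
    thus ?r by blast
  next
    assume ?r
    then obtain b N where N: "is_subgp N" "aa \<subseteq> N" "\<And>r n. n \<in> N ==> r ^ q * n \<in> N"
      and gen: "\<And>g. \<exists>e. g - (\<Sum>i<a. e i ^ q * b i) \<in> N"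
      and indep: "\<And>e i. (\<Sum>i<a. e i ^ q * b i) \<in> N ==> i < a ==> e i \<in> aa" by blast
    note Niff = image_iff[OF N(1,2)]
    let ?S = "\<lambda>E. \<Sum>i<a. E i ^ q * b i"
    define F where "F = range (\<lambda>E. \<pi> (?S E))"
    have SF: "\<pi> (?S E) \<in> F" for E unfolding F_def by (rule rangeI)
    have Sdiff: "\<pi> (?S E - ?S E') = \<pi> (?S (\<lambda>i. E i - E' i))" for E E'
    proof -
      have "(\<Sum>i<a. ((E i - E' i) ^ q - (E i ^ q - E' i ^ q)) * b i) \<in> aa"
        by (intro ideal_sum[OF ideal_aa] ideal_mult2[OF ideal_aa] frob_diff)
      hence "?S (\<lambda>i. E i - E' i) - (?S E - ?S E') \<in> aa" by (simp add: left_diff_distrib sum_subtractf)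
      hence "\<pi> (?S (\<lambda>i. E i - E' i)) = \<pi> (?S E - ?S E')" unfolding ker .
      thus ?thesis by (rule sym)
    qed
    have F: "submodule F R ?M"
    proof (intro submodule.intro submodule_axioms.intro)
      define F0 where "F0 = {x. \<pi> x \<in> F}"
      have "is_subgp F0"
      proof (rule is_subgpI)
        have "\<pi> (?S (\<lambda>_. 0)) \<in> F" by (rule SF)
        thus "0 \<in> F0" using q by (simp add: F0_def power_0_left)
        fix x y assume "x \<in> F0" "y \<in> F0"
        then obtain E E' where E: "\<pi> x = \<pi> (?S E)" "\<pi> y = \<pi> (?S E')" by (auto simp: F0_def F_def)
        hence "\<pi> (x - y) = \<pi> (?S E - ?S E')" by (simp add: hom_diff)
        thus "x - y \<in> F0" using SF[of "\<lambda>i. E i - E' i"] unfolding F0_def Sdiff by simp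
      qed
      moreover have "\<pi> ` F0 = F" by (auto simp: F0_def F_def)
      ultimately show "subgroup F (add_monoid ?M)" using subgroup_image[of F0] by (simp add: am)
      fix r' x' assume r': "r' \<in> carrier R" and "x' \<in> F"
      then obtain E where [simp]: "x' = \<pi> (?S E)" unfolding F_def by blast
      obtain r where [simp]: "r' = \<pi> r" using r' by (rule lift)
      have "r ^ q * ?S E = ?S (\<lambda>i. r * E i)" by (simp add: sum_distrib_left power_mult_distrib mult.assoc)
      hence "r' \<odot>\<^bsub>?M\<^esub> x' = \<pi> (?S (\<lambda>i. r * E i))" by (simp add: sm)
      thus "r' \<odot>\<^bsub>?M\<^esub> x' \<in> F" using SF[of "\<lambda>i. r * E i"] by simp
    qed
    have NM: "submodule (\<pi> ` N) R ?M"
    proof (intro submodule.intro submodule_axioms.intro)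
      show "subgroup (\<pi> ` N) (add_monoid ?M)" using subgroup_image[OF N(1)] by (simp add: am)
      fix r' x' assume r': "r' \<in> carrier R" and "x' \<in> \<pi> ` N"
      then obtain x where [simp]: "x' = \<pi> x" and "x \<in> N" by blast
      obtain r where [simp]: "r' = \<pi> r" using r' by (rule lift)
      show "r' \<odot>\<^bsub>?M\<^esub> x' \<in> \<pi> ` N" using N(3)[OF \<open>x \<in> N\<close>] by (simp add: sm)
    qed
    have z: "\<pi> (?S E) = \<zero>" if "?S E \<in> N" for E
      unfolding ker_0 using indep[OF that] q by (intro ideal_sum[OF ideal_aa] ideal_mult2[OF ideal_aa] ideal_power[OF ideal_aa]) auto
    have "\<zero> \<in> F \<inter> \<pi> ` N"
    proof
      have "\<pi> (?S (\<lambda>_. 0)) = \<zero>" using z[of "\<lambda>_. 0"] subgp_0[OF N(1)] q by (simp add: power_0_left)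
      thus "\<zero> \<in> F" using SF[of "\<lambda>_. 0"] by simp
      show "\<zero> \<in> \<pi> ` N" using subgp_0[OF N(1)] by (metis hom_0 imageI)
    qed
    hence int: "F \<inter> \<pi> ` N = {\<zero>}" using z Niff by (auto simp: F_def)
    have sum: "set_add R F (\<pi> ` N) = carrier R"
    proof (intro equalityI subsetI)
      fix x assume "x \<in> set_add R F (\<pi> ` N)"
      thus "x \<in> carrier R" by (auto simp: set_add_def' F_def closed)
    next
      fix x assume "x \<in> carrier R"
      then obtain g where g: "x = \<pi> g" by (rule lift)
      obtain E where E: "g - ?S E \<in> N" using gen by blast
      have "x = \<pi> (?S E) \<oplus> \<pi> (g - ?S E)" by (simp add: g flip: hom_add)
      thus "x \<in> set_add R F (\<pi> ` N)" using E unfolding set_add_def' F_def by blast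
    qed
    have "free_of_rank R ?M F a" unfolding free_of_rank_def
    proof (intro bexI[of _ "\<lambda>i. \<pi> (b i)"] ballI)
      show "(\<lambda>i. \<pi> (b i)) \<in> {..<a} \<rightarrow> F"
      proof
        fix i assume i: "i \<in> {..<a}"
        have "?S (\<lambda>j. if j = i then 1 else 0) = (\<Sum>j<a. if j = i then b i else 0)" using q by (intro sum.cong) (auto simp: power_0_left)
        hence "\<pi> (b i) = \<pi> (?S (\<lambda>j. if j = i then 1 else 0))" using i by simp
        thus "\<pi> (b i) \<in> F" using SF[of "\<lambda>j. if j = i then 1 else 0"] by simp
      qed
      fix x assume "x \<in> F"
      then obtain E where E: "x = \<pi> (?S E)" by (auto simp: F_def)
      show "\<exists>!c. c \<in> ?E \<and> x = ?L c (\<lambda>i. \<pi> (b i))"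
      proof (rule ex1I[of _ "\<lambda>i\<in>{..<a}. \<pi> (E i)"])
        show "(\<lambda>i\<in>{..<a}. \<pi> (E i)) \<in> ?E \<and> x = ?L (\<lambda>i\<in>{..<a}. \<pi> (E i)) (\<lambda>i. \<pi> (b i))"
          using closed fsum[where c = "\<lambda>i\<in>{..<a}. \<pi> (E i)" and E = E and b = b] by (auto simp: E)
        fix c assume c: "c \<in> ?E \<and> x = ?L c (\<lambda>i. \<pi> (b i))"
        have "\<forall>i. \<exists>y. i < a --> c i = \<pi> y" using c lift by (metis PiE_mem lessThan_iff)
        then obtain E' where E': "\<And>i. i < a ==> c i = \<pi> (E' i)" by metis
        have "x = \<pi> (?S E')" using conjunct2[OF c] by (rule trans) (rule fsum[OF E'])
        hence "\<pi> (?S E') = \<pi> (?S E)" using E by simp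
        hence "\<pi> (?S E' - ?S E) = \<zero>" unfolding ker ker_0 .
        hence "?S (\<lambda>i. E' i - E i) \<in> N" using N(2) unfolding Sdiff ker_0 by blast
        hence "E' i - E i \<in> aa" if "i < a" for i using indep[where e = "\<lambda>i. E' i - E i", OF _ that] by simp
        hence "c i = \<pi> (E i)" if "i < a" for i using that by (simp add: E' ker)
        thus "c = (\<lambda>i\<in>{..<a}. \<pi> (E i))" using c by (intro ext) (auto simp: PiE_def extensional_def)
      qed
    qed
    thus ?l unfolding has_free_direct_summand_def zm pm cm using F NM int sum by blast
  qed
qed

end

section \<open>The hypersurface ring as a quotient of integer power series\<close>

definition psr_hom :: "nat => nat set => mps => expo => int" where
  "psr_hom p V g = (\<lambda>\<alpha>. if supp \<alpha> \<subseteq> V then coef g \<alpha> mod int p else 0)"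

lemma presented_psr:
  assumes p: "p > 1"
  shows "presented (power_series_ring (residue_ring (int p)) V) (psr_hom p V) (KV p V)"
proof -
  interpret residues "int p" "residue_ring (int p)" by unfold_locales (use p in simp)
  let ?P = "power_series_ring (residue_ring (int p)) V" and ?h = "psr_hom p V"
  have cr: "carrier (residue_ring (int p)) = {0..int p - 1}" and zr: "\<zero>\<^bsub>residue_ring (int p)\<^esub> = 0"
    and onr: "\<one>\<^bsub>residue_ring (int p)\<^esub> = 1"
    and ar: "\<And>x y. x \<oplus>\<^bsub>residue_ring (int p)\<^esub> y = (x + y) mod int p" and mr: "\<And>x y. x \<otimes>\<^bsub>residue_ring (int p)\<^esub> y = (x * y) mod int p"
    by (simp_all add: residue_ring_def)
  show ?thesis
  proof
    show "range ?h = carrier ?P"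
    proof (intro equalityI subsetI)
      fix f assume "f \<in> range ?h"
      then obtain x where "f = ?h x" by blast
      thus "f \<in> carrier ?P" using p by (simp add: power_series_ring_def psr_hom_def cr zr)
    next
      fix f assume f: "f \<in> carrier ?P"
      have "f = ?h (Mps f)"
      proof
        fix \<alpha>
        have "f \<alpha> \<in> {0..int p - 1}" "\<not> supp \<alpha> \<subseteq> V --> f \<alpha> = 0" using f by (auto simp: power_series_ring_def cr zr)
        thus "f \<alpha> = ?h (Mps f) \<alpha>" by (simp add: psr_hom_def)
      qed
      thus "f \<in> range ?h" by blast
    qed
    show "?h (x + y) = ?h x \<oplus>\<^bsub>?P\<^esub> ?h y" for x y by (rule ext) (simp add: psr_hom_def power_series_ring_def ar mod_add_eq)
    show "?h (x * y) = ?h x \<otimes>\<^bsub>?P\<^esub> ?h y" for x y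
    proof
      fix \<alpha>
      have "(?h x \<otimes>\<^bsub>?P\<^esub> ?h y) \<alpha> = (\<Oplus>\<^bsub>residue_ring (int p)\<^esub>u\<in>splits \<alpha>. (?h x (fst u) * ?h y (snd u)) mod int p)"
        by (simp add: power_series_ring_def mr splits_def)
      also have "... = (\<Sum>u\<in>splits \<alpha>. ?h x (fst u) * ?h y (snd u)) mod int p" by (rule sum_cong) simp
      also have "... = ?h (x * y) \<alpha>"
      proof (cases "supp \<alpha> \<subseteq> V")
        case True
        have "(\<Sum>u\<in>splits \<alpha>. ?h x (fst u) * ?h y (snd u)) = (\<Sum>u\<in>splits \<alpha>. (coef x (fst u) mod int p) * (coef y (snd u) mod int p))"
        proof (intro sum.cong refl)
          fix u assume "u \<in> splits \<alpha>"
          hence "supp (fst u) \<union> supp (snd u) = supp \<alpha>" by (simp add: splits_def flip: supp_add)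
          hence "supp (fst u) \<subseteq> V" "supp (snd u) \<subseteq> V" using True by blast+
          thus "?h x (fst u) * ?h y (snd u) = (coef x (fst u) mod int p) * (coef y (snd u) mod int p)" by (simp add: psr_hom_def)
        qed
        also have "... mod int p = (\<Sum>u\<in>splits \<alpha>. coef x (fst u) * coef y (snd u)) mod int p"
          by (subst mod_sum_eq[symmetric]) (simp add: mod_mult_eq mod_sum_eq)
        finally show ?thesis using True by (simp add: psr_hom_def coef_mult)
      next
        case False
        have "(\<Sum>u\<in>splits \<alpha>. ?h x (fst u) * ?h y (snd u)) = 0"
        proof (intro sum.neutral ballI)
          fix u assume "u \<in> splits \<alpha>"
          hence "supp (fst u) \<union> supp (snd u) = supp \<alpha>" by (simp add: splits_def flip: supp_add)
          hence "\<not> supp (fst u) \<subseteq> V \<or> \<not> supp (snd u) \<subseteq> V" using False by blast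
          thus "?h x (fst u) * ?h y (snd u) = 0" by (auto simp: psr_hom_def)
        qed
        moreover have "?h (x * y) \<alpha> = 0" unfolding psr_hom_def by (rule if_not_P[OF False])
        ultimately show ?thesis by simp
      qed
      finally show "?h (x * y) \<alpha> = (?h x \<otimes>\<^bsub>?P\<^esub> ?h y) \<alpha>" by simp
    qed
    show "?h 1 = \<one>\<^bsub>?P\<^esub>" using p by (auto simp: psr_hom_def power_series_ring_def zr onr coef_1 fun_eq_iff)
    show "?h 0 = \<zero>\<^bsub>?P\<^esub>" by (auto simp: psr_hom_def power_series_ring_def zr fun_eq_iff)
    show "?h x = ?h y \<longleftrightarrow> x - y \<in> KV p V" for x y by (auto simp: psr_hom_def KV_def did_def fun_eq_iff mod_eq_dvd_iff)
  qed
qed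

context hyp
begin

lemma presented_hypersurface:
  assumes F: "emb F = f"
  shows "\<exists>\<pi>. presented (hypersurface_mod d F p) \<pi> aa"
proof -
  let ?P = "power_series_ring (residue_ring (int p)) {..d}" and ?h = "psr_hom p {..d}"
  interpret P: presented ?P ?h K using presented_psr[OF prime_gt_1_nat[OF pp], of "{..d}"] by (simp add: lessThan_Suc_atMost)
  have "f \<in> A0 (Suc d)"
  proof -
    have "h \<in> A0 (Suc d)" unfolding A0_def
    proof (intro CollectI allI impI)
      fix \<alpha> assume "coef h \<alpha> \<noteq> 0"
      hence "supp \<alpha> \<subseteq> {..<d}" using hA by (simp add: A0_def)
      also have "{..<d} \<subseteq> {..<Suc d}" by auto
      finally show "supp \<alpha> \<subseteq> {..<Suc d}" .
    qed
    moreover have "z ^ 2 \<in> A0 (Suc d)" by (auto simp: A0_def z2)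
    ultimately show ?thesis unfolding f_def by (rule A0_add)
  qed
  hence supp: "coef f \<alpha> \<noteq> 0 ==> supp \<alpha> \<subseteq> {..d}" for \<alpha> by (simp add: A0_def lessThan_Suc_atMost)
  have "reduce_mod p F = ?h f"
  proof
    fix \<alpha>
    have "reduce_mod p F \<alpha> = coef f \<alpha> mod int p" by (simp add: reduce_mod_def flip: F)
    thus "reduce_mod p F \<alpha> = ?h f \<alpha>" using supp[of \<alpha>] by (cases "coef f \<alpha> = 0") (simp_all add: psr_hom_def)
  qed
  moreover have "Idl\<^bsub>?P\<^esub> (?h ` {f}) = ?h ` aa"
  proof (rule P.genideal_eq[OF ideal_aa K_aa])
    show "{f} \<subseteq> aa" using f_aa by simp
    show "aa \<subseteq> I" if "is_ideal I" "K \<subseteq> I" "{f} \<subseteq> I" for I unfolding aa_def using that by (intro with_gen_least) auto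
  qed
  ultimately have "hypersurface_mod d F p = ?P Quot (?h ` aa)" by (simp add: hypersurface_mod_def Let_def)
  thus ?thesis using P.quotient_presented[OF ideal_aa K_aa] by auto
qed

lemma of_nat_aa: "of_nat k \<in> aa \<longleftrightarrow> p dvd k"
proof
  assume "of_nat k \<in> aa"
  hence "int p dvd coef (of_int (int k)) 0" using aa_mm mm_iff[of "of_nat k"] by auto
  thus "p dvd k" unfolding coef_of_int by simp
next
  assume "p dvd k"
  then obtain l where "k = p * l" by blast
  thus "of_nat k \<in> aa" using aa_mult2[OF subsetD[OF pM_aa p_pM], of "of_nat l"] by simp
qed

lemma one_nmm: "1 \<notin> mm" using prime_gt_1_nat[OF pp] unfolding mm_iff by (auto simp: coef_1)

end

context hyp_q
begin

text \<open>Every strict inclusion of ideals of finite index contributes at least a factor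
  \<open>p\<close>, and the chain of socle extensions attains exactly \<open>p\<close> in each
  step.\<close>

lemma length_Mq:
  fixes R :: "('b, 'c) ring_scheme"
  assumes P: "presented R \<pi> aa"
  obtains L where "p ^ L = ind UNIV (Mq q)" "module_length R (quotient_module R (\<pi> ` Mq q)) = enat L"
proof -
  obtain L I where I: "p ^ L = ind UNIV (Mq q)" "I 0 = Mq q" "\<forall>i\<le>L. is_ideal (I i)" "\<forall>i<L. I i \<subset> I (Suc i)"
    using length_lower[OF ideal_Mq aa_Mq ind_Mq_Jq(3) power_mm_Mq[OF vr_mm]] by (elim exE conjE) (rule that)
  have "module_length R (quotient_module R (\<pi> ` Mq q)) = enat L"
  proof (rule presented.length_eq[OF P ideal_Mq aa_Mq])
    show "\<exists>I. I 0 = Mq q \<and> (\<forall>i\<le>L. is_ideal (I i)) \<and> (\<forall>i<L. I i \<subset> I (Suc i))" using I by blast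
    fix k and I' :: "nat => mps set" assume I': "\<forall>i\<le>k. is_ideal (I' i)" "Mq q \<subseteq> I' 0" "\<forall>i<k. I' i \<subset> I' (Suc i)"
    have i0: "is_ideal (I' 0)" using I'(1) by blast
    note le = ind_le[OF i0 ideal_Mq I'(2) ind_Mq_Jq(3)]
    have "pM p \<subseteq> I' 0" using pM_aa aa_Mq I'(2) by blast
    hence "p ^ k <= ind UNIV (I' 0)" using I' le(2) by (intro length_upper) auto
    also have "... <= p ^ L" using le(1) I(1) by simp
    finally show "k <= L" using prime_gt_1_nat[OF pp] by (simp add: power_increasing_iff)
  qed
  thus ?thesis using that[OF I(1)] by blast
qed

lemma free_rank:
  fixes R :: "('b, 'c) ring_scheme"
  assumes "presented R \<pi> aa"
  shows "p ^ max_free_rank R (root_module R q) = ind (Mq q) (Jq q)"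
proof -
  interpret presented R \<pi> aa by fact
  have iff: "has_free_direct_summand R (root_module R q) a \<longleftrightarrow> (\<exists>b N. frk a b N)" for a
    unfolding frk_def by (rule free_summand_iff[OF q0 subsetD[OF pM_aa frob_add[OF pp q]]])
  obtain a where a: "p ^ a = ind (Mq q) (Jq q)" "\<exists>b N. frk a b N" "\<And>a' b N. frk a' b N ==> a' <= a" by (rule max_frk) blast
  have "max_free_rank R (root_module R q) = a" unfolding max_free_rank_def iff by (rule Greatest_equality) (use a in blast)+
  thus ?thesis using a by simp
qed

lemma colength:
  fixes R :: "('b, 'c) ring_scheme"
  assumes P: "presented R \<pi> aa"
  shows "real (the_enat (module_length R (quotient_module R (frobenius_power R (max_ideal R) q))))
      = LD p (cV d q) h (m + 1) + LD p (cV d q) h m" (is "?L = ?R")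
    and "real (max_free_rank R (root_module R q)) = 2 * real q ^ d - (LD p (cV d q) h (m + 1) + LD p (cV d q) h m)"
proof -
  interpret presented R \<pi> aa by fact
  have pr: "real p > 1" using prime_gt_1_nat[OF pp] by simp
  have mx: "max_ideal R = \<pi> ` mm" by (rule max_ideal_eq[OF ideal_bI aa_mm one_nmm]) (use unit in blast)
  have fr: "frobenius_power R (\<pi> ` mm) q = \<pi> ` Mq q" by (rule frobenius_power_eq[OF ideal_Mq aa_Mq power_mm_Mq]) (use Mq_least in blast)+
  obtain L where L: "p ^ L = ind UNIV (Mq q)" "module_length R (quotient_module R (\<pi> ` Mq q)) = enat L" using length_Mq[OF P] .
  let ?a = "ind UNIV (with_gen (bI p (cV d q)) (h ^ (m + 1)))" and ?b = "ind UNIV (with_gen (bI p (cV d q)) (h ^ m))"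
  have i: "ind UNIV (Mq q) = ?a * ?b" by (rule ind_Mq[OF qm])
  have pos: "?a > 0" "?b > 0" using i ind_Mq_Jq(3) by (metis gr0I mult_0 mult_0_right)+
  have "real L = log p (real (p ^ L))" using pr by (simp add: log_nat_power)
  also have "... = log p (real ?a * real ?b)" unfolding L(1) i by simp
  also have "... = ?R" unfolding LD_def ldim_def using pos pr by (simp add: log_mult_pos)
  finally have LR: "real L = ?R" .
  thus "?L = ?R" unfolding mx fr L(2) by simp
  let ?r = "max_free_rank R (root_module R q)"
  \<comment> \<open>The index of \<open>Jq q\<close> splits along \<open>Mq q\<close> into length
    and free rank; this makes the two invariants add up to 2.\<close>
  have "p ^ (2 * q ^ d) = p ^ L * p ^ ?r" using ind_Mq_Jq(1) by (simp add: ind_Jq L(1) free_rank[OF P])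
  hence "p ^ (2 * q ^ d) = p ^ (L + ?r)" by (simp add: power_add)
  hence "2 * q ^ d = L + ?r" using prime_gt_1_nat[OF pp] by simp
  hence "real (2 * q ^ d) = real (L + ?r)" by (rule arg_cong)
  thus "real ?r = 2 * real q ^ d - ?R" using LR by simp
qed

end

lemma (in hyp) invariants:
  fixes R :: "('b, 'c) ring_scheme"
  assumes P: "presented R \<pi> aa"
  obtains l where "HK_multiplicity R = 2 * l" "F_signature R = 2 - 2 * l"
    "\<bar>l - LD p (cV d p) h ((p - 1) div 2) / real p ^ d\<bar> <= 2 / real p"
proof -
  interpret presented R \<pi> aa by fact
  have kd: "krull_dim R = enat d" by (rule krull_dim_eq[OF dim_ge]) (use dim_le in blast)
  have ch: "ring_characteristic R = p" by (rule characteristic_eq[OF of_nat_aa])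
  have rr: "reduced_ring R" by (rule reduced_eq[OF reduced])
  obtain l where l: "(\<lambda>e. LD p (cV d (p ^ e)) h ((p ^ e - 1) div 2) / real p ^ (e * d)) \<longlonglongrightarrow> l"
    "(\<lambda>e. LD p (cV d (p ^ e)) h ((p ^ e + 1) div 2) / real p ^ (e * d)) \<longlonglongrightarrow> l"
    "\<bar>l - LD p (cV d p) h ((p - 1) div 2) / real p ^ d\<bar> <= 2 / real p" by (rule nested_limit[OF pp p2])
  let ?u = "\<lambda>e. LD p (cV d (p ^ e)) h ((p ^ e - 1) div 2)" and ?w = "\<lambda>e. LD p (cV d (p ^ e)) h ((p ^ e + 1) div 2)"
  have od: "odd (p ^ e)" for e using prime_odd_nat[OF pp p2] by simp
  have col: "real (the_enat (module_length R (quotient_module R (frobenius_power R (max_ideal R) (p ^ e))))) = ?w e + ?u e"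
    "real (max_free_rank R (root_module R (p ^ e))) = 2 * real p ^ (e * d) - (?w e + ?u e)" for e
  proof -
    obtain m where m: "p ^ e = 2 * m + 1" using od by (rule oddE)
    interpret hyp_q p d h e "p ^ e" m by unfold_locales (use m in auto)
    have m1: "(p ^ e + 1) div 2 = m + 1" "(p ^ e - 1) div 2 = m" by (simp_all add: m)
    have pe: "real (p ^ e) ^ d = real p ^ (e * d)" by (simp add: power_mult)
    show "real (the_enat (module_length R (quotient_module R (frobenius_power R (max_ideal R) (p ^ e))))) = ?w e + ?u e"
      unfolding m1 by (rule colength(1)[OF P])
    show "real (max_free_rank R (root_module R (p ^ e))) = 2 * real p ^ (e * d) - (?w e + ?u e)"
      unfolding m1 pe[symmetric] by (rule colength(2)[OF P])
  qed
  have pd: "real p ^ (e * d) > 0" for e using prime_gt_0_nat[OF pp] by simp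
  have lim: "(\<lambda>e. (?w e + ?u e) / real p ^ (e * d)) \<longlonglongrightarrow> 2 * l"
    using tendsto_add[OF l(2,1)] by (simp add: add_divide_distrib)
  have "(\<lambda>e. 2 - (?w e + ?u e) / real p ^ (e * d)) \<longlonglongrightarrow> 2 - 2 * l" by (intro tendsto_diff tendsto_const lim)
  moreover have "2 - (?w e + ?u e) / real p ^ (e * d) = (2 * real p ^ (e * d) - (?w e + ?u e)) / real p ^ (e * d)" for e
    using pd[of e] by (simp add: diff_divide_distrib)
  ultimately have "F_signature R = 2 - 2 * l" unfolding F_signature_def Let_def ch kd by (simp add: rr col limI)
  moreover have "HK_multiplicity R = 2 * l" unfolding HK_multiplicity_def Let_def ch kd the_enat.simps col by (rule limI[OF lim])
  ultimately show ?thesis using that l(3) by blast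
qed

lemma coef_mono_neq: "ex \<mu> i \<noteq> ex \<alpha> i ==> coef (mono \<mu>) \<alpha> = 0" by (auto simp: coef_mono)

text \<open>Keeps the equation nonzero modulo every prime: one monomial of the plane curve has
  coefficient 1, and the squares of the other variables cannot cancel it.\<close>

lemma ADE_part_nonzero:
  assumes d: "d \<ge> 2" and t: "valid_ADE t"
  obtains \<alpha> where "supp \<alpha> \<subseteq> {..<d}" "coef (ADE_part t d) \<alpha> = 1"
proof -
  have s: "coef (\<Sum>i=2..<d. vr i ^ 2) (sng j k) = 0" if "j < 2" for j k unfolding coef_sum vr_power
  proof (intro sum.neutral ballI coef_mono_neq)
    fix i assume "i \<in> {2..<d}"
    thus "ex (sng i 2) i \<noteq> ex (sng j k) i" using that by (simp add: lookup_single)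
  qed
  note th = that
  have a: ?thesis if e: "emb (ADE_poly t) = mono \<mu> + mono (sng j k)" and ne: "ex \<mu> i \<noteq> ex (sng j k) i" and j: "j < 2" for \<mu> j k i
  proof (rule th[of "sng j k"])
    show "supp (sng j k) \<subseteq> {..<d}" using j d by (auto split: if_splits)
    show "coef (ADE_part t d) (sng j k) = 1"
      unfolding ADE_part_def coef_add e s[OF j] coef_mono_neq[OF ne] by (simp only: coef_mono simp_thms if_True add_0 add.right_neutral)
  qed
  note l = lookup_single lookup_add when_def and ev = ADE_poly.simps emb_add emb_power emb_mvar emb_mult vr_power mono_add One_nat_def
  show ?thesis
  proof (cases t)
    case (Type_A n)
    show ?thesis by (rule a[of "sng 0 (n + 1)" 1 2 1]) (simp only: Type_A ev, simp_all only: l, simp_all)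
  next
    case (Type_D n)
    show ?thesis by (rule a[of "sng 0 2 + sng 1 1" 1 "n - 1" 0]) (simp only: Type_D ev, simp_all only: l, simp_all)
  next
    case Type_E6
    show ?thesis by (rule a[of "sng 1 4" 0 3 1]) (simp only: Type_E6 ev add.commute, simp_all only: l, simp_all)
  next
    case Type_E7
    show ?thesis by (rule a[of "sng 0 1 + sng 1 3" 0 3 1]) (simp only: Type_E7 ev add.commute, simp_all only: l, simp_all)
  next
    case Type_E8
    show ?thesis by (rule a[of "sng 1 5" 0 3 1]) (simp only: Type_E8 ev add.commute, simp_all only: l, simp_all)
  qed
qed

lemma coef_0_power: "coef (g ^ n) 0 = coef g 0 ^ n" by (induction n) (simp_all add: coef_1)

lemma hyp_ADE:
  assumes d: "d \<ge> 2" and t: "valid_ADE t" and p: "prime p" "p > 2" and g: "good d (ADE_part t d)"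
  shows "hyp p d (ADE_part t d)"
proof
  show "prime p" "p > 2" by fact+
  show "ADE_part t d \<in> A0 d" using g by (intro free_of_A0) (simp add: good_def)
  \<comment> \<open>The exponent 0 lies in the box, so the p-th power of the constant term is
    divisible by \<open>p\<close>, and hence so is the constant term.\<close>
  have "ADE_part t d ^ p \<in> bI p (cV d p)" using g p by (simp add: good_def)
  moreover have "0 \<in> box (cV d p)" using prime_gt_0_nat[OF p(1)] by (auto simp: box_def cV_def)
  ultimately have "int p dvd coef (ADE_part t d) 0 ^ p" unfolding bI_def did_def coef_0_power[symmetric] by blast
  thus "int p dvd coef (ADE_part t d) 0" using p(1) by (meson prime_dvd_power prime_nat_int_transfer)
  obtain \<alpha> where "supp \<alpha> \<subseteq> {..<d}" "coef (ADE_part t d) \<alpha> = 1" using ADE_part_nonzero[OF d t] .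
  thus "ADE_part t d \<notin> KV p {..<d}" using p(2) by (auto simp: KV_def did_def intro!: exI[of _ \<alpha>])
qed

lemma emb_ADE: "d \<ge> 2 ==> emb (ADE_hypersurface t d) = ADE_part t d + vr d ^ 2"
proof -
  assume d: "d \<ge> 2"
  have "{2..d} = insert d {2..<d}" using d by auto
  thus ?thesis by (simp add: ADE_hypersurface_def ADE_part_def del: coef_emb)
qed

lemma tendsto_primes:
  assumes b: "\<And>p. prime p ==> p \<ge> P ==> \<bar>g p - L\<bar> <= C / real p"
  shows "(g \<longlongrightarrow> L) at_top_primes"
proof -
  have "((\<lambda>p. C / real p) \<longlongrightarrow> 0) at_top"
    by (intro tendsto_divide_0[OF tendsto_const] filterlim_at_top_imp_at_infinity filterlim_real_sequentially)
  hence C0: "((\<lambda>p. C / real p) \<longlongrightarrow> 0) at_top_primes" by (rule tendsto_mono[rotated]) (simp add: at_top_primes_def)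
  have "eventually (\<lambda>p. norm (g p - L) <= C / real p) at_top_primes" unfolding at_top_primes_def eventually_inf_principal
    using eventually_ge_at_top[of P] by eventually_elim (use b in auto)
  from Lim_null_comparison[OF this C0] show ?thesis by (simp add: LIM_zero_iff)
qed

theorem theorem1p2:
  fixes d :: nat and t :: ADE
  assumes "d \<ge> 2" and "valid_ADE t"
  shows "has_limit_HK_multiplicity d (ADE_hypersurface t d) (1 + taylor_coeff (ADE_fun t) d)
    \<and> has_limit_F_signature d (ADE_hypersurface t d) (1 - taylor_coeff (ADE_fun t) d)"
proof -
  let ?h = "ADE_part t d"
  obtain \<phi> L where ap: "approx ?h d \<phi>" and L: "L-lipschitz_on {0..1} \<phi>"
    and c: "2 * \<phi> (1/2) - 1 = taylor_coeff (ADE_fun t) d" and g: "good d ?h" using ADE_limit[OF assms] by blast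
  obtain C P where CP: "\<And>p s. prime p ==> p \<ge> P ==> s <= p ==> \<bar>LD p (cV d p) ?h s / real p ^ d - \<phi> (real s / real p)\<bar> <= C / real p"
    using ap unfolding approx_def by blast
  let ?R = "hypersurface_mod d (ADE_hypersurface t d)"
  \<comment> \<open>The errors from the limit over e, from the approximation by
    \<open>\<phi>\<close>, and from replacing s/p by 1/2, doubled because the invariants are 2l and
    2 - 2l.\<close>
  define D where "D = 2 * (2 + C + L)"
  have key: "\<bar>HK_multiplicity (?R p) - 2 * \<phi> (1/2)\<bar> <= D / real p \<and>
      \<bar>F_signature (?R p) - (2 - 2 * \<phi> (1/2))\<bar> <= D / real p"
    if p: "prime p" "p \<ge> max P 3" for p
  proof -
    have p2: "p > 2" using p by simp
    interpret hyp p d ?h by (rule hyp_ADE[OF assms p(1) p2 g])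
    obtain \<pi> where \<pi>: "presented (?R p) \<pi> aa" using presented_hypersurface emb_ADE[OF assms(1)] unfolding f_def by metis
    obtain l where l: "HK_multiplicity (?R p) = 2 * l"
      "F_signature (?R p) = 2 - 2 * l"
      "\<bar>l - LD p (cV d p) ?h ((p - 1) div 2) / real p ^ d\<bar> <= 2 / real p" using invariants[OF \<pi>] .
    define s where "s = (p - 1) div 2"
    have ps: "p = 2 * s + 1" using prime_odd_nat[OF p(1) p2] unfolding s_def by (auto elim!: oddE)
    have a: "\<bar>LD p (cV d p) ?h s / real p ^ d - \<phi> (real s / real p)\<bar> <= C / real p" using p ps by (intro CP) auto
    have "dist (\<phi> (real s / real p)) (\<phi> (1/2)) <= L * dist (real s / real p) (1/2)"
      using ps by (intro lipschitz_onD[OF L]) (auto simp: field_simps)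
    also have "... <= L * (1 / real p)"
    proof (intro mult_left_mono lipschitz_on_nonneg[OF L])
      have "1/2 - real s / real p = (1/2) / real p" using ps by (simp add: field_simps)
      hence "dist (real s / real p) (1/2) = (1/2) / real p" using p2 by (simp add: dist_real_def abs_minus_commute)
      also have "... <= 1 / real p" by (rule divide_right_mono) auto
      finally show "dist (real s / real p) (1/2) <= 1 / real p" .
    qed
    finally have b: "\<bar>\<phi> (real s / real p) - \<phi> (1/2)\<bar> <= L / real p" by (simp add: dist_real_def)
    have "\<bar>l - \<phi> (1/2)\<bar> <= 2 / real p + C / real p + L / real p" using l(3)[folded s_def] a b by linarith
    hence "\<bar>l - \<phi> (1/2)\<bar> <= (2 + C + L) / real p" by (simp add: add_divide_distrib)
    hence "2 * \<bar>l - \<phi> (1/2)\<bar> <= 2 * ((2 + C + L) / real p)" by (rule mult_left_mono) simp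
    also have "... = D / real p" by (simp add: D_def)
    finally have "2 * \<bar>l - \<phi> (1/2)\<bar> <= D / real p" .
    moreover have "\<bar>2 * l - 2 * \<phi> (1/2)\<bar> = 2 * \<bar>l - \<phi> (1/2)\<bar>" unfolding right_diff_distrib[symmetric] abs_mult by simp
    moreover have "2 - 2 * l - (2 - 2 * \<phi> (1/2)) = - (2 * l - 2 * \<phi> (1/2))" by simp
    ultimately show ?thesis unfolding l by (simp only: abs_minus_cancel simp_thms)
  qed
  show ?thesis unfolding has_limit_HK_multiplicity_def has_limit_F_signature_def c[symmetric]
  proof
    show "((\<lambda>p. HK_multiplicity (?R p)) \<longlongrightarrow> 1 + (2 * \<phi> (1/2) - 1)) at_top_primes"
      by (rule tendsto_primes[where P = "max P 3" and C = D]) (use key in simp)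
    show "((\<lambda>p. F_signature (?R p)) \<longlongrightarrow> 1 - (2 * \<phi> (1/2) - 1)) at_top_primes"
      by (rule tendsto_primes[where P = "max P 3" and C = D]) (use key in simp)
  qed
qed

end
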